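(* Let $m>0$ and let $\widehat H=\frac{\widehat p^{\,2}}{2m}+V(\widehat x)$ on $L^2(\mathbb{R})$, where $V:\mathbb{R}\to\mathbb{R}$ is a potential satisfying the following standing assumptions. $\widehat H$ is essentially self-adjoint (its closure is again denoted $\widehat H$), with discrete spectrum bounded from below and eigenvalues of finite multiplicity. For all $\beta>0$ the operator $e^{-\beta\widehat H}$ is trace-class. For every function $A:\mathbb{R}\to\mathbb{R}$ that is either a polynomial or a bounded (measurable) function, one has $\mathrm{Tr}\big[|A(\widehat x)|e^{-\beta\widehat H}\big]<\infty$ for all $\beta>0$, and for all complex $\beta$ with $\mathrm{Re}\,\beta>0$ $$\mathrm{Tr}\big[A(\widehat x)e^{-\beta\widehat H}\big]=\lim_{N\to\infty}\int\frac{d^Nx\,d^Np}{(2\pi)^N}A(x_0)\exp\!\Big[\mathrm{i}\sum_{k=1}^Np_k(x_{k-1}-x_k)-\frac{\beta}{N}\sum_{k=1}^N\Big(\frac{p_k^2}{2m}+V(x_k)\Big)\Big],$$ where $x_0=x_N$ and the integrals over $\mathbb{R}^N\times\mathbb{R}^N$ converge absolutely. Then for every $A$ that is a polynomial or a bounded (measurable) function, and for all $E\in\mathbb{R}$ and $\varepsilon>0$, $$\mathrm{Tr}\big(\widehat\rho_\varepsilon(E)A(\widehat x)\big)=\lim_{N\to\infty}\int_{\mathbb{R}^N}d^Nx\,A(x_0)\,K_N(x;E,\varepsilon),$$ where $$K_N(x;E,\varepsilon)=\int_{\mathbb{R}^N}\frac{d^Np}{(2\pi)^N}\,\frac{e^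{\mathrm{i}\sum_{k=1}^Np_k(x_{k-1}-x_k)}}{\sqrt{2\pi\varepsilon^2}}\exp\!\Big[-\frac12\Big(\frac{1}{2mN\varepsilon}\sum_{k=1}^Np_k^2+\frac{1}{N\varepsilon}\sum_{k=1}^NV(x_k)-\frac{E}{\varepsilon}\Big)^2\Big].$$
   Context: Units with $\hbar=1$ are used: $\widehat x$ is multiplication by $x$ and $\widehat p=-\mathrm{i}\,d/dx$. The operator $\widehat\rho_\varepsilon(E)=\frac{1}{\sqrt{2\pi\varepsilon^2}}\exp\big[-\frac12\big(\frac{\widehat H-E}{\varepsilon}\big)^2\big]$ is the (unnormalized) density operator of the Gaussian ensemble. Points of $\mathbb{R}^N$ are written $x=(x_1,\dots,x_N)$, $p=(p_1,\dots,p_N)$, with the periodic convention $x_0=x_N$. *)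

theory Defs
  imports
    "HOL-Analysis.Analysis"
    "HOL-Computational_Algebra.Polynomial"
    "HOL-Library.Nonpos_Ints"
begin

section \<open>The Hilbert space of square-integrable functions on the real line\<close>

definition square_integrable :: "(real \<Rightarrow> complex) \<Rightarrow> bool" where
  "square_integrable f \<longleftrightarrow>
     f \<in> borel_measurable borel \<and> integrable lborel (\<lambda>x. (cmod (f x))\<^sup>2)"

lemma square_integrable_0: "square_integrable (\<lambda>x. 0)"
  by (simp add: square_integrable_def)

lemma square_integrable_mult: "square_integrable f \<Longrightarrow> square_integrable (\<lambda>x. c * f x)"
  unfolding square_integrable_def
  by (auto simp: norm_mult power_mult_distrib intro!: borel_measurable_times)

lemma borel_measurable_cnj [measurable]: "cnj \<in> borel_measurable borel"
  by (intro borel_measurable_continuous_onI continuous_intros)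

lemma square_integrable_add:
  assumes "square_integrable f" "square_integrable g"
  shows "square_integrable (\<lambda>x. f x + g x)"
proof -
  have [measurable]: "f \<in> borel_measurable borel" "g \<in> borel_measurable borel"
    using assms by (auto simp: square_integrable_def)
  have bound: "(cmod (a + b))\<^sup>2 \<le> 2 * (cmod a)\<^sup>2 + 2 * (cmod b)\<^sup>2" for a b :: complex
  proof -
    have "(cmod (a + b))\<^sup>2 \<le> (cmod a + cmod b)\<^sup>2"
      by (intro power_mono norm_triangle_ineq) auto
    also have "\<dots> \<le> 2 * (cmod a)\<^sup>2 + 2 * (cmod b)\<^sup>2"
      using sum_squares_bound[of "cmod a" "cmod b"] by (simp add: power2_sum)
    finally show ?thesis .
  qed
  have "integrable lborel (\<lambda>x. 2 * (cmod (f x))\<^sup>2 + 2 * (cmod (g x))\<^sup>2)"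
    using assms by (auto simp: square_integrable_def)
  then have "integrable lborel (\<lambda>x. (cmod (f x + g x))\<^sup>2)"
    by (rule Bochner_Integration.integrable_bound) (auto simp: bound)
  then show ?thesis
    by (simp add: square_integrable_def)
qed

lemma square_integrable_cnj_mult:
  assumes "square_integrable f" "square_integrable g"
  shows "integrable lborel (\<lambda>x. cnj (f x) * g x)"
proof -
  have [measurable]: "f \<in> borel_measurable borel" "g \<in> borel_measurable borel"
    using assms by (auto simp: square_integrable_def)
  have meas: "(\<lambda>x. cnj (f x) * g x) \<in> borel_measurable lborel"
    by measurable
  have bound: "cmod a * cmod b \<le> (cmod a)\<^sup>2 + (cmod b)\<^sup>2" for a b :: complex
  proof -
    have "0 \<le> cmod a * cmod b"
      by simp
    then show ?thesis
      using sum_squares_bound[of "cmod a" "cmod b"] by linarith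
  qed
  have "integrable lborel (\<lambda>x. (cmod (f x))\<^sup>2 + (cmod (g x))\<^sup>2)"
    using assms by (auto simp: square_integrable_def)
  then show ?thesis
    by (rule Bochner_Integration.integrable_bound) (auto simp: bound norm_mult meas)
qed

definition L2_rel :: "(real \<Rightarrow> complex) \<Rightarrow> (real \<Rightarrow> complex) \<Rightarrow> bool" where
  "L2_rel f g \<longleftrightarrow>
     square_integrable f \<and> square_integrable g \<and> (AE x in lborel. f x = g x)"

lemma part_equivp_L2_rel: "part_equivp L2_rel"
proof (rule part_equivpI)
  show "\<exists>f. L2_rel f f"
    using square_integrable_0 by (auto simp: L2_rel_def)
  show "symp L2_rel"
    by (auto simp: symp_def L2_rel_def eq_commute)
  show "transp L2_rel"
    by (rule transpI) (auto simp: L2_rel_def elim: eventually_elim2)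
qed

quotient_type L2 = "real \<Rightarrow> complex" / partial: L2_rel
  by (rule part_equivp_L2_rel)

lift_definition scaleC :: "complex \<Rightarrow> L2 \<Rightarrow> L2" (infixr \<open>*\<^sub>C\<close> 75)
  is "\<lambda>c f x. c * f x"
  by (auto simp: L2_rel_def square_integrable_mult)

text \<open>Antilinear in the first argument, as in physics.\<close>

lift_definition cinner :: "L2 \<Rightarrow> L2 \<Rightarrow> complex"
  is "\<lambda>f g. \<integral>x. cnj (f x) * g x \<partial>lborel"
proof -
  fix f f' g g' assume fg: "L2_rel f f'" "L2_rel g g'"
  then have [measurable]: "f \<in> borel_measurable borel" "g \<in> borel_measurable borel"
      "f' \<in> borel_measurable borel" "g' \<in> borel_measurable borel"
    by (auto simp: L2_rel_def square_integrable_def)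
  have m: "(\<lambda>x. cnj (f x) * g x) \<in> borel_measurable lborel"
      "(\<lambda>x. cnj (f' x) * g' x) \<in> borel_measurable lborel"
    by measurable
  have ae: "AE x in lborel. f x = f' x" "AE x in lborel. g x = g' x"
    using fg by (auto simp: L2_rel_def)
  show "(\<integral>x. cnj (f x) * g x \<partial>lborel) = (\<integral>x. cnj (f' x) * g' x \<partial>lborel)"
    using ae by (intro integral_cong_AE m) (auto elim: eventually_elim2)
qed

instantiation L2 :: real_inner
begin

lift_definition zero_L2 :: L2 is "\<lambda>x. 0"
  by (simp add: L2_rel_def square_integrable_0)

lift_definition plus_L2 :: "L2 \<Rightarrow> L2 \<Rightarrow> L2" is "\<lambda>f g x. f x + g x"
  by (auto simp: L2_rel_def square_integrable_add elim: eventually_elim2)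

definition uminus_L2 :: "L2 \<Rightarrow> L2" where "- \<psi> = (- 1) *\<^sub>C \<psi>"
definition minus_L2 :: "L2 \<Rightarrow> L2 \<Rightarrow> L2" where "\<phi> - \<psi> = \<phi> + - (\<psi> :: L2)"
definition scaleR_L2 :: "real \<Rightarrow> L2 \<Rightarrow> L2" where "r *\<^sub>R \<psi> = complex_of_real r *\<^sub>C \<psi>"
definition inner_L2 :: "L2 \<Rightarrow> L2 \<Rightarrow> real" where "inner \<phi> \<psi> = Re (cinner \<phi> \<psi>)"
definition norm_L2 :: "L2 \<Rightarrow> real" where "norm \<psi> = sqrt (inner \<psi> (\<psi> :: L2))"
definition dist_L2 :: "L2 \<Rightarrow> L2 \<Rightarrow> real" where "dist \<phi> \<psi> = norm (\<phi> - \<psi> :: L2)"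
definition sgn_L2 :: "L2 \<Rightarrow> L2" where "sgn \<psi> = inverse (norm \<psi>) *\<^sub>R (\<psi> :: L2)"
definition uniformity_L2 :: "(L2 \<times> L2) filter" where
  "uniformity = (INF e\<in>{0 <..}. principal {(\<phi>, \<psi> :: L2). dist \<phi> \<psi> < e})"
definition open_L2 :: "L2 set \<Rightarrow> bool" where
  "open U = (\<forall>\<phi>\<in>U. eventually (\<lambda>(\<phi>', \<psi>). \<phi>' = \<phi> \<longrightarrow> \<psi> \<in> U) (uniformity :: (L2 \<times> L2) filter))"

instance
proof
  fix \<phi> \<psi> \<xi> :: L2 and r s :: real
  show "\<phi> + \<psi> + \<xi> = \<phi> + (\<psi> + \<xi>)"
    by transfer (auto simp: L2_rel_def square_integrable_add add.assoc)
  show "\<phi> + \<psi> = \<psi> + \<phi>"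
    by transfer (auto simp: L2_rel_def square_integrable_add add.commute)
  show "0 + \<psi> = \<psi>"
    by transfer (auto simp: L2_rel_def)
  show "- \<psi> + \<psi> = 0"
    unfolding uminus_L2_def
    by transfer (auto simp: L2_rel_def square_integrable_0)
  show "\<phi> - \<psi> = \<phi> + - \<psi>"
    by (fact minus_L2_def)
  show "r *\<^sub>R (\<phi> + \<psi>) = r *\<^sub>R \<phi> + r *\<^sub>R \<psi>"
    unfolding scaleR_L2_def
    by transfer (auto simp: L2_rel_def ring_distribs
        intro!: square_integrable_mult square_integrable_add)
  show "(r + s) *\<^sub>R \<psi> = r *\<^sub>R \<psi> + s *\<^sub>R \<psi>"
    unfolding scaleR_L2_def
    by transfer (auto simp: L2_rel_def ring_distribs
        intro!: square_integrable_mult square_integrable_add)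
  show "r *\<^sub>R s *\<^sub>R \<psi> = (r * s) *\<^sub>R \<psi>"
    unfolding scaleR_L2_def
    by transfer (auto simp: L2_rel_def mult.assoc intro!: square_integrable_mult)
  show "1 *\<^sub>R \<psi> = \<psi>"
    unfolding scaleR_L2_def by transfer (auto simp: L2_rel_def)
  show "dist \<phi> \<psi> = norm (\<phi> - \<psi>)"
    by (fact dist_L2_def)
  show "sgn \<psi> = inverse (norm \<psi>) *\<^sub>R \<psi>"
    by (fact sgn_L2_def)
  show "(uniformity :: (L2 \<times> L2) filter) = (INF e\<in>{0 <..}. principal {(\<phi>, \<psi>). dist \<phi> \<psi> < e})"
    by (fact uniformity_L2_def)
  show "open U = (\<forall>\<phi>\<in>U. eventually (\<lambda>(\<phi>', \<psi>). \<phi>' = \<phi> \<longrightarrow> \<psi> \<in> U) uniformity)" for U :: "L2 set"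
    by (fact open_L2_def)
  have "cinner \<phi> \<psi> = cnj (cinner \<psi> \<phi>)"
    by transfer
       (simp add: mult.commute Bochner_Integration.integral_cnj [symmetric]
         del: Bochner_Integration.integral_cnj)
  then show "inner \<phi> \<psi> = inner \<psi> \<phi>"
    by (simp add: inner_L2_def)
  have "cinner (\<phi> + \<psi>) \<xi> = cinner \<phi> \<xi> + cinner \<psi> \<xi>"
    by transfer (simp add: L2_rel_def ring_distribs square_integrable_cnj_mult)
  then show "inner (\<phi> + \<psi>) \<xi> = inner \<phi> \<xi> + inner \<psi> \<xi>"
    by (simp add: inner_L2_def)
  have "cinner (complex_of_real r *\<^sub>C \<phi>) \<psi> = complex_of_real r * cinner \<phi> \<psi>"
    by transfer (simp add: mult.assoc)
  then show "inner (r *\<^sub>R \<phi>) \<psi> = r * inner \<phi> \<psi>"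
    by (simp add: inner_L2_def scaleR_L2_def)
  have sq: "square_integrable f \<Longrightarrow>
      (\<integral>x. cnj (f x) * f x \<partial>lborel) = complex_of_real (\<integral>x. (cmod (f x))\<^sup>2 \<partial>lborel)" for f
    by (subst integral_complex_of_real [symmetric])
       (auto intro!: Bochner_Integration.integral_cong simp: complex_norm_square [symmetric] mult.commute)
  show "inner \<psi> \<psi> \<ge> 0"
    unfolding inner_L2_def by transfer (simp add: L2_rel_def sq)
  show "inner \<psi> \<psi> = 0 \<longleftrightarrow> \<psi> = 0"
    unfolding inner_L2_def
    by transfer
       (auto simp: L2_rel_def sq integral_nonneg_eq_0_iff_AE square_integrable_0
         square_integrable_def[of f for f])
  show "norm \<psi> = sqrt (inner \<psi> \<psi>)"
    by (fact norm_L2_def)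
qed

end


section \<open>Operators\<close>

text \<open>
  A possibly unbounded operator is represented by its graph, with pairs \<open>(\<psi>, T \<psi>)\<close>;
  \<open>S O T\<close> therefore applies \<open>S\<close> first.
\<close>

type_synonym operator = "(L2 \<times> L2) set"

definition op_graph :: "(L2 \<Rightarrow> L2) \<Rightarrow> operator" where
  "op_graph T = {(\<psi>, T \<psi>) | \<psi>. True}"

definition op_sum :: "operator \<Rightarrow> operator \<Rightarrow> operator" where
  "op_sum S T = {(\<psi>, \<phi>\<^sub>1 + \<phi>\<^sub>2) | \<psi> \<phi>\<^sub>1 \<phi>\<^sub>2. (\<psi>, \<phi>\<^sub>1) \<in> S \<and> (\<psi>, \<phi>\<^sub>2) \<in> T}"

definition op_scale :: "complex \<Rightarrow> operator \<Rightarrow> operator" where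
  "op_scale c T = {(\<psi>, c *\<^sub>C \<phi>) | \<psi> \<phi>. (\<psi>, \<phi>) \<in> T}"

definition adjoint_op :: "operator \<Rightarrow> operator" where
  "adjoint_op T = {(\<xi>, \<eta>). \<forall>(\<psi>, \<phi>) \<in> T. cinner \<xi> \<phi> = cinner \<eta> \<psi>}"

definition self_adjoint :: "operator \<Rightarrow> bool" where
  "self_adjoint T \<longleftrightarrow> closure (Domain T) = UNIV \<and> adjoint_op T = T"

definition essentially_self_adjoint :: "operator \<Rightarrow> bool" where
  "essentially_self_adjoint T \<longleftrightarrow> self_adjoint (closure T)"

definition bounded_clinear :: "(L2 \<Rightarrow> L2) \<Rightarrow> bool" where
  "bounded_clinear T \<longleftrightarrow> bounded_linear T \<and> (\<forall>c \<psi>. T (c *\<^sub>C \<psi>) = c *\<^sub>C T \<psi>)"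

definition resolvent_set :: "operator \<Rightarrow> complex set" where
  "resolvent_set T =
     {z. \<exists>R. bounded_clinear R \<and> {(\<phi> - z *\<^sub>C \<psi>, \<psi>) | \<psi> \<phi>. (\<psi>, \<phi>) \<in> T} = op_graph R}"

definition spectrum :: "operator \<Rightarrow> complex set" where
  "spectrum T = - resolvent_set T"

definition eigenspace :: "operator \<Rightarrow> complex \<Rightarrow> L2 set" where
  "eigenspace T z = {\<psi>. (\<psi>, z *\<^sub>C \<psi>) \<in> T}"

definition eigenvalues :: "operator \<Rightarrow> complex set" where
  "eigenvalues T = {z. \<exists>\<psi>. \<psi> \<noteq> 0 \<and> \<psi> \<in> eigenspace T z}"

text \<open>
  The spectrum consists of isolated eigenvalues of finite multiplicity; \<open>span\<close> is the real span,
  which does not affect finite dimensionality.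
\<close>

definition discrete_spectrum :: "operator \<Rightarrow> bool" where
  "discrete_spectrum T \<longleftrightarrow>
     discrete (spectrum T) \<and> spectrum T = eigenvalues T \<and>
     (\<forall>z\<in>eigenvalues T. \<exists>B. finite B \<and> eigenspace T z \<subseteq> span B)"

definition spectrum_bounded_below :: "operator \<Rightarrow> bool" where
  "spectrum_bounded_below T \<longleftrightarrow> (\<exists>c. \<forall>z\<in>spectrum T. c \<le> Re z)"

definition orth_proj :: "L2 set \<Rightarrow> L2 \<Rightarrow> L2" where
  "orth_proj S \<psi> = (THE \<phi>. \<phi> \<in> S \<and> (\<forall>\<xi>\<in>S. cinner \<xi> (\<psi> - \<phi>) = 0))"

text \<open>
  \<open>f(T) = \<Sum>\<^sub>\<mu> f(\<mu>) P\<^sub>\<mu>\<close>, the Borel functional calculus of a self-adjoint operator with discrete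
  spectrum; the domain is the set of all \<open>\<psi>\<close> for which the series converges in norm. Only real
  eigenvalues occur for self-adjoint \<open>T\<close>.
\<close>

definition fun_calc :: "(real \<Rightarrow> complex) \<Rightarrow> operator \<Rightarrow> operator" where
  "fun_calc f T =
     {(\<psi>, \<phi>). ((\<lambda>\<mu>. f \<mu> *\<^sub>C orth_proj (eigenspace T (complex_of_real \<mu>)) \<psi>) has_sum \<phi>)
                {\<mu>. complex_of_real \<mu> \<in> eigenvalues T}}"


section \<open>Trace\<close>

definition orthonormal_basis :: "(nat \<Rightarrow> L2) \<Rightarrow> bool" where
  "orthonormal_basis e \<longleftrightarrow>
     (\<forall>j k. cinner (e j) (e k) = (if j = k then 1 else 0)) \<and>
     (\<forall>\<psi>. (\<forall>k. cinner (e k) \<psi> = 0) \<longrightarrow> \<psi> = 0)"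

definition positive_op :: "(L2 \<Rightarrow> L2) \<Rightarrow> bool" where
  "positive_op P \<longleftrightarrow> bounded_clinear P \<and> (\<forall>\<psi>. cinner \<psi> (P \<psi>) \<in> \<real>\<^sub>\<ge>\<^sub>0)"

text \<open>\<open>P = |T|\<close>, that is, \<open>P\<close> is the positive square root of \<open>T\<^sup>* T\<close>.\<close>

definition is_abs_op :: "(L2 \<Rightarrow> L2) \<Rightarrow> (L2 \<Rightarrow> L2) \<Rightarrow> bool" where
  "is_abs_op T P \<longleftrightarrow>
     positive_op P \<and> (\<forall>\<phi> \<psi>. cinner \<phi> (P (P \<psi>)) = cinner (T \<phi>) (T \<psi>))"

definition trace_class :: "(L2 \<Rightarrow> L2) \<Rightarrow> bool" where
  "trace_class T \<longleftrightarrow>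
     bounded_clinear T \<and>
     (\<exists>P e. is_abs_op T P \<and> orthonormal_basis e \<and> summable (\<lambda>n. Re (cinner (e n) (P (e n)))))"

text \<open>
  For unbounded \<open>A\<close> and bounded \<open>B\<close> the product \<open>BA\<close> is only densely defined, so trace and
  trace class of an operator refer to its closure, which has to be defined everywhere.
\<close>

definition op_trace_class :: "operator \<Rightarrow> bool" where
  "op_trace_class G \<longleftrightarrow> (\<exists>T. closure G = op_graph T \<and> trace_class T)"

definition has_trace :: "operator \<Rightarrow> complex \<Rightarrow> bool" where
  "has_trace G t \<longleftrightarrow>
     (\<exists>T. closure G = op_graph T \<and> trace_class T \<and>
          (\<forall>e. orthonormal_basis e \<longrightarrow> (\<lambda>n. cinner (e n) (T (e n))) sums t))"


section \<open>Schroedinger operators\<close>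

definition mult_op :: "(real \<Rightarrow> real) \<Rightarrow> operator" where
  "mult_op A =
     {(abs_L2 f, abs_L2 (\<lambda>x. complex_of_real (A x) * f x)) | f.
        square_integrable f \<and> square_integrable (\<lambda>x. complex_of_real (A x) * f x)}"

text \<open>
  \<open>-\<i> d/dx\<close> on its maximal domain: \<open>f\<close> is the locally absolutely continuous representative,
  characterised as an indefinite Lebesgue integral, and \<open>g\<close> is its derivative.
\<close>

definition momentum_op :: operator where
  "momentum_op =
     {(abs_L2 f, abs_L2 (\<lambda>x. - \<i> * g x)) | f g.
        square_integrable f \<and> square_integrable g \<and>
        (\<forall>a b. a \<le> b \<longrightarrow> f b - f a = (LINT x:{a..b}|lborel. g x))}"

text \<open>The operator sum, with domain the intersection of the domains of \<open>p\<^sup>2\<close> and \<open>V(x)\<close>.\<close>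

definition schroedinger_op :: "real \<Rightarrow> (real \<Rightarrow> real) \<Rightarrow> operator" where
  "schroedinger_op m V =
     op_sum (op_scale (complex_of_real (1 / (2 * m))) (momentum_op O momentum_op)) (mult_op V)"

definition hamiltonian :: "real \<Rightarrow> (real \<Rightarrow> real) \<Rightarrow> operator" where
  "hamiltonian m V = closure (schroedinger_op m V)"

definition boltzmann_op :: "complex \<Rightarrow> operator \<Rightarrow> operator" where
  "boltzmann_op \<beta> H = fun_calc (\<lambda>\<mu>. exp (- \<beta> * complex_of_real \<mu>)) H"

definition gaussian_density_op :: "real \<Rightarrow> real \<Rightarrow> operator \<Rightarrow> operator" where
  "gaussian_density_op \<epsilon> E H =
     fun_calc (\<lambda>\<mu>. complex_of_real
       (1 / sqrt (2 * pi * \<epsilon>\<^sup>2) * exp (- (1 / 2) * ((\<mu> - E) / \<epsilon>)\<^sup>2))) H"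

definition admissible_observable :: "(real \<Rightarrow> real) \<Rightarrow> bool" where
  "admissible_observable A \<longleftrightarrow>
     (\<exists>q :: real poly. A = poly q) \<or> (A \<in> borel_measurable borel \<and> bounded (range A))"


section \<open>Discretised path integrals\<close>

text \<open>
  A point of \<open>\<real>\<^sup>N\<close> is a function on \<open>{1..N}\<close>, extended by the convention \<open>x\<^sub>0 = x\<^sub>N\<close>.
\<close>

definition lebesgue_N :: "nat \<Rightarrow> (nat \<Rightarrow> real) measure" where
  "lebesgue_N N = (\<Pi>\<^sub>M k\<in>{1..N}. lborel)"

definition periodic :: "nat \<Rightarrow> (nat \<Rightarrow> real) \<Rightarrow> nat \<Rightarrow> real" where
  "periodic N x k = (if k = 0 then x N else x k)"

definition path_phase :: "nat \<Rightarrow> (nat \<Rightarrow> real) \<Rightarrow> (nat \<Rightarrow> real) \<Rightarrow> real" where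
  "path_phase N x p = (\<Sum>k=1..N. p k * (periodic N x (k - 1) - periodic N x k))"

definition boltzmann_integrand ::
    "real \<Rightarrow> (real \<Rightarrow> real) \<Rightarrow> (real \<Rightarrow> real) \<Rightarrow> complex \<Rightarrow> nat \<Rightarrow> (nat \<Rightarrow> real) \<Rightarrow> (nat \<Rightarrow> real) \<Rightarrow> complex"
  where
  "boltzmann_integrand m V A \<beta> N x p =
     complex_of_real (A (periodic N x 0) / (2 * pi) ^ N) *
     exp (\<i> * complex_of_real (path_phase N x p)
          - \<beta> / of_nat N * complex_of_real (\<Sum>k=1..N. (p k)\<^sup>2 / (2 * m) + V (x k)))"

definition gaussian_integrand ::
    "real \<Rightarrow> (real \<Rightarrow> real) \<Rightarrow> real \<Rightarrow> real \<Rightarrow> nat \<Rightarrow> (nat \<Rightarrow> real) \<Rightarrow> (nat \<Rightarrow> real) \<Rightarrow> complex"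
  where
  "gaussian_integrand m V E \<epsilon> N x p =
     complex_of_real (1 / (2 * pi) ^ N) *
     (exp (\<i> * complex_of_real (path_phase N x p)) / complex_of_real (sqrt (2 * pi * \<epsilon>\<^sup>2))) *
     complex_of_real (exp (- (1 / 2) *
       (1 / (2 * m * real N * \<epsilon>) * (\<Sum>k=1..N. (p k)\<^sup>2)
        + 1 / (real N * \<epsilon>) * (\<Sum>k=1..N. V (x k)) - E / \<epsilon>)\<^sup>2))"

definition gaussian_kernel ::
    "real \<Rightarrow> (real \<Rightarrow> real) \<Rightarrow> nat \<Rightarrow> (nat \<Rightarrow> real) \<Rightarrow> real \<Rightarrow> real \<Rightarrow> complex" where
  "gaussian_kernel m V N x E \<epsilon> = (\<integral>p. gaussian_integrand m V E \<epsilon> N x p \<partial>lebesgue_N N)"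

end

theory Submission
  imports Defs "HOL-Probability.Distributions" "HOL-Real_Asymp.Real_Asymp" "HOL-Complex_Analysis.Complex_Analysis"
begin

text \<open>
  The Gaussian is an inverse Laplace transform, so both sides of the limit are integrals over a
  vertical line \<open>Re \<beta> = b\<close> of \<open>w(\<beta>) = exp (\<epsilon>\<^sup>2 \<beta>\<^sup>2 / 2 + \<beta> E)\<close> against the discretised partition
  function \<open>Z\<^sub>N(\<beta>)\<close> and against \<open>Z(\<beta>) = Tr [A e\<^bsup>-\<beta> H\<^esup>]\<close>. Pointwise convergence \<open>Z\<^sub>N \<longlonglongrightarrow> Z\<close> is assumed;
  what is missing is control that is uniform in \<open>N\<close>.

  \<open>Z\<^sub>N(\<beta>)\<close> is the trace of \<open>A\<close> times the \<open>N\<close>-th power of a Hilbert--Schmidt kernel. Inequalities of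
  Lieb--Thirring and Golden--Thompson type for powers \<open>2\<^sup>j\<close> bound it by \<open>C\<^bsup>1 + Re \<beta>\<^esup>\<close> on \<open>2 \<le> Re \<beta> \<le> N / 2\<close>
  if \<open>A\<close> is bounded. For polynomial \<open>A\<close>, Baire's theorem gives a uniform bound at real \<open>\<beta>\<close>; \<open>A\<close> is cut into
  shells on which \<open>1 + x\<^sup>2\<close> doubles, and on each shell the decay known at real \<open>\<beta>\<close> is interpolated with the
  growth in the half plane by a two-constants argument. This bounds \<open>Z\<^sub>N\<close> on rays
  \<open>b\<^sub>1 + r (1 \<plusminus> 3 \<i> / 2)\<close> up to \<open>Re \<beta> = \<kappa> N\<close>. The rays are steeper than \<open>\<pi> / 4\<close>, so \<open>w\<close> decays like a
  Gaussian along them: the line \<open>Re \<beta> = \<kappa> N\<close> is bent to the rays, what stays on the line is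
  negligible, and dominated convergence applies on the rays.

  On the operator side, an orthonormal basis of eigenvectors (completed orthogonally to all of
  them) turns \<open>Z(\<beta>)\<close> into a Dirichlet series, and the closure of \<open>\<rho> A\<close> is a nuclear operator.
\<close>

section \<open>Gaussians as inverse Laplace transforms\<close>

text \<open>The obstacle is a polynomial \<open>A\<close> at complex \<open>\<beta>\<close>. Taking
  moduli in the path integral costs a factor sqrt (|\<beta>| / Re \<beta>) per time slice, the mass
  of the modulus of the complex heat kernel, and this is exponential in \<open>N\<close>. Moment
  bounds uniform in \<open>N\<close> are therefore first obtained at real \<open>\<beta>\<close>,
  where path kernels are nonnegative. Interpolation towards the rays keeps only the 16th root of the
  gain on the real axis, hence the \<open>16 * (d + 1)\<close> additional moments. The abscissa
  \<open>\<kappa> N\<close> grows so that the time step \<open>\<beta> / N\<close> keeps the real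
  part \<open>\<kappa>\<close>. A crude bound exp (c N) is enough there, because outside the wedge
  the weight is of order exp (- const N^2). A moving abscissa is allowed since the inverse Laplace
  integral does not depend on it. On the operator side, traces with \<open>A\<close> only see the
  numbers <e_n, A e_n>, whereas nuclearity needs the norms of A e_n. These come from the trace
  formula for \<open>1 + A^2\<close>, which is admissible along with \<open>A\<close>. Vectors
  orthogonal to all eigenvectors are annihilated by the functional calculus and contribute
  zero.\<close>

lemma cmod_exp_minus_one_le: "cmod (exp w - 1) \<le> cmod w * exp (cmod w)"
proof -
  have "cmod (exp w - exp 0) \<le> exp (cmod w) * cmod (w - 0)"
  proof (rule field_differentiable_bound[of "cball 0 (cmod w)" exp exp])
    fix z :: complex assume "z \<in> cball 0 (cmod w)"
    then have "cmod z \<le> cmod w" by simp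
    then show "cmod (exp z) \<le> exp (cmod w)"
      using norm_exp[of z] by (meson exp_le_cancel_iff order_trans)
  qed (auto intro: DERIV_exp has_field_derivative_at_within)
  then show ?thesis by (simp add: mult.commute)
qed

text \<open>Differentiation under the integral. As \<open>h\<close> may take both signs, difference
  quotients are dominated with two exponents: \<open>|h| * exp (d * |h|)\<close> is absorbed by the
  sum of the exponentials at \<open>Re z - 2 * d\<close> and \<open>Re z + 2 * d\<close>, and
  \<open>d\<close> is small enough for both to lie in \<open>U\<close>.\<close>

lemma holomorphic_laplace:
  fixes a :: "'a \<Rightarrow> complex" and h :: "'a \<Rightarrow> real"
  assumes U: "open U" and [measurable]: "a \<in> borel_measurable M" "h \<in> borel_measurable M"
    and int: "\<And>b. b \<in> U \<Longrightarrow> integrable M (\<lambda>x. cmod (a x) * exp (- b * h x))"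
  shows "(\<lambda>z. \<integral>x. a x * exp (- z * complex_of_real (h x)) \<partial>M) holomorphic_on {z. Re z \<in> U}"
proof -
  let ?F = "\<lambda>z. \<integral>x. a x * exp (- z * complex_of_real (h x)) \<partial>M"
  have intF: "integrable M (\<lambda>x. a x * exp (- z * complex_of_real (h x)))" if "Re z \<in> U" for z
    by (rule Bochner_Integration.integrable_bound[OF int[OF that]]) (auto simp: norm_mult)
  have "\<exists>D. (?F has_field_derivative D) (at z)" if z: "Re z \<in> U" for z
  proof -
    from U z obtain e where e: "e > 0" "ball (Re z) e \<subseteq> U"
      by (meson open_contains_ball)
    define d where "d = e / 4"
    have d: "d > 0" using e by (simp add: d_def)
    have dU: "Re z - 2*d \<in> U" "Re z + 2*d \<in> U"
      using e d by (auto simp: d_def dist_real_def intro!: subsetD[OF e(2)])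
    let ?D = "\<integral>x. a x * (- complex_of_real (h x)) * exp (- z * complex_of_real (h x)) \<partial>M"
    have "((\<lambda>\<eta>. (?F (z + \<eta>) - ?F z) / \<eta>) \<longlongrightarrow> ?D) (at 0)"
    proof -
      have "((\<lambda>\<eta>. (?F (z + \<eta>) - ?F z) / \<eta>) \<longlongrightarrow> ?D) (at 0 within ball 0 d)"
        unfolding tendsto_at_iff_sequentially o_def
      proof (intro allI impI)
        fix X :: "nat \<Rightarrow> complex"
        assume X: "\<forall>i. X i \<in> ball 0 d - {0}" "X \<longlonglongrightarrow> 0"
        have Xn: "cmod (X i) < d" "X i \<noteq> 0" for i using X(1) by (auto simp: dist_norm)
        have XU: "Re (z + X i) \<in> U" for i
          using e(2) Xn(1)[of i] abs_Re_le_cmod[of "X i"] e(1)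
          by (auto simp: d_def dist_real_def subset_iff)
        let ?s = "\<lambda>i x. a x * exp (- z * complex_of_real (h x)) * ((exp (- X i * complex_of_real (h x)) - 1) / X i)"
        have eq: "(?F (z + X i) - ?F z) / X i = (\<integral>x. ?s i x \<partial>M)" for i
        proof -
          have "?F (z + X i) - ?F z
              = (\<integral>x. a x * exp (- (z + X i) * complex_of_real (h x)) - a x * exp (- z * complex_of_real (h x)) \<partial>M)"
            using intF[OF XU] intF[OF z] by simp
          also have "(\<integral>x. a x * exp (- (z + X i) * complex_of_real (h x)) - a x * exp (- z * complex_of_real (h x)) \<partial>M)
              = (\<integral>x. X i * ?s i x \<partial>M)"
            by (rule Bochner_Integration.integral_cong)
               (use Xn(2)[of i] in \<open>auto simp: field_simps exp_add exp_diff exp_minus\<close>)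
          also have "\<dots> = X i * (\<integral>x. ?s i x \<partial>M)"
            by (rule integral_mult_right_zero)
          finally show ?thesis using Xn(2)[of i] by simp
        qed
        have "(\<lambda>i. \<integral>x. ?s i x \<partial>M) \<longlonglongrightarrow> ?D"
        proof (rule integral_dominated_convergence)
          let ?w = "\<lambda>x. (cmod (a x) * exp (- (Re z - 2*d) * h x) + cmod (a x) * exp (- (Re z + 2*d) * h x)) / d"
          show "integrable M ?w"
            using int[OF dU(1)] int[OF dU(2)] by auto
          show "AE x in M. cmod (?s i x) \<le> ?w x" for i
          proof (intro AE_I2)
            fix x
            let ?y = "\<bar>h x\<bar>"
            have "cmod ((exp (- X i * complex_of_real (h x)) - 1) / X i) \<le> ?y * exp (d * ?y)"
            proof -
              have "cmod (exp (- X i * complex_of_real (h x)) - 1) \<le> (cmod (X i) * ?y) * exp (cmod (X i) * ?y)"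
                using cmod_exp_minus_one_le[of "- X i * complex_of_real (h x)"] by (simp add: norm_mult)
              also have "\<dots> \<le> (cmod (X i) * ?y) * exp (d * ?y)"
                using Xn(1)[of i] by (intro mult_left_mono) (auto intro: mult_right_mono)
              finally show ?thesis using Xn(2)[of i] by (simp add: norm_divide field_simps)
            qed
            also have "?y * exp (d * ?y) \<le> exp (2 * d * ?y) / d"
            proof -
              have "d * ?y \<le> exp (d * ?y)" using exp_ge_add_one_self[of "d * ?y"] by linarith
              then have "d * ?y * exp (d * ?y) \<le> exp (d * ?y) * exp (d * ?y)" by (intro mult_right_mono) auto
              then show ?thesis using d by (simp add: field_simps flip: exp_add)
            qed
            also have "exp (2 * d * ?y) \<le> exp (2 * d * h x) + exp (- 2 * d * h x)"
              by (cases "h x \<ge> 0") auto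
            finally have *: "cmod ((exp (- X i * complex_of_real (h x)) - 1) / X i) \<le> (exp (2 * d * h x) + exp (- 2 * d * h x)) / d"
              using d by (simp add: divide_right_mono)
            have "cmod (?s i x) \<le> cmod (a x) * exp (- Re z * h x) * ((exp (2 * d * h x) + exp (- 2 * d * h x)) / d)"
              unfolding norm_mult using * by (intro mult_mono) auto
            also have "\<dots> = ?w x" by (simp add: algebra_simps add_divide_distrib flip: exp_add)
            finally show "cmod (?s i x) \<le> ?w x" .
          qed
          show "AE x in M. (\<lambda>i. ?s i x) \<longlonglongrightarrow> a x * (- complex_of_real (h x)) * exp (- z * complex_of_real (h x))"
          proof (intro AE_I2)
            fix x
            have "((\<lambda>w. exp (w * (- complex_of_real (h x)))) has_field_derivative (- complex_of_real (h x))) (at 0)"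
              by (auto intro!: derivative_eq_intros)
            then have "((\<lambda>w. (exp (- w * complex_of_real (h x)) - 1) / w) \<longlongrightarrow> - complex_of_real (h x)) (at 0)"
              by (simp add: has_field_derivative_iff)
            then have "(\<lambda>i. (exp (- X i * complex_of_real (h x)) - 1) / X i) \<longlonglongrightarrow> - complex_of_real (h x)"
              using X(2) Xn(2) unfolding tendsto_at_iff_sequentially o_def by auto
            from tendsto_mult[OF tendsto_const[of "a x * exp (- z * complex_of_real (h x))"] this]
            show "(\<lambda>i. ?s i x) \<longlonglongrightarrow> a x * (- complex_of_real (h x)) * exp (- z * complex_of_real (h x))"
              by (simp add: mult_ac)
          qed
        qed measurable
        then show "(\<lambda>i. (?F (z + X i) - ?F z) / X i) \<longlonglongrightarrow> ?D" by (simp only: eq)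
      qed
      moreover have "at (0::complex) within ball 0 d = at 0"
        using d by (intro at_within_open) auto
      ultimately show ?thesis by (simp only:)
    qed
    then show ?thesis by (intro exI[of _ ?D]) (simp only: DERIV_def)
  qed
  then show ?thesis
    unfolding holomorphic_on_def field_differentiable_def
    by (auto intro: has_field_derivative_at_within)
qed

lemma integrable_real_gaussian:
  fixes a b :: real assumes "a > 0"
  shows "integrable lborel (\<lambda>x. exp (- a * x\<^sup>2 + b * x))"
    and "(\<integral>x. exp (- a * x\<^sup>2 + b * x) \<partial>lborel) = sqrt (pi / a) * exp (b\<^sup>2 / (4 * a))"
proof -
  define \<sigma> where "\<sigma> = 1 / sqrt (2 * a)"
  define \<mu> where "\<mu> = b / (2 * a)"
  have s: "\<sigma> > 0" "\<sigma>\<^sup>2 = 1 / (2 * a)" using assms by (auto simp: \<sigma>_def power_divide)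
  have eq: "exp (- a * x\<^sup>2 + b * x) = (sqrt (pi / a) * exp (b\<^sup>2 / (4 * a))) * normal_density \<mu> \<sigma> x" for x
  proof -
    have "- a * x\<^sup>2 + b * x = b\<^sup>2 / (4 * a) - (x - \<mu>)\<^sup>2 * a"
      using assms by (simp add: \<mu>_def field_simps power2_eq_square)
    then show ?thesis using assms unfolding normal_density_def s(2)
      by (simp only: exp_diff) (simp add: real_sqrt_divide exp_minus field_simps)
  qed
  show "integrable lborel (\<lambda>x. exp (- a * x\<^sup>2 + b * x))"
    unfolding eq using s by (intro integrable_mult_right integrable_normal_density)
  show "(\<integral>x. exp (- a * x\<^sup>2 + b * x) \<partial>lborel) = sqrt (pi / a) * exp (b\<^sup>2 / (4 * a))"
    unfolding eq using s by simp
qed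

lemma islimpt_reals_halfplane:
  assumes "c < r" shows "complex_of_real r islimpt complex_of_real ` {c<..}"
proof -
  show ?thesis
    unfolding islimpt_approachable
  proof (intro allI impI)
    fix e :: real assume "e > 0"
    then show "\<exists>x'\<in>complex_of_real ` {c<..}. x' \<noteq> complex_of_real r \<and> dist x' (complex_of_real r) < e"
      using assms
      by (intro bexI[of _ "complex_of_real (r + e / 2)"] imageI) (auto simp: dist_norm simp flip: of_real_diff)
  qed
qed

text \<open>The identity theorem is used twice: from real to complex \<open>b\<close> at fixed real
  \<open>a\<close>, then from real \<open>a\<close> to the half plane. The right-hand side is
  holomorphic in \<open>a\<close> because inversion preserves the right half plane, which avoids the
  cut of the principal root.\<close>

lemma complex_gaussian_integral:
  fixes a b :: complex assumes "Re a > 0"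
  shows "integrable lborel (\<lambda>x. exp (- a * complex_of_real (x\<^sup>2) + b * complex_of_real x))"
    and "(\<integral>x. exp (- a * complex_of_real (x\<^sup>2) + b * complex_of_real x) \<partial>lborel)
          = csqrt (of_real pi / a) * exp (b\<^sup>2 / (4 * a))"
proof -
  have int: "integrable lborel (\<lambda>x. exp (- a * complex_of_real (x\<^sup>2) + b * complex_of_real x))"
    if "Re a > 0" for a b :: complex
    by (rule Bochner_Integration.integrable_bound[OF integrable_real_gaussian(1)[OF that, of "Re b"]]) auto
  then show "integrable lborel (\<lambda>x. exp (- a * complex_of_real (x\<^sup>2) + b * complex_of_real x))"
    using assms by blast
  let ?I = "\<lambda>a b. \<integral>x. exp (- a * complex_of_real (x\<^sup>2) + b * complex_of_real x) \<partial>lborel"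
  let ?R = "\<lambda>a b. csqrt (of_real pi / a) * exp (b\<^sup>2 / (4 * a))"
  have npi: "of_real pi / z \<notin> \<real>\<^sub>\<le>\<^sub>0" if "Re z > 0" for z :: complex
  proof -
    have "Re (of_real pi / z) = pi * Re z / (cmod z)\<^sup>2" by (simp add: Re_divide_of_real Re_divide cmod_def)
    moreover have "z \<noteq> 0" using that by auto
    ultimately have "Re (of_real pi / z) > 0" using that by simp
    then show ?thesis by (auto simp: complex_nonpos_Reals_iff)
  qed
  have real_real: "?I (of_real r) (of_real s) = ?R (of_real r) (of_real s)" if "r > 0" for r s :: real
  proof -
    have "?I (of_real r) (of_real s) = (\<integral>x. complex_of_real (exp (- r * x\<^sup>2 + s * x)) \<partial>lborel)"
      by (intro Bochner_Integration.integral_cong) (auto simp flip: exp_of_real)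
    also have "\<dots> = complex_of_real (sqrt (pi / r) * exp (s\<^sup>2 / (4 * r)))"
      using integrable_real_gaussian(2)[OF that] by (simp only: integral_complex_of_real)
    also have "\<dots> = ?R (of_real r) (of_real s)"
    proof -
      have "csqrt (of_real pi / of_real r) = complex_of_real (sqrt (pi / r))"
        using csqrt_of_real_nonneg[of "pi / r"] that by simp
      moreover have "exp ((of_real s)\<^sup>2 / (4 * of_real r)) = complex_of_real (exp (s\<^sup>2 / (4 * r)))"
        by (simp flip: exp_of_real)
      ultimately show ?thesis by (simp only: of_real_mult)
    qed
    finally show ?thesis .
  qed
  have real_complex: "?I (of_real r) b = ?R (of_real r) b" if r: "r > 0" for r :: real and b
  proof -
    have hol: "(\<lambda>z. \<integral>x. exp (- of_real r * complex_of_real (x\<^sup>2)) * exp (- z * complex_of_real (- x)) \<partial>lborel)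
        holomorphic_on {z. Re z \<in> UNIV}"
    proof (rule holomorphic_laplace)
      fix c :: real
      show "integrable lborel (\<lambda>x. cmod (exp (- of_real r * complex_of_real (x\<^sup>2))) * exp (- c * (- x)))"
        using integrable_real_gaussian(1)[OF r, of c] by (simp flip: exp_add)
    qed auto
    have hol1: "?I (of_real r) holomorphic_on UNIV"
      using hol by (simp flip: exp_add)
    have hol2: "?R (of_real r) holomorphic_on UNIV"
      using r by (intro holomorphic_intros) auto
    have "?I (of_real r) b - ?R (of_real r) b = 0"
    proof (rule analytic_continuation[where f = "\<lambda>b. ?I (of_real r) b - ?R (of_real r) b" and w = b and S = UNIV and U = "complex_of_real ` {0<..}" and \<xi> = 1])
      show "(\<lambda>b. ?I (of_real r) b - ?R (of_real r) b) holomorphic_on UNIV"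
        using hol1 hol2 by (rule holomorphic_on_diff)
      show "1 islimpt complex_of_real ` {0<..}"
        using islimpt_reals_halfplane[of 0 1] by simp
    qed (use r real_real in auto)
    then show ?thesis by simp
  qed
  have hol: "(\<lambda>z. \<integral>x. exp (b * complex_of_real x) * exp (- z * complex_of_real (x\<^sup>2)) \<partial>lborel)
      holomorphic_on {z. Re z \<in> {0<..}}"
  proof (rule holomorphic_laplace)
    fix c :: real assume "c \<in> {0<..}"
    then show "integrable lborel (\<lambda>x. cmod (exp (b * complex_of_real x)) * exp (- c * x\<^sup>2))"
      using integrable_real_gaussian(1)[of c "Re b"] by (simp add: mult.commute flip: exp_add)
  qed auto
  have hol1: "(\<lambda>a. ?I a b) holomorphic_on {z. Re z > 0}"
    using hol by (simp flip: exp_add add: algebra_simps)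
  have hol2: "(\<lambda>a. ?R a b) holomorphic_on {z. Re z > 0}"
    by (intro holomorphic_intros) (use npi in auto)
  have "?I a b - ?R a b = 0"
  proof (rule analytic_continuation[where f = "\<lambda>a. ?I a b - ?R a b" and w = a and S = "{z. Re z > 0}" and U = "complex_of_real ` {0<..}" and \<xi> = 1])
    show "(\<lambda>a. ?I a b - ?R a b) holomorphic_on {z. Re z > 0}"
      using hol1 hol2 by (rule holomorphic_on_diff)
    show "1 islimpt complex_of_real ` {0<..}"
      using islimpt_reals_halfplane[of 0 1] by simp
    show "open {z. Re z > 0}" by (rule open_halfspace_Re_gt)
    show "connected {z. Re z > 0}" by (intro convex_connected convex_halfspace_Re_gt)
  qed (use assms real_complex in auto)
  then show "?I a b = ?R a b" by simp
qed

definition gauss :: "real \<Rightarrow> real \<Rightarrow> real \<Rightarrow> real" where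
  "gauss \<epsilon> E y = 1 / sqrt (2 * pi * \<epsilon>\<^sup>2) * exp (- (1 / 2) * ((y - E) / \<epsilon>)\<^sup>2)"

text \<open>The entire function whose product with \<open>exp (- \<beta> * y)\<close>, integrated
  along any vertical line, is \<open>2 * pi * gauss \<epsilon> E y\<close>. Its modulus decays where
  the imaginary part dominates the real part, so contours steeper than the diagonal are
  admissible.\<close>

definition laplace_weight :: "real \<Rightarrow> real \<Rightarrow> complex \<Rightarrow> complex" where
  "laplace_weight \<epsilon> E \<beta> = exp (of_real (\<epsilon>\<^sup>2 / 2) * \<beta>\<^sup>2 + \<beta> * of_real E)"

lemma norm_laplace_weight:
  "cmod (laplace_weight \<epsilon> E (Complex b s)) = exp (\<epsilon>\<^sup>2 * (b\<^sup>2 - s\<^sup>2) / 2 + b * E)"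
  by (simp add: laplace_weight_def power2_eq_square algebra_simps diff_divide_distrib)

lemma holomorphic_laplace_weight: "laplace_weight \<epsilon> E holomorphic_on A"
  unfolding laplace_weight_def[abs_def] by (intro holomorphic_intros)

text \<open>On the line the exponent is quadratic in \<open>s\<close>. Completing the square makes
  every term with \<open>b\<close> cancel, so the abscissa is free; it is later chosen to depend on
  \<open>N\<close>.\<close>

lemma gaussian_laplace_scalar:
  assumes "\<epsilon> > 0"
  shows "integrable lborel (\<lambda>s. laplace_weight \<epsilon> E (Complex b s) * exp (- Complex b s * of_real y))"
    and "(\<integral>s. laplace_weight \<epsilon> E (Complex b s) * exp (- Complex b s * of_real y) \<partial>lborel)
          = of_real (2 * pi * gauss \<epsilon> E y)"
proof -
  let ?a = "complex_of_real (\<epsilon>\<^sup>2 / 2)"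
  let ?b = "\<i> * complex_of_real (\<epsilon>\<^sup>2 * b + E - y)"
  let ?c = "complex_of_real (exp (\<epsilon>\<^sup>2 * b\<^sup>2 / 2 + b * (E - y)))"
  have a: "Re ?a > 0" using assms by simp
  have eq: "laplace_weight \<epsilon> E (Complex b s) * exp (- Complex b s * of_real y)
     = ?c * exp (- ?a * complex_of_real (s\<^sup>2) + ?b * complex_of_real s)" for s
    unfolding laplace_weight_def exp_of_real[symmetric] exp_add[symmetric]
    by (rule arg_cong[where f = exp])
       (simp add: complex_eq_iff power2_eq_square algebra_simps diff_divide_distrib add_divide_distrib)
  show "integrable lborel (\<lambda>s. laplace_weight \<epsilon> E (Complex b s) * exp (- Complex b s * of_real y))"
    unfolding eq using complex_gaussian_integral(1)[OF a] by (rule integrable_mult_right)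
  have "(\<integral>s. laplace_weight \<epsilon> E (Complex b s) * exp (- Complex b s * of_real y) \<partial>lborel)
     = ?c * (csqrt (of_real pi / ?a) * exp (?b\<^sup>2 / (4 * ?a)))"
    unfolding eq using complex_gaussian_integral(2)[OF a] by simp
  also have "csqrt (of_real pi / ?a) = of_real (sqrt (2 * pi) / \<epsilon>)"
  proof -
    have "sqrt (pi / (\<epsilon>\<^sup>2 / 2)) = sqrt (2 * pi) / \<epsilon>"
      using assms by (simp add: real_sqrt_divide real_sqrt_mult)
    moreover have "csqrt (of_real (pi / (\<epsilon>\<^sup>2 / 2))) = of_real (sqrt (pi / (\<epsilon>\<^sup>2 / 2)))"
      by (subst csqrt_of_real_nonneg) simp_all
    ultimately show ?thesis by simp
  qed
  also have "exp (?b\<^sup>2 / (4 * ?a)) = of_real (exp (- ((\<epsilon>\<^sup>2 * b + E - y)\<^sup>2 / (2 * \<epsilon>\<^sup>2))))"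
    by (simp add: power_mult_distrib flip: exp_of_real)
  also have "?c * (of_real (sqrt (2 * pi) / \<epsilon>) * of_real (exp (- ((\<epsilon>\<^sup>2 * b + E - y)\<^sup>2 / (2 * \<epsilon>\<^sup>2)))))
    = of_real (sqrt (2 * pi) / \<epsilon> * exp (\<epsilon>\<^sup>2 * b\<^sup>2 / 2 + b * (E - y) - (\<epsilon>\<^sup>2 * b + E - y)\<^sup>2 / (2 * \<epsilon>\<^sup>2)))"
    unfolding exp_diff exp_minus by (simp add: divide_simps)
  also have "\<epsilon>\<^sup>2 * b\<^sup>2 / 2 + b * (E - y) - (\<epsilon>\<^sup>2 * b + E - y)\<^sup>2 / (2 * \<epsilon>\<^sup>2) = - (1 / 2) * ((y - E) / \<epsilon>)\<^sup>2"
    using assms by (simp add: field_simps power2_eq_square)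
  also have "sqrt (2 * pi) / \<epsilon> = 2 * pi * (1 / sqrt (2 * pi * \<epsilon>\<^sup>2))"
    using assms by (simp add: real_sqrt_mult field_simps flip: power2_eq_square)
  finally show "(\<integral>s. laplace_weight \<epsilon> E (Complex b s) * exp (- Complex b s * of_real y) \<partial>lborel)
          = of_real (2 * pi * gauss \<epsilon> E y)"
    by (simp add: gauss_def)
qed

lemma integrable_laplace_weight:
  assumes "\<epsilon> > 0" shows "integrable lborel (\<lambda>s. cmod (laplace_weight \<epsilon> E (Complex b s)))"
  using gaussian_laplace_scalar(1)[OF assms, of E b 0] by simp

lemma measurable_Complex [measurable]: "Complex b \<in> borel_measurable borel"
  unfolding Complex_eq[abs_def] by measurable

text \<open>Fubini around the scalar identity. \<open>M\<close> stays abstract because it is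
  instantiated both with the phase space of discretised paths and with the counting measure on
  eigenvectors.\<close>

lemma gaussian_inverse_laplace:
  fixes a :: "'a \<Rightarrow> complex" and h :: "'a \<Rightarrow> real"
  assumes "sigma_finite_measure M" and e: "\<epsilon> > 0"
    and [measurable]: "a \<in> borel_measurable M" "h \<in> borel_measurable M"
    and int: "integrable M (\<lambda>x. cmod (a x) * exp (- b * h x))"
  defines "F \<equiv> \<lambda>z. \<integral>x. a x * exp (- z * complex_of_real (h x)) \<partial>M"
  shows "integrable lborel (\<lambda>s. laplace_weight \<epsilon> E (Complex b s) * F (Complex b s))"
    and "integrable M (\<lambda>x. a x * complex_of_real (gauss \<epsilon> E (h x)))"
    and "(\<integral>x. a x * complex_of_real (gauss \<epsilon> E (h x)) \<partial>M)
          = (\<integral>s. laplace_weight \<epsilon> E (Complex b s) * F (Complex b s) \<partial>lborel) / (2 * pi)"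
proof -
  interpret sigma_finite_measure M by fact
  interpret pair_sigma_finite lborel M
    by (rule pair_sigma_finite.intro) (unfold_locales)
  let ?w = "\<lambda>s. laplace_weight \<epsilon> E (Complex b s)"
  let ?f = "\<lambda>s x. a x * (?w s * exp (- Complex b s * complex_of_real (h x)))"
  have [measurable]: "?w \<in> borel_measurable borel"
    unfolding laplace_weight_def by measurable
  have wint: "integrable lborel (\<lambda>s. cmod (?w s))"
    by (rule integrable_laplace_weight[OF e])
  have "integrable (lborel \<Otimes>\<^sub>M M) (\<lambda>(s, x). cmod (?w s) * (cmod (a x) * exp (- b * h x)))"
    using Fubini_integrable[of "\<lambda>(s, x). cmod (?w s) * (cmod (a x) * exp (- b * h x))"] wint int by simp
  then have fint: "integrable (lborel \<Otimes>\<^sub>M M) (case_prod ?f)"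
    by (rule Bochner_Integration.integrable_bound) (auto simp: norm_mult)
  have inner1: "(\<integral>x. ?f s x \<partial>M) = ?w s * F (Complex b s)" for s
    unfolding F_def by (subst mult.left_commute, subst integral_mult_right_zero) simp
  have inner2: "(\<integral>s. ?f s x \<partial>lborel) = of_real (2 * pi) * (a x * complex_of_real (gauss \<epsilon> E (h x)))" for x
    by (subst integral_mult_right_zero, subst gaussian_laplace_scalar(2)[OF e]) simp
  show "integrable lborel (\<lambda>s. ?w s * F (Complex b s))"
    using integrable_fst[OF fint] by (simp only: inner1)
  have "integrable M (\<lambda>x. of_real (2 * pi) * (a x * complex_of_real (gauss \<epsilon> E (h x))))"
    using integrable_snd[OF fint] by (simp only: inner2)
  from integrable_mult_right[OF this, of "of_real (1 / (2 * pi))"]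
  show "integrable M (\<lambda>x. a x * complex_of_real (gauss \<epsilon> E (h x)))"
    by (simp add: mult.assoc[symmetric])
  have "(\<integral>x. of_real (2 * pi) * (a x * complex_of_real (gauss \<epsilon> E (h x))) \<partial>M) = (\<integral>s. ?w s * F (Complex b s) \<partial>lborel)"
    using Fubini_integral[OF fint] by (simp only: inner1 inner2)
  then show "(\<integral>x. a x * complex_of_real (gauss \<epsilon> E (h x)) \<partial>M)
          = (\<integral>s. ?w s * F (Complex b s) \<partial>lborel) / (2 * pi)"
    unfolding integral_mult_right_zero by (simp add: eq_divide_eq mult.commute)
qed

section \<open>Traces of powers in an abstract Hilbert--Schmidt ideal\<close>

text \<open>The trace inequalities only multiply, take adjoints and use Cauchy-Schwarz, so a monoid
  is enough and linear structure is left out. \<open>S\<close> is the Hilbert-Schmidt ideal;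
  \<open>1\<close> need not belong to it, and \<open>tr\<close> and \<open>hs\<close> carry meaning
  on \<open>S\<close> only.\<close>

locale hs_monoid =
  fixes S :: "'a::monoid_mult set" and adj :: "'a \<Rightarrow> 'a" and tr :: "'a \<Rightarrow> complex" and hs :: "'a \<Rightarrow> real"
  assumes ideal_left: "b \<in> S \<Longrightarrow> a * b \<in> S"
    and ideal_right: "a \<in> S \<Longrightarrow> a * b \<in> S"
    and adj_mult: "adj (a * b) = adj b * adj a"
    and adj_adj [simp]: "adj (adj a) = a"
    and adj_closed [simp]: "a \<in> S \<Longrightarrow> adj a \<in> S"
    and tr_commute: "a \<in> S \<Longrightarrow> b \<in> S \<Longrightarrow> tr (a * b) = tr (b * a)"
    and hs_nonneg [simp]: "0 \<le> hs a"
    and tr_adj_mult: "a \<in> S \<Longrightarrow> tr (adj a * a) = of_real ((hs a)\<^sup>2)"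
    and cauchy_schwarz: "a \<in> S \<Longrightarrow> b \<in> S \<Longrightarrow> cmod (tr (a * b)) \<le> hs a * hs b"
    and hs_mult_le: "a \<in> S \<Longrightarrow> b \<in> S \<Longrightarrow> hs (a * b) \<le> hs a * hs b"
begin

lemma adj_1 [simp]: "adj 1 = 1"
  by (metis adj_adj adj_mult mult_1 mult_1_right)

lemma adj_power: "adj (a ^ n) = adj a ^ n"
  by (induction n) (simp_all add: adj_mult power_commutes)

lemma power_closed: "a \<in> S \<Longrightarrow> n > 0 \<Longrightarrow> a ^ n \<in> S"
  by (cases n) (auto intro: ideal_right)

lemma hs_adj: assumes "a \<in> S" shows "hs (adj a) = hs a"
proof -
  have "complex_of_real ((hs (adj a))\<^sup>2) = of_real ((hs a)\<^sup>2)"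
    using tr_adj_mult[of "adj a"] tr_adj_mult[of a] tr_commute[of a "adj a"] assms by simp
  then have "(hs (adj a))\<^sup>2 = (hs a)\<^sup>2" by (simp only: of_real_eq_iff)
  then show ?thesis by (simp add: power2_eq_iff_nonneg)
qed

lemma hs_square: "a \<in> S \<Longrightarrow> (hs a)\<^sup>2 = cmod (tr (adj a * a))"
  by (simp add: tr_adj_mult norm_power)

lemma tr_power_commute:
  assumes "a \<in> S" "b \<in> S" "n > 0" shows "tr ((a * b) ^ n) = tr ((b * a) ^ n)"
proof -
  obtain k where n: "n = Suc k" using assms(3) by (cases n) auto
  have comm: "b * (a * b) ^ k = (b * a) ^ k * b"
    by (induction k) (simp_all add: mult.assoc)
  have "(a * b) ^ n = a * ((b * a) ^ k * b)"
    by (simp add: n mult.assoc comm)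
  moreover have "(b * a) ^ n = (b * a) ^ k * b * a"
    by (simp add: n power_commutes mult.assoc)
  ultimately show ?thesis
    using tr_commute[of a "(b * a) ^ k * b"] assms by (simp add: ideal_left)
qed

lemma hs_power_self_adjoint:
  assumes "a \<in> S" "adj a = a" "n > 0" shows "(hs (a ^ n))\<^sup>2 = cmod (tr (a ^ (2 * n)))"
  using hs_square[of "a ^ n"] assms by (simp add: power_closed adj_power mult_2 power_add)

text \<open>A Weyl type and a Lieb-Thirring type inequality, proved together because each at
  \<open>Suc j\<close> uses both at \<open>j\<close>. The first, applied to \<open>K * K\<close>,
  reduces by cyclicity to the product of \<open>adj K * K\<close> and \<open>K * adj K\<close>,
  which have the same moments. The second reduces by Cauchy-Schwarz to the first for
  \<open>P * Q\<close>, then by cyclicity to the product of \<open>P * P\<close> and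
  \<open>Q * Q\<close>.\<close>

lemma hs_trace_power_aux:
  shows "(\<forall>K\<in>S. (hs (K ^ (2 ^ j)))\<^sup>2 \<le> cmod (tr ((adj K * K) ^ (2 ^ j)))) \<and>
    (\<forall>P\<in>S. \<forall>Q\<in>S. adj P = P \<longrightarrow> adj Q = Q \<longrightarrow>
       cmod (tr ((P * Q) ^ (2 ^ j))) \<le> hs (P ^ (2 ^ j)) * hs (Q ^ (2 ^ j)))"
proof (induction j)
  case 0
  then show ?case by (simp add: hs_square cauchy_schwarz)
next
  case (Suc j)
  let ?l = "2 ^ j :: nat"
  have l: "?l > 0" by simp
  have C: "(hs (K ^ ?l))\<^sup>2 \<le> cmod (tr ((adj K * K) ^ ?l))" if "K \<in> S" for K
    using Suc.IH that by blast
  have LT: "cmod (tr ((P * Q) ^ ?l)) \<le> hs (P ^ ?l) * hs (Q ^ ?l)"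
    if "P \<in> S" "Q \<in> S" "adj P = P" "adj Q = Q" for P Q
    using Suc.IH that by blast
  have "(hs (K ^ (2 ^ Suc j)))\<^sup>2 \<le> cmod (tr ((adj K * K) ^ (2 ^ Suc j)))" if K: "K \<in> S" for K
  proof -
    let ?P = "K * adj K" and ?Q = "adj K * K"
    have PQ: "?P \<in> S" "?Q \<in> S" "adj ?P = ?P" "adj ?Q = ?Q"
      using K by (auto simp: adj_mult intro: ideal_left ideal_right)
    have eqtr: "tr (?P ^ (2 * ?l)) = tr (?Q ^ (2 * ?l))"
      using K by (intro tr_power_commute) auto
    have "(hs (K ^ (2 ^ Suc j)))\<^sup>2 = (hs ((K * K) ^ ?l))\<^sup>2"
      by (simp add: power_mult power2_eq_square)
    also have "\<dots> \<le> cmod (tr ((adj (K * K) * (K * K)) ^ ?l))"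
      using K by (intro C) (auto intro: ideal_left)
    also have "adj (K * K) * (K * K) = adj K * (?Q * K)"
      by (simp add: adj_mult mult.assoc)
    also have "tr ((adj K * (?Q * K)) ^ ?l) = tr ((?Q * ?P) ^ ?l)"
      using tr_power_commute[of "adj K" "?Q * K" ?l] K by (simp add: ideal_left mult.assoc)
    also have "cmod \<dots> \<le> hs (?Q ^ ?l) * hs (?P ^ ?l)"
      using PQ by (intro LT) auto
    also have "hs (?P ^ ?l) = hs (?Q ^ ?l)"
    proof (rule power2_eq_imp_eq)
      show "(hs (?P ^ ?l))\<^sup>2 = (hs (?Q ^ ?l))\<^sup>2"
        unfolding hs_power_self_adjoint[OF PQ(1) PQ(3) l] hs_power_self_adjoint[OF PQ(2) PQ(4) l] eqtr ..
    qed (rule hs_nonneg)+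
    also have "hs (?Q ^ ?l) * hs (?Q ^ ?l) = cmod (tr (?Q ^ (2 ^ Suc j)))"
      using hs_power_self_adjoint[OF PQ(2) PQ(4) l] by (simp add: power2_eq_square)
    finally show ?thesis .
  qed
  moreover have "cmod (tr ((P * Q) ^ (2 ^ Suc j))) \<le> hs (P ^ (2 ^ Suc j)) * hs (Q ^ (2 ^ Suc j))"
    if P: "P \<in> S" "adj P = P" and Q: "Q \<in> S" "adj Q = Q" for P Q
  proof -
    let ?X = "P * Q"
    have X: "?X \<in> S" using P by (intro ideal_right)
    have "cmod (tr (?X ^ (2 ^ Suc j))) = cmod (tr (?X ^ ?l * ?X ^ ?l))"
      by (simp add: mult_2 power_add)
    also have "\<dots> \<le> hs (?X ^ ?l) * hs (?X ^ ?l)"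
      using X by (intro cauchy_schwarz power_closed) auto
    also have "\<dots> \<le> cmod (tr ((adj ?X * ?X) ^ ?l))"
      using C[OF X] by (simp add: power2_eq_square)
    also have "adj ?X * ?X = Q * (P * P * Q)"
      using P Q by (simp add: adj_mult mult.assoc)
    also have "tr ((Q * (P * P * Q)) ^ ?l) = tr ((P * P * Q * Q) ^ ?l)"
      using P Q by (intro tr_power_commute) (auto intro: ideal_left)
    also have "(P * P * Q * Q) ^ ?l = ((P * P) * (Q * Q)) ^ ?l"
      by (simp add: mult.assoc)
    also have "cmod (tr (((P * P) * (Q * Q)) ^ ?l)) \<le> hs ((P * P) ^ ?l) * hs ((Q * Q) ^ ?l)"
      using P Q by (intro LT) (auto simp: adj_mult intro: ideal_left)
    finally show ?thesis
      by (simp add: power_mult power2_eq_square)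
  qed
  ultimately show ?case by blast
qed

lemma hs_power_le_trace: "K \<in> S \<Longrightarrow> (hs (K ^ (2 ^ j)))\<^sup>2 \<le> cmod (tr ((adj K * K) ^ (2 ^ j)))"
  using hs_trace_power_aux by blast

text \<open>One doubling step: half as many factors, each replaced by \<open>adj X * X\<close>.
  Iterating it yields the Golden-Thompson bound.\<close>

lemma trace_power_le:
  assumes "X \<in> S" shows "cmod (tr (X ^ (2 * 2 ^ j))) \<le> cmod (tr ((adj X * X) ^ (2 ^ j)))"
proof -
  have "cmod (tr (X ^ (2 * 2 ^ j))) \<le> hs (X ^ (2 ^ j)) * hs (X ^ (2 ^ j))"
    unfolding mult_2 power_add using assms by (intro cauchy_schwarz power_closed) auto
  then show ?thesis using hs_power_le_trace[OF assms, of j] by (simp add: power2_eq_square)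
qed

text \<open>Stands in for bounding \<open>hs (K * X)\<close> by the operator norm of
  \<open>K\<close> times \<open>hs X\<close>. The operator norm is replaced by the larger Schatten
  norm of order \<open>2 * 2 ^ j\<close>, and the argument is log-convexity in \<open>m\<close> of
  the moments tr (adj X * Q^m * X) with \<open>Q = adj K * K\<close>.\<close>

lemma hs_mult_power_le:
  assumes K: "K \<in> S" and X: "X \<in> S"
  shows "hs (K * X) ^ (2 * 2 ^ j) \<le> hs X ^ (2 * 2 ^ j) * cmod (tr ((adj K * K) ^ (2 ^ j)))"
proof -
  define Q where "Q = adj K * K"
  have Q: "Q \<in> S" "adj Q = Q" using K by (auto simp: Q_def adj_mult intro: ideal_left)
  define t where "t m = cmod (tr (adj X * (Q ^ m * X)))" for m
  have t_hs: "(hs (Q ^ m * X))\<^sup>2 = t (2 * m)" for m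
  proof -
    have "(hs (Q ^ m * X))\<^sup>2 = cmod (tr (adj (Q ^ m * X) * (Q ^ m * X)))"
      using X by (intro hs_square ideal_left)
    also have "adj (Q ^ m * X) * (Q ^ m * X) = adj X * (Q ^ (2 * m) * X)"
      by (simp add: adj_mult adj_power Q mult_2 power_add mult.assoc)
    finally show ?thesis by (simp add: t_def)
  qed
  have t_le: "t m \<le> hs X * hs (Q ^ m * X)" for m
    unfolding t_def using cauchy_schwarz[of "adj X" "Q ^ m * X"] X by (simp add: ideal_left hs_adj)
  have t2: "(t m)\<^sup>2 \<le> (hs X)\<^sup>2 * t (2 * m)" for m
    using power_mono[OF t_le, of m 2] unfolding power_mult_distrib t_hs by (simp add: t_def)
  have t1: "(hs (K * X))\<^sup>2 = t 1"
    using hs_square[of "K * X"] X by (simp add: ideal_left t_def Q_def adj_mult mult.assoc)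
  \<comment> \<open>Iteration of \<open>t2\<close>; the exponents of \<open>hs X\<close> add up to 2
    * (1 + 2 + ... + 2^(i-1)).\<close>
  have ind: "t 1 ^ (2 ^ i) \<le> hs X ^ (2 * (2 ^ i - 1)) * t (2 ^ i)" for i
  proof (induction i)
    case (Suc i)
    have "t 1 ^ (2 ^ Suc i) = (t 1 ^ (2 ^ i))\<^sup>2"
      by (simp add: power_mult[symmetric] mult.commute)
    also have "\<dots> \<le> (hs X ^ (2 * (2 ^ i - 1)) * t (2 ^ i))\<^sup>2"
      using Suc.IH by (intro power_mono) (auto simp: t_def)
    also have "\<dots> = hs X ^ (4 * (2 ^ i - 1)) * (t (2 ^ i))\<^sup>2"
      by (simp add: power_mult_distrib power_mult[symmetric] mult.commute)
    also have "\<dots> \<le> hs X ^ (4 * (2 ^ i - 1)) * ((hs X)\<^sup>2 * t (2 * 2 ^ i))"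
      by (intro mult_left_mono t2) auto
    also have "\<dots> = hs X ^ (4 * (2 ^ i - 1) + 2) * t (2 ^ Suc i)"
      by (simp only: power_add power_Suc mult.assoc)
    also have "4 * (2 ^ i - 1) + 2 = 2 * ((2::nat) ^ Suc i - 1)"
    proof -
      have "(2::nat) ^ i \<ge> 1" by simp
      then obtain k where "(2::nat) ^ i = Suc k" by (cases "(2::nat) ^ i") auto
      then show ?thesis by simp
    qed
    finally show ?case .
  qed simp
  \<comment> \<open>The Hilbert-Schmidt norm of a positive operator is at most its trace. The power
    is split into two factors whose norms multiply to the trace: two equal halves, or
    \<open>adj K\<close> and \<open>K\<close> when \<open>j = 0\<close>.\<close>
  have hsQ: "hs (Q ^ (2 ^ j)) \<le> cmod (tr (Q ^ (2 ^ j)))"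
  proof (cases j)
    case 0
    have "hs Q \<le> hs (adj K) * hs K" unfolding Q_def using K by (intro hs_mult_le) auto
    also have "\<dots> = cmod (tr Q)" using hs_square[OF K] K by (simp add: hs_adj Q_def power2_eq_square)
    finally show ?thesis using 0 by simp
  next
    case (Suc i)
    have "hs (Q ^ (2 ^ j)) = hs (Q ^ (2 ^ i) * Q ^ (2 ^ i))"
      by (simp add: Suc mult_2 power_add)
    also have "\<dots> \<le> hs (Q ^ (2 ^ i)) * hs (Q ^ (2 ^ i))"
      using Q by (intro hs_mult_le power_closed) auto
    also have "\<dots> = cmod (tr (Q ^ (2 ^ j)))"
      using hs_power_self_adjoint[OF Q, of "2 ^ i"] by (simp add: Suc power2_eq_square)
    finally show ?thesis .
  qed
  have "hs (K * X) ^ (2 * 2 ^ j) = t 1 ^ (2 ^ j)" by (simp add: power_mult t1)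
  also have "\<dots> \<le> hs X ^ (2 * (2 ^ j - 1)) * t (2 ^ j)" by (rule ind)
  also have "\<dots> \<le> hs X ^ (2 * (2 ^ j - 1)) * (hs X * (cmod (tr (Q ^ (2 ^ j))) * hs X))"
  proof (intro mult_left_mono order_trans[OF t_le])
    show "hs (Q ^ (2 ^ j) * X) \<le> cmod (tr (Q ^ (2 ^ j))) * hs X"
      using hs_mult_le[of "Q ^ (2 ^ j)" X] hsQ X Q mult_right_mono[OF hsQ hs_nonneg[of X]]
      by (simp add: power_closed)
  qed auto
  also have "\<dots> = hs X ^ (2 * (2 ^ j - 1) + 2) * cmod (tr (Q ^ (2 ^ j)))"
    by (simp add: power_add power2_eq_square)
  also have "2 * (2 ^ j - 1) + 2 = 2 * (2::nat) ^ j"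
    by (cases "(2::nat) ^ j") auto
  finally show ?thesis by (simp add: Q_def)
qed

end

section \<open>Hilbert--Schmidt kernels on the real line\<close>

lemma cauchy_schwarz_integral:
  fixes f g :: "'a \<Rightarrow> complex"
  assumes [measurable]: "f \<in> borel_measurable M" "g \<in> borel_measurable M"
    and f: "integrable M (\<lambda>x. (cmod (f x))\<^sup>2)" and g: "integrable M (\<lambda>x. (cmod (g x))\<^sup>2)"
  shows "integrable M (\<lambda>x. f x * g x)"
    and "(cmod (\<integral>x. f x * g x \<partial>M))\<^sup>2 \<le> (\<integral>x. (cmod (f x))\<^sup>2 \<partial>M) * (\<integral>x. (cmod (g x))\<^sup>2 \<partial>M)"
proof -
  have bound: "cmod (f x * g x) \<le> (cmod (f x))\<^sup>2 + (cmod (g x))\<^sup>2" for x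
  proof -
    have "0 \<le> cmod (f x) * cmod (g x)" by simp
    then show ?thesis
      using sum_squares_bound[of "cmod (f x)" "cmod (g x)"] unfolding norm_mult by linarith
  qed
  show int: "integrable M (\<lambda>x. f x * g x)"
    by (rule Bochner_Integration.integrable_bound[OF Bochner_Integration.integrable_add[OF f g]])
       (auto intro!: AE_I2 order_trans[OF bound])
  have "ennreal ((\<integral>x. cmod (f x * g x) \<partial>M)\<^sup>2) = (\<integral>\<^sup>+x. ennreal (cmod (f x)) * ennreal (cmod (g x)) \<partial>M)\<^sup>2"
    using nn_integral_eq_integral[of M "\<lambda>x. cmod (f x * g x)"] integrable_norm[OF int]
    by (simp add: norm_mult ennreal_mult flip: ennreal_power)
  also have "\<dots> \<le> (\<integral>\<^sup>+x. ennreal (cmod (f x)) ^ 2 \<partial>M) * (\<integral>\<^sup>+x. ennreal (cmod (g x)) ^ 2 \<partial>M)"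
    by (rule Cauchy_Schwarz_nn_integral) measurable
  also have "\<dots> = ennreal ((\<integral>x. (cmod (f x))\<^sup>2 \<partial>M) * (\<integral>x. (cmod (g x))\<^sup>2 \<partial>M))"
    using nn_integral_eq_integral[OF f] nn_integral_eq_integral[OF g]
    by (simp add: ennreal_power ennreal_mult)
  finally have "(\<integral>x. cmod (f x * g x) \<partial>M)\<^sup>2 \<le> (\<integral>x. (cmod (f x))\<^sup>2 \<partial>M) * (\<integral>x. (cmod (g x))\<^sup>2 \<partial>M)"
    by (subst (asm) ennreal_le_iff) auto
  moreover have "(cmod (\<integral>x. f x * g x \<partial>M))\<^sup>2 \<le> (\<integral>x. cmod (f x * g x) \<partial>M)\<^sup>2"
    by (intro power_mono integral_norm_bound) auto
  ultimately show "(cmod (\<integral>x. f x * g x \<partial>M))\<^sup>2 \<le> (\<integral>x. (cmod (f x))\<^sup>2 \<partial>M) * (\<integral>x. (cmod (g x))\<^sup>2 \<partial>M)"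
    by linarith
qed

text \<open>
  Square integrability of every single section makes compositions associative pointwise and not
  only almost everywhere.
\<close>

definition hs_kernel :: "(real \<Rightarrow> real \<Rightarrow> complex) \<Rightarrow> bool" where
  "hs_kernel k \<longleftrightarrow> case_prod k \<in> borel_measurable (borel \<Otimes>\<^sub>M borel) \<and>
     integrable (lborel \<Otimes>\<^sub>M lborel) (\<lambda>(x, y). (cmod (k x y))\<^sup>2) \<and>
     (\<forall>x. integrable lborel (\<lambda>y. (cmod (k x y))\<^sup>2)) \<and>
     (\<forall>y. integrable lborel (\<lambda>x. (cmod (k x y))\<^sup>2))"

definition kernel_comp :: "(real \<Rightarrow> real \<Rightarrow> complex) \<Rightarrow> (real \<Rightarrow> real \<Rightarrow> complex) \<Rightarrow> real \<Rightarrow> real \<Rightarrow> complex" where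
  "kernel_comp f g x y = (\<integral>z. f x z * g z y \<partial>lborel)"

definition kernel_norm :: "(real \<Rightarrow> real \<Rightarrow> complex) \<Rightarrow> real" where
  "kernel_norm k = sqrt (\<integral>(x, y). (cmod (k x y))\<^sup>2 \<partial>(lborel \<Otimes>\<^sub>M lborel))"

lemma kernel_norm_nonneg [simp]: "0 \<le> kernel_norm k"
  and kernel_norm_square: "(kernel_norm k)\<^sup>2 = (\<integral>(x, y). (cmod (k x y))\<^sup>2 \<partial>(lborel \<Otimes>\<^sub>M lborel))"
proof -
  have "0 \<le> (\<integral>(x, y). (cmod (k x y))\<^sup>2 \<partial>(lborel \<Otimes>\<^sub>M lborel))"
    by (intro integral_nonneg_AE AE_I2) auto
  then show "0 \<le> kernel_norm k" "(kernel_norm k)\<^sup>2 = (\<integral>(x, y). (cmod (k x y))\<^sup>2 \<partial>(lborel \<Otimes>\<^sub>M lborel))"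
    by (simp_all add: kernel_norm_def)
qed

lemma kernel_measurable:
  assumes "case_prod k \<in> borel_measurable (borel \<Otimes>\<^sub>M borel)"
    and "f \<in> borel_measurable N" "g \<in> borel_measurable N"
  shows "(\<lambda>w. k (f w) (g w)) \<in> borel_measurable N"
  using measurable_compose[OF measurable_Pair[OF assms(2,3)] assms(1)] by simp

lemma
  assumes "hs_kernel k"
  shows hs_kernel_measurable: "case_prod k \<in> borel_measurable (borel \<Otimes>\<^sub>M borel)"
    and hs_kernel_integrable: "integrable (lborel \<Otimes>\<^sub>M lborel) (\<lambda>(x, y). (cmod (k x y))\<^sup>2)"
    and hs_kernel_fst: "integrable lborel (\<lambda>y. (cmod (k x y))\<^sup>2)"
    and hs_kernel_snd: "integrable lborel (\<lambda>x. (cmod (k x y))\<^sup>2)"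
  using assms by (auto simp: hs_kernel_def)

lemmas hs_kernel_app = kernel_measurable[OF hs_kernel_measurable]

lemma integrable_tensor:
  fixes f g :: "real \<Rightarrow> real"
  assumes f: "integrable lborel f" and g: "integrable lborel g"
  shows "integrable (lborel \<Otimes>\<^sub>M lborel) (\<lambda>(x, y). f x * g y)"
    and "(\<integral>(x, y). f x * g y \<partial>(lborel \<Otimes>\<^sub>M lborel)) = (\<integral>x. f x \<partial>lborel) * (\<integral>y. g y \<partial>lborel)"
proof -
  have [measurable]: "f \<in> borel_measurable borel" "g \<in> borel_measurable borel"
    using f g by (auto dest: borel_measurable_integrable)
  show int: "integrable (lborel \<Otimes>\<^sub>M lborel) (\<lambda>(x, y). f x * g y)"
    using f g by (intro lborel_pair.Fubini_integrable) (auto simp: abs_mult)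
  show "(\<integral>(x, y). f x * g y \<partial>(lborel \<Otimes>\<^sub>M lborel)) = (\<integral>x. f x \<partial>lborel) * (\<integral>y. g y \<partial>lborel)"
    using lborel_pair.integral_fst[OF int] by simp
qed

lemma kernel_comp_bound:
  assumes "hs_kernel f" "hs_kernel g"
  shows "(cmod (kernel_comp f g x y))\<^sup>2 \<le> (\<integral>z. (cmod (f x z))\<^sup>2 \<partial>lborel) * (\<integral>z. (cmod (g z y))\<^sup>2 \<partial>lborel)"
proof -
  note [measurable (raw)] = hs_kernel_app[OF assms(1)] hs_kernel_app[OF assms(2)]
  show ?thesis
    unfolding kernel_comp_def using assms
    by (intro cauchy_schwarz_integral) (auto intro: hs_kernel_fst hs_kernel_snd)
qed

lemma
  assumes f: "hs_kernel f" and g: "hs_kernel g"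
  shows hs_kernel_comp: "hs_kernel (kernel_comp f g)"
    and kernel_norm_comp: "kernel_norm (kernel_comp f g) \<le> kernel_norm f * kernel_norm g"
proof -
  note [measurable (raw)] = hs_kernel_app[OF f] hs_kernel_app[OF g]
  let ?A = "\<lambda>x. \<integral>z. (cmod (f x z))\<^sup>2 \<partial>lborel" and ?B = "\<lambda>y. \<integral>z. (cmod (g z y))\<^sup>2 \<partial>lborel"
  have A: "integrable lborel ?A" using lborel_pair.integrable_fst[OF hs_kernel_integrable[OF f]] .
  have B: "integrable lborel ?B" using lborel_pair.integrable_snd[OF hs_kernel_integrable[OF g]] .
  have [measurable]: "case_prod (kernel_comp f g) \<in> borel_measurable (borel \<Otimes>\<^sub>M borel)"
    unfolding kernel_comp_def by measurable
  have int: "integrable (lborel \<Otimes>\<^sub>M lborel) (\<lambda>(x, y). (cmod (kernel_comp f g x y))\<^sup>2)"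
    by (rule Bochner_Integration.integrable_bound[OF integrable_tensor(1)[OF A B]])
       (auto intro!: AE_I2 order_trans[OF kernel_comp_bound[OF f g]])
  have fst: "integrable lborel (\<lambda>y. (cmod (kernel_comp f g x y))\<^sup>2)" for x
    by (rule Bochner_Integration.integrable_bound[OF integrable_mult_right[OF B, of "?A x"]])
       (auto intro!: AE_I2 order_trans[OF kernel_comp_bound[OF f g]])
  have snd: "integrable lborel (\<lambda>x. (cmod (kernel_comp f g x y))\<^sup>2)" for y
    by (rule Bochner_Integration.integrable_bound[OF integrable_mult_left[OF A, of "?B y"]])
       (auto intro!: AE_I2 order_trans[OF kernel_comp_bound[OF f g]])
  show "hs_kernel (kernel_comp f g)"
    using int fst snd by (simp add: hs_kernel_def)
  have "(\<integral>(x, y). (cmod (kernel_comp f g x y))\<^sup>2 \<partial>(lborel \<Otimes>\<^sub>M lborel)) \<le> (\<integral>(x, y). ?A x * ?B y \<partial>(lborel \<Otimes>\<^sub>M lborel))"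
    by (rule integral_mono[OF int integrable_tensor(1)[OF A B]]) (auto intro: kernel_comp_bound f g)
  also have "\<dots> = (\<integral>x. ?A x \<partial>lborel) * (\<integral>y. ?B y \<partial>lborel)"
    by (rule integrable_tensor(2)[OF A B])
  also have "(\<integral>x. ?A x \<partial>lborel) = (\<integral>(x, y). (cmod (f x y))\<^sup>2 \<partial>(lborel \<Otimes>\<^sub>M lborel))"
    using lborel_pair.integral_fst[OF hs_kernel_integrable[OF f]] .
  also have "(\<integral>x. ?B x \<partial>lborel) = (\<integral>(x, y). (cmod (g x y))\<^sup>2 \<partial>(lborel \<Otimes>\<^sub>M lborel))"
    using lborel_pair.integral_snd[OF hs_kernel_integrable[OF g]] .
  finally show "kernel_norm (kernel_comp f g) \<le> kernel_norm f * kernel_norm g"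
    unfolding kernel_norm_def by (simp flip: real_sqrt_mult)
qed

lemma mult_le_half_squares: "cmod a * cmod b \<le> ((cmod a)\<^sup>2 + (cmod b)\<^sup>2)"
proof -
  have "0 \<le> cmod a * cmod b" by simp
  then show ?thesis using sum_squares_bound[of "cmod a" "cmod b"] by linarith
qed

text \<open>Fubini at every fixed pair \<open>x\<close>, \<open>y\<close>. The majorant
  \<open>|f x z|^2 * |h w y|^2 + |g z w|^2\<close> uses square integrability of the single sections
  \<open>f x\<close> and \<open>h _ y\<close>, and joint square integrability only for the middle
  factor.\<close>

lemma kernel_comp_assoc:
  assumes f: "hs_kernel f" and g: "hs_kernel g" and h: "hs_kernel h"
  shows "kernel_comp (kernel_comp f g) h = kernel_comp f (kernel_comp g h)"
proof (intro ext)
  fix x y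
  note [measurable (raw)] = hs_kernel_app[OF f] hs_kernel_app[OF g] hs_kernel_app[OF h]
  let ?F = "\<lambda>z w. f x z * g z w * h w y"
  have int: "integrable (lborel \<Otimes>\<^sub>M lborel) (case_prod ?F)"
  proof (rule Bochner_Integration.integrable_bound)
    show "integrable (lborel \<Otimes>\<^sub>M lborel)
        (\<lambda>p. (case p of (z, w) \<Rightarrow> (cmod (f x z))\<^sup>2 * (cmod (h w y))\<^sup>2) + (case p of (z, w) \<Rightarrow> (cmod (g z w))\<^sup>2))"
      using hs_kernel_fst[OF f] hs_kernel_snd[OF h] hs_kernel_integrable[OF g]
      by (intro Bochner_Integration.integrable_add integrable_tensor)
    have "cmod (?F z w) \<le> (cmod (f x z))\<^sup>2 * (cmod (h w y))\<^sup>2 + (cmod (g z w))\<^sup>2" for z w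
      using mult_le_half_squares[of "f x z * h w y" "g z w"]
      by (simp add: norm_mult power_mult_distrib mult_ac)
    then show "AE p in lborel \<Otimes>\<^sub>M lborel. cmod (case_prod ?F p)
        \<le> norm ((case p of (z, w) \<Rightarrow> (cmod (f x z))\<^sup>2 * (cmod (h w y))\<^sup>2) + (case p of (z, w) \<Rightarrow> (cmod (g z w))\<^sup>2))"
      by (auto intro!: AE_I2 order_trans[OF _ abs_ge_self])
  qed measurable
  have "kernel_comp (kernel_comp f g) h x y = (\<integral>w. (\<integral>z. ?F z w \<partial>lborel) \<partial>lborel)"
    unfolding kernel_comp_def by simp
  also have "\<dots> = (\<integral>z. (\<integral>w. ?F z w \<partial>lborel) \<partial>lborel)"
    by (rule lborel_pair.Fubini_integral[OF int])
  also have "\<dots> = kernel_comp f (kernel_comp g h) x y"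
    unfolding kernel_comp_def by (simp add: mult.assoc)
  finally show "kernel_comp (kernel_comp f g) h x y = kernel_comp f (kernel_comp g h) x y" .
qed

definition kernel_adj :: "(real \<Rightarrow> real \<Rightarrow> complex) \<Rightarrow> real \<Rightarrow> real \<Rightarrow> complex" where
  "kernel_adj k x y = cnj (k y x)"

definition kernel_trace :: "(real \<Rightarrow> real \<Rightarrow> complex) \<Rightarrow> complex" where
  "kernel_trace k = (\<integral>x. k x x \<partial>lborel)"

lemma hs_kernel_swap:
  assumes "hs_kernel k" shows "hs_kernel (\<lambda>x y. k y x)"
proof -
  note [measurable (raw)] = hs_kernel_app[OF assms]
  show ?thesis
    using assms lborel_pair.integrable_product_swap[OF hs_kernel_integrable[OF assms]]
    by (auto simp: hs_kernel_def)
qed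

lemma hs_kernel_adj: assumes "hs_kernel k" shows "hs_kernel (kernel_adj k)"
proof -
  note [measurable (raw)] = hs_kernel_app[OF assms]
  show ?thesis
    using hs_kernel_swap[OF assms] unfolding hs_kernel_def kernel_adj_def by simp
qed

lemma kernel_norm_swap: assumes "hs_kernel k" shows "kernel_norm (\<lambda>x y. k y x) = kernel_norm k"
proof -
  note [measurable (raw)] = hs_kernel_app[OF assms]
  show ?thesis
    using lborel_pair.integral_product_swap[OF borel_measurable_integrable[OF hs_kernel_integrable[OF assms]]]
    by (simp add: kernel_norm_def)
qed

lemma
  assumes f: "hs_kernel f" and g: "hs_kernel g"
  shows kernel_trace_commute: "kernel_trace (kernel_comp f g) = kernel_trace (kernel_comp g f)"
    and kernel_trace_cauchy_schwarz: "cmod (kernel_trace (kernel_comp f g)) \<le> kernel_norm f * kernel_norm g"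
proof -
  note [measurable (raw)] = hs_kernel_app[OF f] hs_kernel_app[OF g]
  let ?F = "\<lambda>p. case p of (x, z) \<Rightarrow> f x z" and ?G = "\<lambda>p. case p of (x, z) \<Rightarrow> g z x"
  have F: "integrable (lborel \<Otimes>\<^sub>M lborel) (\<lambda>p. (cmod (?F p))\<^sup>2)"
    using hs_kernel_integrable[OF f] by (simp add: case_prod_unfold)
  have G: "integrable (lborel \<Otimes>\<^sub>M lborel) (\<lambda>p. (cmod (?G p))\<^sup>2)"
    using hs_kernel_integrable[OF hs_kernel_swap[OF g]] by (simp add: case_prod_unfold)
  have meas: "?F \<in> borel_measurable (lborel \<Otimes>\<^sub>M lborel)" "?G \<in> borel_measurable (lborel \<Otimes>\<^sub>M lborel)"
    by measurable
  have int: "integrable (lborel \<Otimes>\<^sub>M lborel) (\<lambda>(x, z). f x z * g z x)"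
    using cauchy_schwarz_integral(1)[OF meas F G] by (simp add: case_prod_unfold)
  show "kernel_trace (kernel_comp f g) = kernel_trace (kernel_comp g f)"
    using lborel_pair.Fubini_integral[OF int] by (simp add: kernel_trace_def kernel_comp_def mult.commute)
  have "kernel_trace (kernel_comp f g) = (\<integral>p. ?F p * ?G p \<partial>(lborel \<Otimes>\<^sub>M lborel))"
    using lborel_pair.integral_fst[OF int] by (simp add: kernel_trace_def kernel_comp_def case_prod_unfold)
  then have "(cmod (kernel_trace (kernel_comp f g)))\<^sup>2
      \<le> (\<integral>p. (cmod (?F p))\<^sup>2 \<partial>(lborel \<Otimes>\<^sub>M lborel)) * (\<integral>p. (cmod (?G p))\<^sup>2 \<partial>(lborel \<Otimes>\<^sub>M lborel))"
    using cauchy_schwarz_integral(2)[OF meas F G] by simp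
  also have "\<dots> = (kernel_norm f * kernel_norm g)\<^sup>2"
    unfolding kernel_norm_swap[OF g, symmetric] by (simp add: kernel_norm_square power_mult_distrib case_prod_unfold)
  finally show "cmod (kernel_trace (kernel_comp f g)) \<le> kernel_norm f * kernel_norm g"
    by (rule power2_le_imp_le) simp
qed

lemma kernel_trace_adj_comp:
  assumes f: "hs_kernel f"
  shows "kernel_trace (kernel_comp (kernel_adj f) f) = of_real ((kernel_norm f)\<^sup>2)"
proof -
  have "kernel_trace (kernel_comp (kernel_adj f) f) = (\<integral>x. (\<integral>z. complex_of_real ((cmod (f z x))\<^sup>2) \<partial>lborel) \<partial>lborel)"
    unfolding kernel_trace_def kernel_comp_def kernel_adj_def
    by (simp add: complex_norm_square mult.commute del: of_real_power)
  also have "\<dots> = of_real (\<integral>x. (\<integral>z. (cmod (f z x))\<^sup>2 \<partial>lborel) \<partial>lborel)"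
    unfolding integral_complex_of_real ..
  also have "(\<integral>x. (\<integral>z. (cmod (f z x))\<^sup>2 \<partial>lborel) \<partial>lborel) = (kernel_norm f)\<^sup>2"
    using lborel_pair.integral_snd[OF hs_kernel_integrable[OF f]] by (simp add: kernel_norm_square)
  finally show ?thesis .
qed

text \<open>\<open>None\<close> is the identity operator, which has no Hilbert--Schmidt kernel.\<close>

typedef kernel_op = "{k. \<forall>f. k = Some f \<longrightarrow> hs_kernel f}"
  by (rule exI[of _ None]) simp

setup_lifting type_definition_kernel_op

instantiation kernel_op :: monoid_mult
begin

lift_definition one_kernel_op :: kernel_op is None by simp

lift_definition times_kernel_op :: "kernel_op \<Rightarrow> kernel_op \<Rightarrow> kernel_op" is
  "\<lambda>a b. case a of None \<Rightarrow> b | Some f \<Rightarrow> (case b of None \<Rightarrow> a | Some g \<Rightarrow> Some (kernel_comp f g))"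
  by (auto split: option.splits intro: hs_kernel_comp)

instance
proof
  fix a b c :: kernel_op
  show "a * b * c = a * (b * c)"
    by transfer (auto split: option.splits simp: kernel_comp_assoc)
  show "1 * a = a" by transfer simp
  show "a * 1 = a" by transfer (simp split: option.splits)
qed

end

text \<open>The zero kernel of the identity is a dummy value: \<open>1\<close> lies outside
  \<open>kernel_ops\<close>, so powers are considered with positive exponents.\<close>

lift_definition kernel_of :: "kernel_op \<Rightarrow> real \<Rightarrow> real \<Rightarrow> complex" is
  "\<lambda>a. case a of None \<Rightarrow> (\<lambda>x y. 0) | Some f \<Rightarrow> f" .

lift_definition adj_op :: "kernel_op \<Rightarrow> kernel_op" is "map_option kernel_adj"
  by (auto intro: hs_kernel_adj)

lift_definition op_of :: "(real \<Rightarrow> real \<Rightarrow> complex) \<Rightarrow> kernel_op" is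
  "\<lambda>f. if hs_kernel f then Some f else None"
  by (auto split: if_splits)

definition kernel_ops :: "kernel_op set" where "kernel_ops = op_of ` Collect hs_kernel"

lemma kernel_of_op_of [simp]: "hs_kernel f \<Longrightarrow> kernel_of (op_of f) = f"
  by transfer simp

lemma op_of_in_kernel_ops [simp]: "hs_kernel f \<Longrightarrow> op_of f \<in> kernel_ops"
  by (simp add: kernel_ops_def)

lemma op_of_mult: "hs_kernel f \<Longrightarrow> hs_kernel g \<Longrightarrow> op_of f * op_of g = op_of (kernel_comp f g)"
  by transfer (simp add: hs_kernel_comp)

lemma adj_op_of: "hs_kernel f \<Longrightarrow> adj_op (op_of f) = op_of (kernel_adj f)"
  by transfer (simp add: hs_kernel_adj)

lemma kernel_op_cases: "a = 1 \<or> (\<exists>f. hs_kernel f \<and> a = op_of f)"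
  by transfer (metis option.exhaust)

lemma kernel_opsE: assumes "a \<in> kernel_ops" obtains f where "hs_kernel f" "a = op_of f"
  using assms by (auto simp: kernel_ops_def)

interpretation hs_monoid kernel_ops adj_op "\<lambda>a. kernel_trace (kernel_of a)" "\<lambda>a. kernel_norm (kernel_of a)"
proof
  fix a b :: kernel_op
  show "b \<in> kernel_ops \<Longrightarrow> a * b \<in> kernel_ops"
    using kernel_op_cases[of a] by (auto elim!: kernel_opsE simp: op_of_mult hs_kernel_comp)
  show "a \<in> kernel_ops \<Longrightarrow> a * b \<in> kernel_ops"
    using kernel_op_cases[of b] by (auto elim!: kernel_opsE simp: op_of_mult hs_kernel_comp)
  have adj_comp: "kernel_adj (kernel_comp f g) = kernel_comp (kernel_adj g) (kernel_adj f)" for f g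
    by (intro ext) (simp add: kernel_adj_def kernel_comp_def mult.commute flip: Bochner_Integration.integral_cnj)
  then show "adj_op (a * b) = adj_op b * adj_op a"
    by transfer (auto split: option.splits)
  have "kernel_adj (kernel_adj f) = f" for f
    by (intro ext) (simp add: kernel_adj_def)
  then show "adj_op (adj_op a) = a"
    by transfer (simp add: option.map_comp o_def option.map_ident)
  show "a \<in> kernel_ops \<Longrightarrow> adj_op a \<in> kernel_ops"
    by (auto elim!: kernel_opsE simp: adj_op_of hs_kernel_adj)
  show "a \<in> kernel_ops \<Longrightarrow> b \<in> kernel_ops \<Longrightarrow> kernel_trace (kernel_of (a * b)) = kernel_trace (kernel_of (b * a))"
    by (auto elim!: kernel_opsE simp: op_of_mult hs_kernel_comp intro: kernel_trace_commute)
  show "0 \<le> kernel_norm (kernel_of a)"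
    by simp
  show "a \<in> kernel_ops \<Longrightarrow> kernel_trace (kernel_of (adj_op a * a)) = of_real ((kernel_norm (kernel_of a))\<^sup>2)"
    by (auto elim!: kernel_opsE simp: op_of_mult hs_kernel_comp adj_op_of hs_kernel_adj kernel_trace_adj_comp)
  show "a \<in> kernel_ops \<Longrightarrow> b \<in> kernel_ops \<Longrightarrow>
      cmod (kernel_trace (kernel_of (a * b))) \<le> kernel_norm (kernel_of a) * kernel_norm (kernel_of b)"
    by (auto elim!: kernel_opsE simp: op_of_mult hs_kernel_comp intro: kernel_trace_cauchy_schwarz)
  show "a \<in> kernel_ops \<Longrightarrow> b \<in> kernel_ops \<Longrightarrow>
      kernel_norm (kernel_of (a * b)) \<le> kernel_norm (kernel_of a) * kernel_norm (kernel_of b)"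
    by (auto elim!: kernel_opsE simp: op_of_mult hs_kernel_comp intro: kernel_norm_comp)
qed

section \<open>The complex heat kernel\<close>

text \<open>The integral kernel of exp (- \<tau> p^2 / (2 m)), that is sqrt (m / (2 pi \<tau>)) exp
  (- m u^2 / (2 \<tau>)), with the root in the shape in which the momentum integral produces
  it.\<close>

definition heat_kernel :: "real \<Rightarrow> complex \<Rightarrow> real \<Rightarrow> complex" where
  "heat_kernel m \<tau> u = csqrt (of_real (2 * pi * m) / \<tau>) / of_real (2 * pi) * exp (- of_real (m * u\<^sup>2) / (2 * \<tau>))"

lemma heat_kernel_fourier:
  assumes m: "m > 0" and t: "Re \<tau> > 0"
  shows "integrable lborel (\<lambda>p. exp (\<i> * complex_of_real (p * u) - \<tau> * complex_of_real (p\<^sup>2 / (2 * m))))"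
    and "(\<integral>p. exp (\<i> * complex_of_real (p * u) - \<tau> * complex_of_real (p\<^sup>2 / (2 * m))) \<partial>lborel)
      = of_real (2 * pi) * heat_kernel m \<tau> u"
proof -
  let ?a = "\<tau> / of_real (2 * m)" and ?b = "\<i> * complex_of_real u"
  have a: "Re ?a > 0" using m t by (simp add: Re_divide_of_real del: of_real_mult)
  have eq: "exp (\<i> * complex_of_real (p * u) - \<tau> * complex_of_real (p\<^sup>2 / (2 * m)))
      = exp (- ?a * complex_of_real (p\<^sup>2) + ?b * complex_of_real p)" for p
    using m by (intro arg_cong[where f = exp]) (simp add: field_simps)
  show "integrable lborel (\<lambda>p. exp (\<i> * complex_of_real (p * u) - \<tau> * complex_of_real (p\<^sup>2 / (2 * m))))"
    unfolding eq by (rule complex_gaussian_integral(1)[OF a])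
  have "(\<integral>p. exp (\<i> * complex_of_real (p * u) - \<tau> * complex_of_real (p\<^sup>2 / (2 * m))) \<partial>lborel)
      = csqrt (of_real pi / ?a) * exp (?b\<^sup>2 / (4 * ?a))"
    unfolding eq by (rule complex_gaussian_integral(2)[OF a])
  also have "of_real pi / ?a = of_real (2 * pi * m) / \<tau>" using m by simp
  also have "?b\<^sup>2 / (4 * ?a) = - of_real (m * u\<^sup>2) / (2 * \<tau>)"
    using t by (cases "\<tau> = 0") (simp_all add: power_mult_distrib field_simps)
  finally show "(\<integral>p. exp (\<i> * complex_of_real (p * u) - \<tau> * complex_of_real (p\<^sup>2 / (2 * m))) \<partial>lborel)
      = of_real (2 * pi) * heat_kernel m \<tau> u"
    by (simp add: heat_kernel_def)
qed

text \<open>The value at \<open>u = 0\<close> of the heat kernel for real \<open>t\<close>; at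
  \<open>t = Re \<tau>\<close> it also bounds the complex heat kernel everywhere.\<close>

definition heat_peak :: "real \<Rightarrow> real \<Rightarrow> real" where
  "heat_peak m t = sqrt (2 * pi * m / t) / (2 * pi)"

lemma heat_kernel_real:
  assumes m: "m > 0" and t: "t > 0"
  shows "heat_kernel m (of_real t) u = of_real (heat_peak m t * exp (- m * u\<^sup>2 / (2 * t)))"
proof -
  have "csqrt (of_real (2 * pi * m / t)) = of_real (sqrt (2 * pi * m / t))"
    using m t by (subst csqrt_of_real_nonneg) simp_all
  moreover have "exp (- complex_of_real (m * u\<^sup>2) / (2 * of_real t)) = of_real (exp (- m * u\<^sup>2 / (2 * t)))"
    by (simp flip: exp_of_real)
  ultimately show ?thesis by (simp add: heat_kernel_def heat_peak_def)
qed

lemma norm_heat_kernel: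
  assumes "m > 0" and "Re \<tau> > 0"
  shows "cmod (heat_kernel m \<tau> u) = heat_peak m (cmod \<tau>) * exp (- m * Re \<tau> / (2 * (cmod \<tau>)\<^sup>2) * u\<^sup>2)"
proof -
  have "cmod (csqrt (of_real (2 * pi * m) / \<tau>)) = sqrt (2 * pi * m / cmod \<tau>)"
    using assms by (simp add: norm_divide norm_mult)
  moreover have "Re (- of_real (m * u\<^sup>2) / (2 * \<tau>)) = - m * Re \<tau> / (2 * (cmod \<tau>)\<^sup>2) * u\<^sup>2"
  proof -
    have "\<tau> * cnj \<tau> = of_real ((cmod \<tau>)\<^sup>2)" "\<tau> \<noteq> 0"
      using assms by (auto simp: complex_norm_square simp del: of_real_power)
    then have "- of_real (m * u\<^sup>2) / (2 * \<tau>) = of_real (- (m * u\<^sup>2) / (2 * (cmod \<tau>)\<^sup>2)) * cnj \<tau>"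
      by (simp add: field_simps)
    then show ?thesis by simp
  qed
  ultimately show ?thesis
    unfolding heat_kernel_def heat_peak_def norm_mult norm_divide norm_exp_eq_Re by simp
qed

lemma heat_peak_nonneg [simp]: "m > 0 \<Longrightarrow> t > 0 \<Longrightarrow> 0 \<le> heat_peak m t"
  by (simp add: heat_peak_def)

lemma heat_peak_antimono: "m > 0 \<Longrightarrow> 0 < s \<Longrightarrow> s \<le> t \<Longrightarrow> heat_peak m t \<le> heat_peak m s"
  unfolding heat_peak_def by (intro divide_right_mono real_sqrt_le_mono divide_left_mono) auto

lemma heat_kernel_bound:
  assumes m: "m > 0" and t: "Re \<tau> > 0"
  shows "cmod (heat_kernel m \<tau> u) \<le> heat_peak m (Re \<tau>)"
proof -
  have "cmod \<tau> > 0" using t by auto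
  then have "heat_peak m (cmod \<tau>) * exp (- m * Re \<tau> / (2 * (cmod \<tau>)\<^sup>2) * u\<^sup>2) \<le> heat_peak m (cmod \<tau>) * 1"
    using m t by (intro mult_left_mono) (auto simp: divide_simps)
  also have "\<dots> \<le> heat_peak m (Re \<tau>)"
    using heat_peak_antimono[OF m t complex_Re_le_cmod] by simp
  finally show ?thesis using norm_heat_kernel[OF m t] by simp
qed

lemma heat_kernel_measurable [measurable]: "heat_kernel m \<tau> \<in> borel_measurable borel"
  unfolding heat_kernel_def[abs_def] by measurable

lemma integrable_heat_kernel_square:
  assumes "m > 0" and "Re \<tau> > 0"
  shows "integrable lborel (\<lambda>u. (cmod (heat_kernel m \<tau> u))\<^sup>2)"
proof -
  have c: "cmod \<tau> > 0" using assms by auto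
  have "(cmod (heat_kernel m \<tau> u))\<^sup>2 = (heat_peak m (cmod \<tau>))\<^sup>2 * exp (- (m * Re \<tau> / (cmod \<tau>)\<^sup>2) * u\<^sup>2 + 0 * u)" for u
    unfolding norm_heat_kernel[OF assms] power_mult_distrib exp_double[symmetric]
    by simp
  then show ?thesis
    using integrable_real_gaussian(1)[of "m * Re \<tau> / (cmod \<tau>)\<^sup>2" 0] assms c
    by (auto intro!: integrable_mult_right)
qed

text \<open>The semigroup law for the times \<open>cnj \<tau>\<close> and \<open>\<tau>\<close>,
  whose sum is real. This is what removes the imaginary part of \<open>\<beta>\<close> when a time
  step is multiplied by its adjoint.\<close>

lemma heat_kernel_adj_conv:
  assumes m: "m > 0" and t: "Re \<tau> > 0"
  shows "(\<integral>z. cnj (heat_kernel m \<tau> (z - x)) * heat_kernel m \<tau> (z - y) \<partial>lborel)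
    = heat_kernel m (of_real (2 * Re \<tau>)) (x - y)"
proof -
  define \<sigma> where "\<sigma> = cnj \<tau>"
  have t0: "\<tau> \<noteq> 0" "\<sigma> \<noteq> 0" using t by (auto simp: \<sigma>_def)
  have st: "\<sigma> + \<tau> = of_real (2 * Re \<tau>)" by (simp add: \<sigma>_def complex_eq_iff)
  have st0: "\<sigma> + \<tau> \<noteq> 0" using t by (simp add: st)
  have sm: "\<sigma> * \<tau> = of_real ((cmod \<tau>)\<^sup>2)" by (simp add: \<sigma>_def complex_norm_square mult.commute del: of_real_power)
  have c0: "cmod \<tau> > 0" using t0 by simp
  let ?a = "complex_of_real (m * Re \<tau> / (cmod \<tau>)\<^sup>2)"
  let ?b = "of_real m * (of_real x / \<sigma> + of_real y / \<tau>)"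
  let ?k = "- of_real (m / 2) * (of_real (x\<^sup>2) / \<sigma> + of_real (y\<^sup>2) / \<tau>)"
  have a: "Re ?a > 0" using m t c0 by simp
  have aeq: "?a = of_real (m / 2) * (1 / \<sigma> + 1 / \<tau>)"
  proof -
    have "1 / \<sigma> + 1 / \<tau> = (\<sigma> + \<tau>) / (\<sigma> * \<tau>)" using t0 by (simp add: field_simps)
    then show ?thesis unfolding st sm by (simp add: field_simps)
  qed
  have eq: "cnj (heat_kernel m \<tau> (z - x)) * heat_kernel m \<tau> (z - y)
     = of_real ((heat_peak m (cmod \<tau>))\<^sup>2) * exp ?k * exp (- ?a * complex_of_real (z\<^sup>2) + ?b * complex_of_real z)" for z
  proof -
    let ?c = "csqrt (of_real (2 * pi * m) / \<tau>) / of_real (2 * pi)"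
    have "cnj (heat_kernel m \<tau> (z - x)) * heat_kernel m \<tau> (z - y)
      = (?c * cnj ?c) * (exp (- of_real (m * (z - x)\<^sup>2) / (2 * \<sigma>)) * exp (- of_real (m * (z - y)\<^sup>2) / (2 * \<tau>)))"
      by (simp add: heat_kernel_def \<sigma>_def exp_cnj mult_ac)
    also have "?c * cnj ?c = of_real ((cmod ?c)\<^sup>2)" by (rule complex_norm_square[symmetric])
    also have "cmod ?c = heat_peak m (cmod \<tau>)"
      using m by (simp add: heat_peak_def norm_divide norm_mult)
    also have "exp (- of_real (m * (z - x)\<^sup>2) / (2 * \<sigma>)) * exp (- of_real (m * (z - y)\<^sup>2) / (2 * \<tau>))
      = exp ?k * exp (- ?a * complex_of_real (z\<^sup>2) + ?b * complex_of_real z)"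
      unfolding exp_add[symmetric] aeq
      by (rule arg_cong[where f = exp]) (simp add: power2_eq_square field_simps t0)
    finally show ?thesis by (simp add: mult.assoc)
  qed
  have "(\<integral>z. cnj (heat_kernel m \<tau> (z - x)) * heat_kernel m \<tau> (z - y) \<partial>lborel)
    = of_real ((heat_peak m (cmod \<tau>))\<^sup>2) * exp ?k * (csqrt (of_real pi / ?a) * exp (?b\<^sup>2 / (4 * ?a)))"
    unfolding eq complex_gaussian_integral(2)[OF a, symmetric] by (rule integral_mult_right_zero)
  also have "\<dots> = of_real ((heat_peak m (cmod \<tau>))\<^sup>2) * csqrt (of_real pi / ?a) * exp (?k + ?b\<^sup>2 / (4 * ?a))"
    unfolding exp_add by (simp only: mult_ac)
  also have "csqrt (of_real pi / ?a) = of_real (sqrt (pi * (cmod \<tau>)\<^sup>2 / (m * Re \<tau>)))"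
  proof -
    have "csqrt (of_real (pi * (cmod \<tau>)\<^sup>2 / (m * Re \<tau>))) = of_real (sqrt (pi * (cmod \<tau>)\<^sup>2 / (m * Re \<tau>)))"
      using m t by (subst csqrt_of_real_nonneg) simp_all
    then show ?thesis by simp
  qed
  also have "?k + ?b\<^sup>2 / (4 * ?a) = - of_real (m * (x - y)\<^sup>2) / (2 * (\<sigma> + \<tau>))"
  proof -
    have "1 / \<sigma> + 1 / \<tau> = (\<sigma> + \<tau>) / (\<sigma> * \<tau>)" using t0 by (simp add: field_simps)
    moreover have "of_real x / \<sigma> + of_real y / \<tau> = (of_real x * \<tau> + of_real y * \<sigma>) / (\<sigma> * \<tau>)"
      "of_real (x\<^sup>2) / \<sigma> + of_real (y\<^sup>2) / \<tau> = (of_real (x\<^sup>2) * \<tau> + of_real (y\<^sup>2) * \<sigma>) / (\<sigma> * \<tau>)"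
      using t0 by (simp_all add: field_simps)
    moreover have "\<sigma> * 2 + \<tau> * 2 = 2 * (\<sigma> + \<tau>)" by simp
    then have "\<sigma> * 2 + \<tau> * 2 \<noteq> 0" using st0 by (metis mult_eq_0_iff zero_neq_numeral)
    ultimately show ?thesis
      unfolding aeq using t0 st0 m by (simp add: divide_simps) (simp add: power2_eq_square algebra_simps)
  qed
  also have "of_real ((heat_peak m (cmod \<tau>))\<^sup>2) * of_real (sqrt (pi * (cmod \<tau>)\<^sup>2 / (m * Re \<tau>)))
      = complex_of_real (heat_peak m (2 * Re \<tau>))"
  proof -
    have "(heat_peak m (cmod \<tau>))\<^sup>2 * sqrt (pi * (cmod \<tau>)\<^sup>2 / (m * Re \<tau>)) = heat_peak m (2 * Re \<tau>)"
    proof (rule power2_eq_imp_eq)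
      show "((heat_peak m (cmod \<tau>))\<^sup>2 * sqrt (pi * (cmod \<tau>)\<^sup>2 / (m * Re \<tau>)))\<^sup>2 = (heat_peak m (2 * Re \<tau>))\<^sup>2"
        using m t c0 unfolding heat_peak_def power_mult_distrib power_divide
        by (simp add: field_simps power2_eq_square)
    qed (use m t c0 in auto)
    then show ?thesis by (simp only: of_real_mult[symmetric])
  qed
  also have "complex_of_real (heat_peak m (2 * Re \<tau>)) * exp (- of_real (m * (x - y)\<^sup>2) / (2 * (\<sigma> + \<tau>)))
      = heat_kernel m (of_real (2 * Re \<tau>)) (x - y)"
    unfolding st using m t by (subst heat_kernel_real) (simp_all flip: exp_of_real)
  finally show ?thesis .
qed

section \<open>Bounds of Golden--Thompson type\<close>

lemma hs_kernel_power: "hs_kernel k \<Longrightarrow> n > 0 \<Longrightarrow> \<exists>f. hs_kernel f \<and> op_of k ^ n = op_of f"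
  using power_closed[of "op_of k" n] by (auto elim: kernel_opsE)

lemma kernel_of_power_Suc:
  assumes k: "hs_kernel k" and n: "n > 0"
  shows "kernel_of (op_of k ^ Suc n) = kernel_comp k (kernel_of (op_of k ^ n))"
proof -
  obtain f where f: "hs_kernel f" "op_of k ^ n = op_of f" using hs_kernel_power[OF k n] by blast
  then show ?thesis using k by (simp add: op_of_mult hs_kernel_comp)
qed

lemma kernel_of_mult:
  assumes "a \<in> kernel_ops" "b \<in> kernel_ops"
  shows "kernel_of (a * b) = kernel_comp (kernel_of a) (kernel_of b)"
  using assms by (auto elim!: kernel_opsE simp: op_of_mult hs_kernel_comp)

lemma hs_kernel_kernel_of: "a \<in> kernel_ops \<Longrightarrow> hs_kernel (kernel_of a)"
  by (auto elim!: kernel_opsE)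

text \<open>Conjugation by multiplication with \<open>a\<close>: the inner factors cancel. On the
  diagonal nothing is left of \<open>a\<close>, so potential factors can be moved between the two
  ends of a step without changing traces.\<close>

lemma kernel_power_similar:
  assumes k: "hs_kernel k" and h: "hs_kernel h" and a: "\<And>x. a x \<noteq> 0"
    and eq: "\<And>x y. k x y = a x * h x y / a y" and n: "n > 0"
  shows "kernel_of (op_of k ^ n) x y = a x * kernel_of (op_of h ^ n) x y / a y"
  using n
proof (induction n arbitrary: x y rule: nat_induct_non_zero)
  case 1
  then show ?case
    using eq[of x y] by (simp only: power_one_right kernel_of_op_of[OF k] kernel_of_op_of[OF h])
next
  case (Suc n)
  have "kernel_of (op_of k ^ Suc n) x y = (\<integral>z. (a x * h x z / a z) * (a z * kernel_of (op_of h ^ n) z y / a y) \<partial>lborel)"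
    unfolding kernel_of_power_Suc[OF k Suc.hyps] kernel_comp_def Suc.IH eq ..
  also have "\<dots> = (\<integral>z. (a x / a y) * (h x z * kernel_of (op_of h ^ n) z y) \<partial>lborel)"
    using a by (intro Bochner_Integration.integral_cong) (simp_all add: field_simps)
  also have "\<dots> = (a x / a y) * kernel_of (op_of h ^ Suc n) x y"
    unfolding kernel_of_power_Suc[OF h Suc.hyps] kernel_comp_def by (rule integral_mult_right_zero)
  finally show ?case by simp
qed

locale potential =
  fixes m :: real and V :: "real \<Rightarrow> real"
  assumes mass: "m > 0" and V_measurable [measurable]: "V \<in> borel_measurable borel"
    and V_int: "\<And>b. b > 0 \<Longrightarrow> integrable lborel (\<lambda>x. exp (- b * V x))"
begin

text \<open>The potential sits at the end point only, as in the discretised action, where the step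
  from x_(k-1) to x_k carries \<open>V (x k)\<close>. This makes the kernel non-symmetric even for
  real \<open>\<tau>\<close>.\<close>

definition step_kernel :: "complex \<Rightarrow> real \<Rightarrow> real \<Rightarrow> complex" where
  "step_kernel \<tau> x y = heat_kernel m \<tau> (x - y) * exp (- \<tau> * of_real (V y))"

lemma hs_heat_sandwich:
  fixes f g :: "real \<Rightarrow> complex"
  assumes t: "Re \<tau> > 0" and [measurable]: "f \<in> borel_measurable borel" "g \<in> borel_measurable borel"
    and g: "integrable lborel (\<lambda>x. (cmod (g x))\<^sup>2)" and f: "\<And>x. cmod (f x) \<le> F"
  shows "hs_kernel (\<lambda>x y. f x * heat_kernel m \<tau> (x - y) * g y)"
proof -
  let ?G = "\<lambda>u. (cmod (heat_kernel m \<tau> u))\<^sup>2"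
  let ?k = "\<lambda>x y. f x * heat_kernel m \<tau> (x - y) * g y"
  have G: "integrable lborel ?G" by (rule integrable_heat_kernel_square[OF mass t])
  have shift: "integrable lborel (\<lambda>x. ?G (x - y))" "(\<integral>x. ?G (x - y) \<partial>lborel) = (\<integral>u. ?G u \<partial>lborel)" for y
    using lborel_integrable_real_affine[OF G, of 1 "- y"] lborel_integral_real_affine[of 1 ?G "- y"] by simp_all
  have f2: "(cmod (f x))\<^sup>2 \<le> F\<^sup>2" for x using f[of x] by (intro power_mono) auto
  have bound: "(cmod (?k x y))\<^sup>2 \<le> F\<^sup>2 * (?G (x - y) * (cmod (g y))\<^sup>2)" for x y
    unfolding norm_mult power_mult_distrib mult.assoc using f2 by (intro mult_right_mono) auto
  have G2: "?G u \<le> (heat_peak m (Re \<tau>))\<^sup>2" for u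
    using heat_kernel_bound[OF mass t] by (intro power_mono) auto
  have bound2: "(cmod (?k x y))\<^sup>2 \<le> F\<^sup>2 * (heat_peak m (Re \<tau>))\<^sup>2 * (cmod (g y))\<^sup>2" for x y
    using order_trans[OF bound mult_left_mono[OF mult_right_mono[OF G2]]] by (simp add: mult.assoc)
  have "integrable (lborel \<Otimes>\<^sub>M lborel) (\<lambda>(y, x). F\<^sup>2 * (?G (x - y) * (cmod (g y))\<^sup>2))"
  proof (rule lborel_pair.Fubini_integrable)
    show "integrable lborel (\<lambda>y. \<integral>x. norm (case (y, x) of (y, x) \<Rightarrow> F\<^sup>2 * (?G (x - y) * (cmod (g y))\<^sup>2)) \<partial>lborel)"
      using g by (simp add: abs_mult shift)
    show "AE y in lborel. integrable lborel (\<lambda>x. case (y, x) of (y, x) \<Rightarrow> F\<^sup>2 * (?G (x - y) * (cmod (g y))\<^sup>2))"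
      by (auto intro!: AE_I2 shift)
  qed measurable
  from lborel_pair.integrable_product_swap[OF this]
  have "integrable (lborel \<Otimes>\<^sub>M lborel) (\<lambda>(x, y). (cmod (?k x y))\<^sup>2)"
    by (rule Bochner_Integration.integrable_bound) (use bound in \<open>auto intro!: AE_I2 simp: abs_mult\<close>)
  moreover have "integrable lborel (\<lambda>y. (cmod (?k x y))\<^sup>2)" for x
    by (rule Bochner_Integration.integrable_bound[OF integrable_mult_right[OF g, of "F\<^sup>2 * (heat_peak m (Re \<tau>))\<^sup>2"]])
       (use bound2 in auto)
  moreover have "integrable lborel (\<lambda>x. (cmod (?k x y))\<^sup>2)" for y
    by (rule Bochner_Integration.integrable_bound[OF integrable_mult_right[OF integrable_mult_left[OF shift(1)[of y], of "(cmod (g y))\<^sup>2"], of "F\<^sup>2"]])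
       (use bound in \<open>auto simp: abs_mult\<close>)
  ultimately show ?thesis by (simp add: hs_kernel_def)
qed

lemma exp_V_square: "(cmod (exp (- \<tau> * of_real (V y))))\<^sup>2 = exp (- (2 * Re \<tau>) * V y)"
  by (simp flip: exp_double)

lemma hs_step_kernel: assumes "Re \<tau> > 0" shows "hs_kernel (step_kernel \<tau>)"
proof -
  have "integrable lborel (\<lambda>y. (cmod (exp (- \<tau> * of_real (V y))))\<^sup>2)"
    unfolding exp_V_square using assms by (intro V_int) simp
  then show ?thesis
    using hs_heat_sandwich[OF assms, of "\<lambda>_. 1" "\<lambda>y. exp (- \<tau> * of_real (V y))" 1]
    by (simp add: step_kernel_def[abs_def])
qed

abbreviation step_op :: "complex \<Rightarrow> kernel_op" where "step_op \<tau> \<equiv> op_of (step_kernel \<tau>)"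

abbreviation path_kernel :: "complex \<Rightarrow> nat \<Rightarrow> real \<Rightarrow> real \<Rightarrow> complex" where
  "path_kernel \<tau> n \<equiv> kernel_of (step_op \<tau> ^ n)"

lemma step_op_in [simp]: "Re \<tau> > 0 \<Longrightarrow> step_op \<tau> \<in> kernel_ops"
  by (simp add: hs_step_kernel)

text \<open>The two adjacent heat kernels merge into one at time \<open>2 * Re \<tau>\<close>. The
  remaining outer factors \<open>exp (- cnj \<tau> V x)\<close> and
  \<open>exp (- \<tau> V y)\<close> differ from the single factor
  \<open>exp (- 2 Re \<tau> V y)\<close> by a similarity.\<close>

lemma trace_adj_step_power:
  assumes t: "Re \<tau> > 0" and n: "n > 0"
  shows "kernel_trace (kernel_of ((adj_op (step_op \<tau>) * step_op \<tau>) ^ n))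
       = kernel_trace (path_kernel (of_real (2 * Re \<tau>)) n)"
proof -
  let ?k = "kernel_comp (kernel_adj (step_kernel \<tau>)) (step_kernel \<tau>)"
  let ?h = "step_kernel (of_real (2 * Re \<tau>))"
  let ?a = "\<lambda>x. exp (- cnj \<tau> * of_real (V x))"
  have k: "hs_kernel ?k" using t by (intro hs_kernel_comp hs_kernel_adj hs_step_kernel)
  have h: "hs_kernel ?h" using t by (intro hs_step_kernel) simp
  have op: "adj_op (step_op \<tau>) * step_op \<tau> = op_of ?k"
    using t by (simp add: adj_op_of op_of_mult hs_kernel_adj hs_step_kernel)
  have "?k x y = ?a x * ?h x y / ?a y" for x y
  proof -
    have "?k x y = (\<integral>z. (?a x * exp (- \<tau> * of_real (V y))) * (cnj (heat_kernel m \<tau> (z - x)) * heat_kernel m \<tau> (z - y)) \<partial>lborel)"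
      by (simp add: kernel_comp_def kernel_adj_def step_kernel_def mult_ac exp_cnj)
    also have "\<dots> = (?a x * exp (- \<tau> * of_real (V y))) * heat_kernel m (of_real (2 * Re \<tau>)) (x - y)"
      by (subst integral_mult_right_zero) (simp only: heat_kernel_adj_conv[OF mass t])
    also have "exp (- \<tau> * of_real (V y)) = exp (- of_real (2 * Re \<tau>) * of_real (V y)) / ?a y"
      unfolding exp_diff[symmetric]
      by (rule arg_cong[where f = exp]) (simp add: complex_eq_iff algebra_simps)
    finally show ?thesis
      unfolding step_kernel_def[of "of_real (2 * Re \<tau>)"]
      by (simp only: mult_ac times_divide_eq_left times_divide_eq_right)
  qed
  from kernel_power_similar[OF k h _ this n]
  have "kernel_of (op_of ?k ^ n) x x = kernel_of (op_of ?h ^ n) x x" for x by simp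
  then show ?thesis unfolding op kernel_trace_def by simp
qed

text \<open>The classical partition function: the phase space integral of exp (- u (p^2 / (2 m) + V
  x)) over dx dp / (2 pi), with the momentum integral carried out.\<close>

definition classical_bound :: "real \<Rightarrow> real" where
  "classical_bound u = heat_peak m u * (\<integral>x. exp (- u * V x) \<partial>lborel)"

text \<open>Each doubling step halves the number of time slices and doubles their length. With one
  slice left, the heat kernel is evaluated at 0 and the trace is the classical partition function
  itself.\<close>

lemma golden_thompson:
  assumes "u > 0"
  shows "cmod (kernel_trace (path_kernel (of_real u) (2 ^ j))) \<le> classical_bound (2 ^ j * u)"
  using assms
proof (induction j arbitrary: u)
  case 0
  have "kernel_trace (path_kernel (of_real u) (2 ^ 0)) = (\<integral>x. complex_of_real (heat_peak m u * exp (- u * V x)) \<partial>lborel)"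
    unfolding kernel_trace_def using 0 mass
    by (simp add: hs_step_kernel step_kernel_def heat_kernel_real flip: exp_of_real)
  also have "\<dots> = of_real (classical_bound u)"
    unfolding integral_complex_of_real classical_bound_def by simp
  finally have "cmod (kernel_trace (path_kernel (of_real u) (2 ^ 0))) = \<bar>classical_bound u\<bar>"
    by (simp only: norm_of_real)
  moreover have "0 \<le> classical_bound u"
    using 0 mass by (simp add: classical_bound_def)
  ultimately show ?case by simp
next
  case (Suc j)
  have "cmod (kernel_trace (kernel_of (step_op (of_real u) ^ (2 * 2 ^ j))))
      \<le> cmod (kernel_trace (kernel_of ((adj_op (step_op (of_real u)) * step_op (of_real u)) ^ (2 ^ j))))"
    using Suc.prems by (intro trace_power_le) simp
  also have "\<dots> = cmod (kernel_trace (path_kernel (of_real (2 * u)) (2 ^ j)))"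
    using Suc.prems by (subst trace_adj_step_power) auto
  also have "\<dots> \<le> classical_bound (2 ^ j * (2 * u))"
    using Suc.prems by (intro Suc.IH) simp
  finally show ?case by (simp add: mult_ac)
qed

text \<open>A bound for \<open>classical_bound\<close> on the window from 1 to 2, from
  \<open>exp (- u V) \<le> exp (- V) + exp (- 2 V)\<close> there. The summand 1 makes powers of
  \<open>C0\<close> monotone in the exponent.\<close>

definition C0 :: real where
  "C0 = 1 + heat_peak m 1 * ((\<integral>x. exp (- 1 * V x) \<partial>lborel) + (\<integral>x. exp (- 2 * V x) \<partial>lborel))"

lemma C0_ge_1: "C0 \<ge> 1"
  unfolding C0_def using mass by (intro add_increasing2 mult_nonneg_nonneg add_nonneg_nonneg) auto

lemma classical_bound_le_C0:
  assumes "1 \<le> u" "u \<le> 2" shows "classical_bound u \<le> C0"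
proof -
  have i: "integrable lborel (\<lambda>x. exp (- b * V x))" if "b > 0" for b by (rule V_int[OF that])
  have "(\<integral>x. exp (- u * V x) \<partial>lborel) \<le> (\<integral>x. exp (- 1 * V x) + exp (- 2 * V x) \<partial>lborel)"
  proof (rule integral_mono)
    fix x
    show "exp (- u * V x) \<le> exp (- 1 * V x) + exp (- 2 * V x)"
    proof (cases "V x \<ge> 0")
      case True
      then have "- u * V x \<le> - 1 * V x" using assms mult_right_mono[of 1 u "V x"] by simp
      then show ?thesis by (intro add_increasing2) auto
    next
      case False
      then have "- u * V x \<le> - 2 * V x" using assms mult_right_mono_neg[of u 2 "V x"] by simp
      then show ?thesis by (intro add_increasing) auto
    qed
  qed (use i[of u] i[of 1] i[of 2] assms in auto)
  also have "\<dots> = (\<integral>x. exp (- 1 * V x) \<partial>lborel) + (\<integral>x. exp (- 2 * V x) \<partial>lborel)"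
    using i[of 1] i[of 2] by simp
  finally have "classical_bound u \<le> heat_peak m 1 * ((\<integral>x. exp (- 1 * V x) \<partial>lborel) + (\<integral>x. exp (- 2 * V x) \<partial>lborel))"
    unfolding classical_bound_def using assms mass
    by (intro mult_mono heat_peak_antimono) auto
  then show ?thesis by (simp add: C0_def)
qed

text \<open>The number of doublings that carries a time step into the window on which
  \<open>C0\<close> is a bound.\<close>

lemma dyadic_scale:
  fixes t :: real assumes "0 < t" "t \<le> 1 / 2"
  obtains j :: nat where "1 \<le> 2 * 2 ^ j * t" "2 * 2 ^ j * t \<le> 2"
proof -
  obtain n :: nat where "1 / (2 * t) < 2 ^ n"
    using real_arch_pow[of 2] by auto
  then have ex: "\<exists>n. 1 \<le> 2 * 2 ^ n * t" using assms by (intro exI[of _ n]) (simp add: field_simps)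
  define j where "j = (LEAST n. 1 \<le> 2 * 2 ^ n * t)"
  have j: "1 \<le> 2 * 2 ^ j * t" unfolding j_def using ex by (rule LeastI_ex)
  have "2 * 2 ^ j * t \<le> 2"
  proof (cases j)
    case (Suc i)
    then have "\<not> 1 \<le> 2 * 2 ^ i * t" unfolding j_def by (intro not_less_Least) auto
    then show ?thesis by (simp add: Suc algebra_simps)
  qed (use assms in simp)
  then show ?thesis using j that by blast
qed

text \<open>The trace bound controls the \<open>2 * 2 ^ j\<close>-th power of the operator norm by
  \<open>C0\<close>, hence by \<open>C0 powr t\<close> to that same power because
  \<open>2 * 2 ^ j * t \<ge> 1\<close>. Each factor thus costs \<open>C0 powr t\<close>, and the
  total depends on the elapsed time \<open>n * t\<close> rather than on \<open>n\<close>.\<close>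

lemma hs_mult_iterate:
  fixes t :: real
  assumes "K \<in> kernel_ops" "X \<in> kernel_ops"
    and tr: "cmod (kernel_trace (kernel_of ((adj_op K * K) ^ (2 ^ j)))) \<le> C0"
    and t: "1 \<le> 2 * 2 ^ j * t"
  shows "kernel_norm (kernel_of (K ^ n * X)) \<le> C0 powr (n * t) * kernel_norm (kernel_of X)"
proof -
  have one: "kernel_norm (kernel_of (K * Y)) \<le> C0 powr t * kernel_norm (kernel_of Y)" if Y: "Y \<in> kernel_ops" for Y
  proof -
    let ?n = "2 * 2 ^ j :: nat"
    have "kernel_norm (kernel_of (K * Y)) ^ ?n
        \<le> kernel_norm (kernel_of Y) ^ ?n * cmod (kernel_trace (kernel_of ((adj_op K * K) ^ (2 ^ j))))"
      by (rule hs_mult_power_le[OF assms(1) Y])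
    also have "\<dots> \<le> kernel_norm (kernel_of Y) ^ ?n * (C0 powr t) ^ ?n"
    proof (intro mult_left_mono order_trans[OF tr])
      have "C0 powr 1 \<le> C0 powr (t * real ?n)"
        using t C0_ge_1 by (intro powr_mono) (simp_all add: mult_ac)
      also have "\<dots> = (C0 powr t) ^ ?n"
        using C0_ge_1 by (simp only: powr_powr[symmetric]) (subst powr_realpow, auto)
      finally show "C0 \<le> (C0 powr t) ^ ?n" using C0_ge_1 by simp
    qed auto
    finally have "kernel_norm (kernel_of (K * Y)) ^ ?n \<le> (C0 powr t * kernel_norm (kernel_of Y)) ^ ?n"
      by (simp only: power_mult_distrib mult.commute)
    then show ?thesis by (subst (asm) power_mono_iff) auto
  qed
  show ?thesis
  proof (induction n)
    case (Suc n)
    have "kernel_norm (kernel_of (K ^ Suc n * X)) = kernel_norm (kernel_of (K * (K ^ n * X)))"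
      by (simp add: mult.assoc)
    also have "\<dots> \<le> C0 powr t * kernel_norm (kernel_of (K ^ n * X))"
      using assms by (intro one ideal_left)
    also have "\<dots> \<le> C0 powr t * (C0 powr (n * t) * kernel_norm (kernel_of X))"
      by (intro mult_left_mono Suc.IH) auto
    finally show ?case by (simp add: powr_add algebra_simps flip: powr_add)
  qed (use C0_ge_1 in auto)
qed

lemma hs_kernel_weighted:
  assumes k: "hs_kernel k" and [measurable]: "f \<in> borel_measurable borel" and f: "\<And>x. cmod (f x) \<le> F"
  shows "hs_kernel (\<lambda>x y. f x * k x y)"
    and "kernel_norm (\<lambda>x y. f x * k x y) \<le> F * kernel_norm k"
proof -
  note [measurable (raw)] = hs_kernel_app[OF k]
  have F: "0 \<le> F" using f[of 0] norm_ge_zero[of "f 0"] by linarith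
  have b: "(cmod (f x * k x y))\<^sup>2 \<le> F\<^sup>2 * (cmod (k x y))\<^sup>2" for x y
    unfolding norm_mult power_mult_distrib by (intro mult_right_mono power_mono f) auto
  have int: "integrable (lborel \<Otimes>\<^sub>M lborel) (\<lambda>(x, y). (cmod (f x * k x y))\<^sup>2)"
    by (rule Bochner_Integration.integrable_bound[OF integrable_mult_right[OF hs_kernel_integrable[OF k], of "F\<^sup>2"]])
       (use b in auto)
  moreover have "integrable lborel (\<lambda>y. (cmod (f x * k x y))\<^sup>2)" for x
    by (rule Bochner_Integration.integrable_bound[OF integrable_mult_right[OF hs_kernel_fst[OF k], of "F\<^sup>2"]])
       (use b in auto)
  moreover have "integrable lborel (\<lambda>x. (cmod (f x * k x y))\<^sup>2)" for y
    by (rule Bochner_Integration.integrable_bound[OF integrable_mult_right[OF hs_kernel_snd[OF k], of "F\<^sup>2"]])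
       (use b in auto)
  ultimately show "hs_kernel (\<lambda>x y. f x * k x y)" by (simp add: hs_kernel_def)
  have "(\<integral>(x, y). (cmod (f x * k x y))\<^sup>2 \<partial>(lborel \<Otimes>\<^sub>M lborel))
      \<le> (\<integral>p. F\<^sup>2 * (case p of (x, y) \<Rightarrow> (cmod (k x y))\<^sup>2) \<partial>(lborel \<Otimes>\<^sub>M lborel))"
    using b by (intro integral_mono int integrable_mult_right hs_kernel_integrable k) auto
  then have "(kernel_norm (\<lambda>x y. f x * k x y))\<^sup>2 \<le> (F * kernel_norm k)\<^sup>2"
    by (simp add: kernel_norm_square power_mult_distrib)
  then show "kernel_norm (\<lambda>x y. f x * k x y) \<le> F * kernel_norm k"
    by (rule power2_le_imp_le) (simp add: F)
qed

text \<open>The \<open>N\<close> factors are split as l + r + l with \<open>l = 2 ^ j\<close>. The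
  outer blocks are measured in Hilbert-Schmidt norm, whose square is at most \<open>C0\<close>, and
  the middle one in operator norm. Since \<open>2 * l * Re \<tau> \<le> 2\<close>, the hypothesis on
  \<open>N\<close> leaves room for both outer blocks. The imaginary part of \<open>\<tau>\<close>
  does not enter the bound.\<close>

lemma weighted_trace_bound:
  assumes t: "0 < Re \<tau>" "Re \<tau> \<le> 1 / 2" and N: "2 \<le> N * Re \<tau>"
    and fm: "f \<in> borel_measurable borel" and f: "\<And>x. cmod (f x) \<le> F"
  shows "cmod (\<integral>x. f x * path_kernel \<tau> N x x \<partial>lborel) \<le> F * C0 powr (1 + N * Re \<tau>)"
proof -
  obtain j where j: "1 \<le> 2 * 2 ^ j * Re \<tau>" "2 * 2 ^ j * Re \<tau> \<le> 2" using dyadic_scale[OF t] by blast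
  let ?l = "2 ^ j :: nat" and ?X = "step_op \<tau>"
  have F: "0 \<le> F" using f[of 0] norm_ge_zero[of "f 0"] by linarith
  have X: "?X \<in> kernel_ops" using t by simp
  have "real (2 * 2 ^ j) * Re \<tau> \<le> N * Re \<tau>" using j N by simp
  then have "real (2 * 2 ^ j) \<le> real N" using t by (simp add: mult_le_cancel_right)
  then have lN: "2 * ?l \<le> N" by (simp only: of_nat_le_iff)
  then obtain r where r: "N = ?l + (r + ?l)" by (metis add.commute add.left_commute le_Suc_ex mult_2)
  have tr: "cmod (kernel_trace (kernel_of ((adj_op ?X * ?X) ^ ?l))) \<le> C0"
  proof -
    have "cmod (kernel_trace (kernel_of ((adj_op ?X * ?X) ^ ?l))) = cmod (kernel_trace (path_kernel (of_real (2 * Re \<tau>)) ?l))"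
      using t by (subst trace_adj_step_power) auto
    also have "\<dots> \<le> classical_bound (2 ^ j * (2 * Re \<tau>))"
      using t by (intro golden_thompson) auto
    also have "\<dots> \<le> C0" using j by (intro classical_bound_le_C0) (auto simp: mult_ac)
    finally show ?thesis .
  qed
  let ?k = "path_kernel \<tau> ?l" and ?h = "path_kernel \<tau> (r + ?l)"
  have k: "hs_kernel ?k" and h: "hs_kernel ?h"
    using X by (auto intro!: hs_kernel_kernel_of power_closed)
  have k2: "(kernel_norm ?k)\<^sup>2 \<le> C0" using hs_power_le_trace[OF X, of j] tr by linarith
  have h2: "kernel_norm ?h \<le> C0 powr (r * Re \<tau>) * kernel_norm ?k"
    unfolding power_add by (rule hs_mult_iterate[OF X _ tr j(1)]) (use X in \<open>auto intro: power_closed\<close>)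
  have "path_kernel \<tau> N = kernel_comp ?k ?h"
    unfolding r power_add[of _ ?l] using X by (intro kernel_of_mult power_closed) auto
  then have eq: "(\<integral>x. f x * path_kernel \<tau> N x x \<partial>lborel) = kernel_trace (kernel_comp (\<lambda>x y. f x * ?k x y) ?h)"
    by (simp add: kernel_trace_def kernel_comp_def mult.assoc)
  have "cmod (\<integral>x. f x * path_kernel \<tau> N x x \<partial>lborel)
      \<le> kernel_norm (\<lambda>x y. f x * ?k x y) * kernel_norm ?h"
    unfolding eq by (rule kernel_trace_cauchy_schwarz[OF hs_kernel_weighted(1)[OF k fm f] h])
  also have "\<dots> \<le> (F * kernel_norm ?k) * (C0 powr (r * Re \<tau>) * kernel_norm ?k)"
  proof (rule mult_mono)
    show "kernel_norm (\<lambda>x y. f x * ?k x y) \<le> F * kernel_norm ?k"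
      by (rule hs_kernel_weighted(2)[OF k fm f])
    show "0 \<le> F * kernel_norm ?k" using F by simp
  qed (simp_all only: h2 kernel_norm_nonneg)
  also have "\<dots> = F * ((kernel_norm ?k)\<^sup>2 * C0 powr (r * Re \<tau>))"
    by (simp add: power2_eq_square)
  also have "\<dots> \<le> F * (C0 * C0 powr (N * Re \<tau>))"
  proof (rule mult_left_mono[OF _ F], rule mult_mono[OF k2])
    show "C0 powr (r * Re \<tau>) \<le> C0 powr (N * Re \<tau>)"
      using t C0_ge_1 r by (intro powr_mono mult_right_mono) auto
  qed (use C0_ge_1 in auto)
  also have "C0 * C0 powr (N * Re \<tau>) = C0 powr (1 + N * Re \<tau>)"
    using C0_ge_1 by (simp add: powr_add)
  finally show ?thesis .
qed

text \<open>Moduli inside the integral, so the bound is exponential in \<open>n\<close>. It serves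
  for integrability at fixed \<open>N\<close>, and on the line where the step length stays fixed
  while \<open>N\<close> grows.\<close>

lemma path_kernel_crude_bound:
  assumes t: "0 < Re \<tau>" and n: "n > 0"
  shows "cmod (path_kernel \<tau> n x y)
    \<le> heat_peak m (Re \<tau>) ^ n * (\<integral>z. exp (- Re \<tau> * V z) \<partial>lborel) ^ (n - 1) * exp (- Re \<tau> * V y)"
  using n
proof (induction n arbitrary: x rule: nat_induct_non_zero)
  case 1
  then show ?case
    unfolding power_one_right kernel_of_op_of[OF hs_step_kernel[OF t]]
    using heat_kernel_bound[OF mass t] by (simp add: step_kernel_def norm_mult mult_right_mono)
next
  case (Suc n)
  let ?g = "heat_peak m (Re \<tau>)" and ?v = "\<lambda>z. exp (- Re \<tau> * V z)"
  let ?c = "?g ^ n * (\<integral>z. ?v z \<partial>lborel) ^ (n - 1) * ?v y"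
  have g: "0 \<le> ?g" using mass t by simp
  have "cmod (path_kernel \<tau> (Suc n) x y) = cmod (\<integral>z. step_kernel \<tau> x z * path_kernel \<tau> n z y \<partial>lborel)"
    using t Suc.hyps by (simp only: kernel_of_power_Suc hs_step_kernel kernel_comp_def)
  also have "\<dots> \<le> (\<integral>z. ?g * ?c * ?v z \<partial>lborel)"
  proof (rule order_trans[OF integral_norm_bound integral_mono])
    have h: "hs_kernel (path_kernel \<tau> n)" using t Suc.hyps by (intro hs_kernel_kernel_of power_closed) auto
    show "integrable lborel (\<lambda>z. cmod (step_kernel \<tau> x z * path_kernel \<tau> n z y))"
    proof (rule integrable_norm)
      note [measurable (raw)] = hs_kernel_app[OF h] hs_kernel_app[OF hs_step_kernel[OF t]]
      show "integrable lborel (\<lambda>z. step_kernel \<tau> x z * path_kernel \<tau> n z y)"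
        using hs_kernel_fst[OF hs_step_kernel[OF t]] hs_kernel_snd[OF h]
        by (intro cauchy_schwarz_integral(1)) auto
    qed
    show "integrable lborel (\<lambda>z. ?g * ?c * ?v z)" using V_int[OF t] by (intro integrable_mult_right) auto
    fix z
    have "cmod (step_kernel \<tau> x z) \<le> ?g * ?v z"
      using heat_kernel_bound[OF mass t] by (simp add: step_kernel_def norm_mult mult_right_mono)
    then have "cmod (step_kernel \<tau> x z * path_kernel \<tau> n z y) \<le> (?g * ?v z) * ?c"
      unfolding norm_mult using g by (intro mult_mono Suc.IH) auto
    then show "cmod (step_kernel \<tau> x z * path_kernel \<tau> n z y) \<le> ?g * ?c * ?v z" by (simp add: mult_ac)
  qed
  also have "\<dots> = ?g ^ Suc n * (\<integral>z. ?v z \<partial>lborel) ^ Suc (n - 1) * ?v y"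
    by (simp add: mult_ac)
  also have "Suc (n - 1) = Suc n - 1" using Suc.hyps by simp
  finally show ?case by simp
qed

end

section \<open>Cyclic path integrals\<close>

lemma (in product_sigma_finite) integrable_PiM_insert:
  fixes f :: "_ \<Rightarrow> _::{banach, second_countable_topology}"
  assumes I: "finite I" "i \<notin> I" and f: "integrable (Pi\<^sub>M (insert i I) M) f"
  shows "integrable (Pi\<^sub>M I M \<Otimes>\<^sub>M M i) (\<lambda>(x, y). f (x(i := y)))"
proof -
  interpret I: finite_product_sigma_finite M I by standard fact
  have [measurable]: "f \<in> borel_measurable (Pi\<^sub>M (insert i I) M)"
    using f by (rule borel_measurable_integrable)
  have m[measurable]: "(\<lambda>(x, y). f (x(i := y))) \<in> borel_measurable (Pi\<^sub>M I M \<Otimes>\<^sub>M M i)"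
    using measurable_compose[OF measurable_add_dim[of i I M], of f] by (simp add: case_prod_unfold)
  have "(\<integral>\<^sup>+p. norm (case p of (x, y) \<Rightarrow> f (x(i := y))) \<partial>(Pi\<^sub>M I M \<Otimes>\<^sub>M M i))
      = (\<integral>\<^sup>+x. (\<integral>\<^sup>+y. norm (f (x(i := y))) \<partial>M i) \<partial>Pi\<^sub>M I M)"
    using m by (subst sigma_finite_measure.nn_integral_fst[OF sigma_finite_measures, symmetric]) auto
  also have "\<dots> = (\<integral>\<^sup>+x. norm (f x) \<partial>Pi\<^sub>M (insert i I) M)"
    using I by (intro product_nn_integral_insert[symmetric]) auto
  also have "\<dots> < \<infinity>" using f by (simp add: integrable_iff_bounded)
  finally show ?thesis using m by (simp add: integrable_iff_bounded)
qed

interpretation lborel_product: product_sigma_finite "\<lambda>_::nat. lborel :: real measure"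
  by standard

lemma sigma_finite_lebesgue_N: "sigma_finite_measure (lebesgue_N N)"
proof -
  interpret finite_product_sigma_finite "\<lambda>_::nat. lborel :: real measure" "{1..N}"
    by standard simp
  show ?thesis unfolding lebesgue_N_def ..
qed

definition kernel_apply :: "(real \<Rightarrow> real \<Rightarrow> complex) \<Rightarrow> (real \<Rightarrow> complex) \<Rightarrow> real \<Rightarrow> complex" where
  "kernel_apply k g x = (\<integral>z. k x z * g z \<partial>lborel)"

text \<open>An open path whose initial point is pinned in slot 0; it is what remains of a periodic
  path once its last coordinate is held fixed.\<close>

definition started_at :: "real \<Rightarrow> (nat \<Rightarrow> real) \<Rightarrow> nat \<Rightarrow> real" where
  "started_at y x k = (if k = 0 then y else x k)"

text \<open>Integrating out the last coordinate replaces \<open>g\<close> by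
  \<open>kernel_apply k0 g\<close>, which is why \<open>g\<close> is arbitrary in the
  induction.\<close>

lemma path_integral_iterate:
  assumes "integrable (Pi\<^sub>M {1..n} (\<lambda>_. lborel))
      (\<lambda>x. (\<Prod>k=1..n. k0 (started_at y x (k - 1)) (started_at y x k)) * g (started_at y x n))"
  shows "(\<integral>x. (\<Prod>k=1..n. k0 (started_at y x (k - 1)) (started_at y x k)) * g (started_at y x n)
            \<partial>Pi\<^sub>M {1..n} (\<lambda>_. lborel)) = (kernel_apply k0 ^^ n) g y"
  using assms
proof (induction n arbitrary: g)
  case 0
  then show ?case by (simp add: started_at_def PiM_empty lebesgue_integral_count_space_finite)
next
  case (Suc n)
  let ?c = "\<lambda>x. \<Prod>k=1..n. k0 (started_at y x (k - 1)) (started_at y x k)"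
  let ?f = "\<lambda>x. (\<Prod>k=1..Suc n. k0 (started_at y x (k - 1)) (started_at y x k)) * g (started_at y x (Suc n))"
  have ins: "{1..Suc n} = insert (Suc n) {1..n}" and nin: "Suc n \<notin> {1..n}" by auto
  have upd: "?f (x(Suc n := z)) = ?c x * (k0 (started_at y x n) z * g z)" for x z
  proof -
    have "?c (x(Suc n := z)) = ?c x"
      by (intro prod.cong refl) (auto simp: started_at_def)
    then show ?thesis by (simp add: ins started_at_def mult_ac)
  qed
  have int: "integrable (Pi\<^sub>M (insert (Suc n) {1..n}) (\<lambda>_. lborel)) ?f"
    using Suc.prems by (simp only: ins)
  interpret sf: sigma_finite_measure "Pi\<^sub>M {1..n} (\<lambda>_::nat. lborel :: real measure)"
    using sigma_finite_lebesgue_N[of n] by (simp add: lebesgue_N_def)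
  interpret P: pair_sigma_finite "Pi\<^sub>M {1..n} (\<lambda>_::nat. lborel :: real measure)" "lborel :: real measure" ..
  have int2: "integrable (Pi\<^sub>M {1..n} (\<lambda>_. lborel) \<Otimes>\<^sub>M lborel) (\<lambda>(x, z). ?c x * (k0 (started_at y x n) z * g z))"
    using lborel_product.integrable_PiM_insert[OF finite_atLeastAtMost nin int] by (simp only: upd)
  have inner: "(\<integral>z. ?c x * (k0 (started_at y x n) z * g z) \<partial>lborel) = ?c x * kernel_apply k0 g (started_at y x n)" for x
    unfolding kernel_apply_def by (rule integral_mult_right_zero)
  have int3: "integrable (Pi\<^sub>M {1..n} (\<lambda>_. lborel)) (\<lambda>x. ?c x * kernel_apply k0 g (started_at y x n))"
    using P.integrable_fst[OF int2] by (simp only: inner)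
  have "(\<integral>x. ?f x \<partial>Pi\<^sub>M {1..Suc n} (\<lambda>_. lborel))
      = (\<integral>x. (\<integral>z. ?f (x(Suc n := z)) \<partial>lborel) \<partial>Pi\<^sub>M {1..n} (\<lambda>_. lborel))"
    using lborel_product.product_integral_insert[OF finite_atLeastAtMost nin int] by (simp only: ins)
  also have "\<dots> = (\<integral>x. ?c x * kernel_apply k0 g (started_at y x n) \<partial>Pi\<^sub>M {1..n} (\<lambda>_. lborel))"
    by (simp only: upd inner)
  also have "\<dots> = (kernel_apply k0 ^^ n) (kernel_apply k0 g) y"
    by (rule Suc.IH[OF int3])
  finally show ?case by (simp add: funpow_swap1)
qed

lemma kernel_apply_power:
  assumes k: "hs_kernel k" and j: "j > 0"
  shows "(kernel_apply k ^^ n) (\<lambda>u. kernel_of (op_of k ^ j) u z) y = kernel_of (op_of k ^ (n + j)) y z"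
proof (induction n arbitrary: y)
  case (Suc n)
  have "(kernel_apply k ^^ Suc n) (\<lambda>u. kernel_of (op_of k ^ j) u z) y
      = kernel_apply k (\<lambda>u. kernel_of (op_of k ^ (n + j)) u z) y"
  proof -
    have "(kernel_apply k ^^ n) (\<lambda>u. kernel_of (op_of k ^ j) u z) = (\<lambda>u. kernel_of (op_of k ^ (n + j)) u z)"
      by (rule ext) (rule Suc.IH)
    then show ?thesis by simp
  qed
  also have "\<dots> = kernel_of (op_of k ^ Suc (n + j)) y z"
    using j by (simp only: kernel_of_power_Suc[OF k] kernel_apply_def kernel_comp_def)
  finally show ?case by simp
qed simp

text \<open>The coordinate \<open>x N\<close> is both end point and starting point, so it is
  integrated last; for each value \<open>z\<close> of it the rest is an open path from
  \<open>z\<close> to \<open>z\<close>. Fubini gives integrability of the inner integral only for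
  almost every \<open>z\<close>.\<close>

lemma cyclic_path_integral:
  assumes k: "hs_kernel k" and N: "N \<ge> 1" and [measurable]: "a \<in> borel_measurable borel"
    and int: "integrable (lebesgue_N N) (\<lambda>x. a (x N) * (\<Prod>i=1..N. k (periodic N x (i - 1)) (x i)))"
  shows "(\<integral>x. a (x N) * (\<Prod>i=1..N. k (periodic N x (i - 1)) (x i)) \<partial>lebesgue_N N)
    = (\<integral>z. a z * kernel_of (op_of k ^ N) z z \<partial>lborel)"
proof -
  obtain n where n: "N = Suc n" using N by (cases N) auto
  let ?c = "\<lambda>z x. \<Prod>i=1..n. k (started_at z x (i - 1)) (started_at z x i)"
  let ?f = "\<lambda>x. a (x N) * (\<Prod>i=1..N. k (periodic N x (i - 1)) (x i))"
  have ins: "{1..N} = insert N {1..n}" and nin: "N \<notin> {1..n}" using n by auto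
  have upd: "?f (x(N := z)) = a z * (?c z x * k (started_at z x n) z)" for x z
  proof -
    have "(\<Prod>i=1..n. k (periodic N (x(N := z)) (i - 1)) ((x(N := z)) i)) = ?c z x"
      by (intro prod.cong refl) (auto simp: started_at_def periodic_def n)
    then show ?thesis by (simp add: ins n started_at_def periodic_def mult_ac)
  qed
  have int: "integrable (Pi\<^sub>M (insert N {1..n}) (\<lambda>_. lborel)) ?f"
    using int by (simp only: ins lebesgue_N_def)
  interpret sf: sigma_finite_measure "Pi\<^sub>M {1..n} (\<lambda>_::nat. lborel :: real measure)"
    using sigma_finite_lebesgue_N[of n] by (simp add: lebesgue_N_def)
  interpret P: pair_sigma_finite "Pi\<^sub>M {1..n} (\<lambda>_::nat. lborel :: real measure)" "lborel :: real measure" ..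
  have int2: "integrable (Pi\<^sub>M {1..n} (\<lambda>_. lborel) \<Otimes>\<^sub>M lborel) (\<lambda>(x, z). a z * (?c z x * k (started_at z x n) z))"
    using lborel_product.integrable_PiM_insert[OF finite_atLeastAtMost nin int] by (simp only: upd)
  have "(\<integral>x. ?f x \<partial>lebesgue_N N) = (\<integral>x. (\<integral>z. ?f (x(N := z)) \<partial>lborel) \<partial>Pi\<^sub>M {1..n} (\<lambda>_. lborel))"
    using lborel_product.product_integral_insert[OF finite_atLeastAtMost nin int]
    by (simp only: lebesgue_N_def ins)
  also have "\<dots> = (\<integral>z. (\<integral>x. a z * (?c z x * k (started_at z x n) z) \<partial>Pi\<^sub>M {1..n} (\<lambda>_. lborel)) \<partial>lborel)"
    unfolding upd by (rule P.Fubini_integral[OF int2, symmetric])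
  also have "\<dots> = (\<integral>z. a z * kernel_of (op_of k ^ N) z z \<partial>lborel)"
  proof (rule integral_cong_AE)
    have eq: "(\<integral>x. a z * (?c z x * k (started_at z x n) z) \<partial>Pi\<^sub>M {1..n} (\<lambda>_. lborel)) = a z * kernel_of (op_of k ^ N) z z"
      if "integrable (Pi\<^sub>M {1..n} (\<lambda>_. lborel)) (\<lambda>x. a z * (?c z x * k (started_at z x n) z))" for z
    \<comment> \<open>Integrability of the bare path product is gained by dividing by
      \<open>a z\<close>; where \<open>a\<close> vanishes both sides are 0.\<close>
    proof (cases "a z = 0")
      case False
      have "integrable (Pi\<^sub>M {1..n} (\<lambda>_. lborel)) (\<lambda>x. ?c z x * k (started_at z x n) z)"
        using integrable_mult_right[OF that, of "1 / a z"] False by simp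
      then have "(\<integral>x. ?c z x * k (started_at z x n) z \<partial>Pi\<^sub>M {1..n} (\<lambda>_. lborel)) = (kernel_apply k ^^ n) (\<lambda>u. k u z) z"
        by (rule path_integral_iterate)
      also have "\<dots> = kernel_of (op_of k ^ N) z z"
        using kernel_apply_power[OF k, of 1 n z z] k n by simp
      finally show ?thesis by simp
    qed simp
    show "AE z in lborel. (\<integral>x. a z * (?c z x * k (started_at z x n) z) \<partial>Pi\<^sub>M {1..n} (\<lambda>_. lborel))
        = a z * kernel_of (op_of k ^ N) z z"
      using P.AE_integrable_snd[OF int2] by eventually_elim (rule eq)
    show "(\<lambda>z. \<integral>x. a z * (?c z x * k (started_at z x n) z) \<partial>Pi\<^sub>M {1..n} (\<lambda>_. lborel)) \<in> borel_measurable lborel"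
      using P.integrable_snd[OF int2] by (rule borel_measurable_integrable)
    show "(\<lambda>z. a z * kernel_of (op_of k ^ N) z z) \<in> borel_measurable lborel"
    proof -
      have h: "hs_kernel (kernel_of (op_of k ^ N))"
        using k N by (intro hs_kernel_kernel_of power_closed) auto
      note [measurable (raw)] = hs_kernel_app[OF h]
      show ?thesis by measurable
    qed
  qed
  finally show ?thesis .
qed

section \<open>Discretised path integrals as kernel traces\<close>

lemma hs_kernel_dominated:
  assumes m: "case_prod k \<in> borel_measurable (borel \<Otimes>\<^sub>M borel)"
    and f: "integrable lborel (\<lambda>x. (f x)\<^sup>2)" and g: "integrable lborel (\<lambda>x. (g x)\<^sup>2)"
    and le: "\<And>x y. cmod (k x y) \<le> f x * g y"
  shows "hs_kernel k"
proof -
  note [measurable (raw)] = kernel_measurable[OF m]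
  have b: "(cmod (k x y))\<^sup>2 \<le> (f x)\<^sup>2 * (g y)\<^sup>2" for x y
    using power_mono[OF le, of x y 2] by (simp add: power_mult_distrib)
  have "integrable (lborel \<Otimes>\<^sub>M lborel) (\<lambda>(x, y). (cmod (k x y))\<^sup>2)"
    by (rule Bochner_Integration.integrable_bound[OF integrable_tensor(1)[OF f g]]) (use b in auto)
  moreover have "integrable lborel (\<lambda>y. (cmod (k x y))\<^sup>2)" for x
    by (rule Bochner_Integration.integrable_bound[OF integrable_mult_right[OF g, of "(f x)\<^sup>2"]]) (use b in auto)
  moreover have "integrable lborel (\<lambda>x. (cmod (k x y))\<^sup>2)" for y
    by (rule Bochner_Integration.integrable_bound[OF integrable_mult_left[OF f, of "(g y)\<^sup>2"]]) (use b in auto)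
  ultimately show ?thesis using m by (simp add: hs_kernel_def)
qed

lemma hs_kernel_diag_measurable:
  "hs_kernel k \<Longrightarrow> (\<lambda>x. k x x) \<in> borel_measurable borel"
  by (rule hs_kernel_app) auto

context potential
begin

lemma hs_path_kernel: "Re \<tau> > 0 \<Longrightarrow> n > 0 \<Longrightarrow> hs_kernel (path_kernel \<tau> n)"
  by (intro hs_kernel_kernel_of power_closed) auto

lemma path_kernel_Suc:
  "Re \<tau> > 0 \<Longrightarrow> n > 0 \<Longrightarrow> path_kernel \<tau> (Suc n) = kernel_comp (step_kernel \<tau>) (path_kernel \<tau> n)"
  by (intro kernel_of_power_Suc hs_step_kernel)

text \<open>Positivity is available for real time steps and is what allows an observable to be
  replaced by a majorant under the trace.\<close>

lemma path_kernel_nonneg: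
  assumes t: "t > 0" and n: "n > 0"
  shows "path_kernel (of_real t) n x y \<in> \<real>\<^sub>\<ge>\<^sub>0"
  using n
proof (induction n arbitrary: x rule: nat_induct_non_zero)
  case 1
  have "step_kernel (of_real t) x y = of_real (heat_peak m t * exp (- m * (x - y)\<^sup>2 / (2 * t)) * exp (- t * V y))"
    using heat_kernel_real[OF mass t] by (simp add: step_kernel_def flip: exp_of_real)
  moreover have "0 \<le> heat_peak m t * exp (- m * (x - y)\<^sup>2 / (2 * t)) * exp (- t * V y)"
    using mass t by simp
  ultimately have "step_kernel (of_real t) x y \<in> \<real>\<^sub>\<ge>\<^sub>0" by (simp only: nonneg_Reals_of_real_iff)
  then show ?case using t by (simp add: hs_step_kernel)
next
  case (Suc n)
  have step: "step_kernel (of_real t) x z \<in> \<real>\<^sub>\<ge>\<^sub>0" for z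
  proof -
    have "step_kernel (of_real t) x z = of_real (heat_peak m t * exp (- m * (x - z)\<^sup>2 / (2 * t)) * exp (- t * V z))"
      using heat_kernel_real[OF mass t] by (simp add: step_kernel_def flip: exp_of_real)
    moreover have "0 \<le> heat_peak m t * exp (- m * (x - z)\<^sup>2 / (2 * t)) * exp (- t * V z)"
      using mass t by simp
    ultimately show ?thesis by (simp only: nonneg_Reals_of_real_iff)
  qed
  have "step_kernel (of_real t) x z * path_kernel (of_real t) n z y \<in> \<real>\<^sub>\<ge>\<^sub>0" for z
    by (intro nonneg_Reals_mult_I step Suc.IH)
  then have eq: "step_kernel (of_real t) x z * path_kernel (of_real t) n z y
      = complex_of_real (cmod (step_kernel (of_real t) x z * path_kernel (of_real t) n z y))" for z
    using nonneg_Reals_cmod_eq_Re by (metis complex_eq_iff Im_complex_of_real Re_complex_of_real complex_nonneg_Reals_iff)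
  have "path_kernel (of_real t) (Suc n) x y = (\<integral>z. complex_of_real (cmod (step_kernel (of_real t) x z * path_kernel (of_real t) n z y)) \<partial>lborel)"
    using t Suc.hyps by (simp only: path_kernel_Suc kernel_comp_def eq[symmetric] Re_complex_of_real)
  also have "\<dots> = complex_of_real (\<integral>z. cmod (step_kernel (of_real t) x z * path_kernel (of_real t) n z y) \<partial>lborel)"
    by (rule integral_complex_of_real)
  also have "\<dots> \<in> \<real>\<^sub>\<ge>\<^sub>0" by (simp only: nonneg_Reals_of_real_iff) (rule integral_nonneg_AE, simp)
  finally show ?case .
qed

text \<open>For a fixed path \<open>x\<close> the momenta decouple, and each one-dimensional Fourier
  integral gives one heat kernel.\<close>

lemma momentum_integral:
  assumes b: "Re \<beta> > 0" and N: "N \<ge> 1"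
  shows "(\<integral>p. boltzmann_integrand m V A \<beta> N x p \<partial>lebesgue_N N)
    = of_real (A (x N)) * (\<Prod>k=1..N. step_kernel (\<beta> / of_nat N) (periodic N x (k - 1)) (x k))"
proof -
  define \<tau> where "\<tau> = \<beta> / of_nat N"
  have t: "Re \<tau> > 0" using b N by (simp add: \<tau>_def)
  let ?D = "\<lambda>k. periodic N x (k - 1) - x k"
  let ?f = "\<lambda>k p. of_real (1 / (2 * pi)) * exp (- \<tau> * of_real (V (x k))) * exp (\<i> * complex_of_real (p * ?D k) - \<tau> * complex_of_real (p\<^sup>2 / (2 * m)))"
  have eq: "boltzmann_integrand m V A \<beta> N x p = of_real (A (x N)) * (\<Prod>k=1..N. ?f k (p k))" for p
  proof -
    have ph: "path_phase N x p = (\<Sum>k=1..N. p k * ?D k)"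
      unfolding path_phase_def by (intro sum.cong) (auto simp: periodic_def)
    have "\<i> * complex_of_real (path_phase N x p) - \<beta> / of_nat N * complex_of_real (\<Sum>k=1..N. (p k)\<^sup>2 / (2 * m) + V (x k))
       = (\<Sum>k=1..N. - \<tau> * of_real (V (x k)) + (\<i> * complex_of_real (p k * ?D k) - \<tau> * complex_of_real ((p k)\<^sup>2 / (2 * m))))"
      unfolding ph \<tau>_def[symmetric] of_real_sum sum_distrib_left sum_subtractf[symmetric]
      by (intro sum.cong refl) (simp add: algebra_simps)
    moreover have "complex_of_real (A (periodic N x 0) / (2 * pi) ^ N) = of_real (A (x N)) * (\<Prod>k=1..N. of_real (1 / (2 * pi)))"
      by (simp add: periodic_def power_divide)
    ultimately show ?thesis
      unfolding boltzmann_integrand_def by (simp only: exp_sum finite_atLeastAtMost exp_add prod.distrib mult.assoc)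
  qed
  have fint: "integrable lborel (?f k)" for k
    by (intro integrable_mult_right heat_kernel_fourier(1) mass t)
  have f: "(\<integral>p. ?f k p \<partial>lborel) = step_kernel \<tau> (periodic N x (k - 1)) (x k)" for k
    unfolding integral_mult_right_zero heat_kernel_fourier(2)[OF mass t] step_kernel_def by simp
  have "(\<integral>p. boltzmann_integrand m V A \<beta> N x p \<partial>lebesgue_N N)
      = of_real (A (x N)) * (\<integral>p. (\<Prod>k=1..N. ?f k (p k)) \<partial>lebesgue_N N)"
    unfolding eq by (rule integral_mult_right_zero)
  also have "(\<integral>p. (\<Prod>k=1..N. ?f k (p k)) \<partial>lebesgue_N N) = (\<Prod>k=1..N. \<integral>p. ?f k p \<partial>lborel)"
    unfolding lebesgue_N_def by (rule lborel_product.product_integral_prod[OF finite_atLeastAtMost fint])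
  finally show ?thesis unfolding f unfolding \<tau>_def .
qed

lemma boltzmann_path_integral:
  assumes b: "Re \<beta> > 0" and N: "N \<ge> 1" and [measurable]: "A \<in> borel_measurable borel"
    and int: "integrable (lebesgue_N N \<Otimes>\<^sub>M lebesgue_N N) (\<lambda>(x, p). boltzmann_integrand m V A \<beta> N x p)"
  shows "(\<integral>(x, p). boltzmann_integrand m V A \<beta> N x p \<partial>(lebesgue_N N \<Otimes>\<^sub>M lebesgue_N N))
    = (\<integral>z. of_real (A z) * path_kernel (\<beta> / of_nat N) N z z \<partial>lborel)"
proof -
  interpret sigma_finite_measure "lebesgue_N N" by (rule sigma_finite_lebesgue_N)
  interpret pair_sigma_finite "lebesgue_N N" "lebesgue_N N" ..
  have t: "Re (\<beta> / of_nat N) > 0" using b N by simp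
  have int1: "integrable (lebesgue_N N)
      (\<lambda>x. of_real (A (x N)) * (\<Prod>k=1..N. step_kernel (\<beta> / of_nat N) (periodic N x (k - 1)) (x k)))"
    using integrable_fst[OF int] by (simp only: momentum_integral[OF b N])
  have "(\<integral>(x, p). boltzmann_integrand m V A \<beta> N x p \<partial>(lebesgue_N N \<Otimes>\<^sub>M lebesgue_N N))
      = (\<integral>x. of_real (A (x N)) * (\<Prod>k=1..N. step_kernel (\<beta> / of_nat N) (periodic N x (k - 1)) (x k)) \<partial>lebesgue_N N)"
    unfolding integral_fst[OF int, symmetric] momentum_integral[OF b N] ..
  also have "\<dots> = (\<integral>z. of_real (A z) * path_kernel (\<beta> / of_nat N) N z z \<partial>lborel)"
    using int1 by (intro cyclic_path_integral[OF hs_step_kernel[OF t] N]) auto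
  finally show ?thesis .
qed

text \<open>
  The diagonal of a power of \<open>step_kernel\<close> does not change if the factor \<open>exp (- t * V)\<close> is
  distributed symmetrically; the symmetric kernel gives a self-adjoint operator.
\<close>

definition sym_kernel :: "real \<Rightarrow> real \<Rightarrow> real \<Rightarrow> complex" where
  "sym_kernel t x y = of_real (exp (- t / 2 * V x)) * heat_kernel m (of_real t) (x - y) * of_real (exp (- t / 2 * V y))"

lemma half_exp_V_square: "(exp (- t / 2 * V x))\<^sup>2 = exp (- t * V x)"
  by (simp flip: exp_double)

lemma hs_sym_kernel: assumes t: "t > 0" shows "hs_kernel (sym_kernel t)"
proof (rule hs_kernel_dominated)
  let ?f = "\<lambda>x. heat_peak m t * exp (- t / 2 * V x)" and ?g = "\<lambda>x. exp (- t / 2 * V x)"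
  show "case_prod (sym_kernel t) \<in> borel_measurable (borel \<Otimes>\<^sub>M borel)"
    unfolding sym_kernel_def by measurable
  show "integrable lborel (\<lambda>x. (?f x)\<^sup>2)" "integrable lborel (\<lambda>x. (?g x)\<^sup>2)"
    unfolding power_mult_distrib half_exp_V_square using V_int[OF t] by auto
  show "cmod (sym_kernel t x y) \<le> ?f x * ?g y" for x y
    using heat_kernel_bound[OF mass, of "of_real t" "x - y"] t
    by (simp add: sym_kernel_def norm_mult mult_ac)
qed

lemma sym_kernel_power:
  assumes t: "t > 0" and n: "n > 0"
  shows "path_kernel (of_real t) n x y
    = of_real (exp (t / 2 * V x)) * kernel_of (op_of (sym_kernel t) ^ n) x y / of_real (exp (t / 2 * V y))"
proof (rule kernel_power_similar[OF hs_step_kernel hs_sym_kernel[OF t] _ _ n])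
  fix x y
  have e: "of_real (exp (- t / 2 * V x)) * of_real (exp (t / 2 * V x)) = (1::complex)" for x
    by (simp flip: of_real_mult exp_add)
  have "exp (- of_real t * of_real (V y)) = complex_of_real (exp (- t / 2 * V y) / exp (t / 2 * V y))"
    by (simp flip: exp_diff exp_of_real)
  then show "step_kernel (of_real t) x y = of_real (exp (t / 2 * V x)) * sym_kernel t x y / of_real (exp (t / 2 * V y))"
    unfolding step_kernel_def sym_kernel_def
    using e[of x] by (simp add: mult_ac)
qed (use t in auto)

lemma sym_op_self_adjoint: assumes t: "t > 0" shows "adj_op (op_of (sym_kernel t)) = op_of (sym_kernel t)"
proof -
  have "kernel_adj (sym_kernel t) = sym_kernel t"
    by (intro ext) (simp add: kernel_adj_def sym_kernel_def heat_kernel_real[OF mass t] power2_commute mult_ac)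
  then show ?thesis using t by (simp add: adj_op_of hs_sym_kernel)
qed

text \<open>Write the trace of \<open>B\<close> times K^N as tr (Y K^r Y') with Y = sqrt B K^k, Y'
  its adjoint and N = 2 k + r, for the symmetrised step K. Cauchy-Schwarz and the operator norm
  bound leave \<open>C0 powr (r * t)\<close> times the squared norm of Y, and that square is the
  same trace with only \<open>2 * k\<close> factors.\<close>

lemma real_trace_reduction:
  assumes t: "0 < t" "t \<le> 1 / 2" and k: "k > 0" and N: "2 * k \<le> N"
    and [measurable]: "B \<in> borel_measurable borel" and B: "\<And>x. 0 \<le> B x"
    and Bint: "integrable lborel (\<lambda>x. B x * exp (- t * V x))"
  shows "cmod (\<integral>x. of_real (B x) * path_kernel (of_real t) N x x \<partial>lborel)
    \<le> C0 powr (N * t) * cmod (\<integral>x. of_real (B x) * path_kernel (of_real t) (2 * k) x x \<partial>lborel)"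
proof -
  let ?K = "op_of (sym_kernel t)"
  have K: "?K \<in> kernel_ops" using t by (simp add: hs_sym_kernel)
  have adjK: "adj_op ?K = ?K" using t by (intro sym_op_self_adjoint)
  let ?P = "\<lambda>n. kernel_of (?K ^ n)"
  have diag: "path_kernel (of_real t) n x x = ?P n x x" if "n > 0" for n x
    using sym_kernel_power[OF t(1) that, of x x] by simp
  obtain j where j: "1 \<le> 2 * 2 ^ j * t" "2 * 2 ^ j * t \<le> 2" using dyadic_scale[OF t] by blast
  have tr: "cmod (kernel_trace (kernel_of ((adj_op ?K * ?K) ^ (2 ^ j)))) \<le> C0"
  proof -
    have "(adj_op ?K * ?K) ^ (2 ^ j) = ?K ^ (2 ^ Suc j)"
      by (simp add: adjK power_mult power2_eq_square)
    then have "cmod (kernel_trace (kernel_of ((adj_op ?K * ?K) ^ (2 ^ j)))) = cmod (kernel_trace (path_kernel (of_real t) (2 ^ Suc j)))"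
      by (simp add: kernel_trace_def diag)
    also have "\<dots> \<le> classical_bound (2 ^ Suc j * t)" using t by (intro golden_thompson)
    also have "\<dots> \<le> C0" using j by (intro classical_bound_le_C0) auto
    finally show ?thesis .
  qed
  define y where "y x z = of_real (sqrt (B x)) * ?P k x z" for x z
  have Pk: "hs_kernel (?P k)" using K k by (intro hs_kernel_kernel_of power_closed)
  \<comment> \<open>\<open>B\<close> may be unbounded: the crude bound leaves
    \<open>exp (- t / 2 * V x)\<close> on the left, and its product with \<open>sqrt (B x)\<close>
    is square integrable by \<open>Bint\<close>.\<close>
  have hy: "hs_kernel y"
  proof (rule hs_kernel_dominated)
    note [measurable (raw)] = hs_kernel_app[OF Pk]
    show "case_prod y \<in> borel_measurable (borel \<Otimes>\<^sub>M borel)" unfolding y_def by measurable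
    let ?c = "heat_peak m t ^ k * (\<integral>z. exp (- t * V z) \<partial>lborel) ^ (k - 1)"
    let ?f = "\<lambda>x. ?c * (sqrt (B x) * exp (- t / 2 * V x))" and ?g = "\<lambda>x. exp (- t / 2 * V x)"
    show "integrable lborel (\<lambda>x. (?f x)\<^sup>2)" "integrable lborel (\<lambda>x. (?g x)\<^sup>2)"
      unfolding power_mult_distrib half_exp_V_square using V_int[OF t(1)] Bint B by (auto simp: mult.assoc)
    show "cmod (y x z) \<le> ?f x * ?g z" for x z
    proof -
      have "?P k x z = of_real (exp (- t / 2 * V x)) * path_kernel (of_real t) k x z * of_real (exp (t / 2 * V z))"
        using sym_kernel_power[OF t(1) k, of x z] by (simp add: exp_minus field_simps)
      then have "cmod (?P k x z) = exp (- t / 2 * V x) * cmod (path_kernel (of_real t) k x z) * exp (t / 2 * V z)"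
        by (simp add: norm_mult)
      also have "\<dots> \<le> exp (- t / 2 * V x) * (?c * exp (- t * V z)) * exp (t / 2 * V z)"
        using path_kernel_crude_bound[of "of_real t" k x z] t k
        by (intro mult_right_mono mult_left_mono) auto
      also have "\<dots> = ?c * (exp (- t / 2 * V x) * (exp (- t * V z) * exp (t / 2 * V z)))"
        by (simp only: mult_ac)
      also have "exp (- t * V z) * exp (t / 2 * V z) = exp (- t / 2 * V z)"
        by (simp flip: exp_add)
      finally have "sqrt (B x) * cmod (?P k x z) \<le> sqrt (B x) * (?c * (exp (- t / 2 * V x) * exp (- t / 2 * V z)))"
        using B by (intro mult_left_mono) auto
      then show ?thesis using B by (simp add: y_def norm_mult mult_ac)
    qed
  qed
  let ?Y = "op_of y"
  have Y: "?Y \<in> kernel_ops" using hy by simp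
  have adjP: "kernel_adj (?P n) = ?P n" if n: "n > 0" for n
  proof -
    obtain f where f: "hs_kernel f" "?K ^ n = op_of f"
      using power_closed[OF K n] by (auto elim: kernel_opsE)
    have "op_of (kernel_adj f) = op_of f"
      using adj_power[of ?K n] f by (simp add: adjK adj_op_of)
    then have "kernel_of (op_of (kernel_adj f)) = kernel_of (op_of f)" by simp
    then show ?thesis using f by (simp add: hs_kernel_adj)
  qed
  have adjY: "kernel_of (adj_op ?Y) x z = of_real (sqrt (B z)) * ?P k x z" for x z
    using adjP[OF k] hy by (simp add: adj_op_of hs_kernel_adj kernel_adj_def y_def fun_eq_iff)
  have PY: "kernel_of (?K ^ r * adj_op ?Y) x z = of_real (sqrt (B z)) * ?P (r + k) x z" for r x z
  proof (cases "r = 0")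
    case False
    then have r: "?K ^ r \<in> kernel_ops" "?K ^ k \<in> kernel_ops" using K k by (auto intro: power_closed)
    have "kernel_of (?K ^ r * adj_op ?Y) x z = (\<integral>w. of_real (sqrt (B z)) * (?P r x w * ?P k w z) \<partial>lborel)"
      using r Y by (simp add: kernel_of_mult kernel_comp_def adjY mult_ac)
    also have "\<dots> = of_real (sqrt (B z)) * (\<integral>w. ?P r x w * ?P k w z \<partial>lborel)"
      by (rule integral_mult_right_zero)
    finally show ?thesis using r by (simp add: power_add kernel_of_mult kernel_comp_def)
  qed (simp add: adjY)
  have trace: "kernel_trace (kernel_of (?Y * (?K ^ r * adj_op ?Y))) = (\<integral>x. of_real (B x) * path_kernel (of_real t) (k + (r + k)) x x \<partial>lborel)" for r
  proof -
    have r: "?K ^ r * adj_op ?Y \<in> kernel_ops" "?K ^ k \<in> kernel_ops" "?K ^ (r + k) \<in> kernel_ops"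
      using K Y k by (auto intro: power_closed ideal_left)
    have "kernel_of (?Y * (?K ^ r * adj_op ?Y)) x x = of_real (B x) * path_kernel (of_real t) (k + (r + k)) x x" for x
    proof -
      have "kernel_of (?Y * (?K ^ r * adj_op ?Y)) x x
          = (\<integral>w. of_real (sqrt (B x)) * of_real (sqrt (B x)) * (?P k x w * ?P (r + k) w x) \<partial>lborel)"
        using r Y hy by (simp add: kernel_of_mult kernel_comp_def PY y_def mult_ac)
      also have "\<dots> = of_real (sqrt (B x)) * of_real (sqrt (B x)) * (\<integral>w. ?P k x w * ?P (r + k) w x \<partial>lborel)"
        by (rule integral_mult_right_zero)
      also have "of_real (sqrt (B x)) * of_real (sqrt (B x)) = complex_of_real (B x)"
        using B by (simp flip: of_real_mult)
      also have "(\<integral>w. ?P k x w * ?P (r + k) w x \<partial>lborel) = ?P (k + (r + k)) x x"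
        using r by (simp add: power_add[of _ k "r + k"] kernel_of_mult kernel_comp_def)
      finally show ?thesis using k by (simp add: diag)
    qed
    then show ?thesis by (simp add: kernel_trace_def)
  qed
  have Y2: "(kernel_norm (kernel_of ?Y))\<^sup>2 = cmod (\<integral>x. of_real (B x) * path_kernel (of_real t) (2 * k) x x \<partial>lborel)"
    using hs_square[of "adj_op ?Y"] Y hs_adj[OF Y] trace[of 0] by (simp add: mult_2)
  obtain r where r: "N = k + (r + k)" using N by (metis add.commute add.left_commute le_Suc_ex mult_2)
  have "cmod (kernel_trace (kernel_of (?Y * (?K ^ r * adj_op ?Y))))
      \<le> kernel_norm (kernel_of ?Y) * kernel_norm (kernel_of (?K ^ r * adj_op ?Y))"
    using Y by (intro cauchy_schwarz ideal_left) auto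
  also have "\<dots> \<le> kernel_norm (kernel_of ?Y) * (C0 powr (r * t) * kernel_norm (kernel_of (adj_op ?Y)))"
    using Y by (intro mult_left_mono hs_mult_iterate[OF K _ tr j(1)]) auto
  also have "\<dots> = C0 powr (r * t) * (kernel_norm (kernel_of ?Y))\<^sup>2"
    by (simp add: hs_adj[OF Y] power2_eq_square)
  also have "\<dots> \<le> C0 powr (N * t) * (kernel_norm (kernel_of ?Y))\<^sup>2"
    using C0_ge_1 t by (intro mult_right_mono powr_mono) (auto simp: r)
  finally show ?thesis unfolding trace Y2 r[symmetric] .
qed

end

section \<open>Two-constants estimates and wedge contours\<close>

text \<open>Apply the maximum principle to the product of \<open>f\<close> over the four rotations
  of the square. On each side of the square one of the four factors runs along the good side and is
  at most \<open>m\<close>; at the centre the product is the fourth power of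
  \<open>f c\<close>.\<close>

lemma maximum_modulus_square:
  fixes f :: "complex \<Rightarrow> complex"
  assumes hol: "f holomorphic_on U" and U: "open U"
    and sub: "\<And>x y. \<bar>x\<bar> \<le> 1 \<Longrightarrow> \<bar>y\<bar> \<le> 1 \<Longrightarrow> c + u * Complex x y \<in> U"
    and M: "\<And>x y. \<bar>x\<bar> \<le> 1 \<Longrightarrow> \<bar>y\<bar> \<le> 1 \<Longrightarrow> cmod (f (c + u * Complex x y)) \<le> M"
    and m: "\<And>x. \<bar>x\<bar> \<le> 1 \<Longrightarrow> cmod (f (c + u * Complex x (- 1))) \<le> m"
  shows "cmod (f c) ^ 4 \<le> m * M ^ 3"
proof -
  let ?Q = "cbox (Complex (- 1) (- 1)) (Complex 1 1)"
  have Q: "z \<in> ?Q \<longleftrightarrow> \<bar>Re z\<bar> \<le> 1 \<and> \<bar>Im z\<bar> \<le> 1" for z by (auto simp: in_cbox_complex_iff)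
  have M0: "0 \<le> M" using order_trans[OF norm_ge_zero M[of 0 0]] by simp
  have m0: "0 \<le> m" using order_trans[OF norm_ge_zero m[of 0]] by simp
  let ?r = "\<lambda>w z. f (c + u * (w * z))"
  let ?g = "\<lambda>z. ?r 1 z * ?r \<i> z * ?r (- 1) z * ?r (- \<i>) z"
  have rot: "\<bar>Re (w * z)\<bar> \<le> 1 \<and> \<bar>Im (w * z)\<bar> \<le> 1" if "z \<in> ?Q" "w \<in> {1, \<i>, - 1, - \<i>}" for w z
    using that by (auto simp: Q)
  have inU: "c + u * (w * z) \<in> U" if "z \<in> ?Q" "w \<in> {1, \<i>, - 1, - \<i>}" for w z
    using sub[of "Re (w * z)" "Im (w * z)"] rot[OF that] unfolding complex_surj by blast
  have rM: "cmod (?r w z) \<le> M" if "z \<in> ?Q" "w \<in> {1, \<i>, - 1, - \<i>}" for w z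
    using M[of "Re (w * z)" "Im (w * z)"] rot[OF that] unfolding complex_surj by blast
  have hr: "?r w holomorphic_on ?Q" if "w \<in> {1, \<i>, - 1, - \<i>}" for w
    by (rule holomorphic_on_compose_gen[OF _ hol, unfolded o_def])
       (auto intro!: holomorphic_intros inU[OF _ that])
  have hg: "?g holomorphic_on ?Q"
    by (intro holomorphic_on_mult hr) auto
  have front: "cmod (?g z) \<le> m * M ^ 3" if "z \<in> frontier ?Q" for z
  proof -
    have zQ: "z \<in> ?Q" using that frontier_subset_closed[OF closed_cbox] by blast
    have rm: "cmod (?r w z) \<le> m" if "Im (w * z) = - 1" "w \<in> {1, \<i>, - 1, - \<i>}" for w
      using m[of "Re (w * z)"] rot[OF zQ that(2)] that(1) by (metis complex_surj)
    have "z \<notin> interior ?Q" using that by (simp add: frontier_def)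
    then have "z \<notin> box (Complex (- 1) (- 1)) (Complex 1 1)" by (simp add: interior_cbox)
    then have "Im (1 * z) = - 1 \<or> Im (\<i> * z) = - 1 \<or> Im (- 1 * z) = - 1 \<or> Im (- \<i> * z) = - 1"
      using zQ by (auto simp: in_box_complex_iff Q)
    then consider "cmod (?r 1 z) \<le> m" | "cmod (?r \<i> z) \<le> m" | "cmod (?r (- 1) z) \<le> m" | "cmod (?r (- \<i>) z) \<le> m"
      using rm[of 1] rm[of \<i>] rm[of "- 1"] rm[of "- \<i>"] by blast
    then show ?thesis
    proof cases
      case 1
      then have "cmod (?r 1 z) * cmod (?r \<i> z) * cmod (?r (- 1) z) * cmod (?r (- \<i>) z) \<le> m * M * M * M"
        by (intro mult_mono rM zQ mult_nonneg_nonneg M0 m0) auto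
      then show ?thesis by (simp add: norm_mult power3_eq_cube mult_ac)
    next
      case 2
      then have "cmod (?r 1 z) * cmod (?r \<i> z) * cmod (?r (- 1) z) * cmod (?r (- \<i>) z) \<le> M * m * M * M"
        by (intro mult_mono rM zQ mult_nonneg_nonneg M0 m0) auto
      then show ?thesis by (simp add: norm_mult power3_eq_cube mult_ac)
    next
      case 3
      then have "cmod (?r 1 z) * cmod (?r \<i> z) * cmod (?r (- 1) z) * cmod (?r (- \<i>) z) \<le> M * M * m * M"
        by (intro mult_mono rM zQ mult_nonneg_nonneg M0 m0) auto
      then show ?thesis by (simp add: norm_mult power3_eq_cube mult_ac)
    next
      case 4
      then have "cmod (?r 1 z) * cmod (?r \<i> z) * cmod (?r (- 1) z) * cmod (?r (- \<i>) z) \<le> M * M * M * m"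
        by (intro mult_mono rM zQ mult_nonneg_nonneg M0 m0) auto
      then show ?thesis by (simp add: norm_mult power3_eq_cube mult_ac)
    qed
  qed
  have "cmod (?g 0) \<le> m * M ^ 3"
  proof (rule maximum_modulus_frontier[of ?g ?Q])
    show "?g holomorphic_on interior ?Q" using hg interior_subset by (rule holomorphic_on_subset)
    show "continuous_on (closure ?Q) ?g" using hg holomorphic_on_imp_continuous_on by simp
    show "0 \<in> ?Q" by (simp add: Q)
  qed (use front in auto)
  then show ?thesis by (simp add: norm_mult power4_eq_xxxx mult_ac)
qed

text \<open>
  Applied to a square resting on the real axis and then to a square resting on the diagonal
  \<open>Im z = Re z - b1\<close>, which reaches points of argument larger than \<open>pi / 4\<close> as seen from \<open>b1\<close>.
\<close>

lemma two_constants_wedge: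
  fixes f :: "complex \<Rightarrow> complex"
  assumes hol: "f holomorphic_on {z. 0 < Re z}" and b1: "b1 > 0"
    and M: "\<And>z. b1 \<le> Re z \<Longrightarrow> Re z \<le> B \<Longrightarrow> cmod (f z) \<le> M"
    and m: "\<And>b. b1 \<le> b \<Longrightarrow> b \<le> B \<Longrightarrow> cmod (f (of_real b)) \<le> m"
    and mM: "m \<le> M" and r: "0 \<le> r" "b1 + 3 * r \<le> B" and \<eta>: "\<eta> = 1 \<or> \<eta> = - 1"
  shows "cmod (f (Complex (b1 + r) (\<eta> * (3 / 2) * r))) ^ 16 \<le> m * M ^ 15"
proof -
  have op: "open {z. 0 < Re z}" by (rule open_halfspace_Re_gt)
  have m0: "0 \<le> m" using order_trans[OF norm_ge_zero m[of b1]] r by simp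
  have M0: "0 \<le> M" using m0 mM by linarith
  \<comment> \<open>The square has half side |s|, so its side at height \<open>y = - 1\<close> lies
    on the real axis, for either sign of \<open>s\<close>.\<close>
  have step1: "cmod (f (Complex b s)) ^ 4 \<le> m * M ^ 3" if "b1 + \<bar>s\<bar> \<le> b" "b + \<bar>s\<bar> \<le> B" for b s
  proof (rule maximum_modulus_square[OF hol op, of "Complex b s" "of_real s"])
    fix x y :: real assume xy: "\<bar>x\<bar> \<le> 1" "\<bar>y\<bar> \<le> 1"
    have "\<bar>s * x\<bar> \<le> \<bar>s\<bar>" using xy mult_left_mono[of "\<bar>x\<bar>" 1 "\<bar>s\<bar>"] by (simp add: abs_mult)
    then have *: "b1 \<le> Re (Complex b s + of_real s * Complex x y)" "Re (Complex b s + of_real s * Complex x y) \<le> B"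
      using that by auto
    then show "Complex b s + of_real s * Complex x y \<in> {z. 0 < Re z}" using b1 by simp
    show "cmod (f (Complex b s + of_real s * Complex x y)) \<le> M" using * by (rule M)
    have "Complex b s + of_real s * Complex x (- 1) = of_real (b + s * x)" by (simp add: complex_eq_iff)
    then show "cmod (f (Complex b s + of_real s * Complex x (- 1))) \<le> m"
      using m[of "b + s * x"] * by simp
  qed
  define m1 where "m1 = root 4 (m * M ^ 3)"
  have m1: "0 \<le> m1" "m1 ^ 4 = m * M ^ 3"
    using m0 M0 by (auto simp: m1_def)
  have step1': "cmod (f (Complex b s)) \<le> m1" if "b1 + \<bar>s\<bar> \<le> b" "b + \<bar>s\<bar> \<le> B" for b s
  proof -
    have "cmod (f (Complex b s)) ^ 4 \<le> m1 ^ 4" using step1[OF that] m1 by simp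
    then show ?thesis using m1(1) by (subst (asm) power_mono_iff) auto
  qed
  \<comment> \<open>A tilted square about the target point. Its side \<open>y = - 1\<close> lies on
    the line Im z = \<eta> (Re z - b1), where \<open>step1'\<close> applies; |Im z| reaches at most
    3 r / 2 there, which explains the requirement \<open>b1 + 3 * r \<le> B\<close>.\<close>
  let ?c = "Complex (b1 + r) (\<eta> * (3 / 2) * r)" and ?u = "Complex (\<eta> * r / 4) (r / 4)"
  have re: "Re (?c + ?u * Complex x y) = b1 + r + \<eta> * r / 4 * x - r / 4 * y"
    "Im (?c + ?u * Complex x y) = \<eta> * (3 / 2) * r + \<eta> * r / 4 * y + r / 4 * x" for x y by auto
  have "cmod (f ?c) ^ 4 \<le> m1 * M ^ 3"
  proof (rule maximum_modulus_square[OF hol op, of ?c ?u])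
    fix x y :: real assume xy: "\<bar>x\<bar> \<le> 1" "\<bar>y\<bar> \<le> 1"
    have rx: "\<bar>r * x\<bar> \<le> r" "\<bar>r * y\<bar> \<le> r"
      using xy r mult_left_mono[of "\<bar>x\<bar>" 1 r] mult_left_mono[of "\<bar>y\<bar>" 1 r] by (simp_all add: abs_mult)
    then have *: "b1 \<le> Re (?c + ?u * Complex x y)" "Re (?c + ?u * Complex x y) \<le> B"
      unfolding re using r \<eta> by (auto simp: abs_le_iff)
    then show "?c + ?u * Complex x y \<in> {z. 0 < Re z}" using b1 by simp
    show "cmod (f (?c + ?u * Complex x y)) \<le> M" using * by (rule M)
    define t where "t = r * x"
    have t: "t \<le> r" "- r \<le> t" using rx(1) by (auto simp: abs_le_iff t_def)
    have eq: "?c + ?u * Complex x (- 1) = Complex (b1 + r + \<eta> * t / 4 + r / 4) (\<eta> * (3 / 2) * r - \<eta> * r / 4 + t / 4)"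
      by (simp add: complex_eq_iff t_def)
    show "cmod (f (?c + ?u * Complex x (- 1))) \<le> m1"
      unfolding eq using t r \<eta> by (intro step1') (auto simp: abs_if)
  qed
  then have "(cmod (f ?c) ^ 4) ^ 4 \<le> (m1 * M ^ 3) ^ 4" by (rule power_mono) simp
  also have "\<dots> = m * M ^ 15"
    by (simp add: power_mult_distrib m1 flip: power_mult power_add)
  finally show ?thesis by (simp flip: power_mult)
qed

section \<open>Contour integrals over segments and the deformation of the vertical line\<close>

lemma contour_integral_segment:
  assumes cont: "continuous_on (closed_segment a (a + q * of_real L)) g" and L: "0 \<le> L"
  shows "(g has_contour_integral q * (\<integral>\<rho>. indicator {0..L} \<rho> *\<^sub>R g (a + q * of_real \<rho>) \<partial>lborel)) (linepath a (a + q * of_real L))"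
    and "integrable lborel (\<lambda>\<rho>. indicator {0..L} \<rho> *\<^sub>R g (a + q * of_real \<rho>))"
proof -
  let ?G = "\<lambda>\<rho>. g (a + q * of_real \<rho>)"
  have seg: "a + q * of_real \<rho> \<in> closed_segment a (a + q * of_real L)" if "\<rho> \<in> {0..L}" for \<rho>
  proof (cases "L = 0")
    case False
    then have "a + q * of_real \<rho> = (1 - \<rho> / L) *\<^sub>R a + (\<rho> / L) *\<^sub>R (a + q * of_real L)"
      by (simp add: scaleR_conv_of_real field_simps)
    then show ?thesis
      unfolding in_segment using that L False by (intro exI[of _ "\<rho> / L"]) auto
  qed (use that in auto)
  have cG: "continuous_on {0..L} ?G"
    by (rule continuous_on_compose2[OF cont]) (auto intro!: continuous_intros seg)
  have si: "set_integrable lborel {0..L} ?G"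
    by (rule borel_integrable_compact[OF compact_Icc cG, folded set_integrable_def])
  then show "integrable lborel (\<lambda>\<rho>. indicator {0..L} \<rho> *\<^sub>R ?G \<rho>)"
    by (simp add: set_integrable_def)
  have eq: "(\<integral>\<rho>. indicator {0..L} \<rho> *\<^sub>R ?G \<rho> \<partial>lborel) = integral {0..L} ?G"
    using set_borel_integral_eq_integral(2)[OF si] by (simp add: set_lebesgue_integral_def)
  have hi: "(?G has_integral integral {0..L} ?G) {0..L}"
    using cG by (intro integrable_integral integrable_continuous_real)
  have "((\<lambda>x. g (linepath a (a + q * of_real L) x) * (a + q * of_real L - a)) has_integral q * integral {0..L} ?G) {0..1}"
  proof (cases "L = 0")
    case False
    then have "L > 0" using L by simp
    have img: "(\<lambda>x. x / L) ` {0..L} = {0..1}"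
    proof
      show "(\<lambda>x. x / L) ` {0..L} \<subseteq> {0..1}" using \<open>L > 0\<close> by auto
      show "{0..1} \<subseteq> (\<lambda>x. x / L) ` {0..L}"
        using \<open>L > 0\<close> by (auto intro!: image_eqI[of _ _ "_ * L"] simp: mult_left_le_one_le mult_le_cancel_right1)
    qed
    have "((\<lambda>x. ?G (L * x)) has_integral (1 / \<bar>L\<bar>) *\<^sub>R integral {0..L} ?G) {0..1}"
      using has_integral_stretch_real[OF hi False] by (simp only: img)
    from has_integral_mult_right[OF this, of "q * of_real L"]
    show ?thesis
      using \<open>L > 0\<close> by (simp add: linepath_def scaleR_conv_of_real algebra_simps)
  qed simp
  then show "(g has_contour_integral q * (\<integral>\<rho>. indicator {0..L} \<rho> *\<^sub>R ?G \<rho> \<partial>lborel)) (linepath a (a + q * of_real L))"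
    unfolding has_contour_integral_linepath eq .
qed

lemma has_contour_integral_triangle_zero:
  assumes hol: "g holomorphic_on S" "convex S" "a \<in> S" "a' \<in> S" "b \<in> S"
    and "(g has_contour_integral I1) (linepath a a')" "(g has_contour_integral I2) (linepath b a')"
      "(g has_contour_integral I3) (linepath b a)"
  shows "I1 = I2 - I3"
proof -
  have "g holomorphic_on convex hull {a, a', b}"
    using assms(1-5) by (intro holomorphic_on_subset[OF hol(1)] hull_minimal) auto
  then have 0: "(g has_contour_integral 0) (linepath a a' +++ linepath a' b +++ linepath b a)"
    by (rule Cauchy_theorem_triangle)
  have "(g has_contour_integral - I2) (linepath a' b)"
    using has_contour_integral_reversepath[OF _ assms(7)] by simp
  then have "(g has_contour_integral (I1 + (- I2 + I3))) (linepath a a' +++ linepath a' b +++ linepath b a)"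
    using assms(6,8) by (intro has_contour_integral_join) auto
  with 0 have "0 = I1 + (- I2 + I3)" by (rule has_contour_integral_unique)
  then show ?thesis by (simp add: algebra_simps)
qed

text \<open>The part of the line inside the wedge and the two rays bound a triangle, so Cauchy's
  theorem is needed for a bounded contour only. Dominated convergence handles the rays; the part of
  the line outside the wedge is estimated by absolute values.\<close>

lemma wedge_contour_limit:
  fixes D :: "nat \<Rightarrow> complex \<Rightarrow> complex"
  assumes e: "\<epsilon> > 0" and kap: "\<kappa> > 0" and b1: "b1 > 0"
    and hol: "\<And>N. N \<ge> N0 \<Longrightarrow> D N holomorphic_on {z. 0 < Re z}"
    and lim: "\<And>z. 0 < Re z \<Longrightarrow> (\<lambda>N. D N z) \<longlonglongrightarrow> 0"
    and ray: "\<And>N r \<eta>. N \<ge> N0 \<Longrightarrow> 0 \<le> r \<Longrightarrow> b1 + r \<le> \<kappa> * real N \<Longrightarrow> \<eta> = 1 \<or> \<eta> = - 1 \<Longrightarrow>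
          cmod (D N (Complex (b1 + r) (\<eta> * (3 / 2) * r))) \<le> K * exp (c * r)"
    and line: "\<And>N s. N \<ge> N0 \<Longrightarrow> cmod (D N (Complex (\<kappa> * real N) s)) \<le> K * exp (c * real N)"
  shows "(\<lambda>N. \<integral>s. laplace_weight \<epsilon> E (Complex (\<kappa> * real N) s) * D N (Complex (\<kappa> * real N) s) \<partial>lborel) \<longlonglongrightarrow> 0"
proof -
  let ?w = "laplace_weight \<epsilon> E"
  define g where "g N z = ?w z * D N z" for N z
  have holg: "g N holomorphic_on {z. 0 < Re z}" if "N \<ge> N0" for N
    unfolding g_def using hol[OF that] by (intro holomorphic_on_mult holomorphic_laplace_weight)
  have contg: "continuous_on {z. 0 < Re z} (g N)" if "N \<ge> N0" for N
    using holg[OF that] by (rule holomorphic_on_imp_continuous_on)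
  define ok where "ok N \<longleftrightarrow> N \<ge> N0 \<and> N \<ge> 1 \<and> b1 \<le> \<kappa> * real N" for N
  define R where "R N = \<kappa> * real N - b1" for N
  \<comment> \<open>The ray is parametrised by Re z - b1, so it meets the line at
    \<open>R N\<close>. The integrand is 0 for the finitely many \<open>N\<close> that are not
    \<open>ok\<close>.\<close>
  define J where "J \<eta> N = (\<integral>\<rho>. (if ok N then indicator {0..R N} \<rho> *\<^sub>R g N (of_real b1 + Complex 1 (\<eta> * (3 / 2)) * of_real \<rho>) else 0) \<partial>lborel)" for \<eta> N
  have zeq: "of_real b1 + Complex 1 (\<eta> * (3 / 2)) * of_real \<rho> = Complex (b1 + \<rho>) (\<eta> * (3 / 2) * \<rho>)" for \<eta> \<rho>
    by (simp add: complex_eq_iff)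
  have K0: "0 \<le> K"
  proof -
    have "0 \<le> K * exp (c * real N0)" using line[of N0 0] norm_ge_zero order_trans by blast
    then show ?thesis by (simp add: zero_le_mult_iff)
  qed
  have J: "J \<eta> \<longlonglongrightarrow> 0" if \<eta>: "\<eta> = 1 \<or> \<eta> = - 1" for \<eta>
  proof -
    let ?s = "\<lambda>N \<rho>. if ok N then indicator {0..R N} \<rho> *\<^sub>R g N (of_real b1 + Complex 1 (\<eta> * (3 / 2)) * of_real \<rho>) else 0"
    \<comment> \<open>With slope 3 / 2 the quadratic term of the weight is \<epsilon>^2 / 2 * (1 - 9
      / 4) = - 5 / 8 * \<epsilon>^2.\<close>
    let ?W = "\<lambda>\<rho>. K * exp (\<epsilon>\<^sup>2 * b1\<^sup>2 / 2 + b1 * E) * exp (- (5 / 8 * \<epsilon>\<^sup>2) * \<rho>\<^sup>2 + (\<epsilon>\<^sup>2 * b1 + E + c) * \<rho>)"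
    have eta2: "\<eta>\<^sup>2 = 1" using \<eta> by auto
    have "(\<lambda>N. \<integral>\<rho>. ?s N \<rho> \<partial>lborel) \<longlonglongrightarrow> (\<integral>\<rho>. 0 \<partial>(lborel :: real measure))"
    proof (rule integral_dominated_convergence[where w = ?W])
      show "integrable lborel ?W"
        using e by (intro integrable_mult_right integrable_real_gaussian(1)) auto
      show "AE \<rho> in lborel. (\<lambda>N. ?s N \<rho>) \<longlonglongrightarrow> 0"
      proof (intro AE_I2)
        fix \<rho> :: real
        show "(\<lambda>N. ?s N \<rho>) \<longlonglongrightarrow> 0"
        proof (cases "0 \<le> \<rho>")
          case True
          let ?z = "of_real b1 + Complex 1 (\<eta> * (3 / 2)) * of_real \<rho>"
          have "0 < Re ?z" using b1 True by simp
          then have "(\<lambda>N. cmod (?w ?z) * cmod (D N ?z)) \<longlonglongrightarrow> cmod (?w ?z) * 0"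
            using tendsto_norm_zero[OF lim] by (intro tendsto_intros) auto
          then have *: "(\<lambda>N. cmod (?w ?z) * cmod (D N ?z)) \<longlonglongrightarrow> 0" by simp
          show ?thesis
            by (rule Lim_null_comparison[OF _ *]) (auto simp: g_def norm_mult indicator_def intro!: always_eventually)
        next
          case False
          then have "?s N \<rho> = 0" for N by simp
          then show ?thesis by simp
        qed
      qed
      fix N
      show "?s N \<in> borel_measurable lborel"
      proof (cases "ok N")
        case True
        then have N: "N \<ge> N0" "0 \<le> R N" by (auto simp: ok_def R_def)
        have "continuous_on (closed_segment (of_real b1) (of_real b1 + Complex 1 (\<eta> * (3 / 2)) * of_real (R N))) (g N)"
        proof (rule continuous_on_subset[OF contg[OF N(1)]], rule closed_segment_subset)
          show "convex {z. 0 < Re z}" by (rule convex_halfspace_Re_gt)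
        qed (use b1 N in auto)
        from contour_integral_segment(2)[OF this N(2)] True show ?thesis by (simp add: borel_measurable_integrable)
      qed simp
      show "AE \<rho> in lborel. cmod (?s N \<rho>) \<le> ?W \<rho>"
      proof (intro AE_I2)
        fix \<rho> :: real
        show "cmod (?s N \<rho>) \<le> ?W \<rho>"
        proof (cases "ok N \<and> \<rho> \<in> {0..R N}")
          case True
          have "?s N \<rho> = g N (Complex (b1 + \<rho>) (\<eta> * (3 / 2) * \<rho>))"
            using True unfolding zeq by simp
          then have "cmod (?s N \<rho>) = exp (\<epsilon>\<^sup>2 * ((b1 + \<rho>)\<^sup>2 - (\<eta> * (3 / 2) * \<rho>)\<^sup>2) / 2 + (b1 + \<rho>) * E) * cmod (D N (Complex (b1 + \<rho>) (\<eta> * (3 / 2) * \<rho>)))"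
            by (simp only: g_def norm_mult norm_laplace_weight)
          also have "\<dots> \<le> exp (\<epsilon>\<^sup>2 * ((b1 + \<rho>)\<^sup>2 - (\<eta> * (3 / 2) * \<rho>)\<^sup>2) / 2 + (b1 + \<rho>) * E) * (K * exp (c * \<rho>))"
            using True \<eta> by (intro mult_left_mono ray) (auto simp: ok_def R_def)
          also have "\<dots> = K * exp (\<epsilon>\<^sup>2 * ((b1 + \<rho>)\<^sup>2 - (\<eta> * (3 / 2) * \<rho>)\<^sup>2) / 2 + (b1 + \<rho>) * E + c * \<rho>)"
            by (simp add: exp_add)
          also have "\<epsilon>\<^sup>2 * ((b1 + \<rho>)\<^sup>2 - (\<eta> * (3 / 2) * \<rho>)\<^sup>2) / 2 + (b1 + \<rho>) * E + c * \<rho>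
              = (\<epsilon>\<^sup>2 * b1\<^sup>2 / 2 + b1 * E) + (- (5 / 8 * \<epsilon>\<^sup>2) * \<rho>\<^sup>2 + (\<epsilon>\<^sup>2 * b1 + E + c) * \<rho>)"
            unfolding power_mult_distrib eta2 by (simp add: field_simps power2_eq_square)
          also have "K * exp \<dots> = ?W \<rho>" by (simp add: exp_add)
          finally show ?thesis .
        next
          case False
          then have "?s N \<rho> = 0" by auto
          then show ?thesis using K0 by simp
        qed
      qed
    qed simp
    then show ?thesis by (simp add: J_def[abs_def])
  qed
  \<comment> \<open>Outside the wedge |s| is at least 3 / 2 * R N. Of the decay - \<epsilon>^2 s^2 /
    2 the share 1 / 20 is kept for integrability in \<open>s\<close>; the remaining 9 / 20 times 9 /
    4 gives 81 / 80, which exceeds the 1 / 2 produced by the real part. The surplus 41 / 80 is the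
    leading coefficient of \<open>\<alpha>\<close> below.\<close>
  define T where "T N = K * exp (c * real N + \<epsilon>\<^sup>2 * (\<kappa> * real N)\<^sup>2 / 2 + (\<kappa> * real N) * E - (81 / 80) * \<epsilon>\<^sup>2 * (R N)\<^sup>2)
      * (\<integral>s. exp (- (\<epsilon>\<^sup>2 / 20) * s\<^sup>2 + 0 * s) \<partial>lborel)" for N
  have T: "T \<longlonglongrightarrow> 0"
  proof -
    define \<alpha> where "\<alpha> = 41 / 80 * \<epsilon>\<^sup>2 * \<kappa>\<^sup>2"
    define \<beta> where "\<beta> = c + \<kappa> * E + 81 / 40 * \<epsilon>\<^sup>2 * \<kappa> * b1"
    define \<gamma> where "\<gamma> = - (81 / 80) * \<epsilon>\<^sup>2 * b1\<^sup>2"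
    have a: "\<alpha> > 0" using e kap by (simp add: \<alpha>_def)
    have "c * real N + \<epsilon>\<^sup>2 * (\<kappa> * real N)\<^sup>2 / 2 + (\<kappa> * real N) * E - (81 / 80) * \<epsilon>\<^sup>2 * (R N)\<^sup>2
        = - \<alpha> * (real N)\<^sup>2 + \<beta> * real N + \<gamma>" for N
      by (simp add: R_def \<alpha>_def \<beta>_def \<gamma>_def field_simps power2_eq_square)
    moreover have "(\<lambda>N. exp (- \<alpha> * (real N)\<^sup>2 + \<beta> * real N + \<gamma>)) \<longlonglongrightarrow> 0"
      using a by real_asymp
    ultimately have "(\<lambda>N. exp (c * real N + \<epsilon>\<^sup>2 * (\<kappa> * real N)\<^sup>2 / 2 + (\<kappa> * real N) * E - (81 / 80) * \<epsilon>\<^sup>2 * (R N)\<^sup>2)) \<longlonglongrightarrow> 0"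
      by simp
    from tendsto_mult_left_zero[OF tendsto_mult_right_zero[OF this]] show ?thesis unfolding T_def .
  qed
  have main: "cmod (\<integral>s. g N (Complex (\<kappa> * real N) s) \<partial>lborel) \<le> T N + 2 * (cmod (J 1 N) + cmod (J (- 1) N))"
    if N: "ok N" for N
  proof -
    define b where "b = \<kappa> * real N"
    define S where "S = 3 / 2 * R N"
    have b: "b = b1 + R N" "0 \<le> R N" "N \<ge> N0" "b > 0" using N b1 kap by (auto simp: ok_def R_def b_def)
    have S0: "0 \<le> S" using b by (simp add: S_def)
    let ?G = "\<lambda>s. g N (Complex b s)"
    have contG: "continuous_on UNIV ?G"
    proof (rule continuous_on_compose2[OF contg[OF b(3)]])
      show "continuous_on UNIV (Complex b)" unfolding Complex_eq by (intro continuous_intros)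
    qed (use b in auto)
    have [measurable]: "?G \<in> borel_measurable borel" by (rule borel_measurable_continuous_onI[OF contG])
    have Gb: "cmod (?G s) \<le> K * exp (c * real N) * cmod (?w (Complex b s))" for s
    proof -
      have "cmod (?G s) = cmod (?w (Complex b s)) * cmod (D N (Complex b s))" by (simp add: g_def norm_mult)
      also have "\<dots> \<le> cmod (?w (Complex b s)) * (K * exp (c * real N))"
        unfolding b_def by (intro mult_left_mono line b) auto
      finally show ?thesis by (simp only: mult_ac)
    qed
    have Gint: "integrable lborel ?G"
      by (rule Bochner_Integration.integrable_bound[OF integrable_mult_right[OF integrable_laplace_weight[OF e, of E b], of "K * exp (c * real N)"]])
         (use Gb K0 in auto)
    have split: "(\<integral>s. ?G s \<partial>lborel) = (\<integral>s. indicator {- S..S} s *\<^sub>R ?G s \<partial>lborel) + (\<integral>s. indicator (- {- S..S}) s *\<^sub>R ?G s \<partial>lborel)"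
    proof -
      have "(\<integral>s. ?G s \<partial>lborel) = (\<integral>s. indicator {- S..S} s *\<^sub>R ?G s + indicator (- {- S..S}) s *\<^sub>R ?G s \<partial>lborel)"
        by (intro Bochner_Integration.integral_cong) (auto simp: indicator_def)
      also have "\<dots> = (\<integral>s. indicator {- S..S} s *\<^sub>R ?G s \<partial>lborel) + (\<integral>s. indicator (- {- S..S}) s *\<^sub>R ?G s \<partial>lborel)"
        by (rule Bochner_Integration.integral_add) (auto intro!: integrable_mult_indicator Gint)
      finally show ?thesis .
    qed
    have tail: "cmod (\<integral>s. indicator (- {- S..S}) s *\<^sub>R ?G s \<partial>lborel) \<le> T N"
    proof -
      let ?B = "\<lambda>s. K * exp (c * real N + \<epsilon>\<^sup>2 * b\<^sup>2 / 2 + b * E - (81 / 80) * \<epsilon>\<^sup>2 * (R N)\<^sup>2) * exp (- (\<epsilon>\<^sup>2 / 20) * s\<^sup>2 + 0 * s)"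
      have "cmod (\<integral>s. indicator (- {- S..S}) s *\<^sub>R ?G s \<partial>lborel) \<le> (\<integral>s. ?B s \<partial>lborel)"
      proof (rule order_trans[OF integral_norm_bound integral_mono])
        show "integrable lborel (\<lambda>s. cmod (indicator (- {- S..S}) s *\<^sub>R ?G s))"
          by (intro integrable_norm integrable_mult_indicator Gint) auto
        show "integrable lborel ?B"
          using e by (intro integrable_mult_right integrable_real_gaussian(1)) auto
        fix s
        show "cmod (indicator (- {- S..S}) s *\<^sub>R ?G s) \<le> ?B s"
        proof (cases "s \<in> {- S..S}")
          case False
          then have "S \<le> \<bar>s\<bar>" by auto
          then have "S\<^sup>2 \<le> s\<^sup>2" using S0 abs_le_square_iff[of S s] by simp
          then have "(9 / 4) * (R N)\<^sup>2 \<le> s\<^sup>2" by (simp add: S_def power_mult_distrib power_divide)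
          then have "\<epsilon>\<^sup>2 * ((9 / 4) * (R N)\<^sup>2) \<le> \<epsilon>\<^sup>2 * s\<^sup>2" by (intro mult_left_mono) auto
          then have ex: "c * real N + (\<epsilon>\<^sup>2 * (b\<^sup>2 - s\<^sup>2) / 2 + b * E)
              \<le> (c * real N + \<epsilon>\<^sup>2 * b\<^sup>2 / 2 + b * E - (81 / 80) * \<epsilon>\<^sup>2 * (R N)\<^sup>2) + (- (\<epsilon>\<^sup>2 / 20) * s\<^sup>2 + 0 * s)"
            by (simp add: field_simps)
          have "cmod (indicator (- {- S..S}) s *\<^sub>R ?G s) \<le> K * exp (c * real N) * cmod (?w (Complex b s))"
            using False Gb[of s] by simp
          also have "\<dots> = K * exp (c * real N + (\<epsilon>\<^sup>2 * (b\<^sup>2 - s\<^sup>2) / 2 + b * E))"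
            by (simp only: norm_laplace_weight exp_add mult.assoc)
          also have "\<dots> \<le> K * exp ((c * real N + \<epsilon>\<^sup>2 * b\<^sup>2 / 2 + b * E - (81 / 80) * \<epsilon>\<^sup>2 * (R N)\<^sup>2) + (- (\<epsilon>\<^sup>2 / 20) * s\<^sup>2 + 0 * s))"
            using ex K0 by (intro mult_left_mono) auto
          finally show ?thesis by (simp only: exp_add mult.assoc)
        qed (use K0 in simp)
      qed
      also have "(\<integral>s. ?B s \<partial>lborel) = T N"
        unfolding T_def b_def by (rule integral_mult_right_zero)
      finally show ?thesis .
    qed
    let ?a = "Complex b (- S)" and ?a' = "Complex b S" and ?b = "complex_of_real b1"
    have H: "convex {z. 0 < Re z}" by (rule convex_halfspace_Re_gt)
    have inH: "?a \<in> {z. 0 < Re z}" "?a' \<in> {z. 0 < Re z}" "?b \<in> {z. 0 < Re z}" using b b1 by auto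
    have cont: "continuous_on (closed_segment x y) (g N)" if "x \<in> {z. 0 < Re z}" "y \<in> {z. 0 < Re z}" for x y
      by (rule continuous_on_subset[OF contg[OF b(3)] closed_segment_subset[OF that H]])
    have eq1: "?a + \<i> * of_real (2 * S) = ?a'" by (simp add: complex_eq_iff)
    have ray_int: "(g N has_contour_integral Complex 1 (\<eta> * (3 / 2)) * J \<eta> N) (linepath ?b (Complex b (\<eta> * S)))"
      if "\<eta> = 1 \<or> \<eta> = - 1" for \<eta>
    proof -
      have end_eq: "?b + Complex 1 (\<eta> * (3 / 2)) * of_real (R N) = Complex b (\<eta> * S)"
        using b by (simp add: complex_eq_iff S_def)
      have "continuous_on (closed_segment ?b (?b + Complex 1 (\<eta> * (3 / 2)) * of_real (R N))) (g N)"
        unfolding end_eq using b by (intro cont inH) auto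
      from contour_integral_segment(1)[OF this b(2)]
      show ?thesis using N by (simp only: end_eq J_def if_True)
    qed
    have "continuous_on (closed_segment ?a (?a + \<i> * of_real (2 * S))) (g N)"
      unfolding eq1 by (intro cont inH)
    from contour_integral_segment(1)[OF this] S0
    have vert: "(g N has_contour_integral \<i> * (\<integral>\<rho>. indicator {0..2 * S} \<rho> *\<^sub>R g N (?a + \<i> * of_real \<rho>) \<partial>lborel)) (linepath ?a ?a')"
      by (simp only: eq1 zero_le_mult_iff) simp
    have "(\<integral>\<rho>. indicator {0..2 * S} \<rho> *\<^sub>R g N (?a + \<i> * of_real \<rho>) \<partial>lborel) = (\<integral>s. indicator {- S..S} s *\<^sub>R ?G s \<partial>lborel)"
    proof -
      have "(\<integral>s. indicator {- S..S} s *\<^sub>R ?G s \<partial>lborel) = (\<integral>\<rho>. indicator {- S..S} (- S + 1 * \<rho>) *\<^sub>R ?G (- S + 1 * \<rho>) \<partial>lborel)"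
        by (subst lborel_integral_real_affine[of 1 _ "- S"]) auto
      also have "\<dots> = (\<integral>\<rho>. indicator {0..2 * S} \<rho> *\<^sub>R g N (?a + \<i> * of_real \<rho>) \<partial>lborel)"
      proof (intro Bochner_Integration.integral_cong refl)
        fix \<rho>
        have "Complex b (- S + 1 * \<rho>) = ?a + \<i> * of_real \<rho>" by (simp add: complex_eq_iff)
        then show "indicator {- S..S} (- S + 1 * \<rho>) *\<^sub>R ?G (- S + 1 * \<rho>) = indicator {0..2 * S} \<rho> *\<^sub>R g N (?a + \<i> * of_real \<rho>)"
          by (auto simp: indicator_def)
      qed
      finally show ?thesis by simp
    qed
    with vert have "(g N has_contour_integral \<i> * (\<integral>s. indicator {- S..S} s *\<^sub>R ?G s \<partial>lborel)) (linepath ?a ?a')" by simp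
    from has_contour_integral_triangle_zero[OF holg[OF b(3)] H inH this] ray_int[of 1] ray_int[of "- 1"]
    have "\<i> * (\<integral>s. indicator {- S..S} s *\<^sub>R ?G s \<partial>lborel) = Complex 1 (1 * (3 / 2)) * J 1 N - Complex 1 (- 1 * (3 / 2)) * J (- 1) N"
      by simp
    then have "cmod (\<i> * (\<integral>s. indicator {- S..S} s *\<^sub>R ?G s \<partial>lborel)) = cmod (Complex 1 (1 * (3 / 2)) * J 1 N - Complex 1 (- 1 * (3 / 2)) * J (- 1) N)"
      by (rule arg_cong)
    also have "\<dots> \<le> cmod (Complex 1 (1 * (3 / 2))) * cmod (J 1 N) + cmod (Complex 1 (- 1 * (3 / 2))) * cmod (J (- 1) N)"
      using norm_triangle_ineq4[of "Complex 1 (1 * (3 / 2)) * J 1 N" "Complex 1 (- 1 * (3 / 2)) * J (- 1) N"] by (simp only: norm_mult)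
    also have "\<dots> \<le> 2 * cmod (J 1 N) + 2 * cmod (J (- 1) N)"
    proof -
      have "cmod (Complex 1 (1 * (3 / 2))) \<le> 2" "cmod (Complex 1 (- 1 * (3 / 2))) \<le> 2"
        by (auto simp: cmod_def power2_eq_square intro!: real_le_lsqrt)
      then show ?thesis by (intro add_mono mult_right_mono) auto
    qed
    finally have mid: "cmod (\<integral>s. indicator {- S..S} s *\<^sub>R ?G s \<partial>lborel) \<le> 2 * (cmod (J 1 N) + cmod (J (- 1) N))"
      by (simp add: norm_mult)
    have "cmod (\<integral>s. ?G s \<partial>lborel) \<le> T N + 2 * (cmod (J 1 N) + cmod (J (- 1) N))"
      unfolding split using norm_triangle_ineq mid tail by (smt (verit))
    then show ?thesis by (simp add: b_def)
  qed
  have "\<forall>\<^sub>F N in sequentially. ok N"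
  proof -
    obtain n :: nat where "b1 / \<kappa> \<le> real n" using real_arch_simple by blast
    then have "ok N" if "N \<ge> N0 + n + 1" for N
    proof -
      have "b1 / \<kappa> \<le> real N" using \<open>b1 / \<kappa> \<le> real n\<close> that by linarith
      then show ?thesis using that kap by (auto simp: ok_def field_simps)
    qed
    then show ?thesis unfolding eventually_sequentially by blast
  qed
  then have ev: "\<forall>\<^sub>F N in sequentially. norm (\<integral>s. g N (Complex (\<kappa> * real N) s) \<partial>lborel) \<le> T N + 2 * (cmod (J 1 N) + cmod (J (- 1) N))"
    by eventually_elim (rule main)
  have "(\<lambda>N. T N + 2 * (cmod (J 1 N) + cmod (J (- 1) N))) \<longlonglongrightarrow> 0 + 2 * (0 + 0)"
    by (intro tendsto_intros T tendsto_norm_zero J) auto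
  then have "(\<lambda>N. T N + 2 * (cmod (J 1 N) + cmod (J (- 1) N))) \<longlonglongrightarrow> 0" by simp
  from Lim_null_comparison[OF ev this] show ?thesis by (simp add: g_def)
qed

section \<open>Uniform bounds on the discretised partition functions\<close>

text \<open>The sets where some \<open>f n\<close> exceeds \<open>k\<close> are relatively open and
  have empty intersection over \<open>k\<close>, so one of them is not dense. Where the resulting
  subinterval lies cannot be prescribed.\<close>

lemma uniform_bound_on_subinterval:
  fixes f :: "nat \<Rightarrow> real \<Rightarrow> complex"
  assumes cont: "\<And>n. continuous_on {1..2} (f n)"
    and bdd: "\<And>b. b \<in> {1..2} \<Longrightarrow> \<exists>K. \<forall>n. cmod (f n b) \<le> K"
  obtains j1 j2 K where "1 \<le> j1" "j1 < j2" "j2 \<le> 2" "\<And>n b. j1 \<le> b \<Longrightarrow> b \<le> j2 \<Longrightarrow> cmod (f n b) \<le> K"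
proof -
  define G where "G k = {b \<in> {1..2::real}. \<exists>n. real k < cmod (f n b)}" for k :: nat
  have op: "openin (top_of_set {1..2}) (G k)" for k
  proof -
    have "openin (top_of_set {1..2}) ({1..2} \<inter> f n -` {z. real k < cmod z})" for n
      using cont by (intro continuous_openin_preimage_gen open_Collect_less continuous_intros)
    then have "openin (top_of_set {1..2}) (\<Union>n. {1..2} \<inter> f n -` {z. real k < cmod z})" by blast
    also have "(\<Union>n. {1..2} \<inter> f n -` {z. real k < cmod z}) = G k" by (auto simp: G_def)
    finally show ?thesis .
  qed
  have "\<exists>k. \<not> {1..2} \<subseteq> closure (G k)"
  proof (rule ccontr)
    assume "\<nexists>k. \<not> {1..2} \<subseteq> closure (G k)"
    then have "{1..2} \<subseteq> closure (\<Inter>(range G))"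
      using op by (intro Baire) auto
    moreover have "\<Inter>(range G) = {}"
    proof (rule equals0I)
      fix b assume b: "b \<in> \<Inter>(range G)"
      then have "b \<in> {1..2}" by (auto simp: G_def)
      then obtain K where K: "\<And>n. cmod (f n b) \<le> K" using bdd by blast
      obtain k :: nat where k: "K \<le> real k" using real_arch_simple by blast
      have "b \<in> G k" using b by auto
      then obtain n where "real k < cmod (f n b)" by (auto simp: G_def)
      then show False using K[of n] k by linarith
    qed
    ultimately show False by simp
  qed
  then obtain k b where b: "b \<in> {1..2}" "b \<notin> closure (G k)" by blast
  then obtain e where e: "e > 0" "ball b e \<inter> G k = {}"
    unfolding closure_iff_nhds_not_empty by (metis open_ball centre_in_ball open_contains_ball inf.commute disjoint_iff subsetD)
  \<comment> \<open>At most 1 / 2, so that an interval of length \<open>d\<close> starting or ending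
    at \<open>b\<close> stays inside the interval from 1 to 2.\<close>
  define d where "d = min (e / 2) (1 / 2)"
  have d: "d > 0" "d < e" "d \<le> 1 / 2" using e by (auto simp: d_def)
  have bound: "cmod (f n c) \<le> real k" if "c \<in> {1..2}" "\<bar>c - b\<bar> \<le> d" for n c
  proof -
    have "c \<in> ball b e" using that d by (auto simp: dist_real_def)
    then have "c \<notin> G k" using e by blast
    then show ?thesis using that by (auto simp: G_def not_less)
  qed
  show ?thesis
  proof (cases "b \<le> 3 / 2")
    case True
    then show ?thesis using b d by (intro that[of b "b + d" "real k"] bound) auto
  next
    case False
    then show ?thesis using b d by (intro that[of "b - d" b "real k"] bound) auto
  qed
qed

text \<open>Together with \<open>path_energy\<close> this separates a factor free of
  \<open>\<beta>\<close> from an energy averaged over the slices. The Boltzmann integrand becomes a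
  Laplace integrand in \<open>\<beta>\<close>, and the Gaussian integrand is the same amplitude
  times \<open>gauss\<close> of the same energy.\<close>

definition path_amplitude :: "(real \<Rightarrow> real) \<Rightarrow> nat \<Rightarrow> (nat \<Rightarrow> real) \<times> (nat \<Rightarrow> real) \<Rightarrow> complex" where
  "path_amplitude A N = (\<lambda>(x, p). of_real (A (x N) / (2 * pi) ^ N) * exp (\<i> * of_real (path_phase N x p)))"

definition path_energy :: "real \<Rightarrow> (real \<Rightarrow> real) \<Rightarrow> nat \<Rightarrow> (nat \<Rightarrow> real) \<times> (nat \<Rightarrow> real) \<Rightarrow> real" where
  "path_energy m V N = (\<lambda>(x, p). (\<Sum>k=1..N. (p k)\<^sup>2 / (2 * m) + V (x k)) / real N)"

abbreviation (input) path_measure :: "nat \<Rightarrow> ((nat \<Rightarrow> real) \<times> (nat \<Rightarrow> real)) measure" where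
  "path_measure N \<equiv> lebesgue_N N \<Otimes>\<^sub>M lebesgue_N N"

definition path_partition :: "real \<Rightarrow> (real \<Rightarrow> real) \<Rightarrow> (real \<Rightarrow> real) \<Rightarrow> nat \<Rightarrow> complex \<Rightarrow> complex" where
  "path_partition m V A N \<beta> = (\<integral>(x, p). boltzmann_integrand m V A \<beta> N x p \<partial>path_measure N)"

lemma boltzmann_laplace_form:
  "boltzmann_integrand m V A \<beta> N x p = path_amplitude A N (x, p) * exp (- \<beta> * of_real (path_energy m V N (x, p)))"
proof -
  let ?S = "\<Sum>k=1..N. (p k)\<^sup>2 / (2 * m) + V (x k)"
  have "\<beta> / of_nat N * complex_of_real ?S = \<beta> * complex_of_real (?S / real N)"
    unfolding of_real_divide by simp
  then show ?thesis
    unfolding boltzmann_integrand_def path_amplitude_def path_energy_def case_prod_conv mult.assoc exp_add[symmetric]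
    by (simp only: periodic_def if_True refl diff_conv_add_uminus mult_minus_left)
qed

lemma measurable_coordinate [measurable]:
  "k \<in> {1..N} \<Longrightarrow> (\<lambda>q. fst q k) \<in> borel_measurable (path_measure N)"
  "k \<in> {1..N} \<Longrightarrow> (\<lambda>q. snd q k) \<in> borel_measurable (path_measure N)"
proof -
  assume k: "k \<in> {1..N}"
  have c: "(\<lambda>x. x k) \<in> borel_measurable (lebesgue_N N)"
    unfolding lebesgue_N_def using k measurable_component_singleton[of k "{1..N}" "\<lambda>_. lborel"] by simp
  show "(\<lambda>q. fst q k) \<in> borel_measurable (path_measure N)" "(\<lambda>q. snd q k) \<in> borel_measurable (path_measure N)"
    by (rule measurable_compose[OF measurable_fst c], rule measurable_compose[OF measurable_snd c])
qed

lemma measurable_path_energy: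
  assumes [measurable]: "V \<in> borel_measurable borel"
  shows "path_energy m V N \<in> borel_measurable (path_measure N)"
  unfolding path_energy_def case_prod_unfold by measurable

lemma measurable_path_amplitude:
  assumes N: "N \<ge> 1" and [measurable]: "A \<in> borel_measurable borel"
  shows "path_amplitude A N \<in> borel_measurable (path_measure N)"
proof -
  have [measurable]: "(\<lambda>q. periodic N (fst q) (k - 1)) \<in> borel_measurable (path_measure N)" if "k \<in> {1..N}" for k
    using that N by (cases "k = 1") (auto simp: periodic_def intro!: measurable_coordinate)
  have [measurable]: "(\<lambda>q. periodic N (fst q) k) \<in> borel_measurable (path_measure N)" if "k \<in> {1..N}" for k
    using that N by (auto simp: periodic_def intro!: measurable_coordinate)
  have [measurable]: "(\<lambda>q. fst q N) \<in> borel_measurable (path_measure N)" using N by (intro measurable_coordinate) auto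
  show ?thesis
    unfolding path_amplitude_def case_prod_unfold path_phase_def by measurable
qed

lemma sigma_finite_path_measure: "sigma_finite_measure (path_measure N)"
proof -
  interpret sigma_finite_measure "lebesgue_N N" by (rule sigma_finite_lebesgue_N)
  interpret pair_sigma_finite "lebesgue_N N" "lebesgue_N N" ..
  show ?thesis ..
qed

text \<open>With one time slice the phase vanishes by periodicity and the integrand is a function of
  \<open>x\<close> times a nonvanishing function of \<open>p\<close>, so a section at a single
  \<open>p\<close> is enough.\<close>

lemma exp_potential_integrable:
  assumes [measurable]: "V \<in> borel_measurable borel" "B \<in> borel_measurable borel"
    and int: "integrable (path_measure 1) (\<lambda>(x, p). boltzmann_integrand m V B (of_real b) 1 x p)"
  shows "integrable lborel (\<lambda>x. B x * exp (- b * V x))"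
proof -
  let ?M = "Pi\<^sub>M {1::nat} (\<lambda>_. lborel :: real measure)"
  interpret sigma_finite_measure "lebesgue_N 1" by (rule sigma_finite_lebesgue_N)
  interpret pair_sigma_finite "lebesgue_N 1" "lebesgue_N 1" ..
  have M: "lebesgue_N 1 = ?M" by (simp add: lebesgue_N_def)
  let ?Q = "integrable (lebesgue_N 1) (\<lambda>x. B (x 1) * exp (- b * V (x 1)))"
  have "AE p in lebesgue_N 1. ?Q"
    using AE_integrable_snd[OF int]
  proof eventually_elim
    case (elim p)
    let ?c = "exp (- b * (p 1)\<^sup>2 / (2 * m)) / (2 * pi)"
    have "?c \<noteq> 0" by simp
    have eq: "boltzmann_integrand m V B (of_real b) 1 x p = of_real (?c * (B (x 1) * exp (- b * V (x 1))))" for x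
    proof -
      have "boltzmann_integrand m V B (of_real b) 1 x p
          = of_real (B (x 1) / (2 * pi)) * exp (of_real (- b * (p 1)\<^sup>2 / (2 * m) + - b * V (x 1)))"
        by (simp add: boltzmann_integrand_def path_phase_def periodic_def algebra_simps)
      also have "\<dots> = of_real (?c * (B (x 1) * exp (- b * V (x 1))))"
        unfolding exp_of_real exp_add by simp
      finally show ?thesis .
    qed
    have "integrable (lebesgue_N 1) (\<lambda>x. ?c * (B (x 1) * exp (- b * V (x 1))))"
      using elim unfolding eq by (simp only: complex_of_real_integrable_eq)
    from integrable_mult_right[OF this, of "1 / ?c"] show ?Q by simp
  qed
  \<comment> \<open>\<open>?Q\<close> does not mention \<open>p\<close>, so it follows from holding
    almost everywhere on a space that is not null.\<close>
  moreover have "\<not> (AE p in lebesgue_N 1. False)"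
  proof
    assume "AE p in lebesgue_N 1. False"
    then have "emeasure ?M (space ?M) = 0" 
      unfolding M using AE_iff_measurable[of "space ?M" ?M "\<lambda>_. False"] by simp
    moreover have "emeasure ?M (Pi\<^sub>E {1} (\<lambda>_. {0..1})) = 1"
      by (subst lborel_product.emeasure_PiM) auto
    moreover have "emeasure ?M (Pi\<^sub>E {1} (\<lambda>_. {0..1})) \<le> emeasure ?M (space ?M)"
      by (intro emeasure_mono) (auto simp: space_PiM)
    ultimately show False by simp
  qed
  ultimately have ?Q by (cases ?Q) simp_all
  then have "integrable ?M (\<lambda>x. B (x 1) * exp (- b * V (x 1)))" unfolding M .
  then have "integrable (distr ?M lborel (\<lambda>x. x 1)) (\<lambda>x. B x * exp (- b * V x))"
    by (subst integrable_distr_eq) auto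
  then show ?thesis by (simp add: lborel_product.distr_singleton)
qed

text \<open>A smooth scale of polynomial growth, at least 1 and itself admissible. Every admissible
  observable is bounded by a multiple of it for some \<open>d\<close>, with \<open>d = 0\<close> in
  the bounded case.\<close>

definition moment_weight :: "nat \<Rightarrow> real \<Rightarrow> real" where "moment_weight d x = (1 + x\<^sup>2) ^ d"

lemma moment_weight_measurable [measurable]: "moment_weight d \<in> borel_measurable borel"
  unfolding moment_weight_def by measurable

lemma moment_weight_ge_1: "1 \<le> moment_weight d x"
  unfolding moment_weight_def by (intro one_le_power) simp

text \<open>\<open>moments_bounded\<close> comes from convergence at each fixed \<open>b\<close>, so
  its constant may depend on \<open>b\<close>; removing this dependence is the task of the bounds
  below.\<close>

locale path_integrals = potential +
  assumes moments_integrable: "\<And>d \<beta> N. Re \<beta> > 0 \<Longrightarrow> N \<ge> 1 \<Longrightarrow>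
      integrable (path_measure N) (\<lambda>(x, p). boltzmann_integrand m V (moment_weight d) \<beta> N x p)"
    and moments_bounded: "\<And>d b. b > 0 \<Longrightarrow> \<exists>K. \<forall>N\<ge>1. cmod (path_partition m V (moment_weight d) N (of_real b)) \<le> K"
begin

abbreviation Z :: "(real \<Rightarrow> real) \<Rightarrow> nat \<Rightarrow> complex \<Rightarrow> complex" where "Z \<equiv> path_partition m V"

text \<open>Covers bounded and polynomial observables at once and keeps track of the constant, which
  is what the estimates on shells are about.\<close>

definition moderate :: "real \<Rightarrow> nat \<Rightarrow> (real \<Rightarrow> real) \<Rightarrow> bool" where
  "moderate C d A \<longleftrightarrow> A \<in> borel_measurable borel \<and> (\<forall>x. \<bar>A x\<bar> \<le> C * moment_weight d x)"

lemma boltzmann_measurable: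
  assumes "N \<ge> 1" and "A \<in> borel_measurable borel"
  shows "(\<lambda>(x, p). boltzmann_integrand m V A \<beta> N x p) \<in> borel_measurable (path_measure N)"
proof -
  note [measurable] = measurable_path_energy[OF V_measurable, of m N] measurable_path_amplitude[OF assms]
  have "(\<lambda>q. path_amplitude A N q * exp (- \<beta> * of_real (path_energy m V N q))) \<in> borel_measurable (path_measure N)"
    by measurable
  then show ?thesis by (simp add: boltzmann_laplace_form case_prod_unfold)
qed

lemma moderate_integrable:
  assumes A: "moderate C d A" and b: "Re \<beta> > 0" and N: "N \<ge> 1"
  shows "integrable (path_measure N) (\<lambda>(x, p). boltzmann_integrand m V A \<beta> N x p)"
proof (rule Bochner_Integration.integrable_bound[OF integrable_mult_right[OF moments_integrable[OF b N, of d], of "of_real C"]])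
  show "(\<lambda>(x, p). boltzmann_integrand m V A \<beta> N x p) \<in> borel_measurable (path_measure N)"
    using A N by (intro boltzmann_measurable) (auto simp: moderate_def)
  have "cmod (boltzmann_integrand m V A \<beta> N x p) \<le> cmod (of_real C * boltzmann_integrand m V (moment_weight d) \<beta> N x p)" for x p
  proof -
    have "\<bar>A (x N)\<bar> \<le> \<bar>C * moment_weight d (x N)\<bar>" using A abs_ge_self order_trans unfolding moderate_def by blast
    then have "\<bar>A (x N)\<bar> * cmod (exp (- \<beta> * of_real (path_energy m V N (x, p)))) / (2 * pi) ^ N
      \<le> \<bar>C * moment_weight d (x N)\<bar> * cmod (exp (- \<beta> * of_real (path_energy m V N (x, p)))) / (2 * pi) ^ N"
      by (intro divide_right_mono mult_right_mono) auto
    then show ?thesis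
      by (simp add: boltzmann_laplace_form path_amplitude_def norm_mult norm_divide norm_power abs_mult)
  qed
  then show "AE q in path_measure N. cmod (case q of (x, p) \<Rightarrow> boltzmann_integrand m V A \<beta> N x p)
      \<le> cmod (of_real C * (case q of (x, p) \<Rightarrow> boltzmann_integrand m V (moment_weight d) \<beta> N x p))"
    by (intro AE_I2) auto
qed

lemma moderate_laplace_integrable:
  assumes A: "moderate C d A" and b: "b > 0" and N: "N \<ge> 1"
  shows "integrable (path_measure N) (\<lambda>q. cmod (path_amplitude A N q) * exp (- b * path_energy m V N q))"
proof -
  have "integrable (path_measure N) (\<lambda>q. cmod (case q of (x, p) \<Rightarrow> boltzmann_integrand m V A (of_real b) N x p))"
    using moderate_integrable[OF A _ N, of "of_real b"] b by (intro integrable_norm) auto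
  also have "(\<lambda>q. cmod (case q of (x, p) \<Rightarrow> boltzmann_integrand m V A (of_real b) N x p))
      = (\<lambda>q. cmod (path_amplitude A N q) * exp (- b * path_energy m V N q))"
    by (auto simp: boltzmann_laplace_form norm_mult fun_eq_iff)
  finally show ?thesis .
qed

lemma Z_laplace: "Z A N \<beta> = (\<integral>q. path_amplitude A N q * exp (- \<beta> * of_real (path_energy m V N q)) \<partial>path_measure N)"
  unfolding path_partition_def by (simp add: boltzmann_laplace_form case_prod_unfold)

lemma Z_holomorphic:
  assumes A: "moderate C d A" and N: "N \<ge> 1"
  shows "Z A N holomorphic_on {z. 0 < Re z}"
proof -
  have "(\<lambda>z. \<integral>q. path_amplitude A N q * exp (- z * of_real (path_energy m V N q)) \<partial>path_measure N)
      holomorphic_on {z. Re z \<in> {0<..}}"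
    using A N moderate_laplace_integrable[OF A _ N]
    by (intro holomorphic_laplace measurable_path_amplitude measurable_path_energy V_measurable)
       (auto simp: moderate_def)
  then show ?thesis by (simp add: Z_laplace[abs_def])
qed

lemma weighted_exp_integrable: "b > 0 \<Longrightarrow> integrable lborel (\<lambda>x. moment_weight d x * exp (- b * V x))"
  by (intro exp_potential_integrable[of _ _ m] moments_integrable) auto

lemma Z_kernel:
  assumes A: "moderate C d A" and b: "Re \<beta> > 0" and N: "N \<ge> 1"
  shows "Z A N \<beta> = (\<integral>z. of_real (A z) * path_kernel (\<beta> / of_nat N) N z z \<partial>lborel)"
  unfolding path_partition_def using A
  by (intro boltzmann_path_integral[OF b N _ moderate_integrable[OF A b N]]) (auto simp: moderate_def)

end

context path_integrals
begin

lemma moderateD: "moderate C d A \<Longrightarrow> A \<in> borel_measurable borel" "moderate C d A \<Longrightarrow> \<bar>A x\<bar> \<le> C * moment_weight d x"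
  by (auto simp: moderate_def)

lemma moderate_nonneg: assumes "moderate C d A" shows "0 \<le> C"
proof -
  have "0 \<le> C * moment_weight d 0" using moderateD(2)[OF assms, of 0] abs_ge_zero order_trans by blast
  then show ?thesis by (simp add: moment_weight_def)
qed

lemma bounded_Z_le:
  assumes A: "moderate F 0 A" and b: "2 \<le> Re \<beta>" "Re \<beta> \<le> N / 2"
  shows "cmod (Z A N \<beta>) \<le> F * C0 powr (1 + Re \<beta>)"
proof -
  have N: "N \<ge> 1" using b by (cases N) auto
  let ?\<tau> = "\<beta> / of_nat N"
  have t: "0 < Re ?\<tau>" "Re ?\<tau> \<le> 1 / 2" "N * Re ?\<tau> = Re \<beta>" using b N by (auto simp: field_simps)
  have "cmod (\<integral>x. of_real (A x) * path_kernel ?\<tau> N x x \<partial>lborel) \<le> F * C0 powr (1 + N * Re ?\<tau>)"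
    using t b moderateD[OF A] by (intro weighted_trace_bound) (auto simp: moment_weight_def)
  then show ?thesis using Z_kernel[OF A _ N, of \<beta>] b by (simp only: t)
qed

lemma moderate_moment_weight: "moderate 1 d (moment_weight d)"
  using moment_weight_ge_1[of d] by (auto simp: moderate_def) (smt (verit))

text \<open>At real \<open>b\<close> the diagonal of the path kernel is nonnegative, so
  \<open>A\<close> can be replaced by its majorant under the integral.\<close>

lemma real_Z_dominated:
  assumes A: "moderate C d A" and b: "b > 0" and N: "N \<ge> 1"
  shows "cmod (Z A N (of_real b)) \<le> C * cmod (Z (moment_weight d) N (of_real b))"
proof -
  define t where "t = b / N"
  have t: "t > 0" using b N by (simp add: t_def)
  have tau: "of_real b / of_nat N = complex_of_real t" by (simp add: t_def)
  note [measurable] = moderateD(1)[OF A]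
  have [measurable]: "(\<lambda>z. path_kernel (of_real t) N z z) \<in> borel_measurable borel"
    using t N by (intro hs_kernel_diag_measurable hs_path_kernel) auto
  define p where "p z = Re (path_kernel (of_real t) N z z)" for z
  have [measurable]: "p \<in> borel_measurable borel" unfolding p_def[abs_def] by measurable
  have p: "path_kernel (of_real t) N z z = of_real (p z)" "0 \<le> p z" for z
    using path_kernel_nonneg[OF t, of N z z] N by (auto simp: p_def complex_nonneg_Reals_iff complex_eq_iff)
  let ?c = "heat_peak m t ^ N * (\<integral>z. exp (- t * V z) \<partial>lborel) ^ (N - 1)"
  have pb: "p z \<le> ?c * exp (- t * V z)" for z
    using path_kernel_crude_bound[of "of_real t" N z z] t N p[of z] by simp
  have int: "integrable lborel (\<lambda>z. moment_weight d z * p z)"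
  proof (rule Bochner_Integration.integrable_bound[OF integrable_mult_right[OF weighted_exp_integrable[OF t, of d], of ?c]])
    have "moment_weight d z * p z \<le> ?c * (moment_weight d z * exp (- t * V z))" for z
      using mult_left_mono[OF pb, of "moment_weight d z" z] moment_weight_ge_1[of d z] by (simp add: mult_ac)
    moreover have "0 \<le> moment_weight d z * p z" for z
      using p(2)[of z] moment_weight_ge_1[of d z] by simp
    ultimately show "AE z in lborel. norm (moment_weight d z * p z) \<le> norm (?c * (moment_weight d z * exp (- t * V z)))"
      by (intro AE_I2) (smt (verit, best) real_norm_def)
  qed measurable
  have Ab: "cmod (of_real (A z) * of_real (p z)) \<le> C * (moment_weight d z * p z)" for z
    using mult_right_mono[OF moderateD(2)[OF A, of z] p(2)[of z]] p(2)[of z] by (simp add: norm_mult mult.assoc)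
  have Aint: "integrable lborel (\<lambda>z. complex_of_real (A z) * of_real (p z))"
    by (rule Bochner_Integration.integrable_bound[OF integrable_mult_right[OF int, of C]])
       (use Ab in \<open>auto intro!: AE_I2 order_trans[OF _ abs_ge_self]\<close>)
  have "cmod (Z A N (of_real b)) = cmod (\<integral>z. of_real (A z) * of_real (p z) \<partial>lborel)"
    using Z_kernel[OF A _ N, of "of_real b"] b by (simp add: tau p(1))
  also have "\<dots> \<le> (\<integral>z. C * (moment_weight d z * p z) \<partial>lborel)"
    by (rule order_trans[OF integral_norm_bound integral_mono])
       (use Aint int Ab in \<open>auto intro!: integrable_norm\<close>)
  also have "\<dots> = C * (\<integral>z. moment_weight d z * p z \<partial>lborel)" by simp
  also have "(\<integral>z. moment_weight d z * p z \<partial>lborel) \<le> \<bar>\<integral>z. moment_weight d z * p z \<partial>lborel\<bar>" by simp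
  also have "\<dots> = cmod (Z (moment_weight d) N (of_real b))"
  proof -
    have "Z (moment_weight d) N (of_real b) = (\<integral>z. complex_of_real (moment_weight d z * p z) \<partial>lborel)"
      using Z_kernel[OF moderate_moment_weight _ N, of "of_real b"] b by (simp add: tau p(1))
    then show ?thesis unfolding integral_complex_of_real by (simp only: norm_of_real)
  qed
  finally show ?thesis using moderate_nonneg[OF A] by (simp add: mult_left_mono)
qed

text \<open>
  Baire's theorem gives a bound that is uniform in \<open>N\<close> on an interval of parameters; larger \<open>b\<close> are
  reduced to it by estimating the surplus kernel factors in operator norm.
\<close>

lemma moment_uniform_bound:
  obtains b1 \<kappa> K where "2 \<le> b1" "0 < \<kappa>" "\<kappa> \<le> 1 / 2" "1 \<le> K"
    "\<And>N b. b1 \<le> b \<Longrightarrow> b \<le> \<kappa> * real N \<Longrightarrow> cmod (Z (moment_weight d) N (of_real b)) \<le> K * C0 powr b"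
proof -
  have cont: "continuous_on {1..2} (\<lambda>b. Z (moment_weight d) (Suc n) (of_real b))" for n
    by (rule continuous_on_compose2[OF holomorphic_on_imp_continuous_on[OF Z_holomorphic[OF moderate_moment_weight]]])
       (auto intro!: continuous_intros)
  have bdd: "\<exists>K. \<forall>n. cmod (Z (moment_weight d) (Suc n) (of_real b)) \<le> K" if "b \<in> {1..2}" for b
  proof -
    have "b > 0" using that by auto
    from moments_bounded[OF this, of d] obtain K where "\<forall>N\<ge>1. cmod (Z (moment_weight d) N (of_real b)) \<le> K" by blast
    then show ?thesis by (intro exI[of _ K]) auto
  qed
  obtain j1 j2 K where j: "1 \<le> j1" "j1 < j2" "j2 \<le> 2"
    and K: "\<And>n b. j1 \<le> b \<Longrightarrow> b \<le> j2 \<Longrightarrow> cmod (Z (moment_weight d) (Suc n) (of_real b)) \<le> K"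
    using uniform_bound_on_subinterval[OF cont bdd] by metis
  \<comment> \<open>Half the length of the good interval: for a step \<open>t \<le> \<kappa>\<close>
    the multiples \<open>2 * k * t\<close> advance by at most that length, so one of them lands
    between \<open>j1\<close> and \<open>j2\<close>.\<close>
  define \<kappa> where "\<kappa> = (j2 - j1) / 2"
  have kap: "0 < \<kappa>" "\<kappa> \<le> 1 / 2" using j by (auto simp: \<kappa>_def)
  have "cmod (Z (moment_weight d) N (of_real b)) \<le> max 1 K * C0 powr b" if b: "2 \<le> b" "b \<le> \<kappa> * real N" for N b
  proof -
    have N: "N \<ge> 1" using b by (cases N) auto
    define t where "t = b / N"
    have t: "0 < t" "t \<le> \<kappa>" using b N by (auto simp: t_def field_simps)
    have tN: "of_real b / of_nat N = complex_of_real t" "N * t = b" using N by (auto simp: t_def)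
    define k where "k = nat \<lceil>j1 / (2 * t)\<rceil>"
    have k1: "j1 / (2 * t) \<le> real k" "real k < j1 / (2 * t) + 1"
      using j t unfolding k_def by (auto simp: of_nat_nat) linarith+
    have k: "j1 \<le> 2 * k * t" "2 * k * t \<le> j2"
      using k1 t j by (auto simp: field_simps \<kappa>_def)
    have k0: "k > 0" using k1(1) j t by (cases k) (auto simp: field_simps)
    have "real (2 * k) * t \<le> real N * t" using k b j tN by simp
    then have kN: "2 * k \<le> N" using t by (simp only: mult_le_cancel_right of_nat_le_iff)
    have "cmod (\<integral>x. of_real (moment_weight d x) * path_kernel (of_real t) N x x \<partial>lborel)
        \<le> C0 powr (N * t) * cmod (\<integral>x. of_real (moment_weight d x) * path_kernel (of_real t) (2 * k) x x \<partial>lborel)"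
      using t kap k0 kN moment_weight_ge_1 weighted_exp_integrable[OF t(1)]
      by (intro real_trace_reduction) (auto intro: order_trans[OF zero_le_one])
    also have "(\<integral>x. of_real (moment_weight d x) * path_kernel (of_real t) (2 * k) x x \<partial>lborel)
        = Z (moment_weight d) (2 * k) (of_real (2 * k * t))"
      using Z_kernel[OF moderate_moment_weight, of "of_real (2 * k * t)" "2 * k" d] k0 t by simp
    also have "cmod \<dots> \<le> K" using K[of "2 * k * t" "2 * k - 1"] k k0 by simp
    finally have "cmod (Z (moment_weight d) N (of_real b)) \<le> C0 powr b * K"
      using Z_kernel[OF moderate_moment_weight, of "of_real b" N d] b N by (simp add: tN mult_left_mono)
    also have "\<dots> \<le> C0 powr b * max 1 K" by (intro mult_left_mono) auto
    finally show ?thesis by (simp only: mult.commute)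
  qed
  then show ?thesis using kap by (intro that[of 2 \<kappa> "max 1 K"]) auto
qed

section \<open>Dyadic shells and the interpolation on rays\<close>

definition cut_off :: "nat \<Rightarrow> (real \<Rightarrow> real) \<Rightarrow> real \<Rightarrow> real" where
  "cut_off J A x = (if 1 + x\<^sup>2 < 2 ^ J then A x else 0)"

definition shell :: "nat \<Rightarrow> (real \<Rightarrow> real) \<Rightarrow> real \<Rightarrow> real" where
  "shell J A x = (if 2 ^ J \<le> 1 + x\<^sup>2 \<and> 1 + x\<^sup>2 < 2 ^ Suc J then A x else 0)"

text \<open>The two constants of the interpolation. On shell \<open>J\<close> the observable is
  bounded by about 2^(J d), which gives the bound in the half plane; against a moment with
  \<open>e\<close> more powers it is smaller by 2^(- J e), which gives the decay on the real
  axis.\<close>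

lemma moderate_shell:
  assumes A: "moderate C d A"
  shows "moderate (C * 2 ^ (Suc J * d)) 0 (shell J A)" and "moderate (C * (1 / 2) ^ (J * e)) (d + e) (shell J A)"
    and "moderate C d (shell J A)" and "moderate C d (cut_off J A)"
proof -
  note [measurable] = moderateD(1)[OF A]
  note C = moderate_nonneg[OF A]
  have m[measurable]: "shell J A \<in> borel_measurable borel" "cut_off J A \<in> borel_measurable borel"
    unfolding shell_def[abs_def] cut_off_def[abs_def] by measurable
  have pos: "0 \<le> C * moment_weight n x" for n x
    using C moment_weight_ge_1[of n x] by simp
  show "moderate C d (shell J A)" "moderate C d (cut_off J A)"
    using m moderateD(2)[OF A] pos by (auto simp: moderate_def shell_def cut_off_def)
  have "\<bar>shell J A x\<bar> \<le> C * 2 ^ (Suc J * d) * moment_weight 0 x" for x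
  proof (cases "2 ^ J \<le> 1 + x\<^sup>2 \<and> 1 + x\<^sup>2 < 2 ^ Suc J")
    case True
    then have "(1 + x\<^sup>2) ^ d \<le> (2 ^ Suc J) ^ d" by (intro power_mono) auto
    then have "C * moment_weight d x \<le> C * 2 ^ (Suc J * d)"
      using C unfolding moment_weight_def by (intro mult_left_mono) (simp_all only: power_mult)
    then show ?thesis using True moderateD(2)[OF A, of x] by (simp add: shell_def moment_weight_def)
  qed (use C in \<open>auto simp: shell_def moment_weight_def\<close>)
  then show "moderate (C * 2 ^ (Suc J * d)) 0 (shell J A)" using m by (simp add: moderate_def)
  have "\<bar>shell J A x\<bar> \<le> C * (1 / 2) ^ (J * e) * moment_weight (d + e) x" for x
  proof (cases "2 ^ J \<le> 1 + x\<^sup>2 \<and> 1 + x\<^sup>2 < 2 ^ Suc J")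
    case True
    then have "(2 ^ J) ^ e \<le> (1 + x\<^sup>2) ^ e" by (intro power_mono) auto
    then have "1 \<le> (1 / 2) ^ (J * e) * (1 + x\<^sup>2) ^ e"
      by (simp add: power_divide field_simps flip: power_mult)
    from mult_left_mono[OF this pos, of d x]
    have "C * moment_weight d x \<le> C * (1 / 2) ^ (J * e) * moment_weight (d + e) x"
      by (simp add: moment_weight_def power_add mult_ac)
    then show ?thesis using True moderateD(2)[OF A, of x] by (simp add: shell_def)
  next
    case False
    have "0 \<le> C * (1 / 2) ^ (J * e) * moment_weight (d + e) x"
      using C moment_weight_ge_1[of "d + e" x] by simp
    then show ?thesis using False by (auto simp: shell_def)
  qed
  then show "moderate (C * (1 / 2) ^ (J * e)) (d + e) (shell J A)" using m by (simp add: moderate_def)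
qed

lemma Z_cut_off_Suc:
  assumes A: "moderate C d A" and b: "Re \<beta> > 0" and N: "N \<ge> 1"
  shows "Z (cut_off (Suc J) A) N \<beta> = Z (cut_off J A) N \<beta> + Z (shell J A) N \<beta>"
proof -
  have "boltzmann_integrand m V (cut_off (Suc J) A) \<beta> N x p
      = boltzmann_integrand m V (cut_off J A) \<beta> N x p + boltzmann_integrand m V (shell J A) \<beta> N x p" for x p
  proof -
    have "cut_off (Suc J) A y = cut_off J A y + shell J A y" for y
    proof -
      have "(2::real) ^ J < 2 ^ Suc J" by simp
      then have "1 + y\<^sup>2 < 2 ^ J \<Longrightarrow> 1 + y\<^sup>2 < 2 ^ Suc J" by linarith
      then show ?thesis by (auto simp: cut_off_def shell_def simp del: power_Suc)
    qed
    then show ?thesis by (simp add: boltzmann_integrand_def add_divide_distrib distrib_right)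
  qed
  then show ?thesis
    unfolding path_partition_def case_prod_unfold
    using moderate_integrable[OF moderate_shell(4)[OF A] b N] moderate_integrable[OF moderate_shell(3)[OF A] b N]
    by (simp add: case_prod_unfold)
qed

lemma Z_cut_off_limit:
  assumes A: "moderate C d A" and b: "Re \<beta> > 0" and N: "N \<ge> 1"
  shows "(\<lambda>J. Z (cut_off J A) N \<beta>) \<longlonglongrightarrow> Z A N \<beta>"
  unfolding path_partition_def
proof (rule integral_dominated_convergence)
  show "integrable (path_measure N) (\<lambda>q. cmod (case q of (x, p) \<Rightarrow> boltzmann_integrand m V A \<beta> N x p))"
    using moderate_integrable[OF A b N] by (rule integrable_norm)
  show "AE q in path_measure N. cmod (case q of (x, p) \<Rightarrow> boltzmann_integrand m V (cut_off J A) \<beta> N x p)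
      \<le> cmod (case q of (x, p) \<Rightarrow> boltzmann_integrand m V A \<beta> N x p)" for J
    by (intro AE_I2) (auto simp: boltzmann_integrand_def cut_off_def)
  show "AE q in path_measure N. (\<lambda>J. case q of (x, p) \<Rightarrow> boltzmann_integrand m V (cut_off J A) \<beta> N x p)
      \<longlonglongrightarrow> (case q of (x, p) \<Rightarrow> boltzmann_integrand m V A \<beta> N x p)"
  proof (intro AE_I2)
    fix q :: "(nat \<Rightarrow> real) \<times> (nat \<Rightarrow> real)"
    obtain x p where q: "q = (x, p)" by (cases q)
    obtain n where n: "1 + (periodic N x 0)\<^sup>2 < 2 ^ n" using real_arch_pow[of 2] by auto
    have "boltzmann_integrand m V (cut_off J A) \<beta> N x p = boltzmann_integrand m V A \<beta> N x p" if "J \<ge> n" for J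
    proof -
      have "(2::real) ^ n \<le> 2 ^ J" using that by (intro power_increasing) auto
      then have "1 + (periodic N x 0)\<^sup>2 < 2 ^ J" using n by linarith
      then show ?thesis by (simp add: boltzmann_integrand_def cut_off_def)
    qed
    then show "(\<lambda>J. case q of (x, p) \<Rightarrow> boltzmann_integrand m V (cut_off J A) \<beta> N x p)
      \<longlonglongrightarrow> (case q of (x, p) \<Rightarrow> boltzmann_integrand m V A \<beta> N x p)"
      unfolding q by (auto intro!: tendsto_eventually eventually_sequentiallyI[of n])
  qed
qed (use moderate_integrable[OF A b N] moderate_integrable[OF moderate_shell(4)[OF A] b N] in
      \<open>auto dest: borel_measurable_integrable\<close>)

text \<open>The two-constants estimate takes the real bound to the power 1 / 16 and the half plane
  bound to the power 15 / 16. With \<open>16 * (d + 1)\<close> extra moments the decay 2^(- J (d +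
  1)) beats the growth 2^(15 J d / 16) and leaves at most 2^(- J), so the shells can be
  summed.\<close>

lemma Z_ray_bound:
  assumes A: "moderate C d A"
  obtains b1 \<kappa> K where "2 \<le> b1" "0 < \<kappa>" "0 \<le> K"
    "\<And>N r \<eta>. 0 \<le> r \<Longrightarrow> b1 + r \<le> \<kappa> * real N \<Longrightarrow> \<eta> = 1 \<or> \<eta> = - 1 \<Longrightarrow>
      cmod (Z A N (Complex (b1 + r) (\<eta> * (3 / 2) * r))) \<le> K * C0 powr (b1 + r)"
proof -
  let ?e = "16 * (d + 1)"
  obtain b1 \<kappa> K where b1: "2 \<le> b1" and kap: "0 < \<kappa>" "\<kappa> \<le> 1 / 2" and K: "1 \<le> K"
    and mom: "\<And>N b. b1 \<le> b \<Longrightarrow> b \<le> \<kappa> * real N \<Longrightarrow> cmod (Z (moment_weight (d + ?e)) N (of_real b)) \<le> K * C0 powr b"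
    using moment_uniform_bound[of "d + ?e"] by metis
  note C = moderate_nonneg[OF A]
  define Q where "Q = C * K * C0 * 2 ^ d"
  have Q0: "0 \<le> Q" using C K C0_ge_1 by (simp add: Q_def)
  have shell_bound: "cmod (Z (shell J A) N (Complex (b1 + r) (\<eta> * (3 / 2) * r))) \<le> Q * (1 / 2) ^ J * C0 powr (b1 + r)"
    if r: "0 \<le> r" "b1 + 3 * r \<le> \<kappa> * real N" and \<eta>: "\<eta> = 1 \<or> \<eta> = - 1" for J N r \<eta>
  proof -
    have N: "N \<ge> 1" using r b1 by (cases N) auto
    have kN: "\<kappa> * real N \<le> real N / 2" using kap N by simp
    \<comment> \<open>The exponential factor removes the growth \<open>C0 powr Re z\<close>, so that
      both bounds become constants.\<close>
    define f where "f z = Z (shell J A) N z * exp (- of_real (ln C0) * z)" for z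
    define M where "M = C * 2 ^ (Suc J * d) * C0"
    define \<mu> where "\<mu> = C * (1 / 2) ^ (J * ?e) * K"
    have fn: "cmod (f z) = cmod (Z (shell J A) N z) * C0 powr (- Re z)" for z
      using C0_ge_1 by (simp add: f_def norm_mult powr_def mult.commute)
    have cancel: "x * C0 powr b * C0 powr (- b) = x" for x b
      using C0_ge_1 by (simp add: powr_minus)
    \<comment> \<open>The minimum because \<open>two_constants_wedge\<close> requires the bound on
      the real axis not to exceed \<open>M\<close>.\<close>
    have "cmod (f (Complex (b1 + r) (\<eta> * (3 / 2) * r))) ^ 16 \<le> min \<mu> M * M ^ 15"
    proof (rule two_constants_wedge)
      show "f holomorphic_on {z. 0 < Re z}"
        unfolding f_def[abs_def] using Z_holomorphic[OF moderate_shell(3)[OF A] N] by (intro holomorphic_intros)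
      show "b1 > 0" using b1 by simp
      show fM: "cmod (f z) \<le> M" if "b1 \<le> Re z" "Re z \<le> \<kappa> * real N" for z
      proof -
        have "cmod (Z (shell J A) N z) \<le> C * 2 ^ (Suc J * d) * C0 powr (1 + Re z)"
          using that b1 kN by (intro bounded_Z_le moderate_shell(1)[OF A]) auto
        also have "C0 powr (1 + Re z) = C0 * C0 powr Re z" using C0_ge_1 by (simp add: powr_add)
        finally have "cmod (f z) \<le> (M * C0 powr Re z) * C0 powr (- Re z)"
          unfolding fn M_def by (intro mult_right_mono) (auto simp: mult_ac)
        then show ?thesis unfolding cancel .
      qed
      show "cmod (f (of_real b)) \<le> min \<mu> M" if b: "b1 \<le> b" "b \<le> \<kappa> * real N" for b
      proof -
        have "cmod (Z (shell J A) N (of_real b)) \<le> C * (1 / 2) ^ (J * ?e) * cmod (Z (moment_weight (d + ?e)) N (of_real b))"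
          using b b1 N by (intro real_Z_dominated moderate_shell(2)[OF A]) auto
        also have "\<dots> \<le> C * (1 / 2) ^ (J * ?e) * (K * C0 powr b)"
          using C by (intro mult_left_mono mom b) auto
        finally have "cmod (f (of_real b)) \<le> (\<mu> * C0 powr b) * C0 powr (- b)"
          unfolding fn \<mu>_def by (simp only: Re_complex_of_real) (intro mult_right_mono, auto simp: mult_ac)
        then show ?thesis unfolding cancel using fM[of "of_real b"] b by simp
      qed
    qed (use r \<eta> in auto)
    also have "\<dots> \<le> \<mu> * M ^ 15"
      using C C0_ge_1 by (intro mult_right_mono) (auto simp: M_def)
    also have "\<dots> \<le> (Q * (1 / 2) ^ J) ^ 16"
    proof -
      \<comment> \<open>With \<open>y = 1 / x\<close>, the powers of \<open>x\<close> and
        \<open>y\<close> collect to x^(16 d + 16) * y^(15 d) = x^(16 + d).\<close>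
      define x :: real where "x = (1 / 2) ^ J"
      define y :: real where "y = 2 ^ J"
      have xy: "x * y = 1" "0 \<le> x" "x \<le> 1" by (auto simp: x_def y_def power_divide power_le_one)
      have "\<mu> * M ^ 15 = C * x ^ ?e * K * (C * (2 ^ d * y ^ d) * C0) ^ 15"
        by (simp add: \<mu>_def M_def x_def y_def power_mult[symmetric] power_add[symmetric] mult.commute)
      also have "\<dots> = C ^ 16 * K * C0 ^ 15 * (2 ^ d) ^ 15 * (x ^ 16 * x ^ d * ((x * y) ^ d) ^ 15)"
      proof -
        have "x ^ ?e = x ^ 16 * x ^ d * (x ^ d) ^ 15"
          by (simp add: power_add[symmetric] power_mult[symmetric] algebra_simps)
        moreover have "C ^ 16 = C * C ^ 15" by (simp add: eval_nat_numeral)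
        ultimately show ?thesis by (simp only: power_mult_distrib mult_ac)
      qed
      also have "\<dots> = C ^ 16 * (K * C0 ^ 15 * (2 ^ d) ^ 15 * x ^ d) * x ^ 16" by (simp add: xy)
      also have "\<dots> \<le> C ^ 16 * (K ^ 16 * C0 ^ 16 * (2 ^ d) ^ 16 * 1) * x ^ 16"
      proof (intro mult_left_mono mult_right_mono mult_mono)
        show "K \<le> K ^ 16" using K power_increasing[of 1 16 K] by simp
        show "C0 ^ 15 \<le> C0 ^ 16" using C0_ge_1 by (intro power_increasing) auto
        show "((2::real) ^ d) ^ 15 \<le> (2 ^ d) ^ 16" by (intro power_increasing) auto
        show "x ^ d \<le> 1" using xy by (intro power_le_one)
      qed (use C K C0_ge_1 xy in auto)
      also have "\<dots> = (Q * (1 / 2) ^ J) ^ 16" by (simp add: Q_def x_def power_mult_distrib)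
      finally show ?thesis .
    qed
    finally have "cmod (f (Complex (b1 + r) (\<eta> * (3 / 2) * r))) \<le> Q * (1 / 2) ^ J"
      using Q0 by (subst (asm) power_mono_iff) auto
    then have "cmod (Z (shell J A) N (Complex (b1 + r) (\<eta> * (3 / 2) * r))) * C0 powr (- (b1 + r)) * C0 powr (b1 + r)
        \<le> Q * (1 / 2) ^ J * C0 powr (b1 + r)"
      unfolding fn by (intro mult_right_mono) auto
    moreover have "x * C0 powr (- b) * C0 powr b = x" for x b
      using C0_ge_1 by (simp add: powr_minus)
    ultimately show ?thesis by (simp only:)
  qed
  have bound: "cmod (Z A N (Complex (b1 + r) (\<eta> * (3 / 2) * r))) \<le> 2 * Q * C0 powr (b1 + r)"
    if r: "0 \<le> r" "b1 + 3 * r \<le> \<kappa> * real N" and \<eta>: "\<eta> = 1 \<or> \<eta> = - 1" for N r \<eta>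
  proof -
    have N: "N \<ge> 1" using r b1 by (cases N) auto
    let ?z = "Complex (b1 + r) (\<eta> * (3 / 2) * r)"
    have z: "Re ?z > 0" using b1 r by simp
    have partial: "cmod (Z (cut_off J A) N ?z) \<le> 2 * Q * C0 powr (b1 + r) * (1 - (1 / 2) ^ J)" for J
    proof (induction J)
      case 0
      have "cut_off 0 A = (\<lambda>_. 0)" by (auto simp: cut_off_def fun_eq_iff)
      then show ?case by (simp add: path_partition_def boltzmann_integrand_def case_prod_unfold)
    next
      case (Suc J)
      have "cmod (Z (cut_off (Suc J) A) N ?z) \<le> cmod (Z (cut_off J A) N ?z) + cmod (Z (shell J A) N ?z)"
        unfolding Z_cut_off_Suc[OF A z N] by (rule norm_triangle_ineq)
      also have "\<dots> \<le> 2 * Q * C0 powr (b1 + r) * (1 - (1 / 2) ^ J) + Q * (1 / 2) ^ J * C0 powr (b1 + r)"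
        by (intro add_mono Suc.IH shell_bound r \<eta>)
      also have "\<dots> = 2 * Q * C0 powr (b1 + r) * (1 - (1 / 2) ^ Suc J)" by (simp add: algebra_simps)
      finally show ?case .
    qed
    have "cmod (Z (cut_off J A) N ?z) \<le> 2 * Q * C0 powr (b1 + r)" for J
    proof (rule order_trans[OF partial])
      show "2 * Q * C0 powr (b1 + r) * (1 - (1 / 2) ^ J) \<le> 2 * Q * C0 powr (b1 + r)"
        using Q0 by (intro mult_left_le) auto
    qed
    then show ?thesis
      by (intro LIMSEQ_le_const2[OF tendsto_norm[OF Z_cut_off_limit[OF A z N]]]) auto
  qed
  show ?thesis
  \<comment> \<open>The wedge estimate needs \<open>b1 + 3 * r \<le> \<kappa> * real N\<close>;
    dividing \<open>\<kappa>\<close> by 3 ensures it because \<open>b1\<close> is positive. The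
    factor 2 sums the geometric series over the shells.\<close>
  proof (rule that[of b1 "\<kappa> / 3" "2 * Q"])
    fix N r \<eta> assume "0 \<le> r" "b1 + r \<le> \<kappa> / 3 * real N" "\<eta> = (1::real) \<or> \<eta> = - 1"
    then show "cmod (Z A N (Complex (b1 + r) (\<eta> * (3 / 2) * r))) \<le> 2 * Q * C0 powr (b1 + r)"
      using b1 by (intro bound) auto
  qed (use b1 kap Q0 in auto)
qed

text \<open>On this line the step \<open>\<beta> / N\<close> has real part \<open>\<kappa>\<close>
  for every \<open>N\<close> and \<open>s\<close>, so the crude kernel bound is the
  \<open>N\<close>-th power of a constant.\<close>

lemma Z_line_bound:
  assumes A: "moderate C d A" and kap: "0 < \<kappa>"
  obtains K c where "0 \<le> K" "0 \<le> c" "\<And>N s. N \<ge> 1 \<Longrightarrow> cmod (Z A N (Complex (\<kappa> * real N) s)) \<le> K * exp (c * real N)"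
proof -
  let ?I = "\<integral>z. exp (- \<kappa> * V z) \<partial>lborel" and ?g = "heat_peak m \<kappa>"
  let ?W = "\<integral>z. moment_weight d z * exp (- \<kappa> * V z) \<partial>lborel"
  note C = moderate_nonneg[OF A]
  note [measurable] = moderateD(1)[OF A]
  have I: "0 \<le> ?I" by (rule integral_nonneg_AE) simp
  have g: "0 \<le> ?g" using mass kap by simp
  have "0 \<le> moment_weight d x" for x using moment_weight_ge_1[of d x] by linarith
  then have W: "0 \<le> ?W" by (intro integral_nonneg_AE AE_I2) simp
  \<comment> \<open>Adding 1 to each factor gives \<open>1 \<le> Q\<close> and lets the exponent
    \<open>N - 1\<close> be raised to \<open>N\<close>.\<close>
  define Q where "Q = (1 + ?g) * (1 + ?I)"
  have Q: "1 \<le> Q" unfolding Q_def using g I mult_mono[of 1 "1 + ?g" 1 "1 + ?I"] by simp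
  have "cmod (Z A N (Complex (\<kappa> * real N) s)) \<le> (C * ?W) * exp (ln Q * real N)" if N: "N \<ge> 1" for N s
  proof -
    let ?\<beta> = "Complex (\<kappa> * real N) s"
    let ?\<tau> = "?\<beta> / of_nat N"
    have t: "Re ?\<tau> = \<kappa>" using N by simp
    have [measurable]: "(\<lambda>z. path_kernel ?\<tau> N z z) \<in> borel_measurable borel"
      using t kap N by (intro hs_kernel_diag_measurable hs_path_kernel) auto
    have le: "cmod (of_real (A z) * path_kernel ?\<tau> N z z) \<le> C * Q ^ N * (moment_weight d z * exp (- \<kappa> * V z))" for z
    proof -
      have "?g ^ N * ?I ^ (N - 1) \<le> (1 + ?g) ^ N * (1 + ?I) ^ N"
      proof (rule mult_mono)
        have "?I ^ (N - 1) \<le> (1 + ?I) ^ (N - 1)" using I by (intro power_mono) auto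
        also have "\<dots> \<le> (1 + ?I) ^ N" using I by (intro power_increasing) auto
        finally show "?I ^ (N - 1) \<le> (1 + ?I) ^ N" .
      qed (use g I in \<open>auto intro!: power_mono\<close>)
      then have "?g ^ N * ?I ^ (N - 1) \<le> Q ^ N" by (simp add: Q_def power_mult_distrib)
      then have Q_le: "?g ^ N * ?I ^ (N - 1) * exp (- \<kappa> * V z) \<le> Q ^ N * exp (- \<kappa> * V z)"
        by (rule mult_right_mono) simp
      have "cmod (path_kernel ?\<tau> N z z) \<le> ?g ^ N * ?I ^ (N - 1) * exp (- \<kappa> * V z)"
        using path_kernel_crude_bound[of ?\<tau> N z z, unfolded t] N kap by simp
      also note Q_le
      finally have "cmod (path_kernel ?\<tau> N z z) \<le> Q ^ N * exp (- \<kappa> * V z)" .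
      then have "\<bar>A z\<bar> * cmod (path_kernel ?\<tau> N z z) \<le> (C * moment_weight d z) * (Q ^ N * exp (- \<kappa> * V z))"
        using moderateD(2)[OF A, of z] by (intro mult_mono) (auto intro: order_trans[OF abs_ge_zero])
      then show ?thesis by (simp add: norm_mult mult_ac)
    qed
    have int: "integrable lborel (\<lambda>z. C * Q ^ N * (moment_weight d z * exp (- \<kappa> * V z)))"
      using weighted_exp_integrable[OF kap, of d] by (rule integrable_mult_right)
    have "integrable lborel (\<lambda>z. of_real (A z) * path_kernel ?\<tau> N z z)"
      by (rule Bochner_Integration.integrable_bound[OF int])
         (use le in \<open>auto intro!: AE_I2 order_trans[OF _ abs_ge_self]\<close>)
    then have "cmod (\<integral>z. of_real (A z) * path_kernel ?\<tau> N z z \<partial>lborel) \<le> (\<integral>z. C * Q ^ N * (moment_weight d z * exp (- \<kappa> * V z)) \<partial>lborel)"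
      by (intro order_trans[OF integral_norm_bound integral_mono] integrable_norm int le)
    also have "\<dots> = C * Q ^ N * ?W" by (rule integral_mult_right_zero)
    also have "Q ^ N = exp (ln Q * real N)" using Q by (simp add: exp_of_nat2_mult)
    finally show ?thesis using Z_kernel[OF A _ N, of ?\<beta>] kap N by (simp add: mult_ac)
  qed
  then show ?thesis using C W Q by (intro that[of "C * ?W" "ln Q"]) auto
qed

end

section \<open>The limit of the Gaussian averages\<close>

lemma gaussian_integrand_form:
  assumes "N \<ge> 1" "\<epsilon> > 0"
  shows "of_real (A (periodic N x 0)) * gaussian_integrand m V E \<epsilon> N x p
    = path_amplitude A N (x, p) * of_real (gauss \<epsilon> E (path_energy m V N (x, p)))"
proof -
  have "1 / (2 * m * real N * \<epsilon>) * (\<Sum>k=1..N. (p k)\<^sup>2) + 1 / (real N * \<epsilon>) * (\<Sum>k=1..N. V (x k)) - E / \<epsilon>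
      = (path_energy m V N (x, p) - E) / \<epsilon>"
    unfolding path_energy_def using assms
    by (simp add: sum.distrib add_divide_distrib diff_divide_distrib mult_ac flip: sum_divide_distrib)
  then show ?thesis
    unfolding gaussian_integrand_def path_amplitude_def gauss_def case_prod_conv
    by (simp only: periodic_def if_True refl of_real_mult of_real_divide of_real_1 times_divide_eq_left
        times_divide_eq_right mult_1_left mult_1_right divide_divide_eq_left mult_ac)
qed

lemma gaussian_integrand_integrable:
  assumes m: "m > 0" and N: "N \<ge> 1" and e: "\<epsilon> > 0"
  shows "integrable (lebesgue_N N) (gaussian_integrand m V E \<epsilon> N x)"
proof -
  let ?a = "1 / (2 * m * real N * \<epsilon>)"
  define v where "v = 1 / (real N * \<epsilon>) * (\<Sum>k=1..N. V (x k)) - E / \<epsilon>"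
  let ?c = "1 / (2 * pi) ^ N / sqrt (2 * pi * \<epsilon>\<^sup>2) * exp (1 / 2 - v)"
  have a: "?a > 0" using m N e by simp
  have "integrable lborel (\<lambda>p. exp (- ?a * p\<^sup>2))"
    using integrable_real_gaussian(1)[OF a, of 0] by simp
  then have "integrable (lebesgue_N N) (\<lambda>p. \<Prod>k=1..N. exp (- ?a * (p k)\<^sup>2))"
    unfolding lebesgue_N_def by (intro lborel_product.product_integrable_prod) auto
  then have int: "integrable (lebesgue_N N) (\<lambda>p. ?c * (\<Prod>k=1..N. exp (- ?a * (p k)\<^sup>2)))"
    by (rule integrable_mult_right)
  have c: "(\<lambda>p. p k) \<in> borel_measurable (lebesgue_N N)" if "k \<in> {1..N}" for k
    unfolding lebesgue_N_def using that measurable_component_singleton[of k "{1..N}" "\<lambda>_. lborel"] by simp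
  show ?thesis
  proof (rule Bochner_Integration.integrable_bound[OF int])
    note [measurable] = c
    show "gaussian_integrand m V E \<epsilon> N x \<in> borel_measurable (lebesgue_N N)"
      unfolding gaussian_integrand_def[abs_def] path_phase_def by measurable
    have bound: "cmod (gaussian_integrand m V E \<epsilon> N x p) \<le> ?c * (\<Prod>k=1..N. exp (- ?a * (p k)\<^sup>2))" for p
    proof -
      define q where "q = ?a * (\<Sum>k=1..N. (p k)\<^sup>2)"
      \<comment> \<open>The tangent at \<open>w = 1\<close>. A linear majorant of the exponent makes
        the bound a product of one-dimensional Gaussians in the momenta, at every fixed path
        \<open>x\<close>.\<close>
      have "- (1 / 2) * w\<^sup>2 \<le> 1 / 2 - w" for w :: real
        using zero_le_power2[of "w - 1"] by (simp add: power2_eq_square algebra_simps)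
      from this[of "q + v"] have "- (1 / 2) * (q + v)\<^sup>2 \<le> (1 / 2 - v) + (- q)" by simp
      then have "exp (- (1 / 2) * (q + v)\<^sup>2) \<le> exp (1 / 2 - v) * exp (- q)"
        unfolding exp_add[symmetric] by simp
      also have "exp (- q) = (\<Prod>k=1..N. exp (- ?a * (p k)\<^sup>2))"
        by (simp add: q_def sum_distrib_left sum_negf flip: exp_sum)
      finally have *: "exp (- (1 / 2) * (q + v)\<^sup>2) \<le> exp (1 / 2 - v) * (\<Prod>k=1..N. exp (- ?a * (p k)\<^sup>2))" .
      have "cmod (gaussian_integrand m V E \<epsilon> N x p) = 1 / (2 * pi) ^ N / sqrt (2 * pi * \<epsilon>\<^sup>2) * exp (- (1 / 2) * (q + v)\<^sup>2)"
      proof -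
        have "1 / (2 * m * real N * \<epsilon>) * (\<Sum>k=1..N. (p k)\<^sup>2) + 1 / (real N * \<epsilon>) * (\<Sum>k=1..N. V (x k)) - E / \<epsilon> = q + v"
          by (simp add: q_def v_def)
        then show ?thesis
          unfolding gaussian_integrand_def norm_mult norm_divide norm_of_real using e by simp
      qed
      also have "\<dots> \<le> 1 / (2 * pi) ^ N / sqrt (2 * pi * \<epsilon>\<^sup>2) * (exp (1 / 2 - v) * (\<Prod>k=1..N. exp (- ?a * (p k)\<^sup>2)))"
        by (rule mult_left_mono[OF *]) simp
      finally show ?thesis by (simp only: mult.assoc)
    qed
    show "AE p in lebesgue_N N. cmod (gaussian_integrand m V E \<epsilon> N x p) \<le> norm (?c * (\<Prod>k=1..N. exp (- ?a * (p k)\<^sup>2)))"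
      unfolding real_norm_def by (intro AE_I2 order_trans[OF bound abs_ge_self])
  qed
qed

context path_integrals
begin

text \<open>\<open>b\<close> is free: the limit uses \<open>b = \<kappa> * real N\<close>, the
  integrability claim of the theorem uses \<open>b = 1\<close>.\<close>

lemma moderate_gaussian:
  assumes A: "moderate C d A" and e: "\<epsilon> > 0" and b: "b > 0" and N: "N \<ge> 1"
  shows "integrable lborel (\<lambda>s. laplace_weight \<epsilon> E (Complex b s) * Z A N (Complex b s))"
    and "integrable (lebesgue_N N) (\<lambda>x. of_real (A (periodic N x 0)) * gaussian_kernel m V N x E \<epsilon>)"
    and "(\<integral>x. of_real (A (periodic N x 0)) * gaussian_kernel m V N x E \<epsilon> \<partial>lebesgue_N N)
      = (\<integral>s. laplace_weight \<epsilon> E (Complex b s) * Z A N (Complex b s) \<partial>lborel) / (2 * pi)"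
proof -
  interpret sigma_finite_measure "lebesgue_N N" by (rule sigma_finite_lebesgue_N)
  interpret pair_sigma_finite "lebesgue_N N" "lebesgue_N N" ..
  note il = gaussian_inverse_laplace[OF sigma_finite_path_measure e
      measurable_path_amplitude[OF N moderateD(1)[OF A]] measurable_path_energy[OF V_measurable]
      moderate_laplace_integrable[OF A b N], of E]
  show "integrable lborel (\<lambda>s. laplace_weight \<epsilon> E (Complex b s) * Z A N (Complex b s))"
    using il(1) by (simp only: Z_laplace)
  have eq: "path_amplitude A N q * of_real (gauss \<epsilon> E (path_energy m V N q))
     = (case q of (x, p) \<Rightarrow> of_real (A (periodic N x 0)) * gaussian_integrand m V E \<epsilon> N x p)" for q
    using gaussian_integrand_form[OF N e] by (cases q) simp
  have int: "integrable (path_measure N) (\<lambda>(x, p). of_real (A (periodic N x 0)) * gaussian_integrand m V E \<epsilon> N x p)"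
    using il(2) by (simp only: eq)
  have inner: "(\<integral>p. of_real (A (periodic N x 0)) * gaussian_integrand m V E \<epsilon> N x p \<partial>lebesgue_N N)
      = of_real (A (periodic N x 0)) * gaussian_kernel m V N x E \<epsilon>" for x
    unfolding gaussian_kernel_def by (rule integral_mult_right_zero)
  show "integrable (lebesgue_N N) (\<lambda>x. of_real (A (periodic N x 0)) * gaussian_kernel m V N x E \<epsilon>)"
    using integrable_fst[OF int] by (simp only: inner)
  show "(\<integral>x. of_real (A (periodic N x 0)) * gaussian_kernel m V N x E \<epsilon> \<partial>lebesgue_N N)
      = (\<integral>s. laplace_weight \<epsilon> E (Complex b s) * Z A N (Complex b s) \<partial>lborel) / (2 * pi)"
    using integral_fst[OF int] il(3) by (simp only: inner eq Z_laplace)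
qed

text \<open>Since \<open>T\<close> has the same integral representation on every vertical line,
  average and limit can be compared on a line that moves with \<open>N\<close>. Their difference is
  then one integral of \<open>Z A N - Zi\<close>, to which the wedge deformation applies.\<close>

lemma gaussian_average_limit:
  assumes A: "moderate C d A" and e: "\<epsilon> > 0"
    and conv: "\<And>\<beta>. Re \<beta> > 0 \<Longrightarrow> (\<lambda>N. Z A N \<beta>) \<longlonglongrightarrow> Zi \<beta>"
    and hol: "Zi holomorphic_on {z. 0 < Re z}"
    and bound: "\<And>z. 2 \<le> Re z \<Longrightarrow> cmod (Zi z) \<le> K * exp (c * Re z)"
    and T: "\<And>b. b > 0 \<Longrightarrow> integrable lborel (\<lambda>s. laplace_weight \<epsilon> E (Complex b s) * Zi (Complex b s))"
      "\<And>b. b > 0 \<Longrightarrow> T = (\<integral>s. laplace_weight \<epsilon> E (Complex b s) * Zi (Complex b s) \<partial>lborel) / (2 * pi)"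
  shows "(\<lambda>N. \<integral>x. of_real (A (periodic N x 0)) * gaussian_kernel m V N x E \<epsilon> \<partial>lebesgue_N N) \<longlonglongrightarrow> T"
proof -
  obtain b1 \<kappa> K1 where b1: "2 \<le> b1" and kap: "0 < \<kappa>" and K1: "0 \<le> K1"
    and ray: "\<And>N r \<eta>. 0 \<le> r \<Longrightarrow> b1 + r \<le> \<kappa> * real N \<Longrightarrow> \<eta> = 1 \<or> \<eta> = - 1 \<Longrightarrow>
      cmod (Z A N (Complex (b1 + r) (\<eta> * (3 / 2) * r))) \<le> K1 * C0 powr (b1 + r)"
    using Z_ray_bound[OF A] by metis
  obtain K2 c2 where K2: "0 \<le> K2" "0 \<le> c2"
    and line: "\<And>N s. N \<ge> 1 \<Longrightarrow> cmod (Z A N (Complex (\<kappa> * real N) s)) \<le> K2 * exp (c2 * real N)"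
    using Z_line_bound[OF A kap] by metis
  have K0: "0 \<le> K"
  proof -
    have "0 \<le> K * exp (c * 2)" using order_trans[OF norm_ge_zero bound[of 2]] by simp
    then show ?thesis by (simp add: zero_le_mult_iff)
  qed
  obtain N0 :: nat where N0: "2 / \<kappa> \<le> real N0" using real_arch_simple by blast
  have N0': "N \<ge> 1 \<and> 2 \<le> \<kappa> * real N" if "N \<ge> N0" for N
  proof -
    have "2 / \<kappa> \<le> real N" using N0 that by linarith
    then have "2 \<le> \<kappa> * real N" using kap by (simp add: field_simps)
    then show ?thesis by (cases N) auto
  qed
  \<comment> \<open>One constant and one growth rate have to serve for \<open>Z\<close> and
    \<open>Zi\<close>, on the rays and on the line. The absolute value is taken because
    \<open>c\<close> may be negative.\<close>
  define c3 where "c3 = max (ln C0) \<bar>c\<bar>"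
  define K3 where "K3 = K1 * exp (c3 * b1) + K * exp (c3 * b1) + K2 + K"
  define c4 where "c4 = max c3 (max c2 (\<bar>c\<bar> * \<kappa>))"
  have "(\<lambda>N. \<integral>s. laplace_weight \<epsilon> E (Complex (\<kappa> * real N) s) * (Z A N (Complex (\<kappa> * real N) s) - Zi (Complex (\<kappa> * real N) s)) \<partial>lborel) \<longlonglongrightarrow> 0"
  proof (rule wedge_contour_limit[where D = "\<lambda>N z. Z A N z - Zi z" and ?N0.0 = N0 and K = K3 and c = c4 and ?b1.0 = b1])
    show "(\<lambda>z. Z A N z - Zi z) holomorphic_on {z. 0 < Re z}" if "N \<ge> N0" for N
      using Z_holomorphic[OF A] N0'[OF that] hol by (intro holomorphic_on_diff) auto
    show "(\<lambda>N. Z A N z - Zi z) \<longlonglongrightarrow> 0" if "0 < Re z" for z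
      using tendsto_diff[OF conv[OF that] tendsto_const[of "Zi z"]] by simp
    show "cmod (Z A N (Complex (b1 + r) (\<eta> * (3 / 2) * r)) - Zi (Complex (b1 + r) (\<eta> * (3 / 2) * r))) \<le> K3 * exp (c4 * r)"
      if "N \<ge> N0" "0 \<le> r" "b1 + r \<le> \<kappa> * real N" "\<eta> = 1 \<or> \<eta> = - 1" for N r \<eta>
    proof -
      let ?z = "Complex (b1 + r) (\<eta> * (3 / 2) * r)"
      have r: "0 \<le> b1 + r" using b1 that by simp
      have "C0 powr (b1 + r) = exp (ln C0 * (b1 + r))" using C0_ge_1 by (simp add: powr_def mult.commute)
      also have "\<dots> \<le> exp (c3 * (b1 + r))" using r by (simp add: c3_def mult_right_mono)
      finally have 1: "K1 * C0 powr (b1 + r) \<le> K1 * exp (c3 * (b1 + r))" using K1 by (rule mult_left_mono)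
      have "c * (b1 + r) \<le> c3 * (b1 + r)" using r by (intro mult_right_mono) (auto simp: c3_def)
      then have 2: "K * exp (c * (b1 + r)) \<le> K * exp (c3 * (b1 + r))" using K0 by (intro mult_left_mono) auto
      have "cmod (Z A N ?z - Zi ?z) \<le> cmod (Z A N ?z) + cmod (Zi ?z)" by (rule norm_triangle_ineq4)
      also have "\<dots> \<le> K1 * exp (c3 * (b1 + r)) + K * exp (c3 * (b1 + r))"
        using ray[OF that(2-4)] bound[of ?z] b1 that 1 2 by (intro add_mono) auto
      also have "\<dots> = (K1 * exp (c3 * b1) + K * exp (c3 * b1)) * exp (c3 * r)"
        by (simp add: exp_add algebra_simps)
      also have "\<dots> \<le> K3 * exp (c4 * r)"
        using K0 K1 K2 that by (intro mult_mono) (auto simp: K3_def c4_def intro!: mult_right_mono)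
      finally show ?thesis .
    qed
    show "cmod (Z A N (Complex (\<kappa> * real N) s) - Zi (Complex (\<kappa> * real N) s)) \<le> K3 * exp (c4 * real N)"
      if "N \<ge> N0" for N s
    proof -
      let ?z = "Complex (\<kappa> * real N) s"
      have "c * (\<kappa> * real N) \<le> (\<bar>c\<bar> * \<kappa>) * real N"
        using kap by (simp add: mult.assoc[symmetric] mult_right_mono)
      also have "\<dots> \<le> c4 * real N" by (intro mult_right_mono) (auto simp: c4_def)
      finally have "K * exp (c * (\<kappa> * real N)) \<le> K * exp (c4 * real N)" using K0 by (intro mult_left_mono) auto
      moreover have "K2 * exp (c2 * real N) \<le> K2 * exp (c4 * real N)"
        using K2 by (intro mult_left_mono) (auto simp: c4_def intro!: mult_right_mono)
      moreover have "cmod (Z A N ?z - Zi ?z) \<le> cmod (Z A N ?z) + cmod (Zi ?z)" by (rule norm_triangle_ineq4)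
      ultimately have "cmod (Z A N ?z - Zi ?z) \<le> (K2 + K) * exp (c4 * real N)"
        using line[of N s] bound[of ?z] N0'[OF that] by (simp add: distrib_right)
      also have "\<dots> \<le> K3 * exp (c4 * real N)"
        using K0 K1 by (intro mult_right_mono) (auto simp: K3_def)
      finally show ?thesis .
    qed
  qed (use e kap b1 in auto)
  then have "(\<lambda>N. (\<integral>s. laplace_weight \<epsilon> E (Complex (\<kappa> * real N) s) * (Z A N (Complex (\<kappa> * real N) s) - Zi (Complex (\<kappa> * real N) s)) \<partial>lborel) / (2 * pi) + T) \<longlonglongrightarrow> 0 / (2 * pi) + T"
    by (intro tendsto_intros) auto
  then have "(\<lambda>N. (\<integral>s. laplace_weight \<epsilon> E (Complex (\<kappa> * real N) s) * (Z A N (Complex (\<kappa> * real N) s) - Zi (Complex (\<kappa> * real N) s)) \<partial>lborel) / (2 * pi) + T) \<longlonglongrightarrow> T"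
    by simp
  moreover have "\<forall>\<^sub>F N in sequentially. (\<integral>s. laplace_weight \<epsilon> E (Complex (\<kappa> * real N) s) * (Z A N (Complex (\<kappa> * real N) s) - Zi (Complex (\<kappa> * real N) s)) \<partial>lborel) / (2 * pi) + T
      = (\<integral>x. of_real (A (periodic N x 0)) * gaussian_kernel m V N x E \<epsilon> \<partial>lebesgue_N N)"
  proof (rule eventually_sequentiallyI[of N0])
    fix N assume "N \<ge> N0"
    note N = N0'[OF this]
    have b: "\<kappa> * real N > 0" using N by simp
    note G = moderate_gaussian[OF A e b conjunct1[OF N]]
    show "(\<integral>s. laplace_weight \<epsilon> E (Complex (\<kappa> * real N) s) * (Z A N (Complex (\<kappa> * real N) s) - Zi (Complex (\<kappa> * real N) s)) \<partial>lborel) / (2 * pi) + T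
      = (\<integral>x. of_real (A (periodic N x 0)) * gaussian_kernel m V N x E \<epsilon> \<partial>lebesgue_N N)"
      unfolding G(3) T(2)[OF b] right_diff_distrib Bochner_Integration.integral_diff[OF G(1) T(1)[OF b]]
      by (simp add: diff_divide_distrib)
  qed
  ultimately show ?thesis by (rule Lim_transform_eventually)
qed

end

section \<open>The Hilbert space of square-integrable functions\<close>

lemma abs_L2_rep [simp]: "abs_L2 (rep_L2 \<psi>) = \<psi>"
  by (rule Quotient3_abs_rep[OF Quotient3_L2])

lemma rep_L2_square_integrable [simp]: "square_integrable (rep_L2 \<psi>)"
  using Quotient3_rep_reflp[OF Quotient3_L2, of \<psi>] by (simp add: L2_rel_def)

lemma square_integrable_measurable: "square_integrable f \<Longrightarrow> f \<in> borel_measurable borel"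
  by (simp add: square_integrable_def)

lemma L2_rel_refl: "square_integrable f \<Longrightarrow> L2_rel f f"
  by (simp add: L2_rel_def)

lemma abs_L2_eq_iff:
  "square_integrable f \<Longrightarrow> square_integrable g \<Longrightarrow> abs_L2 f = abs_L2 g \<longleftrightarrow> (AE x in lborel. f x = g x)"
  using Quotient3_rel[OF Quotient3_L2, of f g] by (auto simp: L2_rel_def)

lemma cinner_abs_L2:
  "square_integrable f \<Longrightarrow> square_integrable g \<Longrightarrow> cinner (abs_L2 f) (abs_L2 g) = (\<integral>x. cnj (f x) * g x \<partial>lborel)"
  by (simp add: cinner.abs_eq L2_rel_refl)

lemma scaleC_abs_L2: "square_integrable f \<Longrightarrow> c *\<^sub>C abs_L2 f = abs_L2 (\<lambda>x. c * f x)"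
  by (simp add: scaleC.abs_eq L2_rel_refl)

lemma plus_abs_L2: "square_integrable f \<Longrightarrow> square_integrable g \<Longrightarrow> abs_L2 f + abs_L2 g = abs_L2 (\<lambda>x. f x + g x)"
  by (simp add: plus_L2.abs_eq L2_rel_refl)

lemma zero_abs_L2: "(0 :: L2) = abs_L2 (\<lambda>x. 0)"
  by (simp add: zero_L2_def)

lemma L2_cases: obtains f where "square_integrable f" "\<psi> = abs_L2 f"
  by (rule that[of "rep_L2 \<psi>"]) simp_all

lemma scaleC_add_right: "c *\<^sub>C (\<phi> + \<psi>) = c *\<^sub>C \<phi> + c *\<^sub>C \<psi>"
  by (cases \<phi> rule: L2_cases, cases \<psi> rule: L2_cases)
     (simp add: plus_abs_L2 scaleC_abs_L2 square_integrable_add square_integrable_mult distrib_left)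

lemma scaleC_add_left: "(c + d) *\<^sub>C \<psi> = c *\<^sub>C \<psi> + d *\<^sub>C \<psi>"
  by (cases \<psi> rule: L2_cases) (simp add: plus_abs_L2 scaleC_abs_L2 square_integrable_mult distrib_right)

lemma scaleC_scaleC [simp]: "c *\<^sub>C d *\<^sub>C \<psi> = (c * d) *\<^sub>C \<psi>"
  by (cases \<psi> rule: L2_cases) (simp add: scaleC_abs_L2 square_integrable_mult mult.assoc)

lemma scaleC_one [simp]: "1 *\<^sub>C \<psi> = \<psi>"
  by (cases \<psi> rule: L2_cases) (simp add: scaleC_abs_L2)

lemma scaleC_zero_left [simp]: "0 *\<^sub>C \<psi> = 0"
  by (cases \<psi> rule: L2_cases) (simp add: scaleC_abs_L2 zero_abs_L2)

lemma scaleC_zero_right [simp]: "c *\<^sub>C 0 = 0"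
  unfolding zero_abs_L2 by (simp add: scaleC_abs_L2 square_integrable_0)

lemma scaleR_scaleC: "r *\<^sub>R \<psi> = complex_of_real r *\<^sub>C (\<psi> :: L2)"
  by (simp add: scaleR_L2_def)

lemma scaleC_minus_left [simp]: "(- c) *\<^sub>C \<psi> = - (c *\<^sub>C \<psi>)"
  using scaleC_add_left[of c "- c" \<psi>] by (simp add: eq_neg_iff_add_eq_0 add.commute)

lemma scaleC_minus_right [simp]: "c *\<^sub>C (- \<psi>) = - (c *\<^sub>C \<psi>)"
  using scaleC_add_right[of c \<psi> "- \<psi>"] by (simp add: eq_neg_iff_add_eq_0 add.commute)

lemma scaleC_diff_right: "c *\<^sub>C (\<phi> - \<psi>) = c *\<^sub>C \<phi> - c *\<^sub>C \<psi>"
  using scaleC_add_right[of c \<phi> "- \<psi>"] by simp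

lemma scaleC_sum_right: "c *\<^sub>C (\<Sum>i\<in>I. f i) = (\<Sum>i\<in>I. c *\<^sub>C f i)"
  by (induction I rule: infinite_finite_induct) (simp_all add: scaleC_add_right)

lemma cinner_commute: "cinner \<phi> \<psi> = cnj (cinner \<psi> \<phi>)"
  by (cases \<phi> rule: L2_cases, cases \<psi> rule: L2_cases)
     (simp add: cinner_abs_L2 mult.commute flip: Bochner_Integration.integral_cnj)

lemma cinner_add_right: "cinner \<phi> (\<psi> + \<xi>) = cinner \<phi> \<psi> + cinner \<phi> \<xi>"
proof -
  obtain f g h where "square_integrable f" "square_integrable g" "square_integrable h"
    "\<phi> = abs_L2 f" "\<psi> = abs_L2 g" "\<xi> = abs_L2 h" by (metis L2_cases)
  then show ?thesis
    by (simp add: cinner_abs_L2 plus_abs_L2 square_integrable_add distrib_left square_integrable_cnj_mult)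
qed

lemma cinner_add_left: "cinner (\<psi> + \<xi>) \<phi> = cinner \<psi> \<phi> + cinner \<xi> \<phi>"
  by (simp add: cinner_commute[of _ \<phi>] cinner_add_right)

lemma cinner_scaleC_right [simp]: "cinner \<phi> (c *\<^sub>C \<psi>) = c * cinner \<phi> \<psi>"
  by (cases \<phi> rule: L2_cases, cases \<psi> rule: L2_cases)
     (simp add: cinner_abs_L2 scaleC_abs_L2 square_integrable_mult mult.left_commute)

lemma cinner_scaleC_left [simp]: "cinner (c *\<^sub>C \<psi>) \<phi> = cnj c * cinner \<psi> \<phi>"
  by (simp add: cinner_commute[of _ \<phi>])

lemma cinner_zero [simp]: "cinner \<phi> 0 = 0" "cinner 0 \<phi> = 0"
  using cinner_scaleC_right[of \<phi> 0 0] cinner_scaleC_left[of 0 0 \<phi>] by simp_all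

lemma cinner_minus [simp]: "cinner \<phi> (- \<psi>) = - cinner \<phi> \<psi>" "cinner (- \<psi>) \<phi> = - cinner \<psi> \<phi>"
  using cinner_scaleC_right[of \<phi> "-1" \<psi>] cinner_scaleC_left[of "-1" \<psi> \<phi>] by simp_all

lemma cinner_diff_right: "cinner \<phi> (\<psi> - \<xi>) = cinner \<phi> \<psi> - cinner \<phi> \<xi>"
  using cinner_add_right[of \<phi> \<psi> "- \<xi>"] by simp

lemma cinner_diff_left: "cinner (\<psi> - \<xi>) \<phi> = cinner \<psi> \<phi> - cinner \<xi> \<phi>"
  using cinner_add_left[of \<psi> "- \<xi>" \<phi>] by simp

lemma cinner_sum_right: "cinner \<phi> (\<Sum>i\<in>I. f i) = (\<Sum>i\<in>I. cinner \<phi> (f i))"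
  by (induction I rule: infinite_finite_induct) (simp_all add: cinner_add_right)

lemma cinner_sum_left: "cinner (\<Sum>i\<in>I. f i) \<phi> = (\<Sum>i\<in>I. cinner (f i) \<phi>)"
  by (induction I rule: infinite_finite_induct) (simp_all add: cinner_add_left)

lemma cinner_self: "cinner \<psi> \<psi> = of_real ((norm \<psi>)\<^sup>2)"
proof -
  have "Re (cinner \<psi> \<psi>) = (norm \<psi>)\<^sup>2"
    using power2_norm_eq_inner[of \<psi>] by (simp add: inner_L2_def)
  moreover have "Im (cinner \<psi> \<psi>) = 0"
    using arg_cong[OF cinner_commute[of \<psi> \<psi>], of Im] by simp
  ultimately show ?thesis by (simp add: complex_eq_iff)
qed

lemma norm_scaleC: "norm (c *\<^sub>C \<psi>) = cmod c * norm \<psi>"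
proof (rule power2_eq_imp_eq)
  have "complex_of_real ((norm (c *\<^sub>C \<psi>))\<^sup>2) = of_real ((cmod c * norm \<psi>)\<^sup>2)"
  proof -
    have "cinner (c *\<^sub>C \<psi>) (c *\<^sub>C \<psi>) = (c * cnj c) * cinner \<psi> \<psi>" by simp
    then show ?thesis
      unfolding cinner_self complex_norm_square[symmetric] power_mult_distrib of_real_mult .
  qed
  then show "(norm (c *\<^sub>C \<psi>))\<^sup>2 = (cmod c * norm \<psi>)\<^sup>2" by (simp only: of_real_eq_iff)
qed auto

lemma cinner_cauchy_schwarz: "cmod (cinner \<phi> \<psi>) \<le> norm \<phi> * norm \<psi>"
proof (cases "cinner \<phi> \<psi> = 0")
  case False
  \<comment> \<open>A phase that turns the inner product into its modulus, so that the
    Cauchy-Schwarz inequality of the real inner product applies.\<close>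
  define u where "u = cnj (cinner \<phi> \<psi>) / cmod (cinner \<phi> \<psi>)"
  have u: "cmod u = 1" using False by (simp add: u_def norm_divide)
  have "u * cinner \<phi> \<psi> = of_real (cmod (cinner \<phi> \<psi>))"
    using False by (simp add: u_def mult.commute[of "cnj _"] complex_norm_square[symmetric] power2_eq_square)
  then have "cmod (cinner \<phi> \<psi>) = inner \<phi> (u *\<^sub>C \<psi>)" by (simp add: inner_L2_def)
  also have "\<dots> \<le> norm \<phi> * norm (u *\<^sub>C \<psi>)" by (rule norm_cauchy_schwarz)
  finally show ?thesis by (simp add: norm_scaleC u)
qed simp

lemma bounded_linear_cinner_right: "bounded_linear (cinner \<phi>)"
  by (rule bounded_linear_intro[where K = "norm \<phi>"])
     (auto simp: cinner_add_right scaleR_scaleC scaleR_conv_of_real mult.commute intro: order_trans[OF cinner_cauchy_schwarz])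

lemma bounded_linear_cinner_left: "bounded_linear (\<lambda>\<psi>. cinner \<psi> \<phi>)"
  by (rule bounded_linear_intro[where K = "norm \<phi>"])
     (auto simp: cinner_add_left scaleR_scaleC scaleR_conv_of_real intro: cinner_cauchy_schwarz)

lemma bounded_linear_scaleC: "bounded_linear (\<lambda>\<psi>. c *\<^sub>C \<psi>)"
  by (rule bounded_linear_intro[where K = "cmod c"])
     (auto simp: scaleC_add_right scaleR_scaleC norm_scaleC mult.commute)

lemmas tendsto_cinner_right = bounded_linear.tendsto[OF bounded_linear_cinner_right]

section \<open>Completeness of \<open>L2\<close>\<close>

lemma norm_abs_L2: "square_integrable f \<Longrightarrow> (norm (abs_L2 f))\<^sup>2 = (\<integral>x. (cmod (f x))\<^sup>2 \<partial>lborel)"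
proof -
  assume f: "square_integrable f"
  have "complex_of_real ((norm (abs_L2 f))\<^sup>2) = (\<integral>x. complex_of_real ((cmod (f x))\<^sup>2) \<partial>lborel)"
    unfolding cinner_self[symmetric] cinner_abs_L2[OF f f]
    by (simp add: complex_norm_square mult.commute del: of_real_power)
  then show ?thesis unfolding integral_complex_of_real by (simp only: of_real_eq_iff)
qed

lemma abs_L2_sum:
  "(\<And>i. i \<in> I \<Longrightarrow> square_integrable (f i)) \<Longrightarrow> finite I \<Longrightarrow>
    square_integrable (\<lambda>x. \<Sum>i\<in>I. f i x) \<and> (\<Sum>i\<in>I. abs_L2 (f i)) = abs_L2 (\<lambda>x. \<Sum>i\<in>I. f i x)"
  by (induction I rule: infinite_finite_induct)
     (auto simp: square_integrable_0 zero_abs_L2 square_integrable_add plus_abs_L2)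

text \<open>Riesz-Fischer: by monotone convergence the sum \<open>G\<close> of the moduli is square
  integrable and finite almost everywhere. The series therefore converges pointwise almost
  everywhere, and \<open>G\<close> squared dominates the squared remainders.\<close>

lemma L2_series_converges:
  fixes \<psi> :: "nat \<Rightarrow> L2"
  assumes sm: "summable (\<lambda>n. norm (\<psi> n))"
  shows "\<exists>\<phi>. (\<lambda>n. \<Sum>i<n. \<psi> i) \<longlonglongrightarrow> \<phi>"
proof -
  define f where "f i = rep_L2 (\<psi> i)" for i
  have f: "square_integrable (f i)" "\<psi> i = abs_L2 (f i)" for i by (simp_all add: f_def)
  have [measurable]: "f i \<in> borel_measurable borel" for i using f(1) by (rule square_integrable_measurable)
  define g where "g i x = complex_of_real (cmod (f i x))" for i x
  have [measurable]: "g i \<in> borel_measurable borel" for i unfolding g_def[abs_def] by measurable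
  have g: "square_integrable (g i)" for i
    using f(1)[of i] by (simp add: square_integrable_def) (simp add: g_def)
  have ng: "norm (abs_L2 (g i)) = norm (\<psi> i)" for i
  proof (rule power2_eq_imp_eq)
    have "(norm (abs_L2 (g i)))\<^sup>2 = (\<integral>x. (cmod (f i x))\<^sup>2 \<partial>lborel)"
      unfolding norm_abs_L2[OF g] by (simp add: g_def)
    then show "(norm (abs_L2 (g i)))\<^sup>2 = (norm (\<psi> i))\<^sup>2"
      unfolding f(2) norm_abs_L2[OF f(1)] .
  qed auto
  define C where "C = (\<Sum>n. norm (\<psi> n))"
  define S where "S n x = (\<Sum>i<n. cmod (f i x))" for n x
  have [measurable]: "S n \<in> borel_measurable borel" for n unfolding S_def[abs_def] by measurable
  have S0: "0 \<le> S n x" for n x by (simp add: S_def sum_nonneg)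
  have Smono: "S n x \<le> S k x" if "n \<le> k" for n k x
    unfolding S_def using that by (intro sum_mono2) auto
  have C0: "0 \<le> C" unfolding C_def by (intro suminf_nonneg sm) auto
  have sq: "square_integrable (\<lambda>x. complex_of_real (S n x))" and nS: "norm (abs_L2 (\<lambda>x. complex_of_real (S n x))) \<le> C" for n
  proof -
    have *: "square_integrable (\<lambda>x. \<Sum>i<n. g i x)" "(\<Sum>i<n. abs_L2 (g i)) = abs_L2 (\<lambda>x. \<Sum>i<n. g i x)"
      using abs_L2_sum[of "{..<n}" g] g by auto
    have eq: "(\<lambda>x. \<Sum>i<n. g i x) = (\<lambda>x. complex_of_real (S n x))" by (simp add: g_def S_def)
    show "square_integrable (\<lambda>x. complex_of_real (S n x))" using * by (simp only: eq)
    have "norm (abs_L2 (\<lambda>x. complex_of_real (S n x))) = norm (\<Sum>i<n. abs_L2 (g i))" using * by (simp only: eq)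
    also have "\<dots> \<le> (\<Sum>i<n. norm (\<psi> i))" using norm_sum[of "\<lambda>i. abs_L2 (g i)" "{..<n}"] by (simp add: ng)
    also have "\<dots> \<le> C" unfolding C_def by (intro sum_le_suminf sm) auto
    finally show "norm (abs_L2 (\<lambda>x. complex_of_real (S n x))) \<le> C" .
  qed
  have Sint: "integrable lborel (\<lambda>x. (S n x)\<^sup>2)" for n
    using sq[of n] by (simp add: square_integrable_def)
  have Sle: "(\<integral>\<^sup>+x. ennreal ((S n x)\<^sup>2) \<partial>lborel) \<le> ennreal (C\<^sup>2)" for n
  proof -
    have "(\<integral>x. (S n x)\<^sup>2 \<partial>lborel) \<le> C\<^sup>2"
      using norm_abs_L2[OF sq[of n]] power_mono[OF nS[of n], of 2] by simp
    then show ?thesis using nn_integral_eq_integral[OF Sint[of n]] by (simp add: ennreal_leI)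
  qed
  have "(\<integral>\<^sup>+x. (SUP n. ennreal ((S n x)\<^sup>2)) \<partial>lborel) = (SUP n. \<integral>\<^sup>+x. ennreal ((S n x)\<^sup>2) \<partial>lborel)"
    by (intro nn_integral_monotone_convergence_SUP)
       (auto simp: incseq_def le_fun_def intro!: ennreal_leI power_mono Smono S0)
  also have "\<dots> \<le> ennreal (C\<^sup>2)" by (intro SUP_least Sle)
  finally have nnG: "(\<integral>\<^sup>+x. (SUP n. ennreal ((S n x)\<^sup>2)) \<partial>lborel) \<le> ennreal (C\<^sup>2)" .
  then have "(\<integral>\<^sup>+x. (SUP n. ennreal ((S n x)\<^sup>2)) \<partial>lborel) \<noteq> \<infinity>" by (auto simp: top_unique)
  then have fin: "AE x in lborel. (SUP n. ennreal ((S n x)\<^sup>2)) \<noteq> \<infinity>"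
    by (intro nn_integral_PInf_AE) auto
  have summ: "AE x in lborel. summable (\<lambda>i. cmod (f i x))"
    using fin
  proof eventually_elim
    case (elim x)
    then obtain r where r: "0 \<le> r" "(SUP n. ennreal ((S n x)\<^sup>2)) = ennreal r"
      by (cases "(SUP n. ennreal ((S n x)\<^sup>2))") auto
    have "S n x \<le> sqrt r" for n
    proof -
      have "ennreal ((S n x)\<^sup>2) \<le> ennreal r" unfolding r(2)[symmetric] by (intro SUP_upper) auto
      then have "(S n x)\<^sup>2 \<le> r" using r by simp
      then show ?thesis by (rule real_le_rsqrt)
    qed
    then show ?case unfolding S_def by (intro summableI_nonneg_bounded[where x = "sqrt r"]) auto
  qed
  define G where "G x = (\<Sum>i. cmod (f i x))" for x
  define F where "F x = (\<Sum>i. f i x)" for x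
  have [measurable]: "G \<in> borel_measurable borel" "F \<in> borel_measurable borel"
    unfolding G_def[abs_def] F_def[abs_def] by measurable
  have SG: "(\<lambda>n. S n x) \<longlonglongrightarrow> G x" if "summable (\<lambda>i. cmod (f i x))" for x
    using summable_LIMSEQ[OF that] by (simp add: S_def G_def)
  have Gint: "integrable lborel (\<lambda>x. (G x)\<^sup>2)"
  proof (rule integrableI_bounded)
    have "(\<integral>\<^sup>+x. ennreal (norm ((G x)\<^sup>2)) \<partial>lborel) \<le> (\<integral>\<^sup>+x. (SUP n. ennreal ((S n x)\<^sup>2)) \<partial>lborel)"
    proof (intro nn_integral_mono_AE, use summ in eventually_elim)
      case (elim x)
      have "(\<lambda>n. ennreal ((S n x)\<^sup>2)) \<longlonglongrightarrow> ennreal ((G x)\<^sup>2)"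
        by (intro tendsto_ennrealI tendsto_power SG elim)
      then have "ennreal ((G x)\<^sup>2) \<le> (SUP n. ennreal ((S n x)\<^sup>2))"
        by (rule LIMSEQ_le_const2) (intro exI[of _ 0] allI impI SUP_upper UNIV_I)
      then show ?case by simp
    qed
    also have "\<dots> < \<infinity>" using nnG by (auto simp: le_less_trans)
    finally show "(\<integral>\<^sup>+x. ennreal (norm ((G x)\<^sup>2)) \<partial>lborel) < \<infinity>" .
  qed measurable
  have FG: "cmod (F x - (\<Sum>i<n. f i x)) \<le> G x" if "summable (\<lambda>i. cmod (f i x))" for x n
  proof -
    have s: "summable (\<lambda>i. f i x)" using that by (rule summable_norm_cancel)
    have "F x - (\<Sum>i<n. f i x) = (\<Sum>i. f (i + n) x)"
      using suminf_split_initial_segment[OF s, of n] by (simp add: F_def)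
    also have "cmod \<dots> \<le> (\<Sum>i. cmod (f (i + n) x))"
      by (intro summable_norm) (use that in \<open>simp add: summable_iff_shift[of "\<lambda>i. cmod (f i x)"]\<close>)
    also have "\<dots> \<le> G x"
      unfolding G_def using suminf_split_initial_segment[OF that, of n] by (simp add: sum_nonneg)
    finally show ?thesis .
  qed
  have Fsq: "square_integrable F"
    unfolding square_integrable_def
  proof
    show "integrable lborel (\<lambda>x. (cmod (F x))\<^sup>2)"
      by (rule Bochner_Integration.integrable_bound[OF Gint])
         (use summ in \<open>auto elim!: eventually_mono dest!: FG[of _ 0] intro!: power_mono\<close>)
  qed measurable
  have psq: "square_integrable (\<lambda>x. \<Sum>i<n. f i x)" "(\<Sum>i<n. \<psi> i) = abs_L2 (\<lambda>x. \<Sum>i<n. f i x)" for n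
    using abs_L2_sum[of "{..<n}" f] f by auto
  have dsq: "square_integrable (\<lambda>x. F x + (- 1) * (\<Sum>i<n. f i x))" for n
    by (intro square_integrable_add Fsq square_integrable_mult psq)
  have dn: "(norm (abs_L2 F - (\<Sum>i<n. \<psi> i)))\<^sup>2 = (\<integral>x. (cmod (F x - (\<Sum>i<n. f i x)))\<^sup>2 \<partial>lborel)" for n
  proof -
    have "abs_L2 F - (\<Sum>i<n. \<psi> i) = abs_L2 F + (- 1) *\<^sub>C (\<Sum>i<n. \<psi> i)" by simp
    also have "\<dots> = abs_L2 (\<lambda>x. F x + (- 1) * (\<Sum>i<n. f i x))"
      unfolding psq(2) by (simp only: scaleC_abs_L2[OF psq(1)] plus_abs_L2[OF Fsq square_integrable_mult[OF psq(1)]])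
    finally show ?thesis using norm_abs_L2[OF dsq] by simp
  qed
  have "(\<lambda>n. \<integral>x. (cmod (F x - (\<Sum>i<n. f i x)))\<^sup>2 \<partial>lborel) \<longlonglongrightarrow> (\<integral>x. 0 \<partial>(lborel :: real measure))"
  proof (rule integral_dominated_convergence[OF _ _ Gint])
    show "AE x in lborel. (\<lambda>n. (cmod (F x - (\<Sum>i<n. f i x)))\<^sup>2) \<longlonglongrightarrow> 0"
      using summ
    proof eventually_elim
      case (elim x)
      have "(\<lambda>n. \<Sum>i<n. f i x) \<longlonglongrightarrow> F x"
        using summable_LIMSEQ[OF summable_norm_cancel[OF elim]] by (simp add: F_def)
      then have "(\<lambda>n. (cmod (F x - (\<Sum>i<n. f i x)))\<^sup>2) \<longlonglongrightarrow> (cmod (F x - F x))\<^sup>2"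
        by (intro tendsto_intros)
      then show ?case by simp
    qed
    show "AE x in lborel. norm ((cmod (F x - (\<Sum>i<n. f i x)))\<^sup>2) \<le> (G x)\<^sup>2" for n
      using summ by eventually_elim (auto intro!: power_mono FG)
  qed measurable
  then have "(\<lambda>n. (norm (abs_L2 F - (\<Sum>i<n. \<psi> i)))\<^sup>2) \<longlonglongrightarrow> 0" by (simp add: dn)
  then have "(\<lambda>n. norm (abs_L2 F - (\<Sum>i<n. \<psi> i))) \<longlonglongrightarrow> 0"
    using tendsto_real_sqrt[of "\<lambda>n. (norm (abs_L2 F - (\<Sum>i<n. \<psi> i)))\<^sup>2" 0] by simp
  then have "(\<lambda>n. norm ((\<Sum>i<n. \<psi> i) - abs_L2 F)) \<longlonglongrightarrow> 0" by (simp add: norm_minus_commute)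
  then have "(\<lambda>n. (\<Sum>i<n. \<psi> i) - abs_L2 F) \<longlonglongrightarrow> 0" by (rule tendsto_norm_zero_cancel)
  then have "(\<lambda>n. \<Sum>i<n. \<psi> i) \<longlonglongrightarrow> abs_L2 F" by (rule LIM_zero_cancel)
  then show ?thesis by blast
qed

text \<open>A Cauchy sequence has a subsequence with steps below (1 / 2)^n; it converges as an
  absolutely convergent telescoping series, and takes the whole sequence with it.\<close>

instance L2 :: complete_space
proof
  fix X :: "nat \<Rightarrow> L2" assume X: "Cauchy X"
  have "\<exists>r::nat \<Rightarrow> nat. \<forall>n. (\<forall>i\<ge>r n. \<forall>j\<ge>r n. dist (X i) (X j) < (1 / 2) ^ n) \<and> r n < r (Suc n)"
  proof (rule dependent_nat_choice)
    show "\<exists>x. \<forall>i\<ge>x. \<forall>j\<ge>x. dist (X i) (X j) < (1 / 2) ^ 0"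
      using X unfolding Cauchy_def by (metis zero_less_one power_0)
    fix x n
    obtain M where "\<forall>i\<ge>M. \<forall>j\<ge>M. dist (X i) (X j) < (1 / 2) ^ Suc n"
      using X unfolding Cauchy_def by (metis zero_less_power half_gt_zero zero_less_one)
    then show "\<exists>y. (\<forall>i\<ge>y. \<forall>j\<ge>y. dist (X i) (X j) < (1 / 2) ^ Suc n) \<and> x < y"
      by (intro exI[of _ "max M (Suc x)"]) auto
  qed
  then obtain r :: "nat \<Rightarrow> nat"
    where r': "\<forall>n. (\<forall>i\<ge>r n. \<forall>j\<ge>r n. dist (X i) (X j) < (1 / 2) ^ n) \<and> r n < r (Suc n)" ..
  have r: "\<And>n i j. i \<ge> r n \<Longrightarrow> j \<ge> r n \<Longrightarrow> dist (X i) (X j) < (1 / 2) ^ n" "\<And>n. r n < r (Suc n)"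
    using r' by simp_all
  have rm: "strict_mono r" using r(2) by (simp add: strict_mono_Suc_iff)
  have "summable (\<lambda>n. norm (X (r (Suc n)) - X (r n)))"
  proof (rule summable_comparison_test'[OF summable_geometric[of "1 / 2 :: real"]])
    show "norm (norm (X (r (Suc n)) - X (r n))) \<le> (1 / 2) ^ n" for n
      using r(1)[of n "r (Suc n)" "r n"] r(2)[of n] by (simp add: dist_norm)
  qed simp
  from L2_series_converges[OF this]
  obtain \<phi> where "(\<lambda>n. \<Sum>i<n. X (r (Suc i)) - X (r i)) \<longlonglongrightarrow> \<phi>" ..
  then have "(\<lambda>n. X (r n) - X (r 0)) \<longlonglongrightarrow> \<phi>"
    unfolding sum_lessThan_telescope[of "\<lambda>n. X (r n)"] .
  from tendsto_add[OF this tendsto_const[of "X (r 0)"]]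
  have "(X \<circ> r) \<longlonglongrightarrow> \<phi> + X (r 0)" by (simp add: o_def)
  with X rm have "X \<longlonglongrightarrow> \<phi> + X (r 0)" by (rule Cauchy_converges_subseq)
  then show "convergent X" by (rule convergentI)
qed

instance L2 :: banach ..

section \<open>Orthonormal bases\<close>

definition orthonormal_on :: "('i \<Rightarrow> L2) \<Rightarrow> 'i set \<Rightarrow> bool" where
  "orthonormal_on e I \<longleftrightarrow> (\<forall>j\<in>I. \<forall>k\<in>I. cinner (e j) (e k) = (if j = k then 1 else 0))"

lemma orthonormal_onD: "orthonormal_on e I \<Longrightarrow> j \<in> I \<Longrightarrow> k \<in> I \<Longrightarrow> cinner (e j) (e k) = (if j = k then 1 else 0)"
  by (simp add: orthonormal_on_def)

lemma orthonormal_on_subset: "orthonormal_on e I \<Longrightarrow> J \<subseteq> I \<Longrightarrow> orthonormal_on e J"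
  unfolding orthonormal_on_def by (meson subsetD)

lemma cinner_orthonormal_sum:
  assumes "orthonormal_on e I" "finite I" "k \<in> I"
  shows "cinner (e k) (\<Sum>j\<in>I. c j *\<^sub>C e j) = c k"
proof -
  have "cinner (e k) (\<Sum>j\<in>I. c j *\<^sub>C e j) = (\<Sum>j\<in>I. if j = k then c j else 0)"
    unfolding cinner_sum_right cinner_scaleC_right
    using assms by (intro sum.cong) (auto simp: orthonormal_onD)
  then show ?thesis using assms by simp
qed

lemma norm_orthonormal_sum:
  assumes "orthonormal_on e I" "finite I"
  shows "(norm (\<Sum>j\<in>I. c j *\<^sub>C e j))\<^sup>2 = (\<Sum>j\<in>I. (cmod (c j))\<^sup>2)"
proof -
  have "complex_of_real ((norm (\<Sum>j\<in>I. c j *\<^sub>C e j))\<^sup>2) = (\<Sum>k\<in>I. cnj (c k) * cinner (e k) (\<Sum>j\<in>I. c j *\<^sub>C e j))"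
    unfolding cinner_self[symmetric] by (simp add: cinner_sum_left)
  also have "\<dots> = (\<Sum>k\<in>I. complex_of_real ((cmod (c k))\<^sup>2))"
    using assms by (intro sum.cong refl) (simp add: cinner_orthonormal_sum complex_norm_square mult.commute del: of_real_power)
  also have "\<dots> = complex_of_real (\<Sum>k\<in>I. (cmod (c k))\<^sup>2)" by simp
  finally show ?thesis by (simp only: of_real_eq_iff)
qed

lemma bessel_identity:
  assumes "orthonormal_on e I" "finite I"
  shows "(norm (\<psi> - (\<Sum>j\<in>I. cinner (e j) \<psi> *\<^sub>C e j)))\<^sup>2 = (norm \<psi>)\<^sup>2 - (\<Sum>j\<in>I. (cmod (cinner (e j) \<psi>))\<^sup>2)"
proof -
  let ?p = "\<Sum>j\<in>I. cinner (e j) \<psi> *\<^sub>C e j"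
  have 1: "cinner \<psi> ?p = of_real (\<Sum>j\<in>I. (cmod (cinner (e j) \<psi>))\<^sup>2)"
    unfolding cinner_sum_right of_real_sum
    by (intro sum.cong refl) (simp add: cinner_commute[of \<psi>] complex_norm_square del: of_real_power)
  have 2: "cinner ?p \<psi> = of_real (\<Sum>j\<in>I. (cmod (cinner (e j) \<psi>))\<^sup>2)"
    using cinner_commute[of ?p \<psi>] unfolding 1 by simp
  have 3: "cinner ?p ?p = of_real (\<Sum>j\<in>I. (cmod (cinner (e j) \<psi>))\<^sup>2)"
    unfolding cinner_self norm_orthonormal_sum[OF assms] ..
  have "complex_of_real ((norm (\<psi> - ?p))\<^sup>2) = of_real ((norm \<psi>)\<^sup>2 - (\<Sum>j\<in>I. (cmod (cinner (e j) \<psi>))\<^sup>2))"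
    unfolding cinner_self[symmetric] cinner_diff_left cinner_diff_right 1 2 3 by (simp add: cinner_self)
  then show ?thesis by (simp only: of_real_eq_iff)
qed

lemma bessel_inequality:
  assumes "orthonormal_on e I" "finite I"
  shows "(\<Sum>j\<in>I. (cmod (cinner (e j) \<psi>))\<^sup>2) \<le> (norm \<psi>)\<^sup>2"
  using bessel_identity[OF assms, of \<psi>] zero_le_power2[of "norm (\<psi> - (\<Sum>j\<in>I. cinner (e j) \<psi> *\<^sub>C e j))"] by linarith

lemma orthonormal_basis_on: "orthonormal_basis e \<Longrightarrow> orthonormal_on e I"
  by (simp add: orthonormal_basis_def orthonormal_on_def)

lemma orthonormal_basis_norm: assumes "orthonormal_basis e" shows "norm (e n) = 1"
proof (rule power2_eq_imp_eq)
  have "complex_of_real ((norm (e n))\<^sup>2) = 1"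
    using assms cinner_self[of "e n"] by (simp add: orthonormal_basis_def)
  then show "(norm (e n))\<^sup>2 = 1\<^sup>2" by (simp only: of_real_eq_1_iff one_power2)
qed auto

lemma orthonormal_series:
  assumes e: "orthonormal_on e (UNIV :: nat set)" and c: "summable (\<lambda>n. (cmod (c n))\<^sup>2)"
  shows "summable (\<lambda>n. c n *\<^sub>C e n)" and "cinner (e k) (\<Sum>n. c n *\<^sub>C e n) = c k"
    and "(norm (\<Sum>n. c n *\<^sub>C e n))\<^sup>2 = (\<Sum>n. (cmod (c n))\<^sup>2)"
proof -
  have on: "orthonormal_on e I" for I using e by (rule orthonormal_on_subset) simp
  show s: "summable (\<lambda>n. c n *\<^sub>C e n)"
    unfolding summable_Cauchy
  proof (intro allI impI)
    fix r :: real assume r: "0 < r"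
    then obtain N where N: "\<And>m n. m \<ge> N \<Longrightarrow> norm (\<Sum>i=m..<n. (cmod (c i))\<^sup>2) < r\<^sup>2"
      using c unfolding summable_Cauchy by (meson zero_less_power)
    have "norm (\<Sum>i=m..<n. c i *\<^sub>C e i) < r" if "m \<ge> N" for m n
    proof -
      have "(norm (\<Sum>i=m..<n. c i *\<^sub>C e i))\<^sup>2 = (\<Sum>i=m..<n. (cmod (c i))\<^sup>2)"
        by (rule norm_orthonormal_sum[OF on]) simp
      also have "\<dots> < r\<^sup>2" using N[OF that, of n] by simp
      finally show ?thesis using r by (simp add: power2_less_imp_less)
    qed
    then show "\<exists>N. \<forall>m\<ge>N. \<forall>n. norm (\<Sum>i=m..<n. c i *\<^sub>C e i) < r" by blast
  qed
  have "cinner (e k) (\<Sum>n. c n *\<^sub>C e n) = (\<Sum>n. cinner (e k) (c n *\<^sub>C e n))"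
    by (rule bounded_linear.suminf[OF bounded_linear_cinner_right s])
  also have "(\<lambda>n. cinner (e k) (c n *\<^sub>C e n)) = (\<lambda>n. if n = k then c n else 0)"
    using e by (auto simp: orthonormal_on_def fun_eq_iff)
  also have "(\<Sum>n. if n = k then c n else 0) = c k"
    using sums_single[of k c] by (simp add: sums_iff)
  finally show "cinner (e k) (\<Sum>n. c n *\<^sub>C e n) = c k" .
  have "(\<lambda>n. (norm (\<Sum>i<n. c i *\<^sub>C e i))\<^sup>2) \<longlonglongrightarrow> (norm (\<Sum>n. c n *\<^sub>C e n))\<^sup>2"
    by (intro tendsto_intros summable_LIMSEQ s)
  moreover have "(\<lambda>n. (norm (\<Sum>i<n. c i *\<^sub>C e i))\<^sup>2) \<longlonglongrightarrow> (\<Sum>n. (cmod (c n))\<^sup>2)"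
    unfolding norm_orthonormal_sum[OF on finite_lessThan] by (intro summable_LIMSEQ c)
  ultimately show "(norm (\<Sum>n. c n *\<^sub>C e n))\<^sup>2 = (\<Sum>n. (cmod (c n))\<^sup>2)" by (rule LIMSEQ_unique)
qed

lemma
  assumes e: "orthonormal_basis e"
  shows parseval: "(\<lambda>n. (cmod (cinner (e n) \<psi>))\<^sup>2) sums (norm \<psi>)\<^sup>2"
    and fourier_series: "(\<lambda>n. cinner (e n) \<psi> *\<^sub>C e n) sums \<psi>"
proof -
  have c: "summable (\<lambda>n. (cmod (cinner (e n) \<psi>))\<^sup>2)"
    by (rule summableI_nonneg_bounded[where x = "(norm \<psi>)\<^sup>2"])
       (auto intro: bessel_inequality orthonormal_basis_on[OF e])
  note s = orthonormal_series[OF orthonormal_basis_on[OF e] c]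
  have "cinner (e k) (\<psi> - (\<Sum>n. cinner (e n) \<psi> *\<^sub>C e n)) = 0" for k
    unfolding cinner_diff_right s(2) by simp
  then have "\<psi> - (\<Sum>n. cinner (e n) \<psi> *\<^sub>C e n) = 0"
    using e unfolding orthonormal_basis_def by blast
  then have eq: "(\<Sum>n. cinner (e n) \<psi> *\<^sub>C e n) = \<psi>" by simp
  show "(\<lambda>n. cinner (e n) \<psi> *\<^sub>C e n) sums \<psi>" using s(1) eq by (simp add: sums_iff)
  show "(\<lambda>n. (cmod (cinner (e n) \<psi>))\<^sup>2) sums (norm \<psi>)\<^sup>2" using s(3) c unfolding eq by (simp add: sums_iff)
qed

lemma parseval_cinner:
  assumes e: "orthonormal_basis e"
  shows "(\<lambda>n. cinner \<phi> (e n) * cinner (e n) \<psi>) sums cinner \<phi> \<psi>"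
  using bounded_linear.sums[OF bounded_linear_cinner_right fourier_series[OF e, of \<psi>], of \<phi>]
  by (simp add: mult.commute)

lemma orthonormal_basis_eqI:
  assumes e: "orthonormal_basis e" and "\<And>n. cinner (e n) \<phi> = cinner (e n) \<psi>"
  shows "\<phi> = \<psi>"
proof -
  have "cinner (e n) (\<phi> - \<psi>) = 0" for n using assms(2) by (simp add: cinner_diff_right)
  then have "\<phi> - \<psi> = 0" using e unfolding orthonormal_basis_def by blast
  then show ?thesis by simp
qed

text \<open>Zorn's lemma inside \<open>W\<close>. No linear structure of \<open>W\<close> is used,
  so that \<open>W\<close> may be the union of all eigenspaces as well as the whole space.\<close>

lemma orthonormal_extension:
  assumes S0: "orthonormal_on id S0" "S0 \<subseteq> W"
  obtains S where "S0 \<subseteq> S" "S \<subseteq> W" "orthonormal_on id S"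
    "\<nexists>x. x \<in> W \<and> norm x = 1 \<and> (\<forall>y\<in>S. cinner y x = 0)"
proof -
  define P where "P = {S. S0 \<subseteq> S \<and> S \<subseteq> W \<and> orthonormal_on id S}"
  have "\<exists>M\<in>P. \<forall>X\<in>P. M \<subseteq> X \<longrightarrow> X = M"
  proof (rule subset_Zorn_nonempty)
    show "P \<noteq> {}" using S0 by (auto simp: P_def)
    fix C assume C: "C \<noteq> {}" "subset.chain P C"
    have CP: "C \<subseteq> P" and tot: "\<And>X Y. X \<in> C \<Longrightarrow> Y \<in> C \<Longrightarrow> X \<subseteq> Y \<or> Y \<subseteq> X"
      using C(2) by (auto simp: subset.chain_def)
    have "orthonormal_on id (\<Union>C)"
      unfolding orthonormal_on_def
    proof (intro ballI)
      fix x y assume "x \<in> \<Union>C" "y \<in> \<Union>C"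
      then obtain X Y where XY: "X \<in> C" "Y \<in> C" "x \<in> X" "y \<in> Y" by blast
      then obtain U where U: "U \<in> C" "x \<in> U" "y \<in> U" using tot[of X Y] by blast
      then have "orthonormal_on id U" using CP by (auto simp: P_def)
      then show "cinner (id x) (id y) = (if x = y then 1 else 0)" using U by (simp add: orthonormal_on_def)
    qed
    then show "\<Union>C \<in> P" using CP C(1) by (auto simp: P_def)
  qed
  then obtain M where M: "M \<in> P" "\<And>X. X \<in> P \<Longrightarrow> M \<subseteq> X \<Longrightarrow> X = M" by blast
  show ?thesis
  proof (rule that[of M], goal_cases)
    case 4
    show ?case
    proof
    assume "\<exists>x. x \<in> W \<and> norm x = 1 \<and> (\<forall>y\<in>M. cinner y x = 0)"
    then obtain x where x: "x \<in> W" "norm x = 1" "\<And>y. y \<in> M \<Longrightarrow> cinner y x = 0" by blast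
    have xx: "cinner x x = 1" using x by (simp add: cinner_self)
    have "cinner x y = 0" if "y \<in> M" for y using x(3)[OF that] cinner_commute[of x y] by simp
    then have "insert x M \<in> P" using M(1) x xx by (auto simp: P_def orthonormal_on_def)
    then have "x \<in> M" using M(2)[of "insert x M"] by blast
    then show False using x(3)[of x] xx by simp
    qed
  qed (use M(1) in \<open>auto simp: P_def\<close>)
qed

text \<open>Every unit vector has a nonzero coefficient against some \<open>e0 k\<close>, and by
  Bessel at most \<open>Suc m\<close> orthonormal vectors have squared coefficient at least
  \<open>1 / Suc m\<close> there.\<close>

lemma orthonormal_countable:
  assumes e0: "orthonormal_basis e0" and S: "orthonormal_on id S"
  shows "countable S"
proof -
  have fin: "finite {x \<in> S. 1 / real (Suc m) \<le> (cmod (cinner x (e0 k)))\<^sup>2}" for k m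
  proof (rule conjunct1[OF finite_if_finite_subsets_card_bdd[where C = "Suc m"]])
    fix F assume F: "F \<subseteq> {x \<in> S. 1 / real (Suc m) \<le> (cmod (cinner x (e0 k)))\<^sup>2}" "finite F"
    then have "orthonormal_on id F" using S by (auto intro: orthonormal_on_subset)
    then have "(\<Sum>x\<in>F. (cmod (cinner x (e0 k)))\<^sup>2) \<le> 1"
      using bessel_inequality[of id F "e0 k"] F orthonormal_basis_norm[OF e0] by simp
    moreover have "(\<Sum>x\<in>F. 1 / real (Suc m)) \<le> (\<Sum>x\<in>F. (cmod (cinner x (e0 k)))\<^sup>2)"
      using F by (intro sum_mono) auto
    moreover have "(\<Sum>x\<in>F. 1 / real (Suc m)) = real (card F) / real (Suc m)" by simp
    ultimately have "real (card F) / real (Suc m) \<le> 1" by linarith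
    then have "real (card F) \<le> real (Suc m)" by (simp add: field_simps)
    then show "card F \<le> Suc m" by (simp only: of_nat_le_iff)
  qed
  have "S \<subseteq> (\<Union>k. \<Union>m. {x \<in> S. 1 / real (Suc m) \<le> (cmod (cinner x (e0 k)))\<^sup>2})"
  proof
    fix x assume x: "x \<in> S"
    have "x \<noteq> 0" using orthonormal_onD[OF S x x] by auto
    then obtain k where "cinner (e0 k) x \<noteq> 0" using e0 unfolding orthonormal_basis_def by blast
    then have "(cmod (cinner x (e0 k)))\<^sup>2 > 0" using cinner_commute[of x "e0 k"] by simp
    then obtain m where "inverse (real (Suc m)) < (cmod (cinner x (e0 k)))\<^sup>2" using reals_Archimedean by blast
    then show "x \<in> (\<Union>k. \<Union>m. {x \<in> S. 1 / real (Suc m) \<le> (cmod (cinner x (e0 k)))\<^sup>2})"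
      using x by (auto simp: inverse_eq_divide intro: less_imp_le)
  qed
  then show ?thesis 
    by (rule countable_subset) (intro countable_UN countableI_type countable_finite fin)
qed

lemma maximal_orthonormal_complete:
  assumes max: "\<nexists>x. norm x = 1 \<and> (\<forall>y\<in>S. cinner y x = 0)"
    and \<psi>: "\<And>y. y \<in> S \<Longrightarrow> cinner y \<psi> = 0"
  shows "\<psi> = 0"
proof (rule ccontr)
  assume "\<psi> \<noteq> 0"
  then have "norm (of_real (1 / norm \<psi>) *\<^sub>C \<psi>) = 1" by (simp add: norm_scaleC norm_divide)
  moreover have "\<forall>y\<in>S. cinner y (of_real (1 / norm \<psi>) *\<^sub>C \<psi>) = 0" by (simp add: \<psi>)
  ultimately show False using max by blast
qed

text \<open>Needed because bases are indexed by all of \<open>nat\<close>. If \<open>S\<close> were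
  finite and complete, counting the squared coefficients of \<open>Suc (card S)\<close> vectors of
  \<open>e0\<close> in two ways would give \<open>Suc (card S) \<le> card S\<close>.\<close>

lemma maximal_orthonormal_infinite:
  assumes e0: "orthonormal_basis e0" and S: "orthonormal_on id S"
    and max: "\<nexists>x. norm x = 1 \<and> (\<forall>y\<in>S. cinner y x = 0)"
  shows "infinite S"
proof
  assume fin: "finite S"
  have eq: "\<psi> = (\<Sum>x\<in>S. cinner x \<psi> *\<^sub>C x)" for \<psi>
  proof -
    have "cinner y (\<psi> - (\<Sum>x\<in>S. cinner x \<psi> *\<^sub>C x)) = 0" if "y \<in> S" for y
      using cinner_orthonormal_sum[OF S fin that, of "\<lambda>x. cinner x \<psi>"] by (simp add: cinner_diff_right)
    then have "\<psi> - (\<Sum>x\<in>S. cinner x \<psi> *\<^sub>C x) = 0" by (rule maximal_orthonormal_complete[OF max])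
    then show ?thesis by simp
  qed
  let ?K = "Suc (card S)"
  have one: "(\<Sum>x\<in>S. (cmod (cinner x \<psi>))\<^sup>2) = (norm \<psi>)\<^sup>2" for \<psi>
    using norm_orthonormal_sum[OF S fin, of "\<lambda>x. cinner x \<psi>"] eq[of \<psi>] by simp
  have "real ?K = (\<Sum>k<?K. \<Sum>x\<in>S. (cmod (cinner x (e0 k)))\<^sup>2)"
    unfolding one orthonormal_basis_norm[OF e0] by simp
  also have "\<dots> = (\<Sum>x\<in>S. \<Sum>k<?K. (cmod (cinner (e0 k) x))\<^sup>2)"
    by (subst sum.swap) (simp add: cinner_commute[of _ "e0 _"])
  also have "\<dots> \<le> (\<Sum>x\<in>S. 1)"
  proof (rule sum_mono)
    fix x assume "x \<in> S"
    then have "complex_of_real ((norm x)\<^sup>2) = 1" using S cinner_self[of x] by (simp add: orthonormal_on_def)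
    then have "(norm x)\<^sup>2 = 1" by (simp only: of_real_eq_1_iff)
    then show "(\<Sum>k<?K. (cmod (cinner (e0 k) x))\<^sup>2) \<le> 1"
      using bessel_inequality[OF orthonormal_basis_on[OF e0, of "{..<?K}"], of x] by simp
  qed
  finally show False by simp
qed

section \<open>Eigenspaces of a self-adjoint operator and a basis adapted to them\<close>

lemma adjoint_op_add: "(\<psi>, \<phi>) \<in> adjoint_op T \<Longrightarrow> (\<psi>', \<phi>') \<in> adjoint_op T \<Longrightarrow> (\<psi> + \<psi>', \<phi> + \<phi>') \<in> adjoint_op T"
  unfolding adjoint_op_def by (fastforce simp: cinner_add_left)

lemma adjoint_op_scaleC: "(\<psi>, \<phi>) \<in> adjoint_op T \<Longrightarrow> (c *\<^sub>C \<psi>, c *\<^sub>C \<phi>) \<in> adjoint_op T"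
  unfolding adjoint_op_def by fastforce

abbreviation real_eigenspace :: "operator \<Rightarrow> real \<Rightarrow> L2 set" where
  "real_eigenspace H \<nu> \<equiv> eigenspace H (complex_of_real \<nu>)"

lemma eigenspace_closed:
  assumes H: "adjoint_op H = H"
  shows "\<psi> \<in> eigenspace H z \<Longrightarrow> \<phi> \<in> eigenspace H z \<Longrightarrow> \<psi> + \<phi> \<in> eigenspace H z"
    and "\<psi> \<in> eigenspace H z \<Longrightarrow> c *\<^sub>C \<psi> \<in> eigenspace H z"
    and "0 \<in> eigenspace H z"
proof -
  show "\<psi> \<in> eigenspace H z \<Longrightarrow> \<phi> \<in> eigenspace H z \<Longrightarrow> \<psi> + \<phi> \<in> eigenspace H z"
    using adjoint_op_add[of \<psi> "z *\<^sub>C \<psi>" H \<phi> "z *\<^sub>C \<phi>"] by (simp add: eigenspace_def H scaleC_add_right)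
  show "\<psi> \<in> eigenspace H z \<Longrightarrow> c *\<^sub>C \<psi> \<in> eigenspace H z"
    using adjoint_op_scaleC[of \<psi> "z *\<^sub>C \<psi>" H c] by (simp add: eigenspace_def H mult.commute)
  have "(0, 0) \<in> adjoint_op H" by (simp add: adjoint_op_def)
  then show "0 \<in> eigenspace H z" by (simp add: eigenspace_def H)
qed

lemma eigenspace_sum:
  assumes "adjoint_op H = H" shows "(\<And>i. i \<in> I \<Longrightarrow> f i \<in> eigenspace H z) \<Longrightarrow> (\<Sum>i\<in>I. f i) \<in> eigenspace H z"
  by (induction I rule: infinite_finite_induct) (auto intro: eigenspace_closed[OF assms])

lemma eigenspace_orthogonal:
  assumes H: "adjoint_op H = H" and "\<psi> \<in> real_eigenspace H \<mu>" "\<phi> \<in> real_eigenspace H \<nu>" "\<mu> \<noteq> \<nu>"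
  shows "cinner \<psi> \<phi> = 0"
proof -
  have "(\<psi>, of_real \<mu> *\<^sub>C \<psi>) \<in> adjoint_op H" "(\<phi>, of_real \<nu> *\<^sub>C \<phi>) \<in> H"
    using assms by (simp_all add: eigenspace_def H)
  then have "cinner \<psi> (of_real \<nu> *\<^sub>C \<phi>) = cinner (of_real \<mu> *\<^sub>C \<psi>) \<phi>"
    by (auto simp: adjoint_op_def)
  then show ?thesis using assms(4) by simp
qed

text \<open>A maximal orthonormal set \<open>S1\<close> of eigenvectors is extended to a maximal
  orthonormal set \<open>S2\<close>. Finite multiplicity makes \<open>S1\<close> span each
  eigenspace by finitely many vectors, so the added vectors are orthogonal to all eigenspaces.
  \<open>J\<close> marks the indices of eigenvectors.\<close>

lemma adapted_basis_exists:
  assumes H: "adjoint_op H = H" and e0: "orthonormal_basis e0"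
    and fd: "\<And>z. z \<in> eigenvalues H \<Longrightarrow> \<exists>B. finite B \<and> eigenspace H z \<subseteq> span B"
  obtains e :: "nat \<Rightarrow> L2" and J \<mu> where "orthonormal_basis e"
    "\<And>n. n \<in> J \<Longrightarrow> e n \<in> real_eigenspace H (\<mu> n)"
    "\<And>n \<nu> \<xi>. n \<notin> J \<Longrightarrow> \<xi> \<in> real_eigenspace H \<nu> \<Longrightarrow> cinner \<xi> (e n) = 0"
    "\<And>\<nu>. finite {n \<in> J. \<mu> n = \<nu>}"
proof -
  define W where "W = (\<Union>\<nu>. real_eigenspace H \<nu>)"
  obtain S1 where S1: "S1 \<subseteq> W" "orthonormal_on id S1"
    "\<nexists>x. x \<in> W \<and> norm x = 1 \<and> (\<forall>y\<in>S1. cinner y x = 0)"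
    by (rule orthonormal_extension[of "{}" W]) (auto simp: orthonormal_on_def)
  obtain S2 where S2: "S1 \<subseteq> S2" "orthonormal_on id S2"
    "\<nexists>x. norm x = 1 \<and> (\<forall>y\<in>S2. cinner y x = 0)"
    by (rule orthonormal_extension[OF S1(2) subset_UNIV]) auto
  have fin: "finite (S1 \<inter> real_eigenspace H \<nu>)" for \<nu>
  proof (cases "S1 \<inter> real_eigenspace H \<nu> = {}")
    case False
    then obtain x where "x \<in> S1" "x \<in> real_eigenspace H \<nu>" by blast
    moreover have "x \<noteq> 0" using orthonormal_onD[OF S1(2) \<open>x \<in> S1\<close> \<open>x \<in> S1\<close>] by auto
    ultimately have "of_real \<nu> \<in> eigenvalues H" by (auto simp: eigenvalues_def)
    then obtain B where B: "finite B" "real_eigenspace H \<nu> \<subseteq> span B" using fd by blast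
    \<comment> \<open>Orthogonality and independence over the reals, matching the real span in which
      finite multiplicity is expressed.\<close>
    have "independent (S1 \<inter> real_eigenspace H \<nu>)"
    proof (rule pairwise_orthogonal_independent)
      show "pairwise orthogonal (S1 \<inter> real_eigenspace H \<nu>)"
        using S1(2) by (auto simp: pairwise_def orthogonal_def inner_L2_def orthonormal_on_def)
      show "0 \<notin> S1 \<inter> real_eigenspace H \<nu>" using orthonormal_onD[OF S1(2), of 0 0] by auto
    qed
    then show ?thesis using independent_span_bound[OF B(1)] B(2) by blast
  qed simp
  \<comment> \<open>The remainder of the expansion is again in this eigenspace and orthogonal to
    \<open>S1\<close>, the members from other eigenspaces included; after normalisation it would
    contradict maximality.\<close>
  have expand: "\<xi> = (\<Sum>x\<in>S1 \<inter> real_eigenspace H \<nu>. cinner x \<xi> *\<^sub>C x)" if \<xi>: "\<xi> \<in> real_eigenspace H \<nu>" for \<xi> \<nu>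
  proof -
    let ?F = "S1 \<inter> real_eigenspace H \<nu>" and ?p = "\<Sum>x\<in>S1 \<inter> real_eigenspace H \<nu>. cinner x \<xi> *\<^sub>C x"
    have "\<xi> + (- 1) *\<^sub>C ?p \<in> real_eigenspace H \<nu>"
      using \<xi> by (intro eigenspace_closed[OF H] eigenspace_sum[OF H]) auto
    then have dE: "\<xi> - ?p \<in> real_eigenspace H \<nu>" by simp
    have orth: "cinner y (\<xi> - ?p) = 0" if yS: "y \<in> S1" for y
    proof (cases "y \<in> real_eigenspace H \<nu>")
      case True
      have "orthonormal_on id ?F" using S1(2) by (rule orthonormal_on_subset) simp
      from cinner_orthonormal_sum[OF this fin, of y "\<lambda>x. cinner x \<xi>"] True yS
      show ?thesis by (simp add: cinner_diff_right)
    next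
      case False
      obtain \<nu>' where "y \<in> real_eigenspace H \<nu>'" using S1(1) yS unfolding W_def by blast
      moreover from this False have "\<nu>' \<noteq> \<nu>" by blast
      ultimately show ?thesis using eigenspace_orthogonal[OF H _ dE] by blast
    qed
    have "\<xi> - ?p = 0"
    proof (rule ccontr)
      assume nz: "\<xi> - ?p \<noteq> 0"
      let ?x = "of_real (1 / norm (\<xi> - ?p)) *\<^sub>C (\<xi> - ?p)"
      have "?x \<in> W" using eigenspace_closed(2)[OF H dE] by (auto simp: W_def)
      moreover have "norm ?x = 1" using nz by (simp add: norm_scaleC norm_divide)
      moreover have "\<forall>y\<in>S1. cinner y ?x = 0" by (simp add: orth)
      ultimately show False using S1(3) by blast
    qed
    then show ?thesis by simp
  qed
  have inf: "infinite S2" by (rule maximal_orthonormal_infinite[OF e0 S2(2,3)])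
  have "countable S2" by (rule orthonormal_countable[OF e0 S2(2)])
  from bij_betw_from_nat_into[OF this inf]
  obtain e :: "nat \<Rightarrow> L2" where e: "bij_betw e UNIV S2" by blast
  have inj: "e j = e k \<longleftrightarrow> j = k" and eS: "e j \<in> S2" for j k
    using e by (auto simp: bij_betw_def inj_def)
  define J where "J = {n. e n \<in> S1}"
  \<comment> \<open>The eigenvalue belonging to \<open>e n\<close> for \<open>n \<in> J\<close>; an
    arbitrary value otherwise.\<close>
  define \<mu> where "\<mu> n = (SOME \<nu>. e n \<in> real_eigenspace H \<nu>)" for n
  have \<mu>: "e n \<in> real_eigenspace H (\<mu> n)" if n: "n \<in> J" for n
  proof -
    have "e n \<in> W" using S1(1) n unfolding J_def by blast
    then have "\<exists>\<nu>. e n \<in> real_eigenspace H \<nu>" unfolding W_def by blast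
    then show ?thesis unfolding \<mu>_def by (rule someI_ex)
  qed
  show ?thesis
  proof (rule that)
    show "orthonormal_basis e"
      unfolding orthonormal_basis_def
    proof (intro conjI allI impI)
      show "cinner (e j) (e k) = (if j = k then 1 else 0)" for j k
        using S2(2) eS inj by (simp add: orthonormal_on_def)
      fix \<psi> assume *: "\<forall>k. cinner (e k) \<psi> = 0"
      have "cinner y \<psi> = 0" if "y \<in> S2" for y
        using * that e by (auto simp: bij_betw_def)
      then show "\<psi> = 0" by (rule maximal_orthonormal_complete[OF S2(3)])
    qed
    show "cinner \<xi> (e n) = 0" if "n \<notin> J" "\<xi> \<in> real_eigenspace H \<nu>" for n \<nu> \<xi>
    proof -
      have "cinner x (e n) = 0" if "x \<in> S1" for x
        using S2(1,2) eS[of n] that \<open>n \<notin> J\<close> by (auto simp: orthonormal_on_def J_def)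
      then have "cinner (\<Sum>x\<in>S1 \<inter> real_eigenspace H \<nu>. cinner x \<xi> *\<^sub>C x) (e n) = 0"
        by (simp add: cinner_sum_left)
      then show ?thesis using expand[OF that(2)] by simp
    qed
    show "finite {n \<in> J. \<mu> n = \<nu>}" for \<nu>
    proof (rule finite_imageD)
      have "e ` {n \<in> J. \<mu> n = \<nu>} \<subseteq> S1 \<inter> real_eigenspace H \<nu>" using \<mu> by (auto simp: J_def)
      then show "finite (e ` {n \<in> J. \<mu> n = \<nu>})" using fin by (rule finite_subset)
    qed (auto simp: inj_on_def inj)
  qed (use \<mu> in auto)
qed

section \<open>Functional calculus and multiplication operators\<close>

locale adapted_basis =
  fixes H :: operator and e :: "nat \<Rightarrow> L2" and J :: "nat set" and \<mu> :: "nat \<Rightarrow> real"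
  assumes H: "adjoint_op H = H" and basis: "orthonormal_basis e"
    and eigen: "\<And>n. n \<in> J \<Longrightarrow> e n \<in> real_eigenspace H (\<mu> n)"
    and compl: "\<And>n \<nu> \<xi>. n \<notin> J \<Longrightarrow> \<xi> \<in> real_eigenspace H \<nu> \<Longrightarrow> cinner \<xi> (e n) = 0"
    and fin: "\<And>\<nu>. finite {n \<in> J. \<mu> n = \<nu>}"
begin

lemma on: "orthonormal_on e I"
  by (rule orthonormal_basis_on[OF basis])

lemma cinner_e: "cinner (e j) (e k) = (if j = k then 1 else 0)"
  using basis by (simp add: orthonormal_basis_def)

lemma mu_eigenvalue: assumes "n \<in> J" shows "of_real (\<mu> n) \<in> eigenvalues H"
proof -
  have "e n \<noteq> 0" using orthonormal_basis_norm[OF basis, of n] by auto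
  then show ?thesis using eigen[OF assms] unfolding eigenvalues_def by blast
qed

lemma eigenspace_coeff:
  assumes "\<xi> \<in> real_eigenspace H \<nu>" "\<not> (n \<in> J \<and> \<mu> n = \<nu>)" shows "cinner \<xi> (e n) = 0"
  using assms compl[of n \<xi> \<nu>] eigenspace_orthogonal[OF H assms(1) eigen[of n]] by blast

lemma orth_proj_eq:
  "orth_proj (real_eigenspace H \<nu>) \<psi> = (\<Sum>n\<in>{n \<in> J. \<mu> n = \<nu>}. cinner (e n) \<psi> *\<^sub>C e n)"
  unfolding orth_proj_def
proof (rule the_equality)
  let ?F = "{n \<in> J. \<mu> n = \<nu>}"
  let ?p = "\<Sum>n\<in>?F. cinner (e n) \<psi> *\<^sub>C e n"
  have pE: "?p \<in> real_eigenspace H \<nu>"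
    using eigen by (intro eigenspace_sum[OF H] eigenspace_closed[OF H]) auto
  have orth: "cinner \<xi> (\<psi> - ?p) = 0" if \<xi>: "\<xi> \<in> real_eigenspace H \<nu>" for \<xi>
  proof -
    have "cinner \<xi> (e n) * cinner (e n) (\<psi> - ?p) = 0" for n
    proof (cases "n \<in> ?F")
      case True
      then show ?thesis
        using cinner_orthonormal_sum[OF on fin True, of "\<lambda>n. cinner (e n) \<psi>"] by (simp add: cinner_diff_right)
    qed (use eigenspace_coeff[OF \<xi>] in auto)
    then have "(\<lambda>n. 0) sums cinner \<xi> (\<psi> - ?p)" using parseval_cinner[OF basis, of \<xi> "\<psi> - ?p"] by (simp only:)
    then show ?thesis using sums_unique2[OF _ sums_zero] by blast
  qed
  show "?p \<in> real_eigenspace H \<nu> \<and> (\<forall>\<xi>\<in>real_eigenspace H \<nu>. cinner \<xi> (\<psi> - ?p) = 0)" using pE orth by blast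
  fix \<phi> assume \<phi>: "\<phi> \<in> real_eigenspace H \<nu> \<and> (\<forall>\<xi>\<in>real_eigenspace H \<nu>. cinner \<xi> (\<psi> - \<phi>) = 0)"
  have "?p + (- 1) *\<^sub>C \<phi> \<in> real_eigenspace H \<nu>"
    using \<phi> pE by (intro eigenspace_closed[OF H]) auto
  then have d: "?p - \<phi> \<in> real_eigenspace H \<nu>" by simp
  have "cinner (?p - \<phi>) (?p - \<phi>) = cinner (?p - \<phi>) (\<psi> - \<phi>) - cinner (?p - \<phi>) (\<psi> - ?p)"
    by (simp add: cinner_diff_right)
  also have "\<dots> = 0" using \<phi> orth[OF d] d by simp
  finally have "?p - \<phi> = 0" by (simp add: cinner_self)
  then show "\<phi> = ?p" by simp
qed

lemma fun_calc_iff: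
  "(\<psi>, \<phi>) \<in> fun_calc f H \<longleftrightarrow>
    ((\<lambda>\<nu>. \<Sum>n\<in>{n \<in> J. \<mu> n = \<nu>}. (f \<nu> * cinner (e n) \<psi>) *\<^sub>C e n) has_sum \<phi>) {\<nu>. of_real \<nu> \<in> eigenvalues H}"
  unfolding fun_calc_def by (simp add: orth_proj_eq scaleC_sum_right)

text \<open>Only the group of the eigenvalue \<open>\<mu> n\<close> has a component along
  \<open>e n\<close>, and for \<open>n\<close> outside \<open>J\<close> no group has one: the
  calculus annihilates the vectors added to complete the basis.\<close>

lemma fun_calc_coeff:
  assumes "(\<psi>, \<phi>) \<in> fun_calc f H"
  shows "cinner (e n) \<phi> = (if n \<in> J then f (\<mu> n) * cinner (e n) \<psi> else 0)"
proof -
  let ?M = "{\<nu>. complex_of_real \<nu> \<in> eigenvalues H}"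
  let ?t = "\<lambda>\<nu>. cinner (e n) (\<Sum>n\<in>{n \<in> J. \<mu> n = \<nu>}. (f \<nu> * cinner (e n) \<psi>) *\<^sub>C e n)"
  have t: "?t \<nu> = (if n \<in> J \<and> \<mu> n = \<nu> then f (\<mu> n) * cinner (e n) \<psi> else 0)" for \<nu>
  proof (cases "n \<in> J \<and> \<mu> n = \<nu>")
    case True
    then have "n \<in> {n \<in> J. \<mu> n = \<nu>}" by simp
    from cinner_orthonormal_sum[OF on fin this, of "\<lambda>n. f \<nu> * cinner (e n) \<psi>"] True show ?thesis by simp
  next
    case False
    then have "?t \<nu> = (\<Sum>n\<in>{n \<in> J. \<mu> n = \<nu>}. 0)"
      unfolding cinner_sum_right by (intro sum.cong refl) (auto simp: cinner_e)
    then show ?thesis unfolding if_not_P[OF False] by simp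
  qed
  have "(?t has_sum cinner (e n) \<phi>) ?M"
    using assms unfolding fun_calc_iff by (rule has_sum_bounded_linear[OF bounded_linear_cinner_right])
  moreover have "(?t has_sum (if n \<in> J then f (\<mu> n) * cinner (e n) \<psi> else 0)) ?M"
    unfolding t
    by (rule has_sum_finite_neutralI[where B = "if n \<in> J then {\<mu> n} else {}"])
       (auto simp: mu_eigenvalue split: if_splits)
  ultimately show ?thesis by (rule has_sum_unique)
qed

text \<open>Absolute summability makes the calculus defined everywhere. The series over
  \<open>n\<close> is regrouped by eigenvalue, each group being finite by
  \<open>fin\<close>.\<close>

lemma fun_calc_series:
  assumes s: "summable (\<lambda>n. if n \<in> J then cmod (f (\<mu> n)) else 0)"
  shows "(\<psi>, \<Sum>n. (if n \<in> J then f (\<mu> n) * cinner (e n) \<psi> else 0) *\<^sub>C e n) \<in> fun_calc f H"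
proof -
  let ?M = "{\<nu>. complex_of_real \<nu> \<in> eigenvalues H}"
  let ?g = "\<lambda>n. (if n \<in> J then f (\<mu> n) * cinner (e n) \<psi> else 0) *\<^sub>C e n"
  let ?h = "\<lambda>n. (f (\<mu> n) * cinner (e n) \<psi>) *\<^sub>C e n"
  have sm: "summable (\<lambda>n. norm (?g n))"
  proof (rule summable_comparison_test'[OF summable_mult2[OF s, of "norm \<psi>"]])
    show "norm (norm (?g n)) \<le> (if n \<in> J then cmod (f (\<mu> n)) else 0) * norm \<psi>" for n
      using mult_left_mono[OF cinner_cauchy_schwarz[of "e n" \<psi>], of "cmod (f (\<mu> n))"] orthonormal_basis_norm[OF basis, of n]
      by (auto simp: norm_scaleC norm_mult)
  qed
  have "(?g has_sum suminf ?g) UNIV"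
    by (rule norm_summable_imp_has_sum[OF sm summable_sums[OF summable_norm_cancel[OF sm]]])
  moreover have "(?g has_sum suminf ?g) UNIV \<longleftrightarrow> (?h has_sum suminf ?g) J"
    by (rule has_sum_cong_neutral) auto
  ultimately have hJ: "(?h has_sum suminf ?g) J" by blast
  let ?S = "Sigma ?M (\<lambda>\<nu>. {n \<in> J. \<mu> n = \<nu>})"
  have "bij_betw (\<lambda>n. (\<mu> n, n)) J ?S"
    by (rule bij_betwI[where g = snd]) (auto simp: mu_eigenvalue)
  then have "((\<lambda>(\<nu>, n). (f \<nu> * cinner (e n) \<psi>) *\<^sub>C e n) has_sum suminf ?g) ?S"
    using has_sum_reindex_bij_betw[of "\<lambda>n. (\<mu> n, n)" J ?S "\<lambda>(\<nu>, n). (f \<nu> * cinner (e n) \<psi>) *\<^sub>C e n" "suminf ?g"] hJ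
    by simp
  then have "((\<lambda>\<nu>. \<Sum>n\<in>{n \<in> J. \<mu> n = \<nu>}. (f \<nu> * cinner (e n) \<psi>) *\<^sub>C e n) has_sum suminf ?g) ?M"
    by (rule has_sum_SigmaD) (use fin in \<open>auto intro!: has_sum_finite\<close>)
  then show ?thesis unfolding fun_calc_iff .
qed

end

section \<open>Multiplication operators: symmetry, density of the domain, closedness\<close>

lemma mult_op_iff:
  "(\<psi>, \<phi>) \<in> mult_op A \<longleftrightarrow> (\<exists>f. square_integrable f \<and> square_integrable (\<lambda>x. of_real (A x) * f x) \<and>
      \<psi> = abs_L2 f \<and> \<phi> = abs_L2 (\<lambda>x. of_real (A x) * f x))"
  unfolding mult_op_def by auto

lemma mult_op_symmetric:
  assumes "(\<psi>, \<psi>') \<in> mult_op A" "(\<phi>, \<phi>') \<in> mult_op A"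
  shows "cinner \<psi>' \<phi> = cinner \<psi> \<phi>'"
  using assms by (auto simp: mult_op_iff cinner_abs_L2 mult_ac)

lemma mult_op_scaleC: "(\<psi>, \<phi>) \<in> mult_op A \<Longrightarrow> (c *\<^sub>C \<psi>, c *\<^sub>C \<phi>) \<in> mult_op A"
proof -
  assume "(\<psi>, \<phi>) \<in> mult_op A"
  then obtain f where f: "square_integrable f" "square_integrable (\<lambda>x. of_real (A x) * f x)"
    "\<psi> = abs_L2 f" "\<phi> = abs_L2 (\<lambda>x. of_real (A x) * f x)" by (auto simp: mult_op_iff)
  have eq: "(\<lambda>x. c * (of_real (A x) * f x)) = (\<lambda>x. of_real (A x) * (c * f x))" by (simp add: mult.left_commute)
  show ?thesis
    unfolding mult_op_iff using f square_integrable_mult[OF f(1), of c] square_integrable_mult[OF f(2), of c]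
    by (intro exI[of _ "\<lambda>x. c * f x"]) (simp add: scaleC_abs_L2 eq)
qed

lemma square_integrable_restrict:
  assumes f: "square_integrable f" and [measurable]: "A \<in> borel_measurable borel"
  defines "g k x \<equiv> (if \<bar>A x\<bar> \<le> real k then f x else 0)"
  shows "square_integrable (g k)" and "square_integrable (\<lambda>x. of_real (A x) * g k x)"
    and "(\<lambda>k. abs_L2 (g k)) \<longlonglongrightarrow> abs_L2 f"
proof -
  have [measurable]: "f \<in> borel_measurable borel" using f by (rule square_integrable_measurable)
  have [measurable]: "g k \<in> borel_measurable borel" for k unfolding g_def by measurable
  have f2: "integrable lborel (\<lambda>x. (cmod (f x))\<^sup>2)" using f by (simp add: square_integrable_def)
  show gs: "square_integrable (g k)" for k
    unfolding square_integrable_def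
    by (intro conjI Bochner_Integration.integrable_bound[OF f2]) (auto simp: g_def)
  show "square_integrable (\<lambda>x. of_real (A x) * g k x)"
    unfolding square_integrable_def
  proof (intro conjI Bochner_Integration.integrable_bound[OF integrable_mult_right[OF f2, of "(real k)\<^sup>2"]])
    have "(cmod (of_real (A x) * g k x))\<^sup>2 \<le> (real k)\<^sup>2 * (cmod (f x))\<^sup>2" for x
      by (auto simp: g_def norm_mult power_mult_distrib abs_le_square_iff[symmetric] intro!: mult_right_mono)
    then show "AE x in lborel. norm ((cmod (of_real (A x) * g k x))\<^sup>2) \<le> norm ((real k)\<^sup>2 * (cmod (f x))\<^sup>2)"
      by (intro AE_I2) simp
  qed measurable
  have d: "square_integrable (\<lambda>x. g k x + (- 1) * f x)" for k
    by (intro square_integrable_add square_integrable_mult gs f)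
  have dn: "(norm (abs_L2 (g k) - abs_L2 f))\<^sup>2 = (\<integral>x. (cmod (g k x - f x))\<^sup>2 \<partial>lborel)" for k
  proof -
    have "abs_L2 (g k) - abs_L2 f = abs_L2 (g k) + (- 1) *\<^sub>C abs_L2 f" by simp
    also have "\<dots> = abs_L2 (\<lambda>x. g k x + (- 1) * f x)"
      by (simp only: scaleC_abs_L2[OF f] plus_abs_L2[OF gs square_integrable_mult[OF f]])
    finally show ?thesis using norm_abs_L2[OF d, of k] by simp
  qed
  have "(\<lambda>k. \<integral>x. (cmod (g k x - f x))\<^sup>2 \<partial>lborel) \<longlonglongrightarrow> (\<integral>x. 0 \<partial>(lborel :: real measure))"
  proof (rule integral_dominated_convergence[OF _ _ f2])
    show "AE x in lborel. (\<lambda>k. (cmod (g k x - f x))\<^sup>2) \<longlonglongrightarrow> 0"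
    proof (intro AE_I2)
      fix x
      obtain n where n: "\<bar>A x\<bar> \<le> real n" using real_arch_simple by blast
      then have "(cmod (g k x - f x))\<^sup>2 = 0" if "k \<ge> n" for k using that by (simp add: g_def)
      then show "(\<lambda>k. (cmod (g k x - f x))\<^sup>2) \<longlonglongrightarrow> 0"
        by (intro tendsto_eventually eventually_sequentiallyI[of n])
    qed
  qed (auto simp: g_def)
  then have "(\<lambda>k. (norm (abs_L2 (g k) - abs_L2 f))\<^sup>2) \<longlonglongrightarrow> 0" by (simp add: dn)
  then have "(\<lambda>k. norm (abs_L2 (g k) - abs_L2 f)) \<longlonglongrightarrow> 0"
    using tendsto_real_sqrt[of "\<lambda>k. (norm (abs_L2 (g k) - abs_L2 f))\<^sup>2" 0] by simp
  then have "(\<lambda>k. abs_L2 (g k) - abs_L2 f) \<longlonglongrightarrow> 0" by (rule tendsto_norm_zero_cancel)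
  then show "(\<lambda>k. abs_L2 (g k)) \<longlonglongrightarrow> abs_L2 f" by (rule LIM_zero_cancel)
qed

lemma mult_op_dense:
  assumes "A \<in> borel_measurable borel"
  obtains X where "\<And>k. X k \<in> Domain (mult_op A)" "X \<longlonglongrightarrow> \<psi>"
proof -
  define f where "f = rep_L2 \<psi>"
  have f: "square_integrable f" "\<psi> = abs_L2 f" by (simp_all add: f_def)
  note r = square_integrable_restrict[OF f(1) assms]
  show ?thesis
  proof (rule that)
    show "abs_L2 (\<lambda>x. if \<bar>A x\<bar> \<le> real k then f x else 0) \<in> Domain (mult_op A)" for k
      using r(1,2)[of k] by (auto simp: Domain_iff mult_op_iff)
  qed (use r(3) f in simp)
qed

text \<open>By symmetry the limit pair satisfies \<open>cinner u' \<psi> = cinner u \<phi>\<close>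
  for all \<open>(u, u')\<close> in the graph. Testing with g - A f, cut off to |A| \<le> k so that
  it lies in the domain, shows that its squared norm vanishes for every \<open>k\<close>.\<close>

lemma mult_op_closed_under_limits:
  assumes A[measurable]: "A \<in> borel_measurable borel"
    and XY: "\<And>k. (X k, Y k) \<in> mult_op A" and X: "X \<longlonglongrightarrow> \<psi>" and Y: "Y \<longlonglongrightarrow> \<phi>"
  shows "(\<psi>, \<phi>) \<in> mult_op A"
proof -
  define f where "f = rep_L2 \<psi>"
  define g where "g = rep_L2 \<phi>"
  have f: "square_integrable f" "\<psi> = abs_L2 f" and g: "square_integrable g" "\<phi> = abs_L2 g"
    by (simp_all add: f_def g_def)
  have [measurable]: "f \<in> borel_measurable borel" "g \<in> borel_measurable borel"
    using f g by (auto intro: square_integrable_measurable)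
  have sym: "cinner u' \<psi> = cinner u \<phi>" if "(u, u') \<in> mult_op A" for u u'
  proof -
    have "(\<lambda>k. cinner u (Y k)) \<longlonglongrightarrow> cinner u \<phi>" by (rule tendsto_cinner_right[OF Y])
    moreover have "(\<lambda>k. cinner u (Y k)) = (\<lambda>k. cinner u' (X k))"
      using mult_op_symmetric[OF that XY] by simp
    ultimately have "(\<lambda>k. cinner u' (X k)) \<longlonglongrightarrow> cinner u \<phi>" by simp
    then show ?thesis using tendsto_cinner_right[OF X] LIMSEQ_unique by blast
  qed
  have aek: "AE x in lborel. \<bar>A x\<bar> \<le> real k \<longrightarrow> g x = of_real (A x) * f x" for k
  proof -
    let ?f = "\<lambda>x. if \<bar>A x\<bar> \<le> real k then f x else 0"
    let ?g = "\<lambda>x. if \<bar>A x\<bar> \<le> real k then g x else 0"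
    note rf = square_integrable_restrict(1,2)[OF f(1) A, of k]
    note rg = square_integrable_restrict(1,2)[OF g(1) A, of k]
    define h where "h x = ?g x + (- 1) * (of_real (A x) * ?f x)" for x
    have h: "square_integrable h"
      unfolding h_def[abs_def] by (intro square_integrable_add square_integrable_mult rf rg)
    have "square_integrable (\<lambda>x. of_real (A x) * (if \<bar>A x\<bar> \<le> real k then h x else 0))"
      by (rule square_integrable_restrict(2)[OF h A])
    moreover have "(if \<bar>A x\<bar> \<le> real k then h x else 0) = h x" for x by (simp add: h_def)
    ultimately have Ah: "square_integrable (\<lambda>x. of_real (A x) * h x)" by simp
    have "(abs_L2 h, abs_L2 (\<lambda>x. of_real (A x) * h x)) \<in> mult_op A" using h Ah by (auto simp: mult_op_iff)
    from sym[OF this] have eq: "(\<integral>x. cnj (of_real (A x) * h x) * f x \<partial>lborel) = (\<integral>x. cnj (h x) * g x \<partial>lborel)"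
      using f g h Ah by (simp add: cinner_abs_L2)
    have "complex_of_real ((norm (abs_L2 h))\<^sup>2) = (\<integral>x. cnj (h x) * h x \<partial>lborel)"
      using cinner_self[of "abs_L2 h"] h by (simp add: cinner_abs_L2)
    also have "\<dots> = (\<integral>x. cnj (h x) * g x - cnj (of_real (A x) * h x) * f x \<partial>lborel)"
      by (intro Bochner_Integration.integral_cong refl) (auto simp: h_def algebra_simps)
    also have "\<dots> = (\<integral>x. cnj (h x) * g x \<partial>lborel) - (\<integral>x. cnj (of_real (A x) * h x) * f x \<partial>lborel)"
      by (intro Bochner_Integration.integral_diff square_integrable_cnj_mult h Ah f g)
    finally have "norm (abs_L2 h) = 0" using eq by simp
    then have "abs_L2 h = abs_L2 (\<lambda>x. 0)" by (simp add: zero_abs_L2[symmetric])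
    then have "AE x in lborel. h x = 0" using abs_L2_eq_iff[OF h square_integrable_0] by simp
    then show ?thesis by eventually_elim (auto simp: h_def)
  qed
  have "AE x in lborel. \<forall>k. \<bar>A x\<bar> \<le> real k \<longrightarrow> g x = of_real (A x) * f x"
    unfolding AE_all_countable using aek by blast
  then have ae: "AE x in lborel. g x = of_real (A x) * f x"
    by eventually_elim (meson real_arch_simple)
  have "square_integrable (\<lambda>x. of_real (A x) * f x)"
  proof -
    have "integrable lborel (\<lambda>x. (cmod (of_real (A x) * f x))\<^sup>2)"
      by (rule integrable_cong_AE[THEN iffD1, of "\<lambda>x. (cmod (g x))\<^sup>2"])
         (use ae g in \<open>auto simp: square_integrable_def elim: eventually_mono\<close>)
    then show ?thesis unfolding square_integrable_def by simp
  qed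
  moreover from this have "abs_L2 g = abs_L2 (\<lambda>x. of_real (A x) * f x)"
    using abs_L2_eq_iff[OF g(1)] ae by simp
  ultimately show ?thesis unfolding mult_op_iff using f g by blast
qed

section \<open>Square roots of positive operators\<close>

lemma bounded_clinearD:
  assumes "bounded_clinear T"
  shows "bounded_linear T" "T (c *\<^sub>C \<psi>) = c *\<^sub>C T \<psi>" "T (\<phi> + \<psi>) = T \<phi> + T \<psi>" "T (\<phi> - \<psi>) = T \<phi> - T \<psi>" "T 0 = 0"
  using assms bounded_linear.axioms(1)[of T] by (auto simp: bounded_clinear_def linear_add linear_diff linear_0 bounded_linear.linear)

lemma bounded_clinearI:
  assumes "\<And>\<phi> \<psi>. T (\<phi> + \<psi>) = T \<phi> + T \<psi>" "\<And>c \<psi>. T (c *\<^sub>C \<psi>) = c *\<^sub>C T \<psi>" "\<And>\<psi>. norm (T \<psi>) \<le> K * norm \<psi>"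
  shows "bounded_clinear T"
  unfolding bounded_clinear_def using assms
  by (auto intro!: bounded_linear_intro[where K = K] simp: scaleR_scaleC mult.commute)

text \<open>The coefficients of \<open>1 - sqrt (1 - y)\<close>, the power series solution \<open>R\<close> of \<open>2 * R = y + R\<^sup>2\<close>.\<close>

fun sqrt_coeff :: "nat \<Rightarrow> real" where
  "sqrt_coeff 0 = 0"
| "sqrt_coeff (Suc n) = ((if n = 0 then 1 else 0) + (\<Sum>i<n. sqrt_coeff (Suc i) * sqrt_coeff (n - i))) / 2"

declare sqrt_coeff.simps(2) [simp del]

lemma sqrt_coeff_nonneg: "0 \<le> sqrt_coeff n"
proof (induction n rule: less_induct)
  case (less n)
  show ?case
  proof (cases n)
    case (Suc k)
    have "0 \<le> sqrt_coeff (Suc i) * sqrt_coeff (k - i)" if "i < k" for i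
      using that by (intro mult_nonneg_nonneg less) (auto simp: Suc)
    then have "0 \<le> (\<Sum>i<k. sqrt_coeff (Suc i) * sqrt_coeff (k - i))" by (intro sum_nonneg) auto
    then show ?thesis unfolding Suc sqrt_coeff.simps(2)[of k] by simp
  qed simp
qed

lemma sqrt_coeff_conv:
  "(\<Sum>i\<le>n. sqrt_coeff i * sqrt_coeff (n - i)) = 2 * sqrt_coeff n - (if n = 1 then 1 else 0)"
proof (cases n)
  case (Suc k)
  have "(\<Sum>i\<le>Suc k. sqrt_coeff i * sqrt_coeff (Suc k - i)) = (\<Sum>i\<le>k. sqrt_coeff (Suc i) * sqrt_coeff (k - i))"
    by (subst sum.atMost_Suc_shift) simp
  also have "\<dots> = (\<Sum>i<k. sqrt_coeff (Suc i) * sqrt_coeff (k - i))"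
    by (simp add: lessThan_Suc_atMost[symmetric])
  finally show ?thesis unfolding Suc sqrt_coeff.simps(2)[of k] by simp
qed simp

text \<open>Summing the convolution identity up to \<open>Suc N\<close> gives 2 s - 1 on one side,
  with s the new partial sum. As \<open>sqrt_coeff 0 = 0\<close>, pairs with a member above
  \<open>N\<close> contribute nothing, so the other side is at most the square of the old partial
  sum, hence at most 1.\<close>

lemma sqrt_coeff_sum_le: "(\<Sum>n\<le>N. sqrt_coeff n) \<le> 1"
proof (induction N)
  case (Suc N)
  let ?r = sqrt_coeff
  let ?T = "{(i, j). i + j \<le> Suc N}"
  have fin: "finite ?T" by (rule finite_subset[of _ "{..Suc N} \<times> {..Suc N}"]) auto
  have "(\<Sum>n\<le>Suc N. \<Sum>i\<le>n. ?r i * ?r (n - i)) = (\<Sum>(i, j)\<in>?T. ?r i * ?r j)"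
    by (rule sum.triangle_reindex_eq[symmetric])
  also have "\<dots> = (\<Sum>(i, j)\<in>?T \<inter> {..N} \<times> {..N}. ?r i * ?r j)"
  proof (rule sum.mono_neutral_right[OF fin])
    show "\<forall>p\<in>?T - ?T \<inter> {..N} \<times> {..N}. (case p of (i, j) \<Rightarrow> ?r i * ?r j) = 0"
    proof
      fix p assume p: "p \<in> ?T - ?T \<inter> {..N} \<times> {..N}"
      obtain i j where ij: "p = (i, j)" by (cases p)
      have "i = 0 \<or> j = 0" using p unfolding ij by auto
      then show "(case p of (i, j) \<Rightarrow> ?r i * ?r j) = 0" unfolding ij by auto
    qed
  qed auto
  also have "\<dots> \<le> (\<Sum>(i, j)\<in>{..N} \<times> {..N}. ?r i * ?r j)"
    by (intro sum_mono2) (auto intro: mult_nonneg_nonneg sqrt_coeff_nonneg)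
  also have "\<dots> = (\<Sum>n\<le>N. ?r n) * (\<Sum>n\<le>N. ?r n)"
    by (simp add: sum_product sum.cartesian_product)
  also have "\<dots> \<le> 1 * 1"
    using Suc.IH by (intro mult_mono sum_nonneg sqrt_coeff_nonneg) auto
  finally have "(\<Sum>n\<le>Suc N. 2 * ?r n - (if n = 1 then 1 else 0)) \<le> 1"
    unfolding sqrt_coeff_conv by simp
  then have "2 * (\<Sum>n\<le>Suc N. ?r n) - 1 \<le> 1"
    unfolding sum_subtractf sum_distrib_left[symmetric] by (subst (asm) sum.delta) auto
  then show ?case by simp
qed simp

lemma sqrt_coeff_summable: "summable sqrt_coeff"
proof (rule summableI_nonneg_bounded[where x = 1])
  show "(\<Sum>i<n. sqrt_coeff i) \<le> 1" for n
    using sqrt_coeff_sum_le[of n] sum_mono2[of "{..n}" "{..<n}" sqrt_coeff] sqrt_coeff_nonneg by force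
qed (rule sqrt_coeff_nonneg)

lemma sqrt_coeff_suminf_le: "suminf sqrt_coeff \<le> 1"
proof (rule suminf_le_const[OF sqrt_coeff_summable])
  show "(\<Sum>i<n. sqrt_coeff i) \<le> 1" for n
    using sqrt_coeff_sum_le[of n] sum_mono2[of "{..n}" "{..<n}" sqrt_coeff] sqrt_coeff_nonneg by force
qed

text \<open>A Tonelli criterion phrased with bounds on finite partial row sums, the form in which
  Bessel's inequality delivers them.\<close>

lemma double_series_abs_summable:
  fixes t :: "nat \<Rightarrow> nat \<Rightarrow> 'a :: banach"
  assumes le: "\<And>i F. finite F \<Longrightarrow> (\<Sum>j\<in>F. norm (t i j)) \<le> u i" and u: "summable u"
  shows "(\<lambda>j. norm (t i j)) summable_on UNIV" "\<exists>s. ((\<lambda>(i, j). t i j) has_sum s) (UNIV \<times> UNIV)"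
proof -
  have row: "(\<lambda>j. norm (t i j)) summable_on UNIV" for i
    by (rule nonneg_bounded_partial_sums_imp_summable_on[where C = "u i"])
       (auto intro!: eventually_finite_subsets_at_top_weakI le)
  then show "(\<lambda>j. norm (t i j)) summable_on UNIV" .
  have u0: "0 \<le> u i" for i using le[of "{}" i] by simp
  have us: "u summable_on UNIV" by (rule norm_summable_imp_summable_on) (use u u0 in simp)
  have inf: "0 \<le> (\<Sum>\<^sub>\<infinity>j. norm (t i j))" "(\<Sum>\<^sub>\<infinity>j. norm (t i j)) \<le> u i" for i
    by (auto intro: infsum_nonneg infsum_le_finite_sums[OF row] le)
  have "(\<lambda>i. norm (\<Sum>\<^sub>\<infinity>j. norm (t i j))) summable_on UNIV"
    by (rule summable_on_comparison_test[OF us]) (use inf in auto)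
  then have "(\<lambda>p. norm (case p of (i, j) \<Rightarrow> t i j)) summable_on (UNIV \<times> UNIV)"
    unfolding Infinite_Sum.abs_summable_on_Sigma_iff using row by auto
  then have "(\<lambda>(i, j). t i j) summable_on (UNIV \<times> UNIV)"
    by (rule Infinite_Sum.abs_summable_summable)
  then show "\<exists>s. ((\<lambda>(i, j). t i j) has_sum s) (UNIV \<times> UNIV)"
    by (simp add: summable_on_def)
qed

lemma has_sum_of_sums:
  fixes f :: "nat \<Rightarrow> 'a :: banach"
  assumes "(\<lambda>j. norm (f j)) summable_on UNIV" "f sums s"
  shows "(f has_sum s) UNIV"
proof -
  have *: "(f has_sum infsum f UNIV) UNIV"
    by (rule has_sum_infsum[OF Infinite_Sum.abs_summable_summable[OF assms(1)]])
  show ?thesis using * sums_unique2[OF has_sum_imp_sums[OF *] assms(2)] by simp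
qed

text \<open>Put Y = 1 - X, a contraction, and let R be the series of 1 - sqrt (1 - y) evaluated at
  Y. From R^2 = 2 R - Y it follows that P = 1 - R has square 1 - Y = X. As the coefficients are
  nonnegative with sum at most 1, R is again a contraction, which is the last claim.\<close>

lemma positive_sqrt_exists:
  assumes X: "bounded_clinear X" and sym: "\<And>\<phi> \<psi>. cinner \<phi> (X \<psi>) = cinner (X \<phi>) \<psi>"
    and contr: "\<And>\<psi>. norm (\<psi> - X \<psi>) \<le> norm \<psi>"
  obtains P where "bounded_clinear P" "\<And>\<phi> \<psi>. cinner \<phi> (P \<psi>) = cinner (P \<phi>) \<psi>"
    "\<And>\<psi>. P (P \<psi>) = X \<psi>" "\<And>\<psi>. norm (\<psi> - P \<psi>) \<le> norm \<psi>"
proof -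
  define Y where "Y \<psi> = \<psi> - X \<psi>" for \<psi>
  let ?r = sqrt_coeff
  let ?Y = "\<lambda>n. (Y ^^ n)"
  have Yn: "norm (?Y n \<psi>) \<le> norm \<psi>" for n \<psi>
    by (induction n) (auto intro: order_trans[OF contr[folded Y_def]])
  have Yadd: "?Y n (\<phi> + \<psi>) = ?Y n \<phi> + ?Y n \<psi>" for n \<phi> \<psi>
    by (induction n) (simp_all add: Y_def bounded_clinearD(3)[OF X])
  have Yscale: "?Y n (c *\<^sub>C \<psi>) = c *\<^sub>C ?Y n \<psi>" for n c \<psi>
    by (induction n) (simp_all add: Y_def bounded_clinearD(2)[OF X] scaleC_diff_right)
  have Ylin: "bounded_linear (?Y n)" for n
    using bounded_clinearI[of "?Y n" 1] Yadd Yscale Yn by (auto simp: bounded_clinear_def)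
  have Ysym: "cinner \<phi> (?Y n \<psi>) = cinner (?Y n \<phi>) \<psi>" for n \<phi> \<psi>
  proof (induction n arbitrary: \<phi> \<psi>)
    case (Suc n)
    have "cinner \<phi> (?Y (Suc n) \<psi>) = cinner (Y \<phi>) (?Y n \<psi>)"
      by (simp add: Y_def cinner_diff_left cinner_diff_right sym)
    also have "\<dots> = cinner (?Y n (Y \<phi>)) \<psi>" by (rule Suc.IH)
    finally show ?case by (simp add: funpow_swap1)
  qed simp
  have nle: "norm (?r n *\<^sub>R ?Y n \<psi>) \<le> ?r n * norm \<psi>" for n \<psi>
    using Yn[of n \<psi>] sqrt_coeff_nonneg[of n] by (simp add: mult_left_mono)
  have sm: "summable (\<lambda>n. norm (?r n *\<^sub>R ?Y n \<psi>))" for \<psi>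
    by (rule summable_comparison_test'[OF summable_mult2[OF sqrt_coeff_summable, of "norm \<psi>"]]) (use nle in auto)
  define R where "R \<psi> = (\<Sum>n. ?r n *\<^sub>R ?Y n \<psi>)" for \<psi>
  have Rs: "(\<lambda>n. ?r n *\<^sub>R ?Y n \<psi>) sums R \<psi>" for \<psi>
    unfolding R_def by (rule summable_sums[OF summable_norm_cancel[OF sm]])
  have Rn: "norm (R \<psi>) \<le> norm \<psi>" for \<psi>
  proof -
    have "norm (R \<psi>) \<le> (\<Sum>n. norm (?r n *\<^sub>R ?Y n \<psi>))" unfolding R_def by (rule summable_norm[OF sm])
    also have "\<dots> \<le> (\<Sum>n. ?r n * norm \<psi>)"
      by (intro suminf_le nle sm summable_mult2 sqrt_coeff_summable)
    also have "\<dots> = suminf ?r * norm \<psi>" by (rule suminf_mult2[OF sqrt_coeff_summable, symmetric])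
    also have "\<dots> \<le> 1 * norm \<psi>" by (intro mult_right_mono sqrt_coeff_suminf_le) auto
    finally show ?thesis by simp
  qed
  have Radd: "R (\<phi> + \<psi>) = R \<phi> + R \<psi>" for \<phi> \<psi>
  proof (rule sums_unique2[OF Rs])
    show "(\<lambda>n. ?r n *\<^sub>R ?Y n (\<phi> + \<psi>)) sums (R \<phi> + R \<psi>)"
      unfolding Yadd scaleR_add_right by (intro sums_add Rs)
  qed
  have Rscale: "R (c *\<^sub>C \<psi>) = c *\<^sub>C R \<psi>" for c \<psi>
  proof -
    have "(\<lambda>n. c *\<^sub>C (?r n *\<^sub>R ?Y n \<psi>)) sums (c *\<^sub>C R \<psi>)"
      by (rule bounded_linear.sums[OF bounded_linear_scaleC Rs])
    also have "(\<lambda>n. c *\<^sub>C (?r n *\<^sub>R ?Y n \<psi>)) = (\<lambda>n. ?r n *\<^sub>R ?Y n (c *\<^sub>C \<psi>))"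
      by (simp add: Yscale scaleR_scaleC mult.commute)
    finally show ?thesis using sums_unique2[OF Rs] by blast
  qed
  have Rlin: "bounded_clinear R" by (rule bounded_clinearI[where K = 1]) (use Radd Rscale Rn in auto)
  have Rsym: "cinner \<phi> (R \<psi>) = cinner (R \<phi>) \<psi>" for \<phi> \<psi>
  proof -
    have "(\<lambda>n. cinner \<phi> (?r n *\<^sub>R ?Y n \<psi>)) sums cinner \<phi> (R \<psi>)"
      by (rule bounded_linear.sums[OF bounded_linear_cinner_right Rs])
    moreover have "(\<lambda>n. cinner (?r n *\<^sub>R ?Y n \<phi>) \<psi>) sums cinner (R \<phi>) \<psi>"
      by (rule bounded_linear.sums[OF bounded_linear_cinner_left Rs])
    ultimately show ?thesis by (simp add: scaleR_scaleC Ysym sums_unique2)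
  qed
  \<comment> \<open>The Cauchy product: the absolutely summable double series \<open>t\<close> is
    summed once by rows and once along the diagonals i + j = n, where \<open>sqrt_coeff_conv\<close>
    evaluates it.\<close>
  have RR: "R (R \<psi>) = 2 *\<^sub>R R \<psi> - Y \<psi>" for \<psi>
  proof -
    define t where "t i j = (?r i * ?r j) *\<^sub>R ?Y (i + j) \<psi>" for i j
    have tn: "norm (t i j) \<le> ?r i * (?r j * norm \<psi>)" for i j
      using mult_left_mono[OF Yn[of "i + j" \<psi>], of "?r i * ?r j"] sqrt_coeff_nonneg[of i] sqrt_coeff_nonneg[of j]
      by (simp add: t_def mult.assoc)
    have tle: "(\<Sum>j\<in>F. norm (t i j)) \<le> ?r i * (suminf ?r * norm \<psi>)" if F: "finite F" for i F
    proof -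
      have "(\<Sum>j\<in>F. norm (t i j)) \<le> (\<Sum>j\<in>F. ?r i * (?r j * norm \<psi>))" by (intro sum_mono tn)
      also have "\<dots> = ?r i * ((\<Sum>j\<in>F. ?r j) * norm \<psi>)" by (simp add: sum_distrib_left sum_distrib_right)
      also have "\<dots> \<le> ?r i * (suminf ?r * norm \<psi>)"
        using F by (intro mult_left_mono mult_right_mono sum_le_suminf sqrt_coeff_summable sqrt_coeff_nonneg) auto
      finally show ?thesis .
    qed
    have us: "summable (\<lambda>i. ?r i * (suminf ?r * norm \<psi>))" by (rule summable_mult2[OF sqrt_coeff_summable])
    have tabs: "(\<lambda>j. norm (t i j)) summable_on UNIV" for i
      by (rule double_series_abs_summable(1)[OF _ us]) (rule tle)
    have "\<exists>s. ((\<lambda>(i, j). t i j) has_sum s) (UNIV \<times> UNIV)"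
      by (rule double_series_abs_summable(2)[OF _ us]) (rule tle)
    then obtain s where s: "((\<lambda>(i, j). t i j) has_sum s) (UNIV \<times> UNIV)" ..
    have "((\<lambda>i. ?r i *\<^sub>R ?Y i (R \<psi>)) has_sum s) UNIV"
    proof (rule has_sum_SigmaD[OF s])
      fix i :: nat
      have "(\<lambda>j. ?r i *\<^sub>R ?Y i (?r j *\<^sub>R ?Y j \<psi>)) sums (?r i *\<^sub>R ?Y i (R \<psi>))"
        by (intro sums_scaleR_right bounded_linear.sums[OF Ylin Rs])
      also have "(\<lambda>j. ?r i *\<^sub>R ?Y i (?r j *\<^sub>R ?Y j \<psi>)) = t i"
        by (simp add: t_def fun_eq_iff scaleR_scaleC Yscale funpow_add)
      finally have "t i sums (?r i *\<^sub>R ?Y i (R \<psi>))" .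
      then have "(t i has_sum (?r i *\<^sub>R ?Y i (R \<psi>))) UNIV"
        by (rule has_sum_of_sums[of "t i", OF tabs])
      then show "((\<lambda>j. case (i, j) of (i, j) \<Rightarrow> t i j) has_sum (?r i *\<^sub>R ?Y i (R \<psi>))) UNIV" by simp
    qed
    then have s1: "s = R (R \<psi>)" using has_sum_imp_sums[of "\<lambda>i. ?r i *\<^sub>R ?Y i (R \<psi>)" s] Rs[of "R \<psi>"] sums_unique2 by blast
    let ?S = "Sigma (UNIV :: nat set) (\<lambda>n. {..n})"
    have "bij_betw (\<lambda>(n, i). (i, n - i)) ?S (UNIV \<times> UNIV)"
      by (rule bij_betwI[where g = "\<lambda>(i, j). (i + j, i)"]) auto
    from has_sum_reindex_bij_betw[OF this, of "\<lambda>(i, j). t i j" s] s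
    have "((\<lambda>(n, i). t i (n - i)) has_sum s) ?S" by (simp add: case_prod_unfold)
    then have "((\<lambda>n. \<Sum>i\<le>n. t i (n - i)) has_sum s) UNIV"
      by (rule has_sum_SigmaD) (auto intro!: has_sum_finite)
    then have "(\<lambda>n. \<Sum>i\<le>n. t i (n - i)) sums s" by (rule has_sum_imp_sums)
    also have "(\<lambda>n. \<Sum>i\<le>n. t i (n - i)) = (\<lambda>n. 2 *\<^sub>R (?r n *\<^sub>R ?Y n \<psi>) - (if n = 1 then Y \<psi> else 0))"
    proof
      fix n
      have "(\<Sum>i\<le>n. t i (n - i)) = (\<Sum>i\<le>n. ?r i * ?r (n - i)) *\<^sub>R ?Y n \<psi>"
        unfolding scaleR_sum_left by (intro sum.cong) (auto simp: t_def)
      then show "(\<Sum>i\<le>n. t i (n - i)) = 2 *\<^sub>R (?r n *\<^sub>R ?Y n \<psi>) - (if n = 1 then Y \<psi> else 0)"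
        unfolding sqrt_coeff_conv by (simp add: scaleR_diff_left)
    qed
    finally have "(\<lambda>n. 2 *\<^sub>R (?r n *\<^sub>R ?Y n \<psi>) - (if n = 1 then Y \<psi> else 0)) sums s" .
    moreover have "(\<lambda>n. 2 *\<^sub>R (?r n *\<^sub>R ?Y n \<psi>) - (if n = 1 then Y \<psi> else 0)) sums (2 *\<^sub>R R \<psi> - Y \<psi>)"
      using sums_single[of 1 "\<lambda>_. Y \<psi>"] by (intro sums_diff sums_scaleR_right Rs) simp
    ultimately show ?thesis using s1 sums_unique2 by blast
  qed
  define P where "P \<psi> = \<psi> - R \<psi>" for \<psi>
  show ?thesis
  proof (rule that[of P])
    show "bounded_clinear P"
    proof (rule bounded_clinearI[where K = 2])
      show "norm (P \<psi>) \<le> 2 * norm \<psi>" for \<psi>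
        unfolding P_def using norm_triangle_ineq4[of \<psi> "R \<psi>"] Rn[of \<psi>] by linarith
    qed (simp_all add: P_def Radd Rscale scaleC_diff_right)
    show "cinner \<phi> (P \<psi>) = cinner (P \<phi>) \<psi>" for \<phi> \<psi>
      by (simp add: P_def cinner_diff_left cinner_diff_right Rsym)
    show "norm (\<psi> - P \<psi>) \<le> norm \<psi>" for \<psi> using Rn[of \<psi>] by (simp add: P_def)
    show "P (P \<psi>) = X \<psi>" for \<psi>
    proof -
      have "P (P \<psi>) = \<psi> - R \<psi> - (R \<psi> - R (R \<psi>))" by (simp add: P_def bounded_clinearD(4)[OF Rlin])
      also have "\<dots> = \<psi> - Y \<psi>" unfolding RR by (simp add: scaleR_2)
      finally show ?thesis by (simp add: Y_def)
    qed
  qed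
qed

section \<open>Nuclear operators\<close>

lemma bessel_inequality_pair:
  assumes e: "orthonormal_basis e" and F: "finite F"
  shows "(\<Sum>k\<in>F. cmod (cinner \<phi> (e k)) * cmod (cinner \<psi> (e k))) \<le> norm \<phi> * norm \<psi>"
proof -
  have *: "L2_set (\<lambda>k. cmod (cinner \<phi> (e k))) F \<le> norm \<phi>" for \<phi>
  proof -
    have "(\<Sum>k\<in>F. (cmod (cinner \<phi> (e k)))\<^sup>2) \<le> (norm \<phi>)\<^sup>2"
      using bessel_inequality[OF orthonormal_basis_on[OF e] F, of \<phi>] by (simp add: cinner_commute[of \<phi>])
    from real_sqrt_le_mono[OF this] show ?thesis by (simp add: L2_set_def)
  qed
  have "(\<Sum>k\<in>F. cmod (cinner \<phi> (e k)) * cmod (cinner \<psi> (e k)))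
      = (\<Sum>k\<in>F. \<bar>cmod (cinner \<phi> (e k))\<bar> * \<bar>cmod (cinner \<psi> (e k))\<bar>)" by simp
  also have "\<dots> \<le> L2_set (\<lambda>k. cmod (cinner \<phi> (e k))) F * L2_set (\<lambda>k. cmod (cinner \<psi> (e k))) F"
    by (rule L2_set_mult_ineq)
  also have "\<dots> \<le> norm \<phi> * norm \<psi>" by (intro mult_mono * L2_set_nonneg) auto
  finally show ?thesis .
qed

text \<open>The operator sum of |a n><b n| in bra-ket notation; summability of the products of norms
  makes it nuclear.\<close>

definition nuclear_op :: "(nat \<Rightarrow> L2) \<Rightarrow> (nat \<Rightarrow> L2) \<Rightarrow> L2 \<Rightarrow> L2" where
  "nuclear_op a b \<psi> = (\<Sum>n. cinner (b n) \<psi> *\<^sub>C a n)"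

context
  fixes a b :: "nat \<Rightarrow> L2"
  assumes nuclear: "summable (\<lambda>n. norm (a n) * norm (b n))"
begin

lemma nuclear_op_term_le: "norm (cinner (b n) \<psi> *\<^sub>C a n) \<le> norm (a n) * norm (b n) * norm \<psi>"
  using mult_right_mono[OF cinner_cauchy_schwarz[of "b n" \<psi>], of "norm (a n)"] by (simp add: norm_scaleC mult_ac)

lemma nuclear_op_summable: "summable (\<lambda>n. norm (cinner (b n) \<psi> *\<^sub>C a n))"
  by (rule summable_comparison_test'[OF summable_mult2[OF nuclear, of "norm \<psi>"]]) (use nuclear_op_term_le in auto)

lemma nuclear_op_sums: "(\<lambda>n. cinner (b n) \<psi> *\<^sub>C a n) sums nuclear_op a b \<psi>"
  unfolding nuclear_op_def by (rule summable_sums[OF summable_norm_cancel[OF nuclear_op_summable]])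

lemma nuclear_op_norm_le: "norm (nuclear_op a b \<psi>) \<le> (\<Sum>n. norm (a n) * norm (b n)) * norm \<psi>"
proof -
  have "norm (nuclear_op a b \<psi>) \<le> (\<Sum>n. norm (cinner (b n) \<psi> *\<^sub>C a n))"
    unfolding nuclear_op_def by (rule summable_norm[OF nuclear_op_summable])
  also have "\<dots> \<le> (\<Sum>n. norm (a n) * norm (b n) * norm \<psi>)"
    by (intro suminf_le nuclear_op_term_le nuclear_op_summable summable_mult2 nuclear)
  finally show ?thesis by (simp add: suminf_mult2[OF nuclear])
qed

lemma nuclear_op_clinear: "bounded_clinear (nuclear_op a b)"
proof (rule bounded_clinearI)
  show "nuclear_op a b (\<phi> + \<psi>) = nuclear_op a b \<phi> + nuclear_op a b \<psi>" for \<phi> \<psi>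
  proof (rule sums_unique2[OF nuclear_op_sums])
    show "(\<lambda>n. cinner (b n) (\<phi> + \<psi>) *\<^sub>C a n) sums (nuclear_op a b \<phi> + nuclear_op a b \<psi>)"
      unfolding cinner_add_right scaleC_add_left by (intro sums_add nuclear_op_sums)
  qed
  show "nuclear_op a b (c *\<^sub>C \<psi>) = c *\<^sub>C nuclear_op a b \<psi>" for c \<psi>
  proof (rule sums_unique2[OF nuclear_op_sums])
    show "(\<lambda>n. cinner (b n) (c *\<^sub>C \<psi>) *\<^sub>C a n) sums (c *\<^sub>C nuclear_op a b \<psi>)"
      unfolding cinner_scaleC_right scaleC_scaleC[symmetric]
      by (rule bounded_linear.sums[OF bounded_linear_scaleC nuclear_op_sums])
  qed
qed (rule nuclear_op_norm_le)

lemma cinner_nuclear_op: "(\<lambda>n. cinner (b n) \<psi> * cinner \<phi> (a n)) sums cinner \<phi> (nuclear_op a b \<psi>)"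
  using bounded_linear.sums[OF bounded_linear_cinner_right nuclear_op_sums, of \<phi> \<psi>] by simp

text \<open>For fixed \<open>n\<close> the sum over the basis is Parseval's identity, and Bessel
  bounds it absolutely by \<open>norm (a n) * norm (b n)\<close>. This permits the interchange of
  the two sums and shows that the value does not depend on the basis.\<close>

lemma nuclear_op_trace:
  assumes e: "orthonormal_basis e"
  shows "(\<lambda>k. cinner (e k) (nuclear_op a b (e k))) sums (\<Sum>n. cinner (b n) (a n))"
proof -
  define t where "t n k = cinner (b n) (e k) * cinner (e k) (a n)" for n k
  have nt: "norm (t n k) = cmod (cinner (a n) (e k)) * cmod (cinner (b n) (e k))" for n k
    by (simp add: t_def norm_mult cinner_commute[of "a n"])
  have le: "(\<Sum>k\<in>F. norm (t n k)) \<le> norm (a n) * norm (b n)" if "finite F" for n F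
    unfolding nt by (rule bessel_inequality_pair[OF e that])
  have row: "(\<lambda>k. norm (t n k)) summable_on UNIV" for n
    by (rule double_series_abs_summable(1)[OF _ nuclear]) (rule le)
  have "\<exists>s. ((\<lambda>(n, k). t n k) has_sum s) (UNIV \<times> UNIV)"
    by (rule double_series_abs_summable(2)[OF _ nuclear]) (rule le)
  then obtain s where s: "((\<lambda>(n, k). t n k) has_sum s) (UNIV \<times> UNIV)" ..
  have "((\<lambda>n. cinner (b n) (a n)) has_sum s) UNIV"
  proof (rule has_sum_SigmaD[OF s])
    show "((\<lambda>k. case (n, k) of (n, k) \<Rightarrow> t n k) has_sum cinner (b n) (a n)) UNIV" for n
      using has_sum_of_sums[of "t n", OF row, of "cinner (b n) (a n)"] parseval_cinner[OF e, of "b n" "a n"]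
      by (simp add: t_def[abs_def])
  qed
  then have s_eq: "s = (\<Sum>n. cinner (b n) (a n))" using has_sum_imp_sums sums_unique by blast
  have "((\<lambda>(k, n). t n k) has_sum s) (UNIV \<times> UNIV)"
    using s has_sum_swap[where f = "\<lambda>(n, k). t n k" and A = UNIV and B = UNIV and S = s] by simp
  then have "((\<lambda>k. cinner (e k) (nuclear_op a b (e k))) has_sum s) UNIV"
  proof (rule has_sum_SigmaD)
    fix k
    have "norm (t n k) \<le> norm (a n) * norm (b n)" for n using le[of "{k}" n] by simp
    then have "summable (\<lambda>n. norm (t n k))"
      by (intro summable_comparison_test'[OF nuclear]) auto
    then have "(\<lambda>n. norm (t n k)) summable_on UNIV" by (intro norm_summable_imp_summable_on) simp
    moreover have "(\<lambda>n. t n k) sums cinner (e k) (nuclear_op a b (e k))"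
      unfolding t_def by (rule cinner_nuclear_op)
    ultimately show "((\<lambda>n. case (k, n) of (k, n) \<Rightarrow> t n k) has_sum cinner (e k) (nuclear_op a b (e k))) UNIV"
      using has_sum_of_sums[of "\<lambda>n. t n k"] by simp
  qed
  then show ?thesis unfolding s_eq by (rule has_sum_imp_sums)
qed

text \<open>Duality between bounded operators and the nuclear norm, in absolute form: moving
  \<open>U\<close> onto \<open>a n\<close> as \<open>U'\<close> and applying Bessel to the pair
  \<open>b n\<close>, \<open>U' (a n)\<close> leaves the bound \<open>c\<close> of \<open>U'\<close>
  times the nuclear norm.\<close>

lemma nuclear_op_sum_bound:
  assumes e: "orthonormal_basis e" and U: "\<And>\<phi> \<psi>. cinner \<phi> (U \<psi>) = cinner (U' \<phi>) \<psi>"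
    and U': "\<And>\<phi>. norm (U' \<phi>) \<le> c * norm \<phi>"
  shows "(\<Sum>k<K. cmod (cinner (U (e k)) (nuclear_op a b (e k)))) \<le> c * (\<Sum>n. norm (a n) * norm (b n))"
proof -
  define t where "t n k = cmod (cinner (b n) (e k)) * cmod (cinner (U' (a n)) (e k))" for n k
  have tn: "norm (cinner (b n) (e k) * cinner (U (e k)) (a n)) = t n k" for n k
    by (simp add: t_def norm_mult cinner_commute[of "U (e k)"] U)
  have le: "(\<Sum>k\<in>F. t n k) \<le> c * (norm (a n) * norm (b n))" if "finite F" for F n
  proof -
    have "(\<Sum>k\<in>F. t n k) \<le> norm (b n) * norm (U' (a n))"
      unfolding t_def by (rule bessel_inequality_pair[OF e that])
    also have "\<dots> \<le> norm (b n) * (c * norm (a n))" by (intro mult_left_mono U') auto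
    finally show ?thesis by (simp add: mult_ac)
  qed
  have cn: "summable (\<lambda>n. c * (norm (a n) * norm (b n)))" by (rule summable_mult[OF nuclear])
  have sm: "summable (\<lambda>n. t n k)" for k
    by (rule summable_comparison_test'[OF cn]) (use le[of "{k}"] in \<open>auto simp: t_def\<close>)
  have "cmod (cinner (U (e k)) (nuclear_op a b (e k))) \<le> (\<Sum>n. t n k)" for k
  proof -
    have "cinner (U (e k)) (nuclear_op a b (e k)) = (\<Sum>n. cinner (b n) (e k) * cinner (U (e k)) (a n))"
      by (rule sums_unique[OF cinner_nuclear_op])
    also have "cmod \<dots> \<le> (\<Sum>n. t n k)"
      using summable_norm[of "\<lambda>n. cinner (b n) (e k) * cinner (U (e k)) (a n)"] sm[of k] by (simp only: tn)
    finally show ?thesis .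
  qed
  then have "(\<Sum>k<K. cmod (cinner (U (e k)) (nuclear_op a b (e k)))) \<le> (\<Sum>k<K. \<Sum>n. t n k)" by (intro sum_mono)
  also have "\<dots> = (\<Sum>n. \<Sum>k<K. t n k)" by (rule suminf_sum[symmetric]) (rule sm)
  also have "\<dots> \<le> (\<Sum>n. c * (norm (a n) * norm (b n)))"
    by (intro suminf_le le summable_sum sm cn) auto
  also have "\<dots> = c * (\<Sum>n. norm (a n) * norm (b n))" by (rule suminf_mult[OF nuclear])
  finally show ?thesis .
qed

end

lemma cinner_nuclear_op_swap:
  assumes "summable (\<lambda>n. norm (a n) * norm (b n))"
  shows "cinner \<phi> (nuclear_op a b \<psi>) = cinner (nuclear_op b a \<phi>) \<psi>"
proof -
  have s: "summable (\<lambda>n. norm (b n) * norm (a n))" using assms by (simp add: mult.commute)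
  have "(\<lambda>n. cnj (cinner (a n) \<phi> * cinner \<psi> (b n))) sums cnj (cinner \<psi> (nuclear_op b a \<phi>))"
    using cinner_nuclear_op[OF s] by (simp only: sums_cnj)
  then have "(\<lambda>n. cinner (b n) \<psi> * cinner \<phi> (a n)) sums cinner (nuclear_op b a \<phi>) \<psi>"
    by (simp add: cinner_commute[of _ \<psi>] cinner_commute[of \<phi>] mult.commute)
  then show ?thesis using cinner_nuclear_op[OF assms] sums_unique2 by blast
qed

lemma bounded_clinear_compose: "bounded_clinear S \<Longrightarrow> bounded_clinear T \<Longrightarrow> bounded_clinear (\<lambda>\<psi>. S (T \<psi>))"
  unfolding bounded_clinear_def by (simp add: bounded_linear_compose[of S T])

lemma bounded_clinear_scaleC: "bounded_clinear T \<Longrightarrow> bounded_clinear (\<lambda>\<psi>. c *\<^sub>C T \<psi>)"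
  unfolding bounded_clinear_def by (simp add: bounded_linear_compose[OF bounded_linear_scaleC, of T] mult.commute)

text \<open>
  For \<open>R = 1 - P\<close> one has \<open>P (1 + R + \<dots> + R\<^bsup>m-1\<^esup>) = 1 - R\<^sup>m\<close>, so \<open>P = |S|\<close> is approximated by
  \<open>P (1 - R\<^sup>m) = S\<^sup>* S (1 + R + \<dots> + R\<^bsup>m-1\<^esup>)\<close> without using a polar decomposition of \<open>S\<close>.
\<close>

lemma nuclear_abs_summable:
  assumes nuc: "summable (\<lambda>n. norm (a n) * norm (b n))"
    and P: "bounded_clinear P" and sym: "\<And>\<phi> \<psi>. cinner \<phi> (P \<psi>) = cinner (P \<phi>) \<psi>"
    and contr: "\<And>\<psi>. norm (\<psi> - P \<psi>) \<le> norm \<psi>"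
    and PP: "\<And>\<phi> \<psi>. cinner (P \<phi>) (P \<psi>) = cinner (nuclear_op a b \<phi>) (nuclear_op a b \<psi>)"
    and small: "(\<Sum>n. norm (a n) * norm (b n)) \<le> 1"
    and e: "orthonormal_basis e"
  shows "0 \<le> Re (cinner \<psi> (P \<psi>))" "summable (\<lambda>k. Re (cinner (e k) (P (e k))))"
proof -
  define S where "S = nuclear_op a b"
  define K where "K = (\<Sum>n. norm (a n) * norm (b n))"
  define q where "q \<psi> = Re (cinner \<psi> (P \<psi>))" for \<psi>
  have lin: "P (\<phi> - \<psi>) = P \<phi> - P \<psi>" "P (\<phi> + \<psi>) = P \<phi> + P \<psi>" "P 0 = 0" for \<phi> \<psi>
    using bounded_clinearD[OF P] by auto
  have K0: "0 \<le> K" unfolding K_def by (intro suminf_nonneg nuc) auto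
  have normP: "norm (P \<psi>) \<le> norm \<psi>" for \<psi>
  proof -
    have "complex_of_real ((norm (P \<psi>))\<^sup>2) = of_real ((norm (S \<psi>))\<^sup>2)"
      using PP[of \<psi> \<psi>] by (simp add: cinner_self S_def)
    then have "(norm (P \<psi>))\<^sup>2 = (norm (S \<psi>))\<^sup>2" by (simp only: of_real_eq_iff)
    then have "norm (P \<psi>) = norm (S \<psi>)" by simp
    also have "\<dots> \<le> K * norm \<psi>" unfolding S_def K_def by (rule nuclear_op_norm_le[OF nuc])
    also have "\<dots> \<le> 1 * norm \<psi>" using small by (intro mult_right_mono) (auto simp: K_def)
    finally show ?thesis by simp
  qed
  have sq: "(norm (\<psi> - P \<psi>))\<^sup>2 = (norm \<psi>)\<^sup>2 - 2 * q \<psi> + (norm (P \<psi>))\<^sup>2" for \<psi>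
    by (simp add: power2_norm_eq_inner inner_diff_left inner_diff_right inner_commute q_def inner_L2_def[of \<psi>, symmetric])
  have q0: "0 \<le> q \<psi>" for \<psi>
  proof -
    have "(norm (\<psi> - P \<psi>))\<^sup>2 \<le> (norm \<psi>)\<^sup>2" by (intro power_mono contr) auto
    then show ?thesis using sq[of \<psi>] zero_le_power2[of "norm (P \<psi>)"] by linarith
  qed
  then show "0 \<le> Re (cinner \<psi> (P \<psi>))" unfolding q_def .
  \<comment> \<open>This is P^2 \<le> P as quadratic forms; it follows from positivity of
    \<open>q\<close> at \<open>\<psi> - P \<psi>\<close> and \<open>normP\<close>.\<close>
  have q_ge: "(norm (P \<psi>))\<^sup>2 \<le> q \<psi>" for \<psi>
  proof -
    have 1: "q (\<psi> - P \<psi>) = q \<psi> - 2 * (norm (P \<psi>))\<^sup>2 + Re (cinner (P \<psi>) (P (P \<psi>)))"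
      by (simp add: q_def lin cinner_diff_left cinner_diff_right sym[of \<psi> "P \<psi>"] cinner_self)
    have "Re (cinner (P \<psi>) (P (P \<psi>))) \<le> norm (P \<psi>) * norm (P (P \<psi>))"
      using complex_Re_le_cmod cinner_cauchy_schwarz order_trans by blast
    also have "\<dots> \<le> norm (P \<psi>) * norm (P \<psi>)" by (intro mult_left_mono normP) auto
    finally have "Re (cinner (P \<psi>) (P (P \<psi>))) \<le> (norm (P \<psi>))\<^sup>2" by (simp add: power2_eq_square)
    then show ?thesis using 1 q0[of "\<psi> - P \<psi>"] by linarith
  qed
  define R where "R \<psi> = \<psi> - P \<psi>" for \<psi>
  have Rcontr: "norm ((R ^^ i) \<psi>) \<le> norm \<psi>" for i \<psi>
    by (induction i) (auto simp: R_def intro: order_trans[OF contr])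
  have Rsym: "cinner \<phi> ((R ^^ i) \<psi>) = cinner ((R ^^ i) \<phi>) \<psi>" for i \<phi> \<psi>
  proof (induction i arbitrary: \<phi> \<psi>)
    case (Suc i)
    have "cinner \<phi> ((R ^^ Suc i) \<psi>) = cinner (R \<phi>) ((R ^^ i) \<psi>)"
      by (simp add: R_def cinner_diff_left cinner_diff_right sym)
    also have "\<dots> = cinner ((R ^^ i) (R \<phi>)) \<psi>" by (rule Suc.IH)
    finally show ?case by (simp add: funpow_swap1)
  qed simp
  have PR: "P ((R ^^ i) \<psi>) = (R ^^ i) (P \<psi>)" for i \<psi>
    by (induction i) (simp_all add: R_def lin)
  \<comment> \<open>By \<open>sq\<close> and \<open>q_ge\<close>, \<open>q\<close> at a vector is at
    most the loss of squared norm under \<open>R\<close>. Along the orbit the squared norms decrease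
    to a limit, so the losses tend to 0.\<close>
  have limR: "(\<lambda>i. q ((R ^^ i) \<psi>)) \<longlonglongrightarrow> 0" for \<psi>
  proof -
    define d where "d i = (norm ((R ^^ i) \<psi>))\<^sup>2" for i
    have step: "q ((R ^^ i) \<psi>) \<le> d i - d (Suc i)" for i
      using sq[of "(R ^^ i) \<psi>"] q_ge[of "(R ^^ i) \<psi>"] by (simp add: d_def R_def)
    have "decseq d" using step q0 by (intro decseq_SucI) (metis diff_ge_0_iff_ge order_trans)
    then obtain L where L: "d \<longlonglongrightarrow> L"
      using decseq_convergent[of d 0] by (auto simp: d_def)
    have "(\<lambda>i. d i - d (Suc i)) \<longlonglongrightarrow> L - L" by (intro tendsto_diff L LIMSEQ_Suc[OF L])
    then have lim: "(\<lambda>i. d i - d (Suc i)) \<longlonglongrightarrow> 0" by simp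
    show ?thesis
      by (rule tendsto_sandwich[OF always_eventually always_eventually tendsto_const[of 0] lim])
         (rule allI, rule q0, rule allI, rule step)
  qed
  define Q where "Q m \<psi> = (\<Sum>i<m. (R ^^ i) \<psi>)" for m \<psi>
  have PQ: "P (Q m \<psi>) = \<psi> - (R ^^ m) \<psi>" for m \<psi>
  proof (induction m)
    case (Suc m)
    have "P (Q (Suc m) \<psi>) = P (Q m \<psi>) + P ((R ^^ m) \<psi>)" by (simp add: Q_def lin)
    then show ?case unfolding Suc.IH by (simp add: R_def[of "(R ^^ m) \<psi>"])
  qed (simp add: Q_def lin)
  have Qsym: "cinner \<phi> (Q m \<psi>) = cinner (Q m \<phi>) \<psi>" for m \<phi> \<psi>
    unfolding Q_def cinner_sum_left cinner_sum_right by (intro sum.cong refl Rsym)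
  \<comment> \<open>Bounded by 2 for every \<open>m\<close> although \<open>Q m\<close> has more and
    more terms: its norm at \<open>\<psi>\<close> equals that of P Q_m \<psi> = \<psi> - R^m
    \<psi>.\<close>
  define U where "U m \<psi> = S (Q m \<psi>)" for m \<psi>
  define U' where "U' m \<psi> = Q m (nuclear_op b a \<psi>)" for m \<psi>
  have UU': "cinner \<phi> (U m \<psi>) = cinner (U' m \<phi>) \<psi>" for m \<phi> \<psi>
    by (simp add: U_def U'_def S_def cinner_nuclear_op_swap[OF nuc] Qsym)
  have normU: "norm (U m \<psi>) \<le> 2 * norm \<psi>" for m \<psi>
  proof -
    have "complex_of_real ((norm (U m \<psi>))\<^sup>2) = of_real ((norm (P (Q m \<psi>)))\<^sup>2)"
      using PP[of "Q m \<psi>" "Q m \<psi>"] by (simp add: cinner_self S_def U_def)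
    then have "(norm (U m \<psi>))\<^sup>2 = (norm (P (Q m \<psi>)))\<^sup>2" by (simp only: of_real_eq_iff)
    then have "norm (U m \<psi>) = norm (\<psi> - (R ^^ m) \<psi>)" by (simp add: PQ)
    also have "\<dots> \<le> 2 * norm \<psi>" using norm_triangle_ineq4[of \<psi> "(R ^^ m) \<psi>"] Rcontr[of m \<psi>] by linarith
    finally show ?thesis .
  qed
  have normU': "norm (U' m \<phi>) \<le> 2 * norm \<phi>" for m \<phi>
  proof (cases "U' m \<phi> = 0")
    case False
    have "complex_of_real ((norm (U' m \<phi>))\<^sup>2) = cinner \<phi> (U m (U' m \<phi>))" unfolding UU' by (rule cinner_self[symmetric])
    then have "(norm (U' m \<phi>))\<^sup>2 \<le> norm \<phi> * norm (U m (U' m \<phi>))"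
      using cinner_cauchy_schwarz[of \<phi> "U m (U' m \<phi>)"] unfolding \<open>_ = cinner \<phi> _\<close>[symmetric] norm_of_real by simp
    also have "\<dots> \<le> norm \<phi> * (2 * norm (U' m \<phi>))" by (intro mult_left_mono normU) auto
    finally have "norm (U' m \<phi>) * norm (U' m \<phi>) \<le> (2 * norm \<phi>) * norm (U' m \<phi>)"
      by (simp add: power2_eq_square mult_ac)
    then show ?thesis using False by simp
  qed simp
  have bound: "(\<Sum>k<n. q (e k)) \<le> 2 * K" for n
  proof -
    have eq: "cinner \<psi> (P (\<psi> - (R ^^ (2 * i)) \<psi>)) = cnj (cinner (U (2 * i) \<psi>) (S \<psi>))" for i \<psi>
    proof -
      have "cinner \<psi> (P (\<psi> - (R ^^ (2 * i)) \<psi>)) = cinner (P \<psi>) (P (Q (2 * i) \<psi>))" unfolding PQ by (rule sym)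
      also have "\<dots> = cinner (S \<psi>) (U (2 * i) \<psi>)" by (simp add: PP S_def U_def)
      finally show ?thesis by (simp add: cinner_commute[of "S \<psi>"])
    qed
    \<comment> \<open>The exponent is even so that symmetry of \<open>R\<close> splits it into two
      equal halves, leaving \<open>q\<close> at R^i \<psi>, which tends to 0.\<close>
    have Rq: "Re (cinner \<psi> (P ((R ^^ (2 * i)) \<psi>))) = q ((R ^^ i) \<psi>)" for i \<psi>
    proof -
      have "cinner \<psi> (P ((R ^^ (2 * i)) \<psi>)) = cinner \<psi> ((R ^^ i) (P ((R ^^ i) \<psi>)))"
        by (simp add: PR mult_2 funpow_add)
      then show ?thesis unfolding Rsym[of \<psi>] by (simp add: q_def)
    qed
    have "(\<Sum>k<n. q (e k) - q ((R ^^ i) (e k))) \<le> 2 * K" for i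
    proof -
      have "q \<psi> - q ((R ^^ i) \<psi>) = Re (cinner (U (2 * i) \<psi>) (S \<psi>))" for \<psi>
        using arg_cong[OF eq[of \<psi> i], of Re] by (simp add: lin cinner_diff_right Rq) (simp add: q_def)
      then have "(\<Sum>k<n. q (e k) - q ((R ^^ i) (e k))) \<le> (\<Sum>k<n. cmod (cinner (U (2 * i) (e k)) (S (e k))))"
        by (intro sum_mono) (simp add: complex_Re_le_cmod)
      also have "\<dots> \<le> 2 * K" unfolding S_def K_def
        by (rule nuclear_op_sum_bound[OF nuc e, where U' = "U' (2 * i)"]) (rule UU', rule normU')
      finally show ?thesis .
    qed
    moreover have "(\<lambda>i. \<Sum>k<n. q (e k) - q ((R ^^ i) (e k))) \<longlonglongrightarrow> (\<Sum>k<n. q (e k) - 0)"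
      by (intro tendsto_sum tendsto_diff tendsto_const limR)
    ultimately have "(\<Sum>k<n. q (e k) - 0) \<le> 2 * K" by (intro LIMSEQ_le_const2) auto
    then show ?thesis by simp
  qed
  show "summable (\<lambda>k. Re (cinner (e k) (P (e k))))"
    by (rule summableI_nonneg_bounded[where x = "2 * K"]) (use q0 bound in \<open>auto simp: q_def\<close>)
qed

text \<open>The operator is rescaled to nuclear norm at most 1. Then S has norm at most 1, so 1 -
  S'S is a contraction for its adjoint S' and has the square root required; finally the absolute
  value is scaled back. Dividing by \<open>K + 1\<close> rather than by \<open>K\<close> covers the
  zero operator.\<close>

theorem nuclear_op_trace_class:
  assumes nuc: "summable (\<lambda>n. norm (a n) * norm (b n))" and e: "orthonormal_basis e"
  shows "trace_class (nuclear_op a b)"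
proof -
  define K where "K = (\<Sum>n. norm (a n) * norm (b n))"
  define c where "c = 1 / (K + 1)"
  have K0: "0 \<le> K" unfolding K_def by (intro suminf_nonneg nuc) auto
  then have c: "0 < c" "c * (K + 1) = 1" "c * K \<le> 1" by (auto simp: c_def field_simps)
  define a' where "a' n = of_real c *\<^sub>C a n" for n
  define S where "S = nuclear_op a' b"
  define S' where "S' = nuclear_op b a'"
  have na': "norm (a' n) * norm (b n) = c * (norm (a n) * norm (b n))" for n
    using c by (simp add: a'_def norm_scaleC)
  have nuc1: "summable (\<lambda>n. norm (a' n) * norm (b n))" unfolding na' by (rule summable_mult[OF nuc])
  then have nuc2: "summable (\<lambda>n. norm (b n) * norm (a' n))" by (simp add: mult.commute)
  have sm: "(\<Sum>n. norm (a' n) * norm (b n)) \<le> 1"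
    unfolding na' suminf_mult[OF nuc] using c by (simp add: K_def)
  have ST: "nuclear_op a b \<psi> = of_real (K + 1) *\<^sub>C S \<psi>" for \<psi>
  proof (rule sums_unique2[OF nuclear_op_sums[OF nuc]])
    have "(\<lambda>n. of_real (K + 1) *\<^sub>C cinner (b n) \<psi> *\<^sub>C a' n) sums (of_real (K + 1) *\<^sub>C S \<psi>)"
      unfolding S_def by (rule bounded_linear.sums[OF bounded_linear_scaleC nuclear_op_sums[OF nuc1]])
    moreover have "of_real (K + 1) *\<^sub>C cinner (b n) \<psi> *\<^sub>C a' n = cinner (b n) \<psi> *\<^sub>C a n" for n
    proof -
      have "of_real (K + 1) * (cinner (b n) \<psi> * complex_of_real c) = cinner (b n) \<psi> * complex_of_real (c * (K + 1))"
        by (simp only: of_real_mult mult_ac)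
      then show ?thesis unfolding a'_def scaleC_scaleC by (simp only: c(2) of_real_1 mult_1_right)
    qed
    ultimately show "(\<lambda>n. cinner (b n) \<psi> *\<^sub>C a n) sums (of_real (K + 1) *\<^sub>C S \<psi>)" by simp
  qed
  have Sn: "norm (S \<psi>) \<le> norm \<psi>" for \<psi>
    using nuclear_op_norm_le[OF nuc1, of \<psi>] mult_right_mono[OF sm, of "norm \<psi>"] by (simp add: S_def)
  have SS': "cinner \<phi> (S' \<psi>) = cinner (S \<phi>) \<psi>" "cinner \<phi> (S \<psi>) = cinner (S' \<phi>) \<psi>" for \<phi> \<psi>
    using cinner_nuclear_op_swap[OF nuc1] cinner_nuclear_op_swap[OF nuc2] by (simp_all add: S_def S'_def)
  define X where "X \<psi> = S' (S \<psi>)" for \<psi>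
  have "bounded_clinear X" unfolding X_def[abs_def] S_def S'_def
    by (rule bounded_clinear_compose[OF nuclear_op_clinear[OF nuc2] nuclear_op_clinear[OF nuc1]])
  moreover have "cinner \<phi> (X \<psi>) = cinner (X \<phi>) \<psi>" for \<phi> \<psi> by (simp add: X_def SS')
  moreover have "norm (\<psi> - X \<psi>) \<le> norm \<psi>" for \<psi>
  proof (rule power2_le_imp_le)
    have "(norm (X \<psi>))\<^sup>2 = Re (cinner (S (X \<psi>)) (S \<psi>))"
      using arg_cong[OF cinner_self[of "X \<psi>"], of Re] by (simp add: X_def SS')
    also have "\<dots> \<le> norm (S (X \<psi>)) * norm (S \<psi>)" using complex_Re_le_cmod cinner_cauchy_schwarz order_trans by blast
    also have "\<dots> \<le> norm (X \<psi>) * norm (S \<psi>)" by (intro mult_right_mono Sn) auto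
    finally have "norm (X \<psi>) \<le> norm (S \<psi>)" by (cases "X \<psi> = 0") (auto simp: power2_eq_square)
    then have "(norm (X \<psi>))\<^sup>2 \<le> (norm (S \<psi>))\<^sup>2" by (intro power_mono) auto
    moreover have "inner \<psi> (X \<psi>) = (norm (S \<psi>))\<^sup>2"
      by (simp add: inner_L2_def X_def SS' cinner_self)
    ultimately show "(norm (\<psi> - X \<psi>))\<^sup>2 \<le> (norm \<psi>)\<^sup>2"
      using inner_ge_zero[of "S \<psi>"] by (simp del: inner_ge_zero add: power2_norm_eq_inner inner_diff_left inner_diff_right inner_commute)
  qed auto
  ultimately obtain P where P: "bounded_clinear P" and sym: "\<And>\<phi> \<psi>. cinner \<phi> (P \<psi>) = cinner (P \<phi>) \<psi>"
    and PP: "\<And>\<psi>. P (P \<psi>) = X \<psi>" and contr: "\<And>\<psi>. norm (\<psi> - P \<psi>) \<le> norm \<psi>"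
    using positive_sqrt_exists[of X] by metis
  have PS: "cinner (P \<phi>) (P \<psi>) = cinner (S \<phi>) (S \<psi>)" for \<phi> \<psi>
  proof -
    have "cinner (P \<phi>) (P \<psi>) = cinner \<phi> (X \<psi>)" by (simp only: sym[symmetric] PP)
    then show ?thesis by (simp add: X_def SS')
  qed
  note abs = nuclear_abs_summable[OF nuc1 P sym contr PS[unfolded S_def] sm e]
  define P' where "P' \<psi> = of_real (K + 1) *\<^sub>C P \<psi>" for \<psi>
  have P'i: "cinner \<psi> (P' \<psi>) = of_real ((K + 1) * Re (cinner \<psi> (P \<psi>)))" for \<psi>
  proof -
    have "cinner \<psi> (P \<psi>) = cnj (cinner \<psi> (P \<psi>))" using sym[of \<psi> \<psi>] cinner_commute[of "P \<psi>" \<psi>] by simp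
    then have "cinner \<psi> (P \<psi>) = of_real (Re (cinner \<psi> (P \<psi>)))" by (simp add: complex_eq_iff)
    then show ?thesis unfolding P'_def cinner_scaleC_right of_real_mult by argo
  qed
  have "is_abs_op (nuclear_op a b) P'"
    unfolding is_abs_op_def positive_op_def
  proof (intro conjI allI)
    show "bounded_clinear P'" unfolding P'_def[abs_def] by (rule bounded_clinear_scaleC[OF P])
    show "cinner \<psi> (P' \<psi>) \<in> \<real>\<^sub>\<ge>\<^sub>0" for \<psi> unfolding P'i using abs(1)[of \<psi>] K0 by simp
    show "cinner \<phi> (P' (P' \<psi>)) = cinner (nuclear_op a b \<phi>) (nuclear_op a b \<psi>)" for \<phi> \<psi>
      unfolding P'_def ST bounded_clinearD(2)[OF P] PS[symmetric] by (simp add: PS sym PS[symmetric])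
  qed
  moreover have "summable (\<lambda>k. Re (cinner (e k) (P' (e k))))"
    unfolding P'i using summable_mult[OF abs(2)] by simp
  ultimately show ?thesis unfolding trace_class_def using nuclear_op_clinear[OF nuc] e by blast
qed

section \<open>Expansion in an adapted eigenbasis\<close>

lemma op_graph_closed:
  assumes T: "bounded_clinear T" shows "closed (op_graph T)"
  unfolding closed_sequential_limits
proof (intro allI impI, elim conjE)
  fix p :: "nat \<Rightarrow> L2 \<times> L2" and l assume p: "\<forall>n. p n \<in> op_graph T" and l: "p \<longlonglongrightarrow> l"
  have "(\<lambda>n. T (fst (p n))) \<longlonglongrightarrow> T (fst l)"
    by (intro bounded_linear.tendsto[OF bounded_clinearD(1)[OF T]] tendsto_fst l)
  moreover have "T (fst (p n)) = snd (p n)" for n using spec[OF p, of n] by (auto simp: op_graph_def)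
  ultimately have "T (fst l) = snd l" using tendsto_snd[OF l] LIMSEQ_unique by simp
  then show "l \<in> op_graph T" by (auto simp: op_graph_def) (metis prod.collapse)
qed

lemma gauss_nonneg: "0 \<le> gauss \<epsilon> E y"
  by (simp add: gauss_def)

text \<open>\<open>a n\<close> is the image of \<open>e n\<close> under \<open>A\<close>. The weight
  is instantiated with \<open>1 + (norm (a n))^2\<close>, the diagonal of \<open>1 + A^2\<close>; it
  dominates 1, the norm of \<open>a n\<close>, and hence the diagonal of \<open>A\<close>.\<close>

locale spectral_expansion = adapted_basis +
  fixes A :: "real \<Rightarrow> real" and a :: "nat \<Rightarrow> L2" and \<alpha> :: "nat \<Rightarrow> real" and c0 :: real
  assumes A_measurable: "A \<in> borel_measurable borel"
    and domain: "\<And>n. n \<in> J \<Longrightarrow> (e n, a n) \<in> mult_op A"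
    and weight: "\<And>n. n \<in> J \<Longrightarrow> 1 \<le> \<alpha> n" "\<And>n. n \<in> J \<Longrightarrow> norm (a n) \<le> \<alpha> n"
    and exp_summable: "\<And>b. b > 0 \<Longrightarrow> summable (\<lambda>n. if n \<in> J then exp (- b * \<mu> n) * \<alpha> n else 0)"
    and below: "\<And>n. n \<in> J \<Longrightarrow> c0 \<le> \<mu> n"
begin

definition coeff :: "nat \<Rightarrow> complex" where
  "coeff n = (if n \<in> J then cinner (e n) (a n) else 0)"

definition partition :: "complex \<Rightarrow> complex" where
  "partition \<beta> = (\<Sum>n. if n \<in> J then exp (- \<beta> * of_real (\<mu> n)) * cinner (e n) (a n) else 0)"

text \<open>The value 0 outside \<open>J\<close> is immaterial, as \<open>coeff\<close> vanishes
  there; it keeps the exponentials total so that the series is a Laplace integral over the counting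
  measure.\<close>

definition level :: "nat \<Rightarrow> real" where "level n = (if n \<in> J then \<mu> n else 0)"

lemma coeff_le: assumes "n \<in> J" shows "cmod (coeff n) \<le> \<alpha> n"
proof -
  have "cmod (coeff n) \<le> norm (e n) * norm (a n)" using assms by (simp add: coeff_def cinner_cauchy_schwarz)
  then show ?thesis using weight(2)[OF assms] by (simp add: orthonormal_basis_norm[OF basis])
qed

lemma weighted_integrable:
  assumes f: "\<And>n. n \<in> J \<Longrightarrow> cmod (f n) \<le> \<alpha> n" "\<And>n. n \<notin> J \<Longrightarrow> f n = 0" and b: "b > 0"
  shows "integrable (count_space UNIV) (\<lambda>n. cmod (f n) * exp (- b * level n))"
  unfolding integrable_count_space_nat_iff
proof (rule summable_comparison_test'[OF exp_summable[OF b]])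
  show "norm (norm (cmod (f n) * exp (- b * level n))) \<le> (if n \<in> J then exp (- b * \<mu> n) * \<alpha> n else 0)" for n
    using f[of n] by (cases "n \<in> J") (simp_all add: level_def mult.commute[of "cmod (f n)"])
qed

lemma partition_integral:
  assumes "Re \<beta> > 0"
  shows "partition \<beta> = (\<integral>n. coeff n * exp (- \<beta> * complex_of_real (level n)) \<partial>count_space UNIV)"
proof -
  have "integrable (count_space UNIV) (\<lambda>n. coeff n * exp (- \<beta> * complex_of_real (level n)))"
    by (rule Bochner_Integration.integrable_bound[OF weighted_integrable[OF coeff_le _ assms]])
       (auto simp: coeff_def norm_mult)
  from integral_count_space_nat[OF this] show ?thesis
    by (simp add: partition_def coeff_def level_def if_distrib mult.commute cong: if_cong)
qed

lemma partition_holomorphic: "partition holomorphic_on {z. 0 < Re z}"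
proof (rule holomorphic_transform)
  show "(\<lambda>z. \<integral>n. coeff n * exp (- z * complex_of_real (level n)) \<partial>count_space UNIV) holomorphic_on {z. 0 < Re z}"
    using holomorphic_laplace[of "{0<..}" coeff "count_space UNIV" level] weighted_integrable[OF coeff_le]
    by (simp add: coeff_def)
qed (simp add: partition_integral)

text \<open>Termwise comparison with the weighted series at 2: as the levels are at least
  \<open>c0\<close>, passing from 2 to Re z costs at most
  \<open>exp ((2 - Re z) * c0)\<close>.\<close>

lemma partition_bound: "\<exists>K c. \<forall>z. 2 \<le> Re z \<longrightarrow> cmod (partition z) \<le> K * exp (c * Re z)"
proof -
  define S where "S = (\<Sum>n. if n \<in> J then exp (- 2 * \<mu> n) * \<alpha> n else 0)"
  have "cmod (partition z) \<le> (exp (2 * c0) * S) * exp (- c0 * Re z)" if z: "2 \<le> Re z" for z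
  proof -
    let ?t = "\<lambda>n. if n \<in> J then exp (- z * of_real (\<mu> n)) * cinner (e n) (a n) else 0"
    let ?u = "\<lambda>n. exp ((2 - Re z) * c0) * (if n \<in> J then exp (- 2 * \<mu> n) * \<alpha> n else 0)"
    have tu: "cmod (?t n) \<le> ?u n" for n
    proof (cases "n \<in> J")
      case True
      have "(Re z - 2) * c0 \<le> (Re z - 2) * \<mu> n" using z below[OF True] by (intro mult_left_mono) auto
      then have "- Re z * \<mu> n \<le> (2 - Re z) * c0 + - 2 * \<mu> n" by (simp add: algebra_simps)
      then have "exp (- Re z * \<mu> n) \<le> exp ((2 - Re z) * c0) * exp (- 2 * \<mu> n)"
        unfolding exp_add[symmetric] exp_le_cancel_iff .
      then have "exp (- Re z * \<mu> n) * cmod (coeff n) \<le> (exp ((2 - Re z) * c0) * exp (- 2 * \<mu> n)) * \<alpha> n"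
        using coeff_le[OF True] by (intro mult_mono) auto
      then show ?thesis using True by (simp add: coeff_def norm_mult mult.assoc)
    qed simp
    have us: "summable ?u" by (intro summable_mult exp_summable) simp
    have ts: "summable (\<lambda>n. cmod (?t n))" by (rule summable_comparison_test'[OF us]) (use tu in simp)
    have "cmod (partition z) \<le> (\<Sum>n. cmod (?t n))" unfolding partition_def by (rule summable_norm[OF ts])
    also have "\<dots> \<le> suminf ?u" by (rule suminf_le[OF tu ts us])
    also have "\<dots> = exp ((2 - Re z) * c0) * S"
      unfolding S_def by (rule suminf_mult) (rule exp_summable, simp)
    also have "exp ((2 - Re z) * c0) = exp (2 * c0) * exp (- c0 * Re z)"
      unfolding exp_add[symmetric] by (simp add: algebra_simps)
    finally show ?thesis by (simp add: mult_ac)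
  qed
  then show ?thesis by blast
qed

definition gaussian_trace :: "real \<Rightarrow> real \<Rightarrow> complex" where
  "gaussian_trace \<epsilon> E = (\<Sum>n. coeff n * of_real (gauss \<epsilon> E (level n)))"

lemma gaussian_trace_laplace:
  assumes e: "\<epsilon> > 0" and b: "b > 0"
  shows "integrable lborel (\<lambda>s. laplace_weight \<epsilon> E (Complex b s) * partition (Complex b s))"
    and "gaussian_trace \<epsilon> E = (\<integral>s. laplace_weight \<epsilon> E (Complex b s) * partition (Complex b s) \<partial>lborel) / (2 * pi)"
proof -
  have w: "integrable (count_space UNIV) (\<lambda>n. cmod (coeff n) * exp (- b * level n))"
    by (rule weighted_integrable[OF coeff_le _ b]) (auto simp: coeff_def)
  have p: "partition (Complex b s) = (\<integral>n. coeff n * exp (- Complex b s * complex_of_real (level n)) \<partial>count_space UNIV)" for s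
    using b by (intro partition_integral) simp
  note g = gaussian_inverse_laplace[OF sigma_finite_measure_count_space e _ _ w, folded p, of E]
  show "integrable lborel (\<lambda>s. laplace_weight \<epsilon> E (Complex b s) * partition (Complex b s))"
    by (rule g(1)) auto
  show "gaussian_trace \<epsilon> E = (\<integral>s. laplace_weight \<epsilon> E (Complex b s) * partition (Complex b s) \<partial>lborel) / (2 * pi)"
    unfolding gaussian_trace_def integral_count_space_nat[OF g(2), simplified, symmetric]
    by (rule g(3)) auto
qed

text \<open>The right-hand vectors of the nuclear expansion of \<rho> A: moving \<open>A\<close> and
  the real factor from \<psi> to the basis vector turns the n-th coefficient into
  \<open>cinner (smeared \<epsilon> E n) \<psi>\<close>.\<close>

definition smeared :: "real \<Rightarrow> real \<Rightarrow> nat \<Rightarrow> L2" where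
  "smeared \<epsilon> E n = (if n \<in> J then of_real (gauss \<epsilon> E (\<mu> n)) *\<^sub>C a n else 0)"

lemma gauss_summable:
  assumes e: "\<epsilon> > 0" and f: "\<And>n. n \<in> J \<Longrightarrow> 0 \<le> f n \<and> f n \<le> \<alpha> n"
  shows "summable (\<lambda>n. if n \<in> J then gauss \<epsilon> E (\<mu> n) * f n else 0)"
proof -
  define h where "h n = (if n \<in> J then complex_of_real (f n) else 0)" for n
  have w: "integrable (count_space UNIV) (\<lambda>n. cmod (h n) * exp (- 1 * level n))"
    by (rule weighted_integrable) (use f in \<open>auto simp: h_def\<close>)
  have "integrable (count_space UNIV) (\<lambda>n. h n * complex_of_real (gauss \<epsilon> E (level n)))"
    by (rule gaussian_inverse_laplace(2)[OF sigma_finite_measure_count_space e _ _ w]) auto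
  then have "summable (\<lambda>n. cmod (h n * complex_of_real (gauss \<epsilon> E (level n))))"
    unfolding integrable_count_space_nat_iff .
  moreover have "cmod (h n * complex_of_real (gauss \<epsilon> E (level n))) = (if n \<in> J then gauss \<epsilon> E (\<mu> n) * f n else 0)" for n
    using f[of n] gauss_nonneg[of \<epsilon> E "\<mu> n"] by (auto simp: h_def level_def norm_mult gauss_nonneg)
  ultimately show ?thesis by simp
qed

lemma smeared_nuclear:
  assumes e: "\<epsilon> > 0" shows "summable (\<lambda>n. norm (e n) * norm (smeared \<epsilon> E n))"
proof -
  have "norm (e n) * norm (smeared \<epsilon> E n) = (if n \<in> J then gauss \<epsilon> E (\<mu> n) * norm (a n) else 0)" for n
    by (auto simp: smeared_def norm_scaleC orthonormal_basis_norm[OF basis] gauss_nonneg)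
  then show ?thesis using gauss_summable[OF e, of "\<lambda>n. norm (a n)"] weight(2) by simp
qed

text \<open>On the domain of \<open>A\<close>, symmetry shows that \<rho> A has the coefficients of
  the nuclear operator. That operator is bounded, so its graph is closed; and since the domain of
  \<open>A\<close> is dense while \<rho> is defined everywhere by \<open>fun_calc_series\<close>,
  the graph is also the whole closure.\<close>

lemma smeared_closure:
  assumes e: "\<epsilon> > 0"
  shows "closure (mult_op A O fun_calc (\<lambda>\<mu>. of_real (gauss \<epsilon> E \<mu>)) H) = op_graph (nuclear_op e (smeared \<epsilon> E))"
    (is "closure ?G = op_graph ?T")
proof -
  note nuc = smeared_nuclear[OF e, of E]
  have Tc: "cinner (e n) (?T \<psi>) = cinner (smeared \<epsilon> E n) \<psi>" for n \<psi>
  proof -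
    have "(\<lambda>k. if k = n then cinner (smeared \<epsilon> E k) \<psi> else 0) sums cinner (e n) (?T \<psi>)"
      using cinner_nuclear_op[OF nuc, of \<psi> "e n"] by (simp add: cinner_e if_distrib eq_commute cong: if_cong)
    then show ?thesis using sums_single[of n "\<lambda>k. cinner (smeared \<epsilon> E k) \<psi>"] sums_unique2 by blast
  qed
  have sub: "\<phi> = ?T \<psi>" if \<xi>: "(\<psi>, \<xi>) \<in> mult_op A" and \<phi>: "(\<xi>, \<phi>) \<in> fun_calc (\<lambda>\<mu>. of_real (gauss \<epsilon> E \<mu>)) H" for \<psi> \<xi> \<phi>
  proof (rule orthonormal_basis_eqI[OF basis])
    fix n
    have "cinner (e n) \<xi> = cinner (a n) \<psi>" if "n \<in> J"
      using mult_op_symmetric[OF domain[OF that] \<xi>] by simp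
    then show "cinner (e n) \<phi> = cinner (e n) (?T \<psi>)"
      unfolding Tc fun_calc_coeff[OF \<phi>] by (simp add: smeared_def)
  qed
  show ?thesis
  proof
    have "?G \<subseteq> op_graph ?T" using sub by (auto simp: op_graph_def)
    then show "closure ?G \<subseteq> op_graph ?T"
      by (rule closure_minimal) (rule op_graph_closed[OF nuclear_op_clinear[OF nuc]])
    show "op_graph ?T \<subseteq> closure ?G"
    proof
      fix p assume "p \<in> op_graph ?T"
      then obtain \<psi> where p: "p = (\<psi>, ?T \<psi>)" by (auto simp: op_graph_def)
      obtain X where X: "\<And>k. X k \<in> Domain (mult_op A)" "X \<longlonglongrightarrow> \<psi>"
        using mult_op_dense[OF A_measurable] by blast
      have gs: "summable (\<lambda>n. if n \<in> J then cmod (of_real (gauss \<epsilon> E (\<mu> n))) else 0)"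
        using gauss_summable[OF e, of "\<lambda>_. 1" E] weight(1) by (simp add: gauss_nonneg cong: if_cong)
      have "(X k, ?T (X k)) \<in> ?G" for k
      proof -
        obtain \<xi> where \<xi>: "(X k, \<xi>) \<in> mult_op A" using X(1) by blast
        note f = fun_calc_series[OF gs, of \<xi>]
        show ?thesis using sub[OF \<xi> f] \<xi> f by (metis relcomp.relcompI)
      qed
      then have 1: "\<forall>k. (X k, ?T (X k)) \<in> ?G" by blast
      have 2: "(\<lambda>k. (X k, ?T (X k))) \<longlonglongrightarrow> (\<psi>, ?T \<psi>)"
        by (intro tendsto_Pair X bounded_linear.tendsto[OF bounded_clinearD(1)[OF nuclear_op_clinear[OF nuc]]])
      show "p \<in> closure ?G" unfolding p closure_sequential using 1 2 by (intro exI[of _ "\<lambda>k. (X k, ?T (X k))"] conjI)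
    qed
  qed
qed

theorem smeared_has_trace:
  assumes e: "\<epsilon> > 0"
  shows "has_trace (mult_op A O gaussian_density_op \<epsilon> E H) (gaussian_trace \<epsilon> E)"
proof -
  note nuc = smeared_nuclear[OF e, of E]
  have G: "gaussian_density_op \<epsilon> E H = fun_calc (\<lambda>\<mu>. of_real (gauss \<epsilon> E \<mu>)) H"
    by (simp add: gaussian_density_op_def gauss_def)
  have "(\<Sum>n. cinner (smeared \<epsilon> E n) (e n)) = gaussian_trace \<epsilon> E"
    unfolding gaussian_trace_def
  proof (intro suminf_cong)
    fix n
    show "cinner (smeared \<epsilon> E n) (e n) = coeff n * of_real (gauss \<epsilon> E (level n))"
      using mult_op_symmetric[OF domain[of n] domain[of n]] by (simp add: smeared_def coeff_def level_def)
  qed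
  then have "\<forall>e'. orthonormal_basis e' \<longrightarrow>
      (\<lambda>k. cinner (e' k) (nuclear_op e (smeared \<epsilon> E) (e' k))) sums gaussian_trace \<epsilon> E"
    using nuclear_op_trace[OF nuc] by auto
  then show ?thesis
    unfolding has_trace_def G using smeared_closure[OF e] nuclear_op_trace_class[OF nuc basis] by blast
qed

end

section \<open>Eigenvectors in the domain of the observable\<close>

lemma mult_op_functional:
  assumes "(\<psi>, \<phi>) \<in> mult_op A" "(\<psi>, \<phi>') \<in> mult_op A" shows "\<phi> = \<phi>'"
proof -
  obtain f where f: "square_integrable f" "square_integrable (\<lambda>x. of_real (A x) * f x)"
    "\<psi> = abs_L2 f" "\<phi> = abs_L2 (\<lambda>x. of_real (A x) * f x)" using assms(1) by (auto simp: mult_op_iff)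
  obtain g where g: "square_integrable g" "square_integrable (\<lambda>x. of_real (A x) * g x)"
    "\<psi> = abs_L2 g" "\<phi>' = abs_L2 (\<lambda>x. of_real (A x) * g x)" using assms(2) by (auto simp: mult_op_iff)
  have "AE x in lborel. f x = g x" using f g abs_L2_eq_iff[of f g] by simp
  then have "AE x in lborel. of_real (A x) * f x = of_real (A x) * g x" by (rule AE_mp) simp
  then show ?thesis using abs_L2_eq_iff[OF f(2) g(2)] f g by simp
qed

text \<open>The domain of A^2 is contained in that of A, and the diagonal of \<open>1 + A^2\<close>
  adds the squared norm of A \<psi>. In this way a trace, which only sees diagonal entries, gives
  information on norms.\<close>

lemma mult_op_square_domain:
  assumes [measurable]: "A \<in> borel_measurable borel" and \<psi>: "(\<psi>, \<phi>) \<in> mult_op (\<lambda>x. 1 + (A x)\<^sup>2)"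
  obtains \<xi> where "(\<psi>, \<xi>) \<in> mult_op A" "cinner \<psi> \<phi> = of_real ((norm \<psi>)\<^sup>2 + (norm \<xi>)\<^sup>2)"
proof -
  obtain f where f: "square_integrable f" "square_integrable (\<lambda>x. of_real (1 + (A x)\<^sup>2) * f x)"
    "\<psi> = abs_L2 f" "\<phi> = abs_L2 (\<lambda>x. of_real (1 + (A x)\<^sup>2) * f x)" using \<psi> by (auto simp: mult_op_iff)
  have [measurable]: "f \<in> borel_measurable borel" by (rule square_integrable_measurable[OF f(1)])
  have sf: "integrable lborel (\<lambda>x. (cmod (f x))\<^sup>2)" using f(1) by (simp add: square_integrable_def)
  have int: "integrable lborel (\<lambda>x. cnj (f x) * (of_real (1 + (A x)\<^sup>2) * f x))"
    by (rule square_integrable_cnj_mult[OF f(1,2)])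
  have eq: "cnj (f x) * (of_real (1 + (A x)\<^sup>2) * f x) = of_real ((cmod (f x))\<^sup>2 + (cmod (of_real (A x) * f x))\<^sup>2)" for x
  proof -
    have "cnj (f x) * f x = of_real ((cmod (f x))\<^sup>2)" by (simp add: complex_norm_square[symmetric] mult.commute)
    then have "cnj (f x) * (of_real (1 + (A x)\<^sup>2) * f x) = of_real ((1 + (A x)\<^sup>2) * (cmod (f x))\<^sup>2)"
      by (simp add: mult.left_commute)
    then show ?thesis by (simp add: norm_mult power_mult_distrib distrib_right)
  qed
  have int': "integrable lborel (\<lambda>x. (cmod (f x))\<^sup>2 + (cmod (of_real (A x) * f x))\<^sup>2)"
    using int unfolding eq by (simp only: complex_of_real_integrable_eq)
  have sAf: "integrable lborel (\<lambda>x. (cmod (of_real (A x) * f x))\<^sup>2)"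
    using Bochner_Integration.integrable_diff[OF int' sf] by simp
  have Af: "square_integrable (\<lambda>x. of_real (A x) * f x)"
    unfolding square_integrable_def using sAf by simp
  show ?thesis
  proof (rule that[of "abs_L2 (\<lambda>x. of_real (A x) * f x)"])
    show "(\<psi>, abs_L2 (\<lambda>x. of_real (A x) * f x)) \<in> mult_op A"
      unfolding mult_op_iff using f Af by blast
    show "cinner \<psi> \<phi> = of_real ((norm \<psi>)\<^sup>2 + (norm (abs_L2 (\<lambda>x. of_real (A x) * f x)))\<^sup>2)"
      unfolding f(3,4) cinner_abs_L2[OF f(1,2)] eq norm_abs_L2[OF f(1)] norm_abs_L2[OF Af]
      by (simp only: integral_complex_of_real Bochner_Integration.integral_add[OF sf sAf])
  qed
qed

context adapted_basis
begin

lemma fun_calc_norm_le: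
  assumes f: "\<And>n. n \<in> J \<Longrightarrow> cmod (f (\<mu> n)) \<le> C" "0 \<le> C" and \<psi>: "(\<psi>, \<eta>) \<in> fun_calc f H"
  shows "norm (\<eta> - (if n \<in> J then f (\<mu> n) else 0) *\<^sub>C e n) \<le> C * norm (\<psi> - e n)"
proof (rule power2_le_imp_le)
  let ?\<eta> = "\<eta> - (if n \<in> J then f (\<mu> n) else 0) *\<^sub>C e n"
  have c: "cinner (e k) ?\<eta> = (if k \<in> J then f (\<mu> k) else 0) * cinner (e k) (\<psi> - e n)" for k
    by (simp add: cinner_diff_right fun_calc_coeff[OF \<psi>] cinner_e algebra_simps)
  have le: "(cmod (cinner (e k) ?\<eta>))\<^sup>2 \<le> C\<^sup>2 * (cmod (cinner (e k) (\<psi> - e n)))\<^sup>2" for k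
    unfolding c norm_mult power_mult_distrib using f by (intro mult_right_mono power_mono) auto
  have "(norm ?\<eta>)\<^sup>2 \<le> C\<^sup>2 * (norm (\<psi> - e n))\<^sup>2"
    by (rule sums_le[OF le parseval[OF basis] sums_mult[OF parseval[OF basis]]])
  then show "(norm ?\<eta>)\<^sup>2 \<le> (C * norm (\<psi> - e n))\<^sup>2" by (simp add: power_mult_distrib)
qed (use f in simp)

text \<open>The closure is defined at \<open>e n\<close>, so some graph sequence tends to
  \<open>(e n, T (e n))\<close>. As the calculus is bounded on its domain, the intermediate vectors
  converge to a multiple of \<open>e n\<close>, and closedness of multiplication by \<open>B\<close>
  puts the limit into its domain.\<close>

lemma mult_fun_calc_basis:
  assumes B: "B \<in> borel_measurable borel" and f: "\<And>n. n \<in> J \<Longrightarrow> cmod (f (\<mu> n)) \<le> C" "0 \<le> C"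
    and T: "closure (fun_calc f H O mult_op B) = op_graph T"
  shows "((if n \<in> J then f (\<mu> n) else 0) *\<^sub>C e n, T (e n)) \<in> mult_op B"
proof -
  have "(e n, T (e n)) \<in> closure (fun_calc f H O mult_op B)" unfolding T by (auto simp: op_graph_def)
  then obtain p where p: "\<And>k. p k \<in> fun_calc f H O mult_op B" "p \<longlonglongrightarrow> (e n, T (e n))"
    unfolding closure_sequential by blast
  have "\<exists>\<eta>. (fst (p k), \<eta>) \<in> fun_calc f H \<and> (\<eta>, snd (p k)) \<in> mult_op B" for k
    using p(1)[of k] by (metis relcompEpair prod.collapse)
  then obtain \<eta> where \<eta>: "\<And>k. (fst (p k), \<eta> k) \<in> fun_calc f H" "\<And>k. (\<eta> k, snd (p k)) \<in> mult_op B" by metis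
  have "(\<lambda>k. C * norm (fst (p k) - e n)) \<longlonglongrightarrow> C * norm (e n - e n)"
    using tendsto_fst[OF p(2)] by (intro tendsto_intros) simp
  then have lim0: "(\<lambda>k. C * norm (fst (p k) - e n)) \<longlonglongrightarrow> 0" by simp
  have "(\<lambda>k. \<eta> k - (if n \<in> J then f (\<mu> n) else 0) *\<^sub>C e n) \<longlonglongrightarrow> 0"
    by (rule Lim_null_comparison[OF always_eventually lim0]) (intro allI fun_calc_norm_le f \<eta>)
  then have "\<eta> \<longlonglongrightarrow> (if n \<in> J then f (\<mu> n) else 0) *\<^sub>C e n" by (rule LIM_zero_cancel)
  moreover have "(\<lambda>k. snd (p k)) \<longlonglongrightarrow> T (e n)" using tendsto_snd[OF p(2)] by simp
  ultimately show ?thesis by (rule mult_op_closed_under_limits[OF B \<eta>(2)])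
qed

text \<open>Since \<open>f\<close> has no zeros, dividing by \<open>f (\<mu> n)\<close> shows that
  each eigenvector in the basis lies in the domain of \<open>B\<close>; outside \<open>J\<close> the
  closure vanishes. The trace becomes a Dirichlet type series when \<open>f\<close> is
  exponential.\<close>

lemma has_trace_on_basis:
  assumes B: "B \<in> borel_measurable borel" and f: "\<And>n. n \<in> J \<Longrightarrow> cmod (f (\<mu> n)) \<le> C" "\<And>y. f y \<noteq> 0"
    and t: "has_trace (fun_calc f H O mult_op B) t"
  obtains b where "\<And>n. n \<in> J \<Longrightarrow> (e n, b n) \<in> mult_op B"
    "(\<lambda>n. if n \<in> J then f (\<mu> n) * cinner (e n) (b n) else 0) sums t"
proof -
  obtain T where T: "closure (fun_calc f H O mult_op B) = op_graph T" "(\<lambda>n. cinner (e n) (T (e n))) sums t"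
    using t basis unfolding has_trace_def by blast
  \<comment> \<open>\<open>max C 0\<close> because nothing forces \<open>C\<close> to be nonnegative
    when \<open>J\<close> is empty.\<close>
  have Te: "((if n \<in> J then f (\<mu> n) else 0) *\<^sub>C e n, T (e n)) \<in> mult_op B" for n
    by (rule mult_fun_calc_basis[OF B _ _ T(1), of "max C 0"]) (use f(1) in \<open>auto simp: le_max_iff_disj\<close>)
  define b where "b n = (1 / f (\<mu> n)) *\<^sub>C T (e n)" for n
  have Tb: "T (e n) = (if n \<in> J then f (\<mu> n) *\<^sub>C b n else 0)" for n
  proof (cases "n \<in> J")
    case False
    then have "(0, T (e n)) \<in> mult_op B" using Te[of n] by simp
    moreover have "(0, 0) \<in> mult_op B" using mult_op_scaleC[OF Te[of n], of 0] by simp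
    ultimately show ?thesis using False mult_op_functional by auto
  qed (use f(2) in \<open>simp add: b_def\<close>)
  show ?thesis
  proof (rule that[of b])
    show "(e n, b n) \<in> mult_op B" if "n \<in> J" for n
      using mult_op_scaleC[OF Te[of n], of "1 / f (\<mu> n)"] f(2)[of "\<mu> n"] that by (simp add: b_def)
    have "(\<lambda>n. if n \<in> J then f (\<mu> n) * cinner (e n) (b n) else 0) = (\<lambda>n. cinner (e n) (T (e n)))"
      by (simp add: Tb fun_eq_iff)
    then show "(\<lambda>n. if n \<in> J then f (\<mu> n) * cinner (e n) (b n) else 0) sums t" using T(2) by simp
  qed
qed

end

theorem trace_laplace_representation:
  assumes sa: "self_adjoint H" and ds: "discrete_spectrum H" and bb: "spectrum_bounded_below H"
    and A: "A \<in> borel_measurable borel"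
    and t: "\<And>\<beta>. Re \<beta> > 0 \<Longrightarrow> has_trace (boltzmann_op \<beta> H O mult_op A) (t \<beta>)"
    and s: "\<And>b :: real. b > 0 \<Longrightarrow> has_trace (boltzmann_op (of_real b) H O mult_op (\<lambda>x. 1 + (A x)\<^sup>2)) (s b)"
    and \<epsilon>: "\<epsilon> > 0"
  obtains T K c where "t holomorphic_on {z. 0 < Re z}"
    and "\<And>z. 2 \<le> Re z \<Longrightarrow> cmod (t z) \<le> K * exp (c * Re z)"
    and "\<And>b. b > 0 \<Longrightarrow> integrable lborel (\<lambda>x. laplace_weight \<epsilon> E (Complex b x) * t (Complex b x))"
    and "\<And>b. b > 0 \<Longrightarrow> T = (\<integral>x. laplace_weight \<epsilon> E (Complex b x) * t (Complex b x) \<partial>lborel) / (2 * pi)"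
    and "has_trace (mult_op A O gaussian_density_op \<epsilon> E H) T"
proof -
  have H: "adjoint_op H = H" using sa by (simp add: self_adjoint_def)
  \<comment> \<open>The basis contained in the definition of \<open>trace_class\<close> supplies
    separability of the Hilbert space.\<close>
  obtain e0 where e0: "orthonormal_basis e0"
    using s[of 1] unfolding has_trace_def trace_class_def by force
  have fd: "\<exists>B. finite B \<and> eigenspace H z \<subseteq> span B" if "z \<in> eigenvalues H" for z
    using ds that by (simp add: discrete_spectrum_def)
  obtain e :: "nat \<Rightarrow> L2" and J \<mu> where eJ: "orthonormal_basis e"
    "\<And>n. n \<in> J \<Longrightarrow> e n \<in> real_eigenspace H (\<mu> n)"
    "\<And>n \<nu> \<xi>. n \<notin> J \<Longrightarrow> \<xi> \<in> real_eigenspace H \<nu> \<Longrightarrow> cinner \<xi> (e n) = 0"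
    "\<And>\<nu>. finite {n \<in> J. \<mu> n = \<nu>}"
    using adapted_basis_exists[OF H e0 fd] by blast
  interpret adapted_basis H e J \<mu> by unfold_locales (use H eJ in auto)
  obtain c0 where "\<forall>z\<in>spectrum H. c0 \<le> Re z" using bb by (auto simp: spectrum_bounded_below_def)
  then have below: "c0 \<le> \<mu> n" if "n \<in> J" for n
    using mu_eigenvalue[OF that] ds by (auto simp: discrete_spectrum_def)
  have f: "cmod (exp (- \<beta> * of_real (\<mu> n))) \<le> exp (- Re \<beta> * c0)" if "n \<in> J" "Re \<beta> > 0" for n \<beta>
    using below[OF that(1)] that(2) by simp
  have A2: "(\<lambda>x. 1 + (A x)\<^sup>2) \<in> borel_measurable borel" using A by measurable
  have sq: "\<exists>b. (\<forall>n\<in>J. (e n, b n) \<in> mult_op (\<lambda>x. 1 + (A x)\<^sup>2)) \<and>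
      (\<lambda>n. if n \<in> J then exp (- complex_of_real r * of_real (\<mu> n)) * cinner (e n) (b n) else 0) sums s r" if "r > 0" for r
    by (rule has_trace_on_basis[OF A2 f _ s[OF that, unfolded boltzmann_op_def]]) (use that in auto)
  obtain b where b: "\<And>n. n \<in> J \<Longrightarrow> (e n, b n) \<in> mult_op (\<lambda>x. 1 + (A x)\<^sup>2)" using sq[of 1] by auto
  have "\<exists>a. (e n, a) \<in> mult_op A \<and> cinner (e n) (b n) = of_real (1 + (norm a)\<^sup>2)" if "n \<in> J" for n
    using mult_op_square_domain[OF A b[OF that]] orthonormal_basis_norm[OF basis, of n] by (metis one_power2)
  then obtain a where a: "\<And>n. n \<in> J \<Longrightarrow> (e n, a n) \<in> mult_op A"
    "\<And>n. n \<in> J \<Longrightarrow> cinner (e n) (b n) = of_real (1 + (norm (a n))\<^sup>2)" by metis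
  have sm: "summable (\<lambda>n. if n \<in> J then exp (- r * \<mu> n) * (1 + (norm (a n))\<^sup>2) else 0)" if r: "r > 0" for r
  proof -
    \<comment> \<open>The trace at each \<open>r\<close> produces its own image vectors;
      \<open>mult_op_functional\<close> identifies them with those chosen at
      \<open>r = 1\<close>.\<close>
    obtain b' where b': "\<And>n. n \<in> J \<Longrightarrow> (e n, b' n) \<in> mult_op (\<lambda>x. 1 + (A x)\<^sup>2)"
      "(\<lambda>n. if n \<in> J then exp (- complex_of_real r * of_real (\<mu> n)) * cinner (e n) (b' n) else 0) sums s r"
      using sq[OF r] by blast
    have "(if n \<in> J then exp (- complex_of_real r * of_real (\<mu> n)) * cinner (e n) (b' n) else 0)
        = of_real (if n \<in> J then exp (- r * \<mu> n) * (1 + (norm (a n))\<^sup>2) else 0)" for n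
      using mult_op_functional[OF b'(1) b] a(2)[of n] by (simp add: exp_of_real[symmetric])
    then show ?thesis using sums_summable[OF b'(2)] by (simp only: summable_complex_of_real)
  qed
  interpret spectral_expansion H e J \<mu> A a "\<lambda>n. 1 + (norm (a n))\<^sup>2" c0
  proof unfold_locales
    show "norm (a n) \<le> 1 + (norm (a n))\<^sup>2" for n
      using sum_squares_bound[of "norm (a n)" 1] by (simp, smt (verit) norm_ge_zero)
  qed (use A a sm below in auto)
  have t_eq: "t \<beta> = partition \<beta>" if re: "Re \<beta> > 0" for \<beta>
  proof -
    obtain a' where a': "\<And>n. n \<in> J \<Longrightarrow> (e n, a' n) \<in> mult_op A"
      "(\<lambda>n. if n \<in> J then exp (- \<beta> * of_real (\<mu> n)) * cinner (e n) (a' n) else 0) sums t \<beta>"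
      by (rule has_trace_on_basis[OF A f _ t[OF re, unfolded boltzmann_op_def]]) (use re in auto)
    have "(if n \<in> J then exp (- \<beta> * of_real (\<mu> n)) * cinner (e n) (a' n) else 0)
        = (if n \<in> J then exp (- \<beta> * of_real (\<mu> n)) * cinner (e n) (a n) else 0)" for n
      using mult_op_functional[OF a'(1) a(1)] by simp
    then show ?thesis using sums_unique[OF a'(2)] by (simp add: partition_def)
  qed
  obtain K c where K: "\<And>z. 2 \<le> Re z \<Longrightarrow> cmod (partition z) \<le> K * exp (c * Re z)" using partition_bound by blast
  show ?thesis
  proof (rule that[of K c "gaussian_trace \<epsilon> E"])
    show "t holomorphic_on {z. 0 < Re z}"
      by (rule holomorphic_transform[OF partition_holomorphic]) (simp add: t_eq)
    show "cmod (t z) \<le> K * exp (c * Re z)" if "2 \<le> Re z" for z using K[OF that] that by (simp add: t_eq)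
    show "integrable lborel (\<lambda>x. laplace_weight \<epsilon> E (Complex b x) * t (Complex b x))" if "b > 0" for b
      using gaussian_trace_laplace(1)[OF \<epsilon> that] that by (simp add: t_eq)
    show "gaussian_trace \<epsilon> E = (\<integral>x. laplace_weight \<epsilon> E (Complex b x) * t (Complex b x) \<partial>lborel) / (2 * pi)" if "b > 0" for b
      using gaussian_trace_laplace(2)[OF \<epsilon> that] that by (simp add: t_eq)
  qed (rule smeared_has_trace[OF \<epsilon>])
qed

section \<open>Admissible observables\<close>

lemma admissible_measurable: "admissible_observable A \<Longrightarrow> A \<in> borel_measurable borel"
  unfolding admissible_observable_def by (elim disjE exE conjE) (simp_all add: borel_measurable_continuous_onI continuous_on_poly)

lemma poly_moment_bound: "\<exists>C d. 0 \<le> C \<and> (\<forall>x :: real. \<bar>poly q x\<bar> \<le> C * moment_weight d x)"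
proof (induction q)
  case 0
  show ?case by (intro exI[of _ 0]) simp
next
  case (pCons c q)
  then obtain C d where C: "0 \<le> C" "\<And>x. \<bar>poly q x\<bar> \<le> C * moment_weight d x" by blast
  have "\<bar>poly (pCons c q) x\<bar> \<le> (\<bar>c\<bar> + C) * moment_weight (Suc d) x" for x
  proof -
    have x: "\<bar>x\<bar> \<le> 1 + x\<^sup>2" using sum_squares_bound[of "\<bar>x\<bar>" 1] by simp
    have "\<bar>poly (pCons c q) x\<bar> \<le> \<bar>c\<bar> * 1 + \<bar>x\<bar> * \<bar>poly q x\<bar>"
      using abs_triangle_ineq[of c "x * poly q x"] by (simp add: abs_mult)
    also have "\<dots> \<le> \<bar>c\<bar> * moment_weight (Suc d) x + (1 + x\<^sup>2) * (C * moment_weight d x)"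
      using x C moment_weight_ge_1[of "Suc d" x] by (intro add_mono mult_mono) auto
    also have "\<dots> = (\<bar>c\<bar> + C) * moment_weight (Suc d) x" by (simp add: moment_weight_def algebra_simps)
    finally show ?thesis .
  qed
  then show ?case using C(1) by (intro exI[of _ "\<bar>c\<bar> + C"] exI[of _ "Suc d"]) auto
qed

lemma admissible_moment_bound:
  assumes "admissible_observable A" shows "\<exists>C d. \<forall>x. \<bar>A x\<bar> \<le> C * moment_weight d x"
  using assms unfolding admissible_observable_def
proof (elim disjE conjE)
  show ?thesis if "\<exists>q. A = poly q" using that poly_moment_bound by blast
  show ?thesis if "bounded (range A)"
  proof -
    from that obtain C where "\<And>x. \<bar>A x\<bar> \<le> C" by (auto simp: bounded_iff)
    then show ?thesis by (intro exI[of _ C] exI[of _ 0]) (simp add: moment_weight_def)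
  qed
qed

lemma admissible_moment_weight: "admissible_observable (moment_weight d)"
proof -
  have "moment_weight d = poly ([:1, 0, 1:] ^ d)"
    by (simp add: moment_weight_def fun_eq_iff poly_power power2_eq_square)
  then show ?thesis unfolding admissible_observable_def by blast
qed

text \<open>This closure property makes the trace formula applicable to \<open>1 + A^2\<close>, from
  which the norms of the images of eigenvectors under \<open>A\<close> are obtained.\<close>

lemma admissible_one_plus_square:
  assumes "admissible_observable A" shows "admissible_observable (\<lambda>x. 1 + (A x)\<^sup>2)"
  using assms unfolding admissible_observable_def
proof (elim disjE conjE)
  assume "\<exists>q. A = poly q"
  then obtain q where "A = poly q" ..
  then have "(\<lambda>x. 1 + (A x)\<^sup>2) = poly (1 + q\<^sup>2)" by (simp add: fun_eq_iff poly_power)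
  then show "(\<exists>q. (\<lambda>x. 1 + (A x)\<^sup>2) = poly q) \<or> (\<lambda>x. 1 + (A x)\<^sup>2) \<in> borel_measurable borel \<and> bounded (range (\<lambda>x. 1 + (A x)\<^sup>2))"
    by blast
next
  assume [measurable]: "A \<in> borel_measurable borel" and "bounded (range A)"
  then obtain C where C: "\<And>x. \<bar>A x\<bar> \<le> C" by (auto simp: bounded_iff)
  have "\<bar>1 + (A x)\<^sup>2\<bar> \<le> 1 + C\<^sup>2" for x using power_mono[OF C[of x], of 2] by simp
  then show "(\<exists>q. (\<lambda>x. 1 + (A x)\<^sup>2) = poly q) \<or> (\<lambda>x. 1 + (A x)\<^sup>2) \<in> borel_measurable borel \<and> bounded (range (\<lambda>x. 1 + (A x)\<^sup>2))"
    by (intro disjI2 conjI boundedI[of _ "1 + C\<^sup>2"]) auto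
qed

theorem mainTheorem3:
  fixes m E \<epsilon> :: real and V A :: "real \<Rightarrow> real"
  assumes "m > 0"
    and "V \<in> borel_measurable borel"
    and "essentially_self_adjoint (schroedinger_op m V)"
    and "discrete_spectrum (hamiltonian m V)"
    and "spectrum_bounded_below (hamiltonian m V)"
    and "\<And>\<beta> :: real. \<beta> > 0 \<Longrightarrow>
           op_trace_class (boltzmann_op (complex_of_real \<beta>) (hamiltonian m V))"
    and "\<And>(B :: real \<Rightarrow> real) (\<beta> :: real). admissible_observable B \<Longrightarrow> \<beta> > 0 \<Longrightarrow>
           op_trace_class
             (boltzmann_op (complex_of_real \<beta>) (hamiltonian m V) O mult_op (\<lambda>x. \<bar>B x\<bar>))"
    and "\<And>(B :: real \<Rightarrow> real) (\<beta> :: complex) (N :: nat).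
           admissible_observable B \<Longrightarrow> Re \<beta> > 0 \<Longrightarrow> N \<ge> 1 \<Longrightarrow>
           integrable (lebesgue_N N \<Otimes>\<^sub>M lebesgue_N N)
             (\<lambda>(x, p). boltzmann_integrand m V B \<beta> N x p)"
    and "\<And>(B :: real \<Rightarrow> real) (\<beta> :: complex). admissible_observable B \<Longrightarrow> Re \<beta> > 0 \<Longrightarrow>
           \<exists>t. has_trace (boltzmann_op \<beta> (hamiltonian m V) O mult_op B) t \<and>
             (\<lambda>N. \<integral>(x, p). boltzmann_integrand m V B \<beta> N x p \<partial>(lebesgue_N N \<Otimes>\<^sub>M lebesgue_N N))
               \<longlonglongrightarrow> t"
    and "admissible_observable A"
    and "\<epsilon> > 0"
  shows "(\<forall>N\<ge>1. (\<forall>x. integrable (lebesgue_N N) (gaussian_integrand m V E \<epsilon> N x)) \<and>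
            integrable (lebesgue_N N)
              (\<lambda>x. complex_of_real (A (periodic N x 0)) * gaussian_kernel m V N x E \<epsilon>)) \<and>
         (\<exists>t. has_trace (mult_op A O gaussian_density_op \<epsilon> E (hamiltonian m V)) t \<and>
            (\<lambda>N. \<integral>x. complex_of_real (A (periodic N x 0)) * gaussian_kernel m V N x E \<epsilon> \<partial>lebesgue_N N)
              \<longlonglongrightarrow> t)"
proof -
  note conv = assms(9)
  have "\<exists>t. \<forall>\<beta>. Re \<beta> > 0 \<longrightarrow> has_trace (boltzmann_op \<beta> (hamiltonian m V) O mult_op B) (t \<beta>) \<and>
      (\<lambda>N. path_partition m V B N \<beta>) \<longlonglongrightarrow> t \<beta>" if B: "admissible_observable B" for B
    unfolding path_partition_def by (intro choice allI) (use conv[OF B] in blast)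
  then obtain t where t: "\<And>B \<beta>. admissible_observable B \<Longrightarrow> Re \<beta> > 0 \<Longrightarrow>
      has_trace (boltzmann_op \<beta> (hamiltonian m V) O mult_op B) (t B \<beta>) \<and>
      (\<lambda>N. path_partition m V B N \<beta>) \<longlonglongrightarrow> t B \<beta>" by metis
  \<comment> \<open>The path integral with one time slice and the constant observable
    \<open>moment_weight 0\<close>, which equals 1.\<close>
  have V_int: "integrable lborel (\<lambda>x. exp (- b * V x))" if "b > 0" for b
    using exp_potential_integrable[OF assms(2) moment_weight_measurable[of 0], of m b]
      assms(8)[OF admissible_moment_weight[of 0], of "of_real b" 1] that
    by (simp add: moment_weight_def)
  interpret potential m V
    by unfold_locales (use assms(1,2) V_int in auto)
  interpret path_integrals m V
  proof unfold_locales
    show "integrable (path_measure N) (\<lambda>(x, p). boltzmann_integrand m V (moment_weight d) \<beta> N x p)"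
      if "Re \<beta> > 0" "N \<ge> 1" for d \<beta> N
      by (rule assms(8)[OF admissible_moment_weight that])
    show "\<exists>K. \<forall>N\<ge>1. cmod (path_partition m V (moment_weight d) N (of_real b)) \<le> K" if b: "b > 0" for d b
    proof -
      have "(\<lambda>N. path_partition m V (moment_weight d) N (of_real b)) \<longlonglongrightarrow> t (moment_weight d) (of_real b)"
        using t[OF admissible_moment_weight, of "of_real b"] b by simp
      from Bseq_def[THEN iffD1, OF convergent_imp_Bseq[OF convergentI[OF this]]] show ?thesis by blast
    qed
  qed
  have A: "admissible_observable A" and \<epsilon>: "\<epsilon> > 0" by fact+
  obtain C d where "\<And>x. \<bar>A x\<bar> \<le> C * moment_weight d x" using admissible_moment_bound[OF A] by blast
  then have mod: "moderate C d A" using admissible_measurable[OF A] by (simp add: moderate_def)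
  have sa: "self_adjoint (hamiltonian m V)"
    using assms(3) by (simp add: essentially_self_adjoint_def hamiltonian_def)
  have tr: "has_trace (boltzmann_op \<beta> (hamiltonian m V) O mult_op A) (t A \<beta>)" if "Re \<beta> > 0" for \<beta>
    using t[OF A that] by simp
  define s where "s b = t (\<lambda>x. 1 + (A x)\<^sup>2) (complex_of_real b)" for b
  have tr2: "has_trace (boltzmann_op (of_real b) (hamiltonian m V) O mult_op (\<lambda>x. 1 + (A x)\<^sup>2)) (s b)" if "b > 0" for b
    using t[OF admissible_one_plus_square[OF A], of "of_real b"] that by (simp add: s_def)
  obtain T K c where T: "t A holomorphic_on {z. 0 < Re z}"
    "\<And>z. 2 \<le> Re z \<Longrightarrow> cmod (t A z) \<le> K * exp (c * Re z)"
    "\<And>b. b > 0 \<Longrightarrow> integrable lborel (\<lambda>x. laplace_weight \<epsilon> E (Complex b x) * t A (Complex b x))"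
    "\<And>b. b > 0 \<Longrightarrow> T = (\<integral>x. laplace_weight \<epsilon> E (Complex b x) * t A (Complex b x) \<partial>lborel) / (2 * pi)"
    "has_trace (mult_op A O gaussian_density_op \<epsilon> E (hamiltonian m V)) T"
    by (rule trace_laplace_representation[OF sa assms(4,5) admissible_measurable[OF A] tr tr2 \<epsilon>, of E]) (assumption, assumption, rule that)
  have "(\<lambda>N. \<integral>x. of_real (A (periodic N x 0)) * gaussian_kernel m V N x E \<epsilon> \<partial>lebesgue_N N) \<longlonglongrightarrow> T"
    using t[OF A] by (intro gaussian_average_limit[OF mod \<epsilon> _ T(1-4)]) auto
  \<comment> \<open>\<open>zero_less_one\<close> selects the abscissa 1, an arbitrary choice for the
    integrability claim.\<close>
  then show ?thesis
    using T(5) gaussian_integrand_integrable[OF mass _ \<epsilon>] moderate_gaussian(2)[OF mod \<epsilon> zero_less_one] by blast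
qed

end
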